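(* Let $n\ge2$ and $\alpha>-1$. There is an $r_0$ with $0<r_0<1/2$, depending only on $n$ and $\alpha$, such that if $\{a_m\}_{m\ge1}$ is an $r$-lattice in $\mathbb B$ with $0<r<r_0$, then for every $f\in\mathcal B$ (resp. $f\in\mathcal B_0$) there exists $\{\lambda_m\}\in\ell^\infty$ (resp. $\{\lambda_m\}\in c_0$) such that $$f(x)=\sum_{m=1}^\infty\lambda_m\frac{\mathcal R_\alpha(x,a_m)}{\|\mathcal R_\alpha(\cdot,a_m)\|_{\mathcal B}}\qquad(x\in\mathbb B),$$ where the series converges absolutely and uniformly on compact subsets of $\mathbb B$ and the norm $\|\{\lambda_m\}\|_{\ell^\infty}$ is equivalent to $\|f\|_{\mathcal B}$ (i.e. each is bounded by a constant multiple of the other, with constants independent of $f$).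
   Context: $\mathbb B=\{x\in\mathbb R^n:|x|<1\}$. A $C^2$ function $f:\mathbb B\to\mathbb C$ is $\mathcal H$-harmonic if $\Delta_h f=0$ on $\mathbb B$, where $\Delta_hf(x)=(1-|x|^2)^2\Delta f(x)+2(n-2)(1-|x|^2)\langle x,\nabla f(x)\rangle$ ($\Delta$, $\nabla$ the Euclidean Laplacian and gradient); $\mathcal H(\mathbb B)$ is the space of all such functions. $\nu$ is Lebesgue measure on $\mathbb B$ normalized so that $\nu(\mathbb B)=1$; for $\alpha>-1$, $d\nu_\alpha(x)=(1-|x|^2)^\alpha d\nu(x)$. The Bergman space $\mathcal B^2_\alpha=L^2(\nu_\alpha)\cap\mathcal H(\mathbb B)$ is a reproducing kernel Hilbert space; its reproducing kernel $\mathcal R_\alpha(x,y)$ is real-valued and symmetric, with $f(x)=\int_{\mathbb B}f(y)\mathcal R_\alpha(x,y)\,d\nu_\alpha(y)$ for $f\in\mathcal B^2_\alpha$, $x\in\mathbb B$. The Bloch space $\mathcal B$ consists of all $f\in\mathcal H(\mathbb B)$ with $p_{\mathcal B}(f)=\sup_{x\in\mathbb B}(1-|x|^2)|\nabla f(x)|<\infty$, with norm $\|f\|_{\mathcal B}=|f(0)|+p_{\mathcal B}(f)$; the little Bloch space $\mathcal B_0$ is the subspace of $f$ with $\lim_{|x|\to1^-}(1-|x|^2)|\nabla f(x)|=0$. The pseudo-hyperbolic metric on $\mathbb B$ is $\rho(a,b)=|a-b|/[a,b]$ where $[a,b]=\sqrt{1-2\langle a,b\rangle+|a|^2|b|^2}$,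 and $E_r(a)=\{x\in\mathbb B:\rho(x,a)<r\}$ for $0<r<1$. A sequence $\{a_m\}$ in $\mathbb B$ is $r$-separated if $\rho(a_m,a_k)\ge r$ for $m\ne k$; an $r$-separated sequence is an $r$-lattice if $\bigcup_{m=1}^\infty E_r(a_m)=\mathbb B$. $\ell^\infty$ is the space of bounded complex sequences with the supremum norm, $c_0$ the subspace of sequences converging to $0$. *)

theory Defs
  imports "HOL-Analysis.Analysis"
begin

text \<open>
  Functions on the unit ball of \<open>\<real>\<^sup>n\<close> are total functions on \<^typ>\<open>real^'n\<close>, with \<open>n = CARD('n)\<close>.
  Only their values on the open ball matter; all notions below ignore the values elsewhere.
\<close>

abbreviation unit_ball :: "(real^'n) set" where
  "unit_ball \<equiv> ball 0 1"

definition pderivative :: "'n \<Rightarrow> (real^'n \<Rightarrow> complex) \<Rightarrow> real^'n \<Rightarrow> complex" where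
  "pderivative i f x = frechet_derivative f (at x) (axis i 1)"

text \<open>
  For open \<open>S\<close> this is the usual \<open>C\<^sup>2\<close>: continuity of \<open>f\<close> and of its first partial derivatives
  follows from their differentiability.
\<close>

definition C2_on :: "(real^'n) set \<Rightarrow> (real^'n \<Rightarrow> complex) \<Rightarrow> bool" where
  "C2_on S f \<longleftrightarrow>
     f differentiable_on S \<and>
     (\<forall>i. pderivative i f differentiable_on S) \<and>
     (\<forall>i j. continuous_on S (pderivative j (pderivative i f)))"

definition gradient :: "(real^'n \<Rightarrow> complex) \<Rightarrow> real^'n \<Rightarrow> complex^'n" where
  "gradient f x = (\<chi> i. pderivative i f x)"

definition laplacian :: "(real^'n \<Rightarrow> complex) \<Rightarrow> real^'n \<Rightarrow> complex" where
  "laplacian f x = (\<Sum>i\<in>UNIV. pderivative i (pderivative i f) x)"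

definition hyp_laplacian :: "(real^'n \<Rightarrow> complex) \<Rightarrow> real^'n \<Rightarrow> complex" where
  "hyp_laplacian f x =
     of_real ((1 - (norm x)\<^sup>2)\<^sup>2) * laplacian f x
     + of_real (2 * (real CARD('n) - 2) * (1 - (norm x)\<^sup>2))
       * (\<Sum>i\<in>UNIV. of_real (x $ i) * gradient f x $ i)"

definition h_harmonic :: "(real^'n \<Rightarrow> complex) set" where
  "h_harmonic = {f. C2_on unit_ball f \<and> (\<forall>x\<in>unit_ball. hyp_laplacian f x = 0)}"

definition nu :: "(real^'n) measure" where
  "nu = uniform_measure (lebesgue_on unit_ball) unit_ball"

definition nu_weighted :: "real \<Rightarrow> (real^'n) measure" where
  "nu_weighted \<alpha> = density nu (\<lambda>x. ennreal ((1 - (norm x)\<^sup>2) powr \<alpha>))"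

definition bergman_space :: "real \<Rightarrow> (real^'n \<Rightarrow> complex) set" where
  "bergman_space \<alpha> =
     {f \<in> h_harmonic. f \<in> borel_measurable (nu_weighted \<alpha>) \<and>
        integrable (nu_weighted \<alpha>) (\<lambda>x. (cmod (f x))\<^sup>2)}"

text \<open>
  \<open>bergman_kernel \<alpha> x y = k x\<close>, where \<open>k\<close> is the Riesz representative in the Bergman space of
  evaluation at \<open>y\<close>.  Setting \<open>k\<close> to zero off the ball makes it unique as a total function.
  The conjugate comes from the \<open>L\<^sup>2\<close> inner product; the kernel is in fact real and symmetric,
  so it can be dropped and the arguments interchanged.
\<close>

definition bergman_kernel :: "real \<Rightarrow> real^'n \<Rightarrow> real^'n \<Rightarrow> complex" where
  "bergman_kernel \<alpha> x y =
     (THE k. k \<in> bergman_space \<alpha> \<and> (\<forall>z. z \<notin> unit_ball \<longrightarrow> k z = 0) \<and>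
        (\<forall>f\<in>bergman_space \<alpha>. f y = (\<integral>z. f z * cnj (k z) \<partial>nu_weighted \<alpha>))) x"

definition bloch_density :: "(real^'n \<Rightarrow> complex) \<Rightarrow> real^'n \<Rightarrow> real" where
  "bloch_density f x = (1 - (norm x)\<^sup>2) * norm (gradient f x)"

definition bloch_space :: "(real^'n \<Rightarrow> complex) set" where
  "bloch_space = {f \<in> h_harmonic. bdd_above (bloch_density f ` unit_ball)}"

definition bloch_norm :: "(real^'n \<Rightarrow> complex) \<Rightarrow> real" where
  "bloch_norm f = cmod (f 0) + (SUP x\<in>unit_ball. bloch_density f x)"

text \<open>The filter expresses \<open>\<bar>x\<bar> \<rightarrow> 1\<close> from below.\<close>

definition little_bloch_space :: "(real^'n \<Rightarrow> complex) set" where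
  "little_bloch_space =
     {f \<in> bloch_space. (bloch_density f \<longlongrightarrow> 0) (filtercomap norm (at_left 1))}"

definition pseudo_hyp :: "real^'n \<Rightarrow> real^'n \<Rightarrow> real" where
  "pseudo_hyp a b = norm (a - b) / sqrt (1 - 2 * (a \<bullet> b) + (norm a)\<^sup>2 * (norm b)\<^sup>2)"

definition pseudo_hyp_ball :: "real \<Rightarrow> real^'n \<Rightarrow> (real^'n) set" where
  "pseudo_hyp_ball r a = {x \<in> unit_ball. pseudo_hyp x a < r}"

definition separated :: "real \<Rightarrow> (nat \<Rightarrow> real^'n) \<Rightarrow> bool" where
  "separated r a \<longleftrightarrow> range a \<subseteq> unit_ball \<and> (\<forall>m k. m \<noteq> k \<longrightarrow> r \<le> pseudo_hyp (a m) (a k))"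

definition lattice_seq :: "real \<Rightarrow> (nat \<Rightarrow> real^'n) \<Rightarrow> bool" where
  "lattice_seq r a \<longleftrightarrow> separated r a \<and> (\<Union>m. pseudo_hyp_ball r (a m)) = unit_ball"

definition kernel_atom :: "real \<Rightarrow> real^'n \<Rightarrow> real^'n \<Rightarrow> complex" where
  "kernel_atom \<alpha> a x = bergman_kernel \<alpha> x a / of_real (bloch_norm (\<lambda>z. bergman_kernel \<alpha> z a))"

definition kernel_expansion ::
  "real \<Rightarrow> (nat \<Rightarrow> real^'n) \<Rightarrow> (nat \<Rightarrow> complex) \<Rightarrow> (real^'n \<Rightarrow> complex) \<Rightarrow> bool" where
  "kernel_expansion \<alpha> a c f \<longleftrightarrow>
     (\<forall>x\<in>unit_ball. (\<lambda>m. c m * kernel_atom \<alpha> (a m) x) sums f x) \<and>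
     (\<forall>x\<in>unit_ball. summable (\<lambda>m. cmod (c m * kernel_atom \<alpha> (a m) x))) \<and>
     (\<forall>K. compact K \<and> K \<subseteq> unit_ball \<longrightarrow>
        uniform_limit K (\<lambda>N x. \<Sum>m<N. c m * kernel_atom \<alpha> (a m) x) f sequentially)"

definition sup_norm :: "(nat \<Rightarrow> complex) \<Rightarrow> real" where
  "sup_norm c = (SUP m. cmod (c m))"

end

theory Submission
 imports Defs "HOL-Analysis.Analysis"
begin

text \<open>
  The kernel \<open>R\<close> is never computed. Green's identity shows that averages against bumps in the hyperbolic
  distance reproduce \<open>\<H>\<close>-harmonic functions. This yields local estimates, completeness of the Bergman
  space and \<open>R(a,a) \<le> C / w(a)\<close> with \<open>w(a) = (1 - |a|\<^sup>2)\<^sup>n\<^sup>+\<^sup>\<alpha>\<close>. The bound \<open>|R(x,a)| \<le> C / w(a)\<close>, uniform in \<open>x\<close>,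
  follows because \<open>(r,t) \<mapsto> R(r \<zeta>, t \<eta>)\<close>, symmetrised in the unit vectors \<open>\<zeta>, \<eta>\<close>, solves an ultrahyperbolic
  equation, which together with positive definiteness forces it to be at most its value at
  \<open>(sqrt (r t), sqrt (r t))\<close>. Hence the Bloch norm of \<open>R(-,a)\<close> is at most \<open>C / w(a)\<close>.

  For a Bloch function \<open>f\<close>, radial integration by parts gives \<open>\<integral> f g d\<nu>\<^sub>\<alpha> = \<integral> \<phi> g d\<nu>\<^sub>\<alpha>\<close> for all Bergman functions \<open>g\<close>,
  where \<open>\<phi>\<close> is bounded by the Bloch norm and vanishes at the boundary if \<open>f\<close> is little Bloch. Moving the local
  mean value kernel from \<open>y\<close> to a nearby lattice point \<open>a(y)\<close> perturbs the identity by an operator of norm at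
  most 1/2 on bounded functions, so a Neumann series yields \<open>\<Phi>\<close> with \<open>\<integral> \<phi> g d\<nu>\<^sub>\<alpha> = \<integral> g(a(y)) \<Phi>(y) d\<nu>\<^sub>\<alpha>(y)\<close>.
  For \<open>g = R(x,-)\<close> this is the expansion of \<open>f(x)\<close>, its coefficients being integrals of \<open>\<Phi>\<close> over the cells.

  For the lower bound on the coefficients, the lattice without \<open>a\<^sub>0\<close> still suffices to expand \<open>R(-,a\<^sub>0)\<close>, which
  gives a relation between the atoms with coefficients in \<open>c\<^sub>0\<close>; adding a multiple of it makes the
  coefficient of \<open>a\<^sub>0\<close> equal to the Bloch norm of \<open>f\<close>.
\<close>

text \<open>Orthogonal maps are the only symmetries of the ball that act on integrals; what Moebius
  maps would give is drawn from differential identities for \<open>sg\<close>, for instance that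
  \<open>ball_mass\<close> does not depend on its centre. For \<zeta> \<noteq> \<eta> the function
  R(r \<zeta>, t \<eta>) of (r, t) need not be positive definite. The inner product of R(-, r
  \<zeta>) + \<sigma> R(-, r \<eta>) with the same vector at t is, and \<sigma> = 1 and \<sigma> =
  -1 together recover both of its terms (\<open>qform\<close>). It solves the equation because
  rotating one argument amounts to the inverse rotation of the other, so both radial operators
  produce the same spherical term. Cauchy-Schwarz alone bounds R(x,y) by a quantity that may grow at
  the boundary in y; the uniform bound makes R(x,-) a bounded test function in the discretisation
  and the series locally uniformly convergent. Bounding the Bloch norm of a series by its
  coefficients would call for integral estimates of the kernel. As the theorem asks only for one
  good sequence for each f, the relation between the atoms takes their place, and the lower constant
  becomes 1.\<close>

abbreviation Sq :: "(real \<times> real) set" where "Sq \<equiv> {-1<..<1} \<times> {-1<..<1}"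

abbreviation UB :: "(real^'n) set" where "UB \<equiv> unit_ball"

abbreviation dl :: "real^'n \<Rightarrow> real" where "dl x \<equiv> 1 - (norm x)\<^sup>2"

section \<open>Functions with continuous partial derivatives\<close>

text \<open>The partials are explicit data rather than \<open>pderivative\<close> terms: closed
  formulas pass through products, compositions and integrals, and a C2 function is given by two
  nested instances (\<open>C2_onI\<close>). Continuity of \<open>f1\<close> is included, so the
  notion is C1.\<close>

definition has_partials ::
 "(real^'n => 'c::real_normed_vector) => ('n => real^'n => 'c) => (real^'n) set => bool" where
 "has_partials f f1 S \<longleftrightarrow>
   (\<forall>x\<in>S. (f has_derivative (%v. \<Sum>i\<in>UNIV. v$i *\<^sub>R f1 i x)) (at x)) \<and>
   (\<forall>i. continuous_on S (f1 i))"

lemma has_partialsD: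
 assumes "has_partials f f1 S"
 shows "x \<in> S ==> (f has_derivative (%v. \<Sum>i\<in>UNIV. v$i *\<^sub>R f1 i x)) (at x)"
  and "continuous_on S (f1 i)"
 using assms by (auto simp: has_partials_def)

lemma has_partials_continuous:
 assumes "has_partials f f1 S" shows "continuous_on S f"
 by (intro continuous_at_imp_continuous_on ballI)
  (rule has_derivative_continuous[OF has_partialsD(1)[OF assms]])

lemma has_partialsI:
 assumes "!!x. x \<in> S ==> (f has_derivative f' x) (at x)"
  and "!!x i. x \<in> S ==> f1 i x = f' x (axis i 1)"
  and "!!i. continuous_on S (f1 i)"
 shows "has_partials f f1 S"
proof -
 have "f' x = (%v. \<Sum>i\<in>UNIV. v$i *\<^sub>R f1 i x)" if x: "x \<in> S" for x
 proof
  fix v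
  have lin: "linear (f' x)" using assms(1)[OF x] has_derivative_linear by blast
  have "f' x v = f' x (\<Sum>i\<in>UNIV. v$i *\<^sub>R axis i 1)"
   using basis_expansion[of v] by (simp add: scalar_mult_eq_scaleR)
  also have "... = (\<Sum>i\<in>UNIV. v$i *\<^sub>R f' x (axis i 1))"
   by (simp add: linear_sum[OF lin] linear_cmul[OF lin])
  finally show "f' x v = (\<Sum>i\<in>UNIV. v$i *\<^sub>R f1 i x)" by (simp add: assms(2)[OF x])
 qed
 thus ?thesis unfolding has_partials_def using assms by force
qed

lemma has_partials_cong:
 assumes "has_partials f f1 S" "open S" "!!x. x \<in> S ==> f x = g x"
  "!!x i. x \<in> S ==> f1 i x = g1 i x"
 shows "has_partials g g1 S"
 unfolding has_partials_def
proof (intro conjI ballI allI)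
 fix x assume x: "x \<in> S"
 have "(g has_derivative (%v. \<Sum>i\<in>UNIV. v$i *\<^sub>R f1 i x)) (at x)"
  using has_derivative_transform_within_open[OF has_partialsD(1)[OF assms(1) x] assms(2) x] assms(3)
  by blast
 thus "(g has_derivative (%v. \<Sum>i\<in>UNIV. v$i *\<^sub>R g1 i x)) (at x)"
  by (simp add: assms(4)[OF x])
next
 fix i show "continuous_on S (g1 i)"
  using has_partialsD(2)[OF assms(1), of i] assms(4) continuous_on_cong by fastforce
qed

lemma sum_axis: "(\<Sum>j\<in>UNIV. (axis i 1 :: real^'n) $ j *\<^sub>R c j) = (c i :: 'c::real_vector)"
proof -
 have "(\<Sum>j\<in>UNIV. (axis i 1 :: real^'n) $ j *\<^sub>R c j) = (\<Sum>j\<in>UNIV. if j = i then c j else 0)"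
  by (rule sum.cong) (auto simp: axis_def)
 thus ?thesis by simp
qed

lemma sum_axis_real: "(\<Sum>j\<in>UNIV. (axis i 1 :: real^'n) $ j * c j) = (c i :: real)"
 using sum_axis[of i c] by simp

lemma has_partials_const: "has_partials (%x. c) (%i x. 0) S"
 by (rule has_partialsI[where f'="%x v. 0"]) auto

lemma has_partials_add:
 assumes "has_partials f f1 S" "has_partials g g1 S"
 shows "has_partials (%x. f x + g x) (%i x. f1 i x + g1 i x) S"
 by (rule has_partialsI, rule has_derivative_add[OF has_partialsD(1)[OF assms(1)] has_partialsD(1)[OF assms(2)]])
  (auto simp: sum_axis sum_axis_real intro!: continuous_intros assms[THEN has_partialsD(2)])

lemma has_partials_diff:
 assumes "has_partials f f1 S" "has_partials g g1 S"
 shows "has_partials (%x. f x - g x) (%i x. f1 i x - g1 i x) S"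
 by (rule has_partialsI, rule has_derivative_diff[OF has_partialsD(1)[OF assms(1)] has_partialsD(1)[OF assms(2)]])
  (auto simp: sum_axis sum_axis_real intro!: continuous_intros assms[THEN has_partialsD(2)])

lemma has_partials_mult:
 fixes f g :: "real^'n => 'c::real_normed_algebra"
 assumes "has_partials f f1 S" "has_partials g g1 S"
 shows "has_partials (%x. f x * g x) (%i x. f x * g1 i x + f1 i x * g x) S"
 by (rule has_partialsI, rule has_derivative_mult[OF has_partialsD(1)[OF assms(1)] has_partialsD(1)[OF assms(2)]])
  (auto simp: sum_axis sum_axis_real intro!: continuous_intros assms[THEN has_partialsD(2)] assms[THEN has_partials_continuous])

lemma has_partials_bounded_linear:
 assumes "bounded_linear T" "has_partials f f1 S"
 shows "has_partials (%x. T (f x)) (%i x. T (f1 i x)) S"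
 by (rule has_partialsI, rule bounded_linear.has_derivative[OF assms(1) has_partialsD(1)[OF assms(2)]])
  (auto simp: sum_axis sum_axis_real intro!: bounded_linear.continuous_on[OF assms(1)] assms(2)[THEN has_partialsD(2)])

lemma has_partials_compose_real:
 fixes u :: "real^'n => real" and h :: "real => 'c::real_normed_vector"
 assumes "has_partials u u1 S" "!!x. x \<in> S ==> (h has_vector_derivative h' (u x)) (at (u x))"
  "continuous_on (u ` S) h'"
 shows "has_partials (%x. h (u x)) (%i x. u1 i x *\<^sub>R h' (u x)) S"
proof (rule has_partialsI)
 fix x assume x: "x \<in> S"
 show "((%x. h (u x)) has_derivative (%v. (\<Sum>i\<in>UNIV. v$i *\<^sub>R u1 i x) *\<^sub>R h' (u x))) (at x)"
  using has_derivative_compose[OF has_partialsD(1)[OF assms(1) x] assms(2)[OF x, unfolded has_vector_derivative_def]] .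
next
 show "u1 i x *\<^sub>R h' (u x) = (\<Sum>j\<in>UNIV. axis i 1 $ j *\<^sub>R u1 j x) *\<^sub>R h' (u x)" for i x
  by (subst sum_axis) simp
 have "continuous_on S (%x. h' (u x))"
  using continuous_on_compose2[OF assms(3) has_partials_continuous[OF assms(1)]] by auto
 thus "continuous_on S (%x. u1 i x *\<^sub>R h' (u x))" for i
  by (intro continuous_intros has_partialsD(2)[OF assms(1)])
qed

lemma has_partials_nth: "has_partials (%x. x $ k) (%i x. if i = k then 1 else 0) S"
proof (rule has_partialsI)
 show "((%x. x $ k) has_derivative (%v. v $ k)) (at x)" for x
  by (rule bounded_linear_imp_has_derivative[OF bounded_linear_vec_nth])
 show "(if i = k then 1 else 0) = axis i 1 $ k" for i by (simp add: axis_def)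
qed (auto simp: axis_def)

lemma has_partials_norm_sq:
 "has_partials (%x::real^'n. (norm (x - c))^2) (%i x. 2 * (x - c) $ i) S"
proof (rule has_partialsI)
 fix x :: "real^'n"
 have "((%x. (x - c) \<bullet> (x - c)) has_derivative (%v. (x - c) \<bullet> v + v \<bullet> (x - c))) (at x)"
  by (auto intro!: derivative_eq_intros)
 thus "((%x. (norm (x - c))^2) has_derivative (%v. 2 * ((x - c) \<bullet> v))) (at x)"
  by (simp add: dot_square_norm inner_commute algebra_simps flip: power2_norm_eq_inner)
qed (auto simp: inner_axis intro!: continuous_intros)

lemma has_partials_pderivative:
 assumes "has_partials f f1 S" "x \<in> S"
 shows "pderivative i f x = f1 i x"
 using frechet_derivative_at[OF has_partialsD(1)[OF assms], symmetric]
 by (simp add: pderivative_def sum_axis)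

lemma has_partials_of_differentiable:
 assumes "open S" "f differentiable_on S" "!!i. continuous_on S (pderivative i f)"
 shows "has_partials f (%i. pderivative i f) S"
proof (rule has_partialsI)
 fix x assume "x \<in> S"
 hence "f differentiable at x" using assms(1,2) differentiable_on_eq_differentiable_at by blast
 thus "(f has_derivative frechet_derivative f (at x)) (at x)"
  by (simp add: frechet_derivative_works)
qed (use assms(3) in \<open>auto simp: pderivative_def[abs_def]\<close>)

lemma C2_onD:
 assumes "C2_on S f" "open S"
 shows "has_partials f (%i. pderivative i f) S"
  "!!i. has_partials (pderivative i f) (%j. pderivative j (pderivative i f)) S"
 using assms unfolding C2_on_def
 by (blast intro: has_partials_of_differentiable differentiable_imp_continuous_on)+

lemma C2_onI:
 assumes "open S" "has_partials f f1 S" "!!i. has_partials (f1 i) (f2 i) S"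
 shows "C2_on S f" "!!x i j. x \<in> S ==> pderivative j (pderivative i f) x = f2 i j x"
proof -
 have 1: "has_partials (pderivative i f) (f2 i) S" for i
  by (rule has_partials_cong[OF assms(3) assms(1)]) (auto simp: has_partials_pderivative[OF assms(2)])
 show 2: "pderivative j (pderivative i f) x = f2 i j x" if "x \<in> S" for x i j
  using has_partials_pderivative[OF 1 that] .
 have d: "has_partials g g1 S ==> g differentiable_on S" for g :: "real^'a => complex" and g1
  unfolding differentiable_on_def differentiable_def
  using has_partialsD(1) has_derivative_at_withinI by blast
 show "C2_on S f"
  unfolding C2_on_def using d[OF assms(2)] d[OF 1]
   continuous_on_cong[THEN iffD2, OF refl 2 has_partialsD(2)[OF 1]] by blast
qed

lemma hyp_laplacian_partials:
 assumes "open S" "has_partials f f1 S" "!!i. has_partials (f1 i) (f2 i) S" "x \<in> S"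
 shows "hyp_laplacian f (x::real^'n) =
   of_real ((dl x)^2) * (\<Sum>i\<in>UNIV. f2 i i x)
   + of_real (2 * (real CARD('n) - 2) * (dl x)) * (\<Sum>i\<in>UNIV. of_real (x $ i) * f1 i x)"
 by (simp add: hyp_laplacian_def laplacian_def gradient_def C2_onI(2)[OF assms]
   has_partials_pderivative[OF assms(2,4)])

lemma h_harmonicI:
 fixes f :: "real^'n => complex"
 assumes "has_partials f f1 UB" "!!i. has_partials (f1 i) (f2 i) UB"
  "!!x. x \<in> UB ==>
   of_real ((dl x)^2) * (\<Sum>i\<in>UNIV. f2 i i x)
   + of_real (2 * (real CARD('n) - 2) * (dl x)) * (\<Sum>i\<in>UNIV. of_real (x $ i) * f1 i x) = 0"
 shows "f \<in> h_harmonic"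
 using assms C2_onI(1)[OF open_ball assms(1,2)] hyp_laplacian_partials[OF open_ball assms(1,2)]
 by (simp add: h_harmonic_def)

lemma h_harmonicD:
 fixes f :: "real^'n => complex"
 assumes "f \<in> h_harmonic"
 shows "has_partials f (%i. pderivative i f) UB"
  "!!i. has_partials (pderivative i f) (%j. pderivative j (pderivative i f)) UB"
  "!!x. x \<in> UB ==>
   of_real ((dl x)^2) * (\<Sum>i\<in>UNIV. pderivative i (pderivative i f) x)
   + of_real (2 * (real CARD('n) - 2) * (dl x)) * (\<Sum>i\<in>UNIV. of_real (x $ i) * pderivative i f x) = 0"
 using assms C2_onD[OF _ open_ball] by (auto simp: h_harmonic_def hyp_laplacian_def laplacian_def gradient_def)

section \<open>Differentiation under the integral sign\<close>

text \<open>The zero extension is continuous on U x \<Omega> and on U x (-K); these open sets cover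
  everything, so nothing has to be known at the boundary of \<Omega>. It moves integrals over
  \<Omega> to a box, where the parameter theorems for Henstock-Kurzweil integrals apply.\<close>

lemma continuous_on_extend_zero_param:
 fixes F :: "'p::topological_space => 'a::euclidean_space => 'c::real_normed_vector"
 assumes "open U" "open \<Omega>" "compact K" "K \<subseteq> \<Omega>"
  and cont: "continuous_on (U \<times> \<Omega>) (%(p, z). F p z)"
  and zero: "!!p z. p \<in> U ==> z \<in> \<Omega> - K ==> F p z = 0"
 shows "continuous_on (U \<times> UNIV) (%(p, z). if z \<in> \<Omega> then F p z else 0)"
proof -
 have eq: "U \<times> UNIV = U \<times> \<Omega> \<union> U \<times> (- K)" using assms(4) by auto
 have op: "open (U \<times> \<Omega>)" "open (U \<times> (- K))"
  using assms(1-3) by (auto intro: open_Times simp: compact_imp_closed open_Compl)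
 show ?thesis unfolding eq
 proof (rule continuous_on_open_Un[OF op])
  show "continuous_on (U \<times> \<Omega>) (%(p, z). if z \<in> \<Omega> then F p z else 0)"
   using cont by (rule continuous_on_eq) auto
  show "continuous_on (U \<times> (- K)) (%(p, z). if z \<in> \<Omega> then F p z else 0)"
   by (rule continuous_on_eq[OF continuous_on_const[of _ 0]]) (auto simp: zero)
 qed
qed

lemma continuous_on_extend_zero:
 fixes f :: "'a::euclidean_space => 'c::real_normed_vector"
 assumes "open \<Omega>" "compact K" "K \<subseteq> \<Omega>" "continuous_on \<Omega> f" "!!z. z \<in> \<Omega> - K ==> f z = 0"
 shows "continuous_on UNIV (%z. if z \<in> \<Omega> then f z else 0)"
proof -
 have "continuous_on (UNIV \<times> UNIV) (%(p::real, z). if z \<in> \<Omega> then f z else 0)"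
  using assms by (intro continuous_on_extend_zero_param)
   (auto simp: split_beta intro!: continuous_on_compose2[OF assms(4)] continuous_intros)
 from continuous_on_compose2[OF this, of UNIV "%z. (0, z)"] show ?thesis
  by (simp add: continuous_intros)
qed

lemma integrable_compact_support:
 fixes f :: "'a::euclidean_space => 'c::euclidean_space"
 assumes "open \<Omega>" "compact K" "K \<subseteq> \<Omega>" "continuous_on \<Omega> f" "!!z. z \<in> \<Omega> - K ==> f z = 0"
 shows "set_integrable lborel \<Omega> f"
proof -
 let ?f = "%z. if z \<in> \<Omega> then f z else 0"
 have "integrable lborel (%x. indicator K x *\<^sub>R ?f x)"
  by (rule borel_integrable_compact[OF assms(2) continuous_on_subset[OF continuous_on_extend_zero[OF assms] subset_UNIV]])
 also have "(%x. indicator K x *\<^sub>R ?f x) = (%x. indicator \<Omega> x *\<^sub>R f x)"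
  using assms(3,5) by (auto simp: fun_eq_iff indicator_def)
 finally show ?thesis unfolding set_integrable_def .
qed

lemma set_integral_compact_support:
 fixes f :: "'a::euclidean_space => 'c::euclidean_space"
 assumes "open \<Omega>" "compact K" "K \<subseteq> \<Omega>" "continuous_on \<Omega> f" "!!z. z \<in> \<Omega> - K ==> f z = 0"
  and "\<Omega> \<subseteq> cbox a b"
 shows "(LBINT z:\<Omega>. f z) = integral (cbox a b) (%z. if z \<in> \<Omega> then f z else 0)"
proof -
 have "(LBINT z:\<Omega>. f z) = integral \<Omega> f"
  by (rule set_borel_integral_eq_integral(2)[OF integrable_compact_support[OF assms(1-5)]])
 also have "... = integral (cbox a b) (%z. if z \<in> \<Omega> then f z else 0)"
  by (subst integral_restrict_Int) (simp add: Int_absorb2[OF assms(6)])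
 finally show ?thesis .
qed

text \<open>One compact \<open>K\<close> serves all parameters in \<open>U\<close>. The second
  conclusion records that the derivative inherits the support: off \<open>K\<close> the integrand
  vanishes on the whole open set \<open>U\<close> of parameters.\<close>

lemma has_derivative_integral_compact_support:
 fixes F :: "'p::euclidean_space => 'a::euclidean_space => 'c::euclidean_space"
 assumes U: "open U" "convex U" and \<Omega>: "open \<Omega>" "bounded \<Omega>" and K: "compact K" "K \<subseteq> \<Omega>"
  and cF: "!!p. p \<in> U ==> continuous_on \<Omega> (F p)"
  and cF': "!!v. continuous_on (U \<times> \<Omega>) (%(p, z). F' p z v)"
  and D: "!!p z. p \<in> U ==> z \<in> \<Omega> ==> ((%p. F p z) has_derivative F' p z) (at p)"
  and zero: "!!p z. p \<in> U ==> z \<in> \<Omega> - K ==> F p z = 0"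
  and p0: "p0 \<in> U"
 shows "((%p. LBINT z:\<Omega>. F p z) has_derivative (%v. LBINT z:\<Omega>. F' p0 z v)) (at p0)"
  and "!!v p z. p \<in> U ==> z \<in> \<Omega> - K ==> F' p z v = 0"
proof -
 show zero': "F' p z v = 0" if "p \<in> U" "z \<in> \<Omega> - K" for p z v
 proof -
  have "((%p. 0) has_derivative F' p z) (at p)"
   using has_derivative_transform_within_open[OF D[OF that(1)] U(1) that(1)] that zero by auto
  hence "F' p z = (%v. 0)" using has_derivative_unique has_derivative_const by blast
  thus ?thesis by simp
 qed
 obtain a b where ab: "\<Omega> \<subseteq> cbox a b" using \<Omega>(2) bounded_subset_cbox_symmetric by metis
 define F0 where "F0 p z = (if z \<in> \<Omega> then F p z else 0)" for p z
 \<comment> \<open>\<open>leibniz_rule\<close> wants the derivative as a \<open>blinfun\<close>,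
   continuous in the operator norm; in finite dimension continuity in each basis direction is
   enough.\<close>
 define D0 where "D0 p z = (if z \<in> \<Omega> then Blinfun (F' p z) else 0)" for p z
 have bl: "bounded_linear (F' p z)" if "p \<in> U" "z \<in> \<Omega>" for p z
  using D[OF that] has_derivative_bounded_linear by blast
 have D0_app: "blinfun_apply (D0 p z) v = (if z \<in> \<Omega> then F' p z v else 0)" if "p \<in> U" for p z v
  using that by (simp add: D0_def bounded_linear_Blinfun_apply bl)
 have contD0: "continuous_on (U \<times> UNIV) (%(p, z). D0 p z)"
 proof (rule continuous_on_blinfun_componentwise)
  fix i :: 'p
  have "continuous_on (U \<times> UNIV) (%(p, z). if z \<in> \<Omega> then F' p z i else 0)"
   using continuous_on_extend_zero_param[OF U(1) \<Omega>(1) K cF'] zero' by blast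
  thus "continuous_on (U \<times> UNIV) (%x. blinfun_apply (case x of (p, z) => D0 p z) i)"
   by (rule continuous_on_eq) (auto simp: D0_app)
 qed
 have contF0: "continuous_on UNIV (F0 p)" if "p \<in> U" for p
  unfolding F0_def[abs_def] using that by (intro continuous_on_extend_zero[OF \<Omega>(1) K cF]) (auto simp: zero)
 have "((%p. integral (cbox a b) (F0 p)) has_derivative integral (cbox a b) (D0 p0)) (at p0 within U)"
 proof (rule leibniz_rule[OF _ _ _ p0 U(2)])
  fix p t assume p: "p \<in> U"
  show "((%x. F0 x t) has_derivative blinfun_apply (D0 p t)) (at p within U)"
  proof (cases "t \<in> \<Omega>")
   case True
   have "blinfun_apply (D0 p t) = F' p t" using True p by (auto simp: D0_app fun_eq_iff)
   thus ?thesis using D[OF p True] True by (simp add: F0_def has_derivative_at_withinI)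
  next
   case False
   thus ?thesis by (simp add: F0_def D0_def zero_blinfun.rep_eq)
  qed
 next
  show "F0 x integrable_on cbox a b" if "x \<in> U" for x
   using contF0[OF that] by (intro integrable_continuous) (auto intro: continuous_on_subset)
  show "continuous_on (U \<times> cbox a b) (%(x, t). D0 x t)"
   by (rule continuous_on_subset[OF contD0]) auto
 qed
 hence *: "((%p. integral (cbox a b) (F0 p)) has_derivative integral (cbox a b) (D0 p0)) (at p0)"
  using at_within_open[OF p0 U(1)] by simp
 have eqF: "integral (cbox a b) (F0 p) = (LBINT z:\<Omega>. F p z)" if "p \<in> U" for p
  unfolding F0_def[abs_def]
  by (subst set_integral_compact_support[OF \<Omega>(1) K cF[OF that] _ ab]) (auto simp: zero that)
 have eqD: "integral (cbox a b) (D0 p0) v = (LBINT z:\<Omega>. F' p0 z v)" for v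
 proof -
  have int: "D0 p0 integrable_on cbox a b"
   by (intro integrable_continuous continuous_on_compose2[OF contD0, of _ "%z. (p0, z)", simplified])
    (auto intro!: continuous_intros p0)
  have c: "continuous_on \<Omega> (%z. F' p0 z v)"
   using continuous_on_compose2[OF cF', of \<Omega> "%z. (p0, z)"] p0
   by (force intro!: continuous_intros)
  have "integral (cbox a b) (D0 p0) v = integral (cbox a b) (%z. D0 p0 z v)"
   using integral_linear[OF int blinfun.bounded_linear_left[of v]] by (simp add: o_def)
  also have "... = (LBINT z:\<Omega>. F' p0 z v)"
   by (subst set_integral_compact_support[OF \<Omega>(1) K c _ ab]) (auto simp: zero' p0 D0_app)
  finally show ?thesis .
 qed
 have "((%p. LBINT z:\<Omega>. F p z) has_derivative integral (cbox a b) (D0 p0)) (at p0)"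
  using has_derivative_transform_within_open[OF * U(1) p0] eqF by auto
 moreover have "blinfun_apply (integral (cbox a b) (D0 p0)) = (%v. LBINT z:\<Omega>. F' p0 z v)"
  using eqD by auto
 ultimately show "((%p. LBINT z:\<Omega>. F p z) has_derivative (%v. LBINT z:\<Omega>. F' p0 z v)) (at p0)"
  by metis
qed

lemma continuous_on_integral_compact_support:
 fixes F :: "'p::first_countable_topology => 'a::euclidean_space => 'c::euclidean_space"
 assumes U: "open U" and \<Omega>: "open \<Omega>" "bounded \<Omega>" and K: "compact K" "K \<subseteq> \<Omega>"
  and cF: "continuous_on (U \<times> \<Omega>) (%(p, z). F p z)"
  and zero: "!!p z. p \<in> U ==> z \<in> \<Omega> - K ==> F p z = 0"
 shows "continuous_on U (%p. LBINT z:\<Omega>. F p z)"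
proof -
 obtain a b where ab: "\<Omega> \<subseteq> cbox a b" using \<Omega>(2) bounded_subset_cbox_symmetric by metis
 have "continuous_on (U \<times> UNIV) (%(p, z). if z \<in> \<Omega> then F p z else 0)"
  by (rule continuous_on_extend_zero_param[OF U \<Omega>(1) K cF zero])
 hence "continuous_on U (%p. integral (cbox a b) (%z. if z \<in> \<Omega> then F p z else 0))"
  by (intro integral_continuous_on_param) (auto intro: continuous_on_subset)
 thus ?thesis
 proof (rule continuous_on_eq)
  fix p assume p: "p \<in> U"
  have "continuous_on \<Omega> (F p)"
   using continuous_on_compose2[OF cF, of \<Omega> "%z. (p, z)"] p by (force intro!: continuous_intros)
  thus "integral (cbox a b) (%z. if z \<in> \<Omega> then F p z else 0) = (LBINT z:\<Omega>. F p z)"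
   by (subst set_integral_compact_support[OF \<Omega>(1) K _ _ ab]) (auto simp: zero p)
 qed
qed

text \<open>The translates of \<open>u\<close> have constant integral, so the integral of a derivative of \<open>u\<close> vanishes.\<close>

lemma integral_derivative_eq_0:
 fixes u :: "'a::euclidean_space => 'c::euclidean_space"
 assumes \<Omega>: "open \<Omega>" "bounded \<Omega>" and K: "compact K" "K \<subseteq> \<Omega>"
  and D: "!!z. z \<in> \<Omega> ==> (u has_derivative u' z) (at z)"
  and c: "continuous_on \<Omega> (%z. u' z v)"
  and zero: "!!z. z \<in> \<Omega> - K ==> u z = 0"
 shows "set_integrable lborel \<Omega> (%z. u' z v)" "(LBINT z:\<Omega>. u' z v) = 0"
proof -
 have op: "open (\<Omega> - K)" using \<Omega>(1) K(1) by (simp add: compact_imp_closed open_Diff)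
 have zero': "u' z = (%v. 0)" if "z \<in> \<Omega> - K" for z
 proof -
  have "((%p. 0) has_derivative u' z) (at z)"
   using has_derivative_transform_within_open[OF D op that] that zero by auto
  thus ?thesis using has_derivative_unique has_derivative_const by blast
 qed
 have cu: "continuous_on \<Omega> u"
  by (intro continuous_at_imp_continuous_on ballI) (rule has_derivative_continuous[OF D])
 show "set_integrable lborel \<Omega> (%z. u' z v)"
  by (rule integrable_compact_support[OF \<Omega>(1) K c]) (simp add: zero')
 define u0 where "u0 z = (if z \<in> \<Omega> then u z else 0)" for z
 define d0 where "d0 z = (if z \<in> \<Omega> then u' z v else 0)" for z
 have cu0: "continuous_on UNIV u0"
  unfolding u0_def[abs_def] by (rule continuous_on_extend_zero[OF \<Omega>(1) K cu zero])
 have cd0: "continuous_on UNIV d0"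
  unfolding d0_def[abs_def] by (rule continuous_on_extend_zero[OF \<Omega>(1) K c]) (simp add: zero')
 define u0' where "u0' z = (if z \<in> \<Omega> then u' z else (%v. 0))" for z
 have Du0: "(u0 has_derivative u0' z) (at z)" for z
 proof (cases "z \<in> \<Omega>")
  case True
  from has_derivative_transform_within_open[OF D[OF True] \<Omega>(1) True, of u0] show ?thesis
   by (simp add: u0_def u0'_def True)
 next
  case False
  hence z: "z \<in> - K" using K(2) by auto
  have "open (- K)" using K(1) by (simp add: compact_imp_closed open_Compl)
  from has_derivative_transform_within_open[OF has_derivative_const[of 0] this z, of u0] show ?thesis
   using zero False by (auto simp: u0_def u0'_def)
 qed
 obtain B where B: "!!z. z \<in> \<Omega> ==> norm z <= B" using \<Omega>(2) bounded_iff by blast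
 \<comment> \<open>Contains every translate of \<Omega> by a multiple t v with |t| <= 1, so the
   integrals of all translates are taken over one fixed box.\<close>
 define C where "C = (cball 0 (B + norm v) :: 'a set)"
 obtain a b :: 'a where ab: "C \<subseteq> cbox a b"
  using bounded_subset_cbox_symmetric[OF bounded_cball] unfolding C_def by metis
 have in_C: "z \<in> C" if "z + t *\<^sub>R v \<in> \<Omega>" "\<bar>t\<bar> <= 1" for z t
 proof -
  have "norm z <= norm (z + t *\<^sub>R v) + norm (t *\<^sub>R v)" by (metis add_diff_cancel norm_triangle_ineq4)
  also have "... <= B + 1 * norm v"
   using B[OF that(1)] mult_right_mono[OF that(2) norm_ge_zero[of v]] by (intro add_mono) auto
  finally show ?thesis by (simp add: C_def)
 qed
 have const: "integral (cbox a b) (%z. u0 (z + t *\<^sub>R v)) = (LBINT z. u0 z)" if t: "\<bar>t\<bar> <= 1" for t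
 proof -
  have c1: "continuous_on UNIV (%z. u0 (z + t *\<^sub>R v))"
   by (intro continuous_on_compose2[OF cu0]) (auto intro!: continuous_intros)
  have "set_integrable lborel (cbox a b) (%z. u0 (z + t *\<^sub>R v))"
   unfolding set_integrable_def
   using borel_integrable_compact[OF compact_cbox continuous_on_subset[OF c1 subset_UNIV], of a b]
   by (simp add: indicator_scaleR_eq_if)
  from set_borel_integral_eq_integral(2)[OF this]
  have "integral (cbox a b) (%z. u0 (z + t *\<^sub>R v)) = (LBINT z:cbox a b. u0 (z + t *\<^sub>R v))" ..
  also have "... = (LBINT z. u0 (z + t *\<^sub>R v))"
   unfolding set_lebesgue_integral_def
   using in_C[OF _ t] ab by (intro Bochner_Integration.integral_cong) (auto simp: indicator_def u0_def)
  also have "... = (LBINT z. u0 (t *\<^sub>R v + z))" by (simp add: add.commute)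
  also have "... = (\<integral>z. u0 z \<partial>distr lborel borel ((+) (t *\<^sub>R v)))"
   using cu0 by (subst integral_distr) (auto simp: borel_measurable_continuous_onI)
  finally show ?thesis by (simp add: lborel_distr_plus)
 qed
 have "((%t. integral (cbox a b) (%z. u0 (z + t *\<^sub>R v))) has_vector_derivative
   integral (cbox a b) (%z. d0 (z + 0 *\<^sub>R v))) (at 0 within {-1<..<1::real})"
 proof (rule leibniz_rule_vector_derivative)
  fix t :: real and z
  have "((%t. z + t *\<^sub>R v) has_derivative (%s. s *\<^sub>R v)) (at t)"
   by (auto intro!: derivative_eq_intros)
  from has_derivative_compose[OF this Du0]
  have "((%t. u0 (z + t *\<^sub>R v)) has_derivative (%s. u0' (z + t *\<^sub>R v) (s *\<^sub>R v))) (at t)" .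
  moreover have "u0' (z + t *\<^sub>R v) (s *\<^sub>R v) = s *\<^sub>R d0 (z + t *\<^sub>R v)" for s
   using linear_cmul[OF has_derivative_linear[OF Du0]] by (simp add: u0'_def d0_def)
  ultimately show "((%x. u0 (z + x *\<^sub>R v)) has_vector_derivative d0 (z + t *\<^sub>R v)) (at t within {-1<..<1})"
   by (simp add: has_vector_derivative_def has_derivative_at_withinI)
 next
  show "(%z. u0 (z + t *\<^sub>R v)) integrable_on cbox a b" for t
   by (intro integrable_continuous continuous_on_compose2[OF cu0]) (auto intro!: continuous_intros)
  show "continuous_on ({-1<..<1} \<times> cbox a b) (%(x, t). d0 (t + x *\<^sub>R v))"
   by (simp add: split_beta, intro continuous_on_compose2[OF cd0]) (auto intro!: continuous_intros)
 qed auto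
 hence *: "((%t. integral (cbox a b) (%z. u0 (z + t *\<^sub>R v))) has_vector_derivative
   integral (cbox a b) d0) (at 0)"
  by (simp add: at_within_open[of _ "{-1<..<1::real}"])
 have "((%t. LBINT z. u0 z) has_vector_derivative integral (cbox a b) d0) (at 0)"
  by (rule has_vector_derivative_transform_within_open[OF *, of "{-1<..<1}"]) (auto simp: const)
 hence "integral (cbox a b) d0 = 0"
  using vector_derivative_unique_at has_vector_derivative_const by blast
 moreover have "\<Omega> \<subseteq> cbox a b" using ab in_C[of _ 0] by auto
 ultimately show "(LBINT z:\<Omega>. u' z v) = 0"
  using set_integral_compact_support[OF \<Omega>(1) K c, of a b] by (auto simp: zero' d0_def[abs_def])
qed

text \<open>Both the image measure and \<open>lborel\<close> are translation invariant, hence proportional; the unit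
 ball fixes the factor.\<close>

lemma lborel_distr_orthogonal:
 fixes U :: "'a::euclidean_space => 'a"
 assumes U: "orthogonal_transformation U"
 shows "distr lborel borel U = lborel"
proof (rule measure_eqI)
 have lin: "linear U" using U orthogonal_transformation_linear by blast
 have Um[measurable]: "U \<in> borel_measurable borel"
  using linear_continuous_on linear_conv_bounded_linear lin by (intro borel_measurable_continuous_onI) blast
 let ?B = "ball 0 1 :: 'a set"
 define c where "c = emeasure lborel ?B"
 have c: "c \<noteq> 0" "c \<noteq> \<infinity>"
  unfolding c_def using emeasure_bounded_finite[of ?B] open_not_negligible[of ?B]
  by (auto simp: negligible_iff_emeasure0 less_top)
 fix A assume "A \<in> sets (distr lborel borel U)"
 hence A[measurable]: "A \<in> sets borel" by simp
 define iA iB :: "'a => ennreal" where "iA = indicator A" and "iB = indicator ?B"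
 have [measurable]: "iA \<in> borel_measurable borel" "iB \<in> borel_measurable borel"
  by (auto simp: iA_def iB_def intro!: borel_measurable_indicator)
 have tr: "(\<integral>\<^sup>+y. f y \<partial>lborel) = (\<integral>\<^sup>+y. f (a + y) \<partial>lborel)" if [measurable]: "f \<in> borel_measurable borel" for f :: "'a => ennreal" and a
  by (subst lborel_distr_plus[symmetric, of a], subst nn_integral_distr) auto
 have refl: "(\<integral>\<^sup>+y. f y \<partial>lborel) = (\<integral>\<^sup>+y. f (x - y) \<partial>lborel)" if [measurable]: "f \<in> borel_measurable borel" for f :: "'a => ennreal" and x
  by (subst lborel_affine[of "-1" x], simp, subst nn_integral_density, measurable, subst nn_integral_distr) auto
 have BU: "iB (U x) = iB x" for x
  using orthogonal_transformation_norm[OF U] by (simp add: indicator_def iB_def)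
 have cB: "(\<integral>\<^sup>+x. iB x \<partial>lborel) = c" by (simp add: iB_def c_def)
 have eA: "(\<integral>\<^sup>+x. iA x \<partial>lborel) = emeasure lborel A" by (simp add: iA_def)
 have eU: "(\<integral>\<^sup>+x. iA (U x) \<partial>lborel) = emeasure (distr lborel borel U) A"
  by (subst nn_integral_distr[symmetric, of U lborel borel]) (auto simp: iA_def)
 \<comment> \<open>Uniqueness of the Haar measure: in the double integral of 1_A(U x) 1_B(y)
   substitute y by U x + y, then x by w + x with U w = -y, then y by U x - y. The result is the
   integral of 1_A(y) 1_B(U x), and the ball B is invariant under U.\<close>
 have "emeasure (distr lborel borel U) A * c = (\<integral>\<^sup>+x. (\<integral>\<^sup>+y. iA (U x) * iB y \<partial>lborel) \<partial>lborel)"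
  by (simp add: nn_integral_cmult nn_integral_multc cB eU)
 also have "... = (\<integral>\<^sup>+x. (\<integral>\<^sup>+y. iA (U x) * iB (U x + y) \<partial>lborel) \<partial>lborel)"
 proof (rule nn_integral_cong)
  fix x show "(\<integral>\<^sup>+y. iA (U x) * iB y \<partial>lborel) = (\<integral>\<^sup>+y. iA (U x) * iB (U x + y) \<partial>lborel)"
   by (rule tr) measurable
 qed
 also have "... = (\<integral>\<^sup>+y. (\<integral>\<^sup>+x. iA (U x) * iB (U x + y) \<partial>lborel) \<partial>lborel)"
  by (subst lborel_pair.Fubini') auto
 also have "... = (\<integral>\<^sup>+y. (\<integral>\<^sup>+x. iA (U x - y) * iB (U x) \<partial>lborel) \<partial>lborel)"
 proof (rule nn_integral_cong)
  fix y :: 'a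
  obtain w where w: "U w = - y" using orthogonal_transformation_surj[OF U] by (metis surjD)
  have "(\<integral>\<^sup>+x. iA (U x) * iB (U x + y) \<partial>lborel) = (\<integral>\<^sup>+x. iA (U (w + x)) * iB (U (w + x) + y) \<partial>lborel)"
   by (rule tr) measurable
  thus "(\<integral>\<^sup>+x. iA (U x) * iB (U x + y) \<partial>lborel) = (\<integral>\<^sup>+x. iA (U x - y) * iB (U x) \<partial>lborel)"
   by (simp add: linear_add[OF lin] w)
 qed
 also have "... = (\<integral>\<^sup>+x. (\<integral>\<^sup>+y. iA (U x - y) * iB (U x) \<partial>lborel) \<partial>lborel)"
  by (subst lborel_pair.Fubini') auto
 also have "... = (\<integral>\<^sup>+x. (\<integral>\<^sup>+y. iA y * iB (U x) \<partial>lborel) \<partial>lborel)"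
 proof (rule nn_integral_cong)
  fix x show "(\<integral>\<^sup>+y. iA (U x - y) * iB (U x) \<partial>lborel) = (\<integral>\<^sup>+y. iA y * iB (U x) \<partial>lborel)"
   by (rule refl[symmetric]) measurable
 qed
 also have "... = emeasure lborel A * c"
  by (simp add: BU nn_integral_cmult nn_integral_multc eA cB)
 finally show "emeasure (distr lborel borel U) A = emeasure lborel A"
  using c by (metis mult_divide_eq_ennreal infinity_ennreal_def)
qed simp

section \<open>The invariant Laplacian\<close>

lemma has_partials_zero:
 assumes "has_partials f f1 S" "open T" "T \<subseteq> S" "!!x. x \<in> T ==> f x = 0" "x \<in> T"
 shows "f1 i x = 0"
proof -
 have "((%x. 0) has_derivative (%v. \<Sum>i\<in>UNIV. v$i *\<^sub>R f1 i x)) (at x)"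
  by (rule has_derivative_transform_within_open[OF has_partialsD(1)[OF assms(1) subsetD[OF assms(3,5)]] assms(2,5) assms(4)])
 hence "(%v. \<Sum>i\<in>UNIV. v$i *\<^sub>R f1 i x) = (%v. 0)"
  using has_derivative_unique has_derivative_const by blast
 hence "(\<Sum>j\<in>UNIV. axis i 1$j *\<^sub>R f1 j x) = 0" by metis
 thus ?thesis by (simp add: sum_axis)
qed

lemma integral_partial_eq_0:
 fixes u :: "real^'n => 'c::euclidean_space"
 assumes "has_partials u u1 UB" "compact K" "K \<subseteq> UB"
  "!!z. z \<in> UB - K ==> u z = 0"
 shows "set_integrable lborel UB (u1 i)" "(LBINT z:UB. u1 i z) = 0"
 using integral_derivative_eq_0[OF open_ball bounded_ball assms(2,3) has_partialsD(1)[OF assms(1)] _ assms(4), of "axis i 1"]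
 by (simp_all add: sum_axis has_partialsD(2)[OF assms(1)])

lemma integral_divergence_eq_0:
 fixes u :: "'n => real^'n => 'c::euclidean_space"
 assumes "!!i. has_partials (u i) (u1 i) UB" "compact K" "K \<subseteq> UB"
  "!!i z. z \<in> UB - K ==> u i z = 0"
 shows "set_integrable lborel UB (%z. \<Sum>i\<in>UNIV. u1 i i z)" "(LBINT z:UB. (\<Sum>i\<in>UNIV. u1 i i z)) = 0"
proof -
 note * = integral_partial_eq_0[OF assms(1-3) assms(4)]
 show "set_integrable lborel UB (%z. \<Sum>i\<in>UNIV. u1 i i z)"
  unfolding set_integrable_def scaleR_sum_right
  by (intro Bochner_Integration.integrable_sum *(1)[unfolded set_integrable_def])
 show "(LBINT z:UB. (\<Sum>i\<in>UNIV. u1 i i z)) = 0"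
  unfolding set_lebesgue_integral_def scaleR_sum_right
  by (subst Bochner_Integration.integral_sum)
   (simp_all only: *[unfolded set_integrable_def set_lebesgue_integral_def] sum.neutral_const)
qed

lemma dl_pos: "x \<in> UB ==> 0 < dl x"
 by (simp add: abs_square_less_1)

lemma DERIV_inverse_power:
 assumes "(x::real) \<noteq> 1"
 shows "((%t. 1 / (1 - t) ^ m) has_real_derivative real m / (1 - x) ^ (m + 1)) (at x)"
proof -
 have "((%t. inverse (1 - t) ^ m) has_real_derivative
   real m * (inverse (1 - x) * inverse (1 - x) * inverse (1 - x) ^ (m - Suc 0))) (at x)"
  using assms by (auto intro!: derivative_eq_intros)
 also have "real m * (inverse (1 - x) * inverse (1 - x) * inverse (1 - x) ^ (m - Suc 0)) = real m / (1 - x) ^ (m + 1)"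
  by (cases m) (simp_all add: divide_inverse power_inverse mult_ac)
 finally show ?thesis by (simp add: divide_inverse power_inverse)
qed

lemma has_partials_weight:
 "has_partials (%z::real^'n. 1 / (dl z) ^ m)
   (%i z. 2 * z$i * (real m / (dl z) ^ (m + 1))) UB"
proof -
 have "has_partials (%z::real^'n. 1 / (dl (z - 0)) ^ m)
   (%i z. (2 * (z - 0)$i) *\<^sub>R (real m / (dl (z - 0)) ^ (m + 1))) UB"
 proof (rule has_partials_compose_real[OF has_partials_norm_sq])
  fix x :: "real^'n" assume "x \<in> UB"
  hence "dl (x - 0) \<noteq> 0" using dl_pos by force
  thus "((%t. 1 / (1 - t) ^ m) has_vector_derivative real m / (dl (x - 0)) ^ (m + 1)) (at ((norm (x - 0))^2))"
   unfolding has_real_derivative_iff_has_vector_derivative[symmetric]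
   by (intro DERIV_inverse_power) auto
 next
  show "continuous_on ((%x::real^'n. (norm (x - 0))^2) ` UB) (%t. real m / (1 - t) ^ (m + 1))"
   using dl_pos by (intro continuous_intros) force+
 qed
 thus ?thesis by simp
qed

definition radial_derivative :: "(real^'n => complex) => real^'n => complex" where
 "radial_derivative f x = (\<Sum>i\<in>UNIV. of_real (x $ i) * pderivative i f x)"

lemma h_harmonic_continuous: "f \<in> h_harmonic ==> continuous_on UB f"
 using has_partials_continuous h_harmonicD(1) by blast

lemma continuous_on_radial_derivative:
 "f \<in> h_harmonic ==> continuous_on UB (radial_derivative f)"
 unfolding radial_derivative_def[abs_def]
 by (intro continuous_intros has_partialsD(2)[OF h_harmonicD(1)])

lemma h_harmonic_laplacian:
 fixes f :: "real^'n => complex"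
 assumes f: "f \<in> h_harmonic" and x: "x \<in> UB"
 shows "of_real (dl x) * (\<Sum>i\<in>UNIV. pderivative i (pderivative i f) x)
   = - (of_real (2 * (real CARD('n) - 2)) * radial_derivative f x)"
proof -
 let ?B = "dl x"
 have "of_real ?B * (of_real ?B * (\<Sum>i\<in>UNIV. pderivative i (pderivative i f) x)
   + of_real (2 * (real CARD('n) - 2)) * radial_derivative f x) = 0"
  using h_harmonicD(3)[OF f x] by (simp add: radial_derivative_def power2_eq_square algebra_simps)
 moreover have "?B \<noteq> 0" using dl_pos[OF x] by simp
 hence "complex_of_real ?B \<noteq> 0" unfolding of_real_eq_0_iff .
 ultimately have "of_real ?B * (\<Sum>i\<in>UNIV. pderivative i (pderivative i f) x)
   + of_real (2 * (real CARD('n) - 2)) * radial_derivative f x = 0"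
  by (auto simp only: mult_eq_0_iff)
 thus ?thesis unfolding eq_neg_iff_add_eq_0 .
qed

text \<open>\<open>hyp_laplacian\<close> is \<open>(1 - |z|\<^sup>2)\<^sup>n div ((1 - |z|\<^sup>2)\<^sup>2\<^sup>-\<^sup>n grad)\<close>, hence symmetric with respect to the
 invariant measure \<open>(1 - |z|\<^sup>2)\<^sup>-\<^sup>n dz\<close>.\<close>

lemma green_identity:
 fixes g \<psi> :: "real^'n => complex"
 assumes n: "2 <= CARD('n)" and g: "g \<in> h_harmonic"
  and p1: "has_partials \<psi> \<psi>1 UB" and p2: "!!i. has_partials (\<psi>1 i) (\<psi>2 i) UB"
  and K: "compact K" "K \<subseteq> UB" and zero: "!!z. z \<in> UB - K ==> \<psi> z = 0"
 shows "(LBINT z:UB. g z * hyp_laplacian \<psi> z / of_real ((dl z) ^ CARD('n))) = 0"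
proof -
 let ?n = "CARD('n)" let ?B = "%z::real^'n. dl z"
 let ?g1 = "%i. pderivative i g" and ?g2 = "%i j. pderivative j (pderivative i g)"
 let ?p = "%z. complex_of_real (1 / ?B z ^ (?n - 2))"
 let ?p1 = "%i z. complex_of_real (2 * z$i * (real (?n - 2) / ?B z ^ (?n - 2 + 1)))"
 have hp: "has_partials ?p ?p1 UB"
  by (rule has_partials_bounded_linear[OF bounded_linear_of_real has_partials_weight])
 note hg = h_harmonicD(1,2)[OF g]
 have op: "open (UB - K)" using K(1) by (simp add: compact_imp_closed open_Diff)
 have zero1: "\<psi>1 i z = 0" if "z \<in> UB - K" for i z
  by (rule has_partials_zero[OF p1 op _ zero that]) auto
 \<comment> \<open>The field is (1 - |z|^2)^(2-n) (g grad \<psi> - \<psi> grad g). In its divergence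
   the products of two gradients cancel, and \<open>h_harmonic_laplacian\<close> removes the terms
   with \<psi> undifferentiated; n >= 2 makes the natural exponent n - 2 a true difference.\<close>
 note hu = has_partials_mult[OF hp has_partials_diff[OF has_partials_mult[OF hg(1) p2] has_partials_mult[OF p1 hg(2)]]]
 have eq: "(\<Sum>i\<in>UNIV. ?p z * (g z * \<psi>2 i i z + ?g1 i z * \<psi>1 i z - (\<psi> z * ?g2 i i z + \<psi>1 i z * ?g1 i z))
   + ?p1 i z * (g z * \<psi>1 i z - \<psi> z * ?g1 i z)) = g z * hyp_laplacian \<psi> z / of_real (?B z ^ ?n)"
  if z: "z \<in> UB" for z
 proof -
  have B: "?B z \<noteq> 0" using dl_pos[OF z] by simp
  define b where "b = complex_of_real (?B z)"
  have b: "b \<noteq> 0" using B unfolding b_def of_real_eq_0_iff .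
  define k where "k = complex_of_real (2 * (real ?n - 2))"
  define q where "q = 1 / b ^ (?n - 2)"
  define Lp Lg Ep Eg where "Lp = (\<Sum>i\<in>UNIV. \<psi>2 i i z)" and "Lg = (\<Sum>i\<in>UNIV. ?g2 i i z)"
   and "Ep = (\<Sum>i\<in>UNIV. of_real (z$i) * \<psi>1 i z)" and "Eg = (\<Sum>i\<in>UNIV. of_real (z$i) * ?g1 i z)"
  have p: "?p z = q" by (simp add: q_def b_def)
  have p1': "?p1 i z = of_real (z$i) * (k * q / b)" for i
  proof -
   have "2 * z$i * (real (?n - 2) / ?B z ^ (?n - 2 + 1)) = z$i * (2 * (real ?n - 2) * (1 / ?B z ^ (?n - 2)) / ?B z)"
    using n by (simp add: of_nat_diff algebra_simps)
   thus ?thesis by (simp only: q_def b_def k_def of_real_mult of_real_divide of_real_power of_real_1)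
  qed
  have "(\<Sum>i\<in>UNIV. ?p z * (g z * \<psi>2 i i z + ?g1 i z * \<psi>1 i z - (\<psi> z * ?g2 i i z + \<psi>1 i z * ?g1 i z))
   + ?p1 i z * (g z * \<psi>1 i z - \<psi> z * ?g1 i z))
   = (\<Sum>i\<in>UNIV. q * g z * \<psi>2 i i z - q * \<psi> z * ?g2 i i z + (k * q / b * g z) * (of_real (z$i) * \<psi>1 i z)
     - (k * q / b * \<psi> z) * (of_real (z$i) * ?g1 i z))"
   unfolding p p1' by (rule sum.cong) (simp_all add: algebra_simps)
  also have "... = q * g z * Lp - q * \<psi> z * Lg + (k * q / b * g z) * Ep
     - (k * q / b * \<psi> z) * Eg"
   by (simp add: sum.distrib sum_subtractf sum_distrib_left Lp_def Lg_def Ep_def Eg_def)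
  also have "... = q * g z * Lp + (k * q / b * g z) * Ep
    - q / b * \<psi> z * (b * Lg + k * Eg)"
   using b by (simp add: field_simps)
  also have "b * Lg + k * Eg = 0"
   using h_harmonic_laplacian[OF g z] by (simp add: b_def Lg_def Eg_def radial_derivative_def k_def)
  also have "q * g z * Lp + (k * q / b * g z) * Ep - q / b * \<psi> z * 0
    = g z * (b^2 * Lp + k * b * Ep) * (q / b^2)"
   using b by (simp add: field_simps power2_eq_square)
  also have "q / b^2 = 1 / b ^ ?n"
  proof -
   have "b ^ ?n = b ^ (?n - 2) * b^2" using n by (metis le_add_diff_inverse2 power_add)
   thus ?thesis by (simp add: q_def)
  qed
  also have "b^2 * Lp + k * b * Ep = hyp_laplacian \<psi> z"
   by (simp add: hyp_laplacian_partials[OF open_ball p1 p2 z] b_def k_def Lp_def Ep_def)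
  finally show ?thesis by (simp add: b_def)
 qed
 have "(LBINT z:UB. (\<Sum>i\<in>UNIV. ?p z * (g z * \<psi>2 i i z + ?g1 i z * \<psi>1 i z - (\<psi> z * ?g2 i i z + \<psi>1 i z * ?g1 i z))
   + ?p1 i z * (g z * \<psi>1 i z - \<psi> z * ?g1 i z))) = 0"
  by (rule integral_divergence_eq_0(2)[OF hu K]) (simp add: zero zero1)
 also have "(LBINT z:UB. (\<Sum>i\<in>UNIV. ?p z * (g z * \<psi>2 i i z + ?g1 i z * \<psi>1 i z - (\<psi> z * ?g2 i i z + \<psi>1 i z * ?g1 i z))
   + ?p1 i z * (g z * \<psi>1 i z - \<psi> z * ?g1 i z))) = (LBINT z:UB. g z * hyp_laplacian \<psi> z / of_real (?B z ^ ?n))"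
  by (rule set_lebesgue_integral_cong) (auto simp only: eq lborelD sets_lborel borel_open open_ball)
 finally show ?thesis .
qed

text \<open>\<open>(1 - |z|\<^sup>2)\<^sup>2\<^sup>-\<^sup>n (f grad g - g grad f)\<close> is divergence free; it is tested against the gradient of a
 radial function.\<close>

lemma radial_derivative_symmetric:
 fixes f g :: "real^'n => complex"
 assumes n: "2 <= CARD('n)" and f: "f \<in> h_harmonic" and g: "g \<in> h_harmonic"
  and w: "continuous_on UNIV w" and s: "s < 1" "!!t. s <= t ==> w t = 0"
 shows "(LBINT z:UB. of_real (w ((norm z)^2)) * (f z * radial_derivative g z - g z * radial_derivative f z)) = 0"
proof -
 let ?n = "CARD('n)" let ?B = "%z::real^'n. dl z"
 let ?g1 = "%i. pderivative i g" and ?g2 = "%i j. pderivative j (pderivative i g)"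
 let ?f1 = "%i. pderivative i f" and ?f2 = "%i j. pderivative j (pderivative i f)"
 let ?p = "%z. complex_of_real (1 / ?B z ^ (?n - 2))"
 let ?p1 = "%i z. complex_of_real (2 * z$i * (real (?n - 2) / ?B z ^ (?n - 2 + 1)))"
 have hp: "has_partials ?p ?p1 UB"
  by (rule has_partials_bounded_linear[OF bounded_linear_of_real has_partials_weight])
 \<comment> \<open>The gradient of W(|z|^2) with W' = q is 2 z q(|z|^2); the factor (1 - t)^(n-2) /
   2 cancels the weight of the field and leaves exactly w. \<open>W\<close> is normalised to vanish
   beyond s, so the field has compact support.\<close>
 define q where "q t = w t * (1 - t) ^ (?n - 2) / 2" for t
 have cq: "continuous_on UNIV q" unfolding q_def[abs_def] by (intro continuous_intros w) auto
 define W where "W t = integral {-1..t} q - integral {-1..1} q" for t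
 have W': "(W has_vector_derivative q t) (at t)" if "-1 < t" "t < 2" for t
 proof -
  have "((%t. integral {-1..t} q) has_vector_derivative q t) (at t within {-1..2})"
   using that by (intro integral_has_vector_derivative continuous_on_subset[OF cq]) auto
  hence "((%t. integral {-1..t} q) has_vector_derivative q t) (at t)"
   using that at_within_interior[of t "{-1..2}"] by (simp add: interior_atLeastAtMost_real)
  from has_vector_derivative_diff[OF this has_vector_derivative_const[of "integral {-1..1} q"]]
  show ?thesis unfolding W_def[abs_def] by simp
 qed
 have W0: "W t = 0" if "s <= t" "-1 <= t" "t <= 1" for t
 proof -
  have "integral {-1..t} q + integral {t..1} q = integral {-1..1} q"
   using that by (intro Henstock_Kurzweil_Integration.integral_combine integrable_continuous_real continuous_on_subset[OF cq]) auto
  moreover have "integral {t..1} q = integral {t..1} (%x. 0)"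
   using that s(2) by (intro Henstock_Kurzweil_Integration.integral_cong) (simp add: q_def)
  ultimately show ?thesis by (simp add: W_def)
 qed
 let ?W = "%z::real^'n. complex_of_real (W ((norm (z - 0))^2))"
 let ?W1 = "%i z::real^'n. complex_of_real ((2 * (z - 0)$i) *\<^sub>R q ((norm (z - 0))^2))"
 have hW: "has_partials ?W ?W1 UB"
 proof (intro has_partials_bounded_linear[OF bounded_linear_of_real] has_partials_compose_real[OF has_partials_norm_sq])
  show "(W has_vector_derivative q ((norm (x - 0))^2)) (at ((norm (x - 0))^2))" if "x \<in> UB" for x :: "real^'n"
   using dl_pos[OF that] by (intro W') (auto intro: less_le_trans[of _ 0])
  show "continuous_on ((%x::real^'n. (norm (x - 0))^2) ` UB) q"
   by (rule continuous_on_subset[OF cq]) auto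
 qed
 note hg = h_harmonicD(1,2)[OF g] and hf = h_harmonicD(1,2)[OF f]
 define K where "K = (cball 0 (sqrt (max 0 s)) :: (real^'n) set)"
 have K: "compact K" "K \<subseteq> UB"
  unfolding K_def using s(1) real_sqrt_lt_1_iff[of "max 0 s"] by (auto simp del: real_sqrt_lt_1_iff)
 have zero: "W ((norm z)^2) = 0" if "z \<in> UB - K" for z
 proof (rule W0)
  have "sqrt (max 0 s) <= norm z" using that by (simp add: K_def)
  thus "s <= (norm z)^2" using sqrt_le_D by fastforce
  show "(norm z)^2 <= 1" using dl_pos[of z] that by simp
 qed (auto intro: order_trans[of _ 0])
 note hu = has_partials_mult[OF hW has_partials_mult[OF hp has_partials_diff[OF has_partials_mult[OF hf(1) hg(2)] has_partials_mult[OF hg(1) hf(2)]]]]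
 let ?d = "%i z. ?W z * (?p z * (f z * ?g2 i i z + ?f1 i z * ?g1 i z - (g z * ?f2 i i z + ?g1 i z * ?f1 i z))
   + ?p1 i z * (f z * ?g1 i z - g z * ?f1 i z)) + ?W1 i z * (?p z * (f z * ?g1 i z - g z * ?f1 i z))"
 have eq: "(\<Sum>i\<in>UNIV. ?d i z) = of_real (w ((norm z)^2)) * (f z * radial_derivative g z - g z * radial_derivative f z)"
  if z: "z \<in> UB" for z
 proof -
  have B: "?B z \<noteq> 0" using dl_pos[OF z] by simp
  define b where "b = complex_of_real (?B z)"
  have b: "b \<noteq> 0" using B unfolding b_def of_real_eq_0_iff .
  define r where "r = 1 / b ^ (?n - 2)"
  define Lf Lg Ef Eg where "Lf = (\<Sum>i\<in>UNIV. ?f2 i i z)" and "Lg = (\<Sum>i\<in>UNIV. ?g2 i i z)"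
   and "Ef = (\<Sum>i\<in>UNIV. of_real (z$i) * ?f1 i z)" and "Eg = (\<Sum>i\<in>UNIV. of_real (z$i) * ?g1 i z)"
  define k where "k = complex_of_real (2 * (real ?n - 2))"
  define v where "v = complex_of_real (w ((norm z)^2))"
  have p: "?p z = r" by (simp add: r_def b_def)
  have p1': "?p1 i z = of_real (z$i) * (k * r / b)" for i
  proof -
   have "2 * z$i * (real (?n - 2) / ?B z ^ (?n - 2 + 1)) = z$i * (2 * (real ?n - 2) * (1 / ?B z ^ (?n - 2)) / ?B z)"
    using n by (simp add: of_nat_diff algebra_simps)
   thus ?thesis by (simp only: r_def b_def k_def of_real_mult of_real_divide of_real_power of_real_1)
  qed
  have W1': "?W1 i z = of_real (z$i) * (v / r)" for i
   by (simp add: r_def b_def v_def q_def)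
  have LE: "b * Lf = - (k * Ef)" "b * Lg = - (k * Eg)"
   using h_harmonic_laplacian[OF f z] h_harmonic_laplacian[OF g z]
   by (simp_all add: b_def Lf_def Lg_def Ef_def Eg_def radial_derivative_def k_def)
  have "(\<Sum>i\<in>UNIV. ?d i z) = (\<Sum>i\<in>UNIV. (?W z * r * f z) * ?g2 i i z - (?W z * r * g z) * ?f2 i i z
    + (?W z * (k * r / b) * f z + v / r * r * f z) * (of_real (z$i) * ?g1 i z)
    - (?W z * (k * r / b) * g z + v / r * r * g z) * (of_real (z$i) * ?f1 i z))"
   unfolding p p1' W1' by (rule sum.cong) (simp_all add: algebra_simps)
  also have "... = (?W z * r * f z) * Lg - (?W z * r * g z) * Lf + (?W z * (k * r / b) * f z + v / r * r * f z) * Eg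
    - (?W z * (k * r / b) * g z + v / r * r * g z) * Ef"
   by (simp add: sum.distrib sum_subtractf sum_distrib_left Lf_def Lg_def Ef_def Eg_def)
  also have "... = (?W z * r * f z / b) * (b * Lg) - (?W z * r * g z / b) * (b * Lf) + (?W z * (k * r / b) * f z + v / r * r * f z) * Eg
    - (?W z * (k * r / b) * g z + v / r * r * g z) * Ef"
   using b by simp
  also have "... = (v / r * r) * (f z * Eg - g z * Ef)"
   unfolding LE by (simp add: algebra_simps)
  also have "v / r * r = v" using b by (simp add: r_def)
  finally show ?thesis by (simp add: v_def Ef_def Eg_def radial_derivative_def)
 qed
 have "(LBINT z:UB. (\<Sum>i\<in>UNIV. ?d i z)) = 0"
  by (rule integral_divergence_eq_0(2)[OF hu K]) (simp add: zero)
 also have "(LBINT z:UB. (\<Sum>i\<in>UNIV. ?d i z)) = (LBINT z:UB. of_real (w ((norm z)^2)) * (f z * radial_derivative g z - g z * radial_derivative f z))"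
  by (rule set_lebesgue_integral_cong) (auto simp only: eq sets_lborel borel_open open_ball)
 finally show ?thesis .
qed

text \<open>For the hyperbolic distance \<open>d\<close> of curvature -1, \<open>sg y z = (sinh (d y z / 2))\<^sup>2\<close>.\<close>

definition sg :: "real^'n => real^'n => real" where
 "sg y z = (norm (z - y))^2 / ((dl y) * (dl z))"

definition sg1 :: "real^'n => 'n => real^'n => real" where
 "sg1 y i z = ((norm (z - y))^2 * (2 * z$i / (dl z)^2) + 2 * (z - y)$i / (dl z)) / (dl y)"

definition sg2 :: "real^'n => 'n => 'n => real^'n => real" where
 "sg2 y i j z =
   ((norm (z - y))^2 * (2 * (if j = i then 1 else 0) / (dl z)^2 + 8 * z$i * z$j / (dl z)^3)
   + 4 * (z - y)$j * z$i / (dl z)^2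
   + 2 * (if j = i then 1 else 0) / (dl z) + 4 * (z - y)$i * z$j / (dl z)^2) / (dl y)"

lemma sg_sym: "sg y z = sg z y"
 by (simp add: sg_def norm_minus_commute mult.commute)

lemma sg_nonneg: "y \<in> UB ==> z \<in> UB ==> 0 <= sg y z"
 using dl_pos[of y] dl_pos[of z] by (simp add: sg_def)

lemma has_partials_cmult:
 fixes f :: "real^'n => 'c::real_normed_algebra"
 assumes "has_partials f f1 S" shows "has_partials (%x. c * f x) (%i x. c * f1 i x) S"
 by (rule has_partials_bounded_linear[OF bounded_linear_mult_right assms])

lemma has_partials_eq:
 assumes "has_partials f f1 S" "open S" "!!x. x \<in> S ==> f x = g x"
  "!!x i. x \<in> S ==> f1 i x = g1 i x"
 shows "has_partials g g1 S"
 by (rule has_partials_cong[OF assms])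

lemma has_partials_sg:
 fixes y :: "real^'n"
 shows "has_partials (sg y) (sg1 y) UB"
proof (rule has_partials_eq[OF has_partials_cmult[where c="1 / (dl y)", OF has_partials_mult[OF has_partials_norm_sq[of y] has_partials_weight[of 1]]] open_ball])
 fix z :: "real^'n" and i assume "z \<in> UB"
 show "1 / (dl y) * ((norm (z - y))^2 * (1 / (dl z) ^ 1)) = sg y z"
  by (simp add: sg_def)
 show "1 / (dl y) * ((norm (z - y))^2 * (2 * z$i * (real 1 / (dl z) ^ (1 + 1))) + 2 * (z - y)$i * (1 / (dl z) ^ 1)) = sg1 y i z"
  by (simp add: sg1_def power2_eq_square)
qed

lemma has_partials_sg1:
 fixes y :: "real^'n"
 shows "has_partials (sg1 y i) (sg2 y i) UB"
proof -
 have c: "has_partials (%z. (z - y) $ i) (%j z. if j = i then 1 else 0) UB"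
  using has_partials_diff[OF has_partials_nth has_partials_const[of "y$i"], of i] by simp
 note h = has_partials_cmult[where c="1 / (dl y)", OF has_partials_add[OF
   has_partials_mult[OF has_partials_norm_sq[of y] has_partials_cmult[OF has_partials_mult[OF has_partials_nth[of i] has_partials_weight[of 2]], of 2]]
   has_partials_cmult[OF has_partials_mult[OF c has_partials_weight[of 1]], of 2]]]
 show ?thesis
 proof (rule has_partials_eq[OF h open_ball])
  fix z :: "real^'n" and j assume "z \<in> UB"
  hence B: "dl z \<noteq> 0" using dl_pos by force
  show "1 / (dl y) * ((norm (z - y))^2 * (2 * (z $ i * (1 / (dl z)^2))) +
    2 * ((z - y) $ i * (1 / (dl z) ^ 1))) = sg1 y i z"
   by (simp add: sg1_def)
  show "1 / (dl y) * ((norm (z - y))^2 * (2 * (z $ i * (2 * z $ j * (real 2 / (dl z) ^ (2 + 1)))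
     + (if j = i then 1 else 0) * (1 / (dl z)^2))) + 2 * (z - y) $ j * (2 * (z $ i * (1 / (dl z)^2))) +
    2 * ((z - y) $ i * (2 * z $ j * (real 1 / (dl z) ^ (1 + 1))) + (if j = i then 1 else 0) * (1 / (dl z) ^ 1)))
    = sg2 y i j z" (is "1 / ?A * ?Y = _")
  proof -
   define b N zi zj di dj e where "b = dl z" and "N = (norm (z - y))^2" and "zi = z$i" and "zj = z$j"
    and "di = (z - y)$i" and "dj = (z - y)$j" and "e = (if j = i then 1 else 0::real)"
   note defs = b_def[symmetric] N_def[symmetric] zi_def[symmetric] zj_def[symmetric] di_def[symmetric] dj_def[symmetric] e_def[symmetric]
   have b: "b \<noteq> 0" using B by (simp add: b_def)
   have "N * (2 * (zi * (2 * zj * (real 2 / b ^ (2 + 1))) + e * (1 / b^2))) + 2 * dj * (2 * (zi * (1 / b^2))) +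
    2 * (di * (2 * zj * (real 1 / b ^ (1 + 1))) + e * (1 / b ^ 1))
    = N * (2 * e / b^2 + 8 * zi * zj / b^3) + 4 * dj * zi / b^2 + 2 * e / b + 4 * di * zj / b^2"
    using b by (simp add: divide_simps power2_eq_square power3_eq_cube) (simp add: algebra_simps)
   thus ?thesis unfolding sg2_def defs by simp
  qed
 qed
qed

lemma sum_inner: "(\<Sum>i\<in>UNIV. (x::real^'n)$i * y$i) = x \<bullet> y"
 by (simp add: inner_vec_def)

text \<open>Since z . (z - y) = (A - B + N) / 2, every sum becomes a rational function of
  \<open>A\<close>, \<open>B\<close>, \<open>N\<close>, and the claim is an identity between such
  functions. That only \<open>sg y z\<close> is left on the right is the invariance of the Laplacian
  in disguise: for functions of \<open>sg y z\<close> the operator is an ordinary differential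
  one.\<close>

lemma sg_laplacian:
 fixes y z :: "real^'n"
 assumes y: "y \<in> UB" and z: "z \<in> UB"
 shows "(dl z)^2 * (\<Sum>i\<in>UNIV. sg2 y i i z * h1 + sg1 y i z * sg1 y i z * h2)
   + 2 * (real CARD('n) - 2) * (dl z) * (\<Sum>i\<in>UNIV. z$i * (sg1 y i z * h1))
  = 4 * (sg y z * (1 + sg y z) * h2 + real CARD('n) * (sg y z + 1/2) * h1)"
proof -
 define A B N c n where "A = dl y" and "B = dl z" and "N = (norm (z - y))^2"
  and "c = z \<bullet> (z - y)" and "n = real CARD('n)"
 have A: "A \<noteq> 0" and B: "B \<noteq> 0" using dl_pos[OF y] dl_pos[OF z] by (simp_all add: A_def B_def)
 have c: "c = (A - B + N) / 2"
  unfolding A_def B_def N_def c_def power2_norm_eq_inner by (simp add: inner_diff algebra_simps inner_commute)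
 have zz: "z \<bullet> z = 1 - B" and dd: "(z - y) \<bullet> (z - y) = N"
  by (simp_all add: B_def N_def power2_norm_eq_inner)
 have s1: "sg1 y i z = (2 * N / (A * B^2)) * z$i + (2 / (A * B)) * (z - y)$i" for i
  unfolding sg1_def A_def[symmetric] B_def[symmetric] N_def[symmetric] using A B
  by (simp del: vector_minus_component add: divide_simps power2_eq_square)
 have E: "(\<Sum>i\<in>UNIV. z$i * sg1 y i z) = (2 * N / (A * B^2)) * (1 - B) + (2 / (A * B)) * c"
 proof -
  have "(\<Sum>i\<in>UNIV. z$i * sg1 y i z) = (\<Sum>i\<in>UNIV. (2 * N / (A * B^2)) * (z$i * z$i) + (2 / (A * B)) * (z$i * (z - y)$i))"
   unfolding s1 by (rule sum.cong) (auto simp del: vector_minus_component simp: algebra_simps)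
  also have "... = (2 * N / (A * B^2)) * (z \<bullet> z) + (2 / (A * B)) * c"
   unfolding c_def by (simp only: sum.distrib sum_distrib_left[symmetric] sum_inner)
  finally show ?thesis by (simp add: zz)
 qed
 have G: "(\<Sum>i\<in>UNIV. sg1 y i z * sg1 y i z) = (2 * N / (A * B^2))^2 * (1 - B) + 2 * (2 * N / (A * B^2)) * (2 / (A * B)) * c + (2 / (A * B))^2 * N"
 proof -
  have "(\<Sum>i\<in>UNIV. sg1 y i z * sg1 y i z) = (\<Sum>i\<in>UNIV. (2 * N / (A * B^2))^2 * (z$i * z$i) + 2 * (2 * N / (A * B^2)) * (2 / (A * B)) * (z$i * (z - y)$i)
    + (2 / (A * B))^2 * ((z-y)$i * (z-y)$i))"
   unfolding s1 by (rule sum.cong) (auto simp del: vector_minus_component simp: algebra_simps power2_eq_square)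
  also have "... = (2 * N / (A * B^2))^2 * (z \<bullet> z) + 2 * (2 * N / (A * B^2)) * (2 / (A * B)) * c + (2 / (A * B))^2 * ((z - y) \<bullet> (z - y))"
   unfolding c_def by (simp only: sum.distrib sum_distrib_left[symmetric] sum_inner)
  finally show ?thesis by (simp add: zz dd)
 qed
 have L: "(\<Sum>i\<in>UNIV. sg2 y i i z) = n * (2 * N / (A * B^2) + 2 / (A * B)) + 8 * N / (A * B^3) * (1 - B) + 8 / (A * B^2) * c"
 proof -
  have "sg2 y i i z = (2 * N / (A * B^2) + 2 / (A * B)) + 8 * N / (A * B^3) * (z$i * z$i) + 8 / (A * B^2) * (z$i * (z - y)$i)" for i
   unfolding sg2_def A_def[symmetric] B_def[symmetric] N_def[symmetric] using A B
   by (simp add: field_simps power2_eq_square power3_eq_cube)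
  hence "(\<Sum>i\<in>UNIV. sg2 y i i z) = n * (2 * N / (A * B^2) + 2 / (A * B)) + 8 * N / (A * B^3) * (z \<bullet> z) + 8 / (A * B^2) * c"
   unfolding c_def n_def by (simp only: sum.distrib sum_distrib_left[symmetric] sum_inner sum_constant)
    (simp add: distrib_left)
  thus ?thesis by (simp add: zz)
 qed
 have S: "sg y z = N / (A * B)" by (simp add: sg_def A_def B_def N_def)
 have "(\<Sum>i\<in>UNIV. sg2 y i i z * h1 + sg1 y i z * sg1 y i z * h2) = (\<Sum>i\<in>UNIV. sg2 y i i z) * h1 + (\<Sum>i\<in>UNIV. sg1 y i z * sg1 y i z) * h2"
  by (simp add: sum.distrib sum_distrib_right)
 moreover have "(\<Sum>i\<in>UNIV. z$i * (sg1 y i z * h1)) = (\<Sum>i\<in>UNIV. z$i * sg1 y i z) * h1"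
  by (simp add: sum_distrib_right mult.assoc)
 ultimately have "?thesis \<longleftrightarrow> (B^2 * ((\<Sum>i\<in>UNIV. sg2 y i i z) * h1 + (\<Sum>i\<in>UNIV. sg1 y i z * sg1 y i z) * h2)
  + 2 * (n - 2) * B * ((\<Sum>i\<in>UNIV. z$i * sg1 y i z) * h1) = 4 * (N / (A * B) * (1 + N / (A * B)) * h2 + n * (N / (A * B) + 1/2) * h1))" (is "_ \<longleftrightarrow> ?eq")
  unfolding S B_def[symmetric] n_def[symmetric] by simp
 moreover have ?eq
  unfolding E G L c using A B by (simp add: divide_simps) algebra
 ultimately show ?thesis by blast
qed

text \<open>\<open>h1\<close> and \<open>h2\<close> are the first two derivatives of \<open>h\<close>.\<close>

lemma has_partials_sg_compose:
 fixes y :: "real^'n"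
 assumes y: "y \<in> UB"
  and h: "!!t. 0 <= t ==> (h has_real_derivative h1 t) (at t)"
  and h1: "!!t. 0 <= t ==> (h1 has_real_derivative h2 t) (at t)"
  and h2: "continuous_on {0..} h2"
 shows "has_partials (%z. complex_of_real (h (sg y z))) (%i z. of_real (sg1 y i z * h1 (sg y z))) UB"
  and "!!i. has_partials (%z. complex_of_real (sg1 y i z * h1 (sg y z)))
   (%j z. of_real (sg2 y i j z * h1 (sg y z) + sg1 y i z * sg1 y j z * h2 (sg y z))) UB"
  and "!!z. z \<in> UB ==> hyp_laplacian (%z. complex_of_real (h (sg y z))) z
   = of_real (4 * (sg y z * (1 + sg y z) * h2 (sg y z) + real CARD('n) * (sg y z + 1/2) * h1 (sg y z)))"
proof -
 have ch1: "continuous_on {0..} h1"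
  using h1 by (intro DERIV_continuous_on[where D=h2]) (auto intro: has_field_derivative_at_within)
 have im: "sg y ` UB \<subseteq> {0..}" using sg_nonneg[OF y] by auto
 have c1: "has_partials (%z. h (sg y z)) (%i z. sg1 y i z *\<^sub>R h1 (sg y z)) UB"
  using h[OF sg_nonneg[OF y]] im
  by (intro has_partials_compose_real[OF has_partials_sg] continuous_on_subset[OF ch1])
   (auto simp: has_real_derivative_iff_has_vector_derivative)
 have c2: "has_partials (%z. h1 (sg y z)) (%i z. sg1 y i z *\<^sub>R h2 (sg y z)) UB"
  using h1[OF sg_nonneg[OF y]] im
  by (intro has_partials_compose_real[OF has_partials_sg] continuous_on_subset[OF h2])
   (auto simp: has_real_derivative_iff_has_vector_derivative)
 show 1: "has_partials (%z. complex_of_real (h (sg y z))) (%i z. of_real (sg1 y i z * h1 (sg y z))) UB"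
  using has_partials_bounded_linear[OF bounded_linear_of_real[where 'a=complex] c1] by simp
 show 2: "has_partials (%z. complex_of_real (sg1 y i z * h1 (sg y z)))
   (%j z. of_real (sg2 y i j z * h1 (sg y z) + sg1 y i z * sg1 y j z * h2 (sg y z))) UB" for i
  by (rule has_partials_eq[OF has_partials_bounded_linear[OF bounded_linear_of_real has_partials_mult[OF has_partials_sg1 c2]] open_ball])
   (auto simp: algebra_simps)
 fix z :: "real^'n" assume z: "z \<in> UB"
 show "hyp_laplacian (%z. complex_of_real (h (sg y z))) z
   = of_real (4 * (sg y z * (1 + sg y z) * h2 (sg y z) + real CARD('n) * (sg y z + 1/2) * h1 (sg y z)))"
  unfolding hyp_laplacian_partials[OF open_ball 1 2 z] sg_laplacian[OF y z, symmetric] by simp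
qed

section \<open>The mean value property\<close>

lemma norm_neq_minus_1 [simp]: "norm x \<noteq> -1"
 using norm_ge_zero[of x] by linarith

lemma norm_sq_less_1: "x \<in> UB ==> (norm x)^2 < 1"
 using dl_pos by fastforce

lemma sg_eq:
 assumes "y \<in> UB" "z \<in> UB"
 shows "(norm (z - y))^2 = sg y z * ((dl y) * (dl z))"
 using dl_pos[OF assms(1)] dl_pos[OF assms(2)] by (simp add: sg_def)

lemma norm_sq_diff_le:
 assumes "y \<in> UB" "z \<in> UB"
 shows "\<bar>(norm z)^2 - (norm y)^2\<bar> <= 2 * norm (z - y)"
proof -
 have "\<bar>(norm z)^2 - (norm y)^2\<bar> = \<bar>norm z - norm y\<bar> * (norm z + norm y)"
 proof -
  have "(norm z)^2 - (norm y)^2 = (norm z - norm y) * (norm z + norm y)"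
   by (simp add: power2_eq_square algebra_simps)
  thus ?thesis by (simp add: abs_mult)
 qed
 also have "... <= norm (z - y) * 2"
  using assms by (intro mult_mono norm_triangle_ineq3) auto
 finally show ?thesis by simp
qed

text \<open>If B > 2 A then B^2 / 4 < (B - A)^2 <= 4 |z - y|^2 <= A B / 4, which is absurd. This
  comparison makes all powers of 1 - |z|^2 almost constant on a set sg <= 1/16 and is the origin of
  the constant 1/16.\<close>

lemma sg_comparable:
 assumes "y \<in> UB" "z \<in> UB" "sg y z <= 1/16"
 shows "dl z <= 2 * (dl y)"
proof (rule ccontr)
 define A B where "A = dl y" and "B = dl z"
 have A: "A > 0" and B: "B > 0" using dl_pos assms by (auto simp: A_def B_def)
 assume "\<not> ?thesis"
 hence *: "B > 2 * A" by (simp add: A_def B_def)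
 have "(B - A)^2 = \<bar>(norm z)^2 - (norm y)^2\<bar>^2" by (simp add: A_def B_def power2_commute)
 also have "... <= (2 * norm (z - y))^2" by (intro power_mono norm_sq_diff_le assms) auto
 also have "... = 4 * (sg y z * (A * B))" using sg_eq[OF assms(1,2)] by (simp add: A_def B_def power_mult_distrib)
 also have "... <= 4 * (1/16 * (A * B))" using assms(3) A B by (intro mult_left_mono mult_right_mono) auto
 finally have 1: "(B - A)^2 <= A * B / 4" by simp
 have "(B/2)^2 < (B - A)^2" using * B by (intro power_strict_mono) auto
 hence "B * B < A * B" using 1 by (simp add: power2_eq_square)
 thus False using * A B by simp
qed

text \<open>\<open>sg\<close> behaves like a squared distance: 8 is 2 from (a + b)^2 <= 2 a^2 + 2
  b^2, times 2 for the two summands, times 2 from \<open>sg_comparable\<close>.\<close>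

lemma sg_triangle:
 assumes "x \<in> UB" "y \<in> UB" "z \<in> UB" "sg x y <= \<delta>" "sg y z <= \<delta>" "\<delta> <= 1/16"
 shows "sg x z <= 8 * \<delta>"
proof -
 define A B C where "A = dl x" and "B = dl y" and "C = dl z"
 have A: "A > 0" and B: "B > 0" and C: "C > 0" using dl_pos assms by (auto simp: A_def B_def C_def)
 have d: "0 <= \<delta>" using sg_nonneg assms order_trans by blast
 have 1: "B <= 2 * A" "B <= 2 * C"
  using sg_comparable[of x y] sg_comparable[of z y] assms by (auto simp: A_def B_def C_def sg_sym)
 have "norm (z - x) <= norm (z - y) + norm (y - x)" by (metis norm_triangle_ineq diff_add_cancel add_diff_eq)
 hence "(norm (z - x))^2 <= (norm (z - y) + norm (y - x))^2" by (intro power_mono) auto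
 also have "... <= 2 * (norm (z - y))^2 + 2 * (norm (y - x))^2"
  using sum_squares_bound[of "norm (z - y)" "norm (y - x)"] by (simp add: power2_sum)
 also have "... <= 2 * (\<delta> * (B * C)) + 2 * (\<delta> * (A * B))"
  using assms A B C sg_eq[of y z] sg_eq[of x y] by (auto simp: A_def[symmetric] B_def[symmetric] C_def[symmetric] intro!: add_mono mult_right_mono)
 also have "... <= 2 * (\<delta> * (2 * A * C)) + 2 * (\<delta> * (A * (2 * C)))"
  using A B C d 1 by (intro add_mono mult_left_mono mult_right_mono) auto
 finally have "(norm (z - x))^2 <= 8 * \<delta> * (A * C)" by (simp add: mult_ac)
 thus ?thesis using A C by (simp add: sg_def A_def[symmetric] C_def[symmetric] divide_le_eq)
qed

text \<open>By \<open>sg_comparable\<close>, 1 - |z|^2 is at least half of 1 - |y|^2. This gives one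
  compact set containing the supports of all local kernels that are centred in a smaller
  ball.\<close>

lemma sg_support:
 assumes y: "norm y <= \<rho>" and \<rho>: "\<rho> < 1" and z: "z \<in> UB" "sg y z <= 1/16"
 shows "norm z <= sqrt ((1 + \<rho>^2) / 2)"
proof -
 have yb: "y \<in> UB" using y \<rho> by simp
 have "dl y <= 2 * (dl z)" using sg_comparable[OF z(1) yb] z(2) by (simp add: sg_sym)
 moreover have "(norm y)^2 <= \<rho>^2" using y by (intro power_mono) auto
 ultimately have "(norm z)^2 <= (1 + \<rho>^2) / 2" by simp
 thus ?thesis by (rule real_le_rsqrt)
qed

lemma sg_support_radius:
 assumes "0 <= \<rho>" "\<rho> < (1::real)" shows "sqrt ((1 + \<rho>^2) / 2) < 1"
 using assms by (simp add: abs_square_less_1)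

lemma continuous_on_sg: "continuous_on (UB \<times> UB) (%(y, z). sg y z)"
 unfolding sg_def split_beta
 by (intro continuous_intros) (use dl_pos in force)

lemma continuous_on_sg1: "continuous_on (UB \<times> UB) (%(y, z). sg1 y i z)"
 unfolding sg1_def split_beta
 by (intro continuous_intros) (use dl_pos in force)+

lemma continuous_on_sg2: "continuous_on (UB \<times> UB) (%(y, z). sg2 y i j z)"
 unfolding sg2_def split_beta
 by (intro continuous_intros) (use dl_pos in force)+

section \<open>A C2 bump and averages over hyperbolic annuli\<close>

lemma DERIV_max_power:
 "((%u::real. (max 0 u) ^ Suc (Suc k)) has_real_derivative real (Suc (Suc k)) * (max 0 u) ^ Suc k) (at u)"
proof -
 consider "u > 0" | "u < 0" | "u = 0" by linarith
 thus ?thesis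
 proof cases
  case 1
  have "((%u::real. u ^ Suc (Suc k)) has_real_derivative real (Suc (Suc k)) * (max 0 u) ^ Suc k) (at u)"
   using DERIV_pow[of "Suc (Suc k)" u] 1 by simp
  thus ?thesis by (rule has_field_derivative_transform_within_open[of _ _ _ "{0<..}"]) (use 1 in auto)
 next
  case 2
  have "((%u::real. 0) has_real_derivative real (Suc (Suc k)) * (max 0 u) ^ Suc k) (at u)"
   using 2 by simp
  thus ?thesis by (rule has_field_derivative_transform_within_open[of _ _ _ "{..<0}"]) (use 2 in auto)
 next
  case 3
  have "((%h. (max 0 h) ^ Suc (Suc k) / h) \<longlongrightarrow> 0) (at (0::real))"
  proof (rule Lim_null_comparison)
   show "\<forall>\<^sub>F h in at 0. norm ((max 0 h) ^ Suc (Suc k) / h) <= \<bar>h\<bar> ^ Suc k"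
   proof (rule always_eventually, rule allI)
    fix h :: real
    show "norm ((max 0 h) ^ Suc (Suc k) / h) <= \<bar>h\<bar> ^ Suc k"
    proof (cases "h > 0")
     case False
     hence "max 0 h = 0" by simp
     thus ?thesis using zero_le_power[OF abs_ge_zero, of h "Suc k"] by (simp del: power_Suc)
    qed (simp add: abs_mult)
   qed
   have "((%h. \<bar>h\<bar> ^ Suc k) \<longlongrightarrow> \<bar>0\<bar> ^ Suc k) (at (0::real))" by (intro tendsto_intros)
   thus "((%h. \<bar>h\<bar> ^ Suc k) \<longlongrightarrow> 0) (at (0::real))" by simp
  qed
  thus ?thesis using 3 by (simp add: DERIV_def)
 qed
qed

text \<open>The cube makes it C2, as two differentiations under the integral require. The support
  [s/2, s] avoids 0, where the radial equation degenerates; the averages are thus over annuli around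
  y rather than balls.\<close>

definition bump :: "real => real => real" where "bump s t = (max 0 ((t - s/2) * (s - t))) ^ 3"
definition bump1 :: "real => real => real" where
 "bump1 s t = 3 * (max 0 ((t - s/2) * (s - t)))^2 * (3 * s / 2 - 2 * t)"
definition bump2 :: "real => real => real" where
 "bump2 s t = 6 * max 0 ((t - s/2) * (s - t)) * (3 * s / 2 - 2 * t)^2 - 6 * (max 0 ((t - s/2) * (s - t)))^2"

lemma DERIV_bump: "(bump s has_real_derivative bump1 s t) (at t)"
proof -
 have 1: "((%t. (t - s/2) * (s - t)) has_real_derivative (3 * s / 2 - 2 * t)) (at t)"
  by (auto intro!: derivative_eq_intros)
 show ?thesis
  using DERIV_chain2[OF DERIV_max_power[of 1] 1]
  by (simp add: bump_def[abs_def] bump1_def numeral_3_eq_3 power2_eq_square)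
qed

lemma DERIV_bump1: "(bump1 s has_real_derivative bump2 s t) (at t)"
proof -
 have 1: "((%t. (t - s/2) * (s - t)) has_real_derivative (3 * s / 2 - 2 * t)) (at t)"
  by (auto intro!: derivative_eq_intros)
 have 2: "((%t. (max 0 ((t - s/2) * (s - t)))^2) has_real_derivative 2 * max 0 ((t - s/2) * (s - t)) * (3 * s / 2 - 2 * t)) (at t)"
  using DERIV_chain2[OF DERIV_max_power[of 0] 1] by (simp add: power2_eq_square)
 have 3: "((%t. (3 * s / 2 - 2 * t)) has_real_derivative - 2) (at t)"
  by (auto intro!: derivative_eq_intros)
 show ?thesis using DERIV_mult[OF DERIV_cmult[OF 2, of 3] 3]
  by (simp add: bump1_def[abs_def] bump2_def algebra_simps power2_eq_square)
qed

lemma continuous_on_bump [continuous_intros]: "continuous_on S (bump s)" "continuous_on S (bump1 s)" "continuous_on S (bump2 s)"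
 unfolding bump_def[abs_def] bump1_def[abs_def] bump2_def[abs_def] by (intro continuous_intros)+

lemma bump_nonneg: "0 <= bump s t" by (simp add: bump_def)

lemma bump_zero:
 assumes "0 <= s" "t <= s/2 \<or> s <= t" shows "bump s t = 0" "bump1 s t = 0" "bump2 s t = 0"
proof -
 have "(t - s/2) * (s - t) <= 0" using assms by (auto simp: mult_nonneg_nonpos mult_nonpos_nonneg)
 hence "max 0 ((t - s/2) * (s - t)) = 0" by simp
 thus "bump s t = 0" "bump1 s t = 0" "bump2 s t = 0" by (simp_all add: bump_def bump1_def bump2_def)
qed

lemma bump_pos: "s/2 < t ==> t < s ==> 0 < bump s t"
 by (simp add: bump_def)

lemma antiderivative_exists:
 fixes \<omega> :: "real => real"
 assumes c: "continuous_on UNIV \<omega>" and z: "!!t. b <= t ==> \<omega> t = 0"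
 shows "\<exists>V. (\<forall>t. (V has_real_derivative \<omega> t) (at t)) \<and> (\<forall>t\<ge>b. V t = 0) \<and> (\<forall>t\<le>b. V t = - integral {t..b} \<omega>)"
proof (intro exI conjI allI impI)
 define V where "V t = (if t <= b then - integral {t..b} \<omega> else 0)" for t
 have int: "\<omega> integrable_on {u..v}" for u v
  by (intro integrable_continuous_real continuous_on_subset[OF c]) auto
 show "V t = 0" if "b <= t" for t using that by (auto simp: V_def)
 show "V t = - integral {t..b} \<omega>" if "t <= b" for t using that by (simp add: V_def)
 fix t0
 define d where "d = min t0 b - 1"
 have eq: "V t = integral {d..t} \<omega> - integral {d..b} \<omega>" if "d < t" for t
 proof (cases "t <= b")
  case True
  thus ?thesis using Henstock_Kurzweil_Integration.integral_combine[of d t b \<omega>] int that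
   by (simp add: V_def)
 next
  case False
  have "integral {b..t} \<omega> = integral {b..t} (%x. 0)"
   by (intro Henstock_Kurzweil_Integration.integral_cong) (simp add: z)
  thus ?thesis using Henstock_Kurzweil_Integration.integral_combine[of d b t \<omega>] int that False
   by (simp add: V_def d_def)
 qed
 have "((%t. integral {d..t} \<omega>) has_vector_derivative \<omega> t0) (at t0 within {d..t0+1})"
  by (intro integral_has_vector_derivative continuous_on_subset[OF c]) (auto simp: d_def)
 moreover have "at t0 within {d..t0+1} = at t0" by (rule at_within_interior) (simp add: d_def)
 ultimately have "((%t. integral {d..t} \<omega>) has_real_derivative \<omega> t0) (at t0)"
  by (simp only: has_real_derivative_iff_has_vector_derivative)
 from DERIV_diff[OF this DERIV_const[of "integral {d..b} \<omega>"]]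
 have "((%t. integral {d..t} \<omega> - integral {d..b} \<omega>) has_real_derivative \<omega> t0) (at t0)" by simp
 thus "(V has_real_derivative \<omega> t0) (at t0)"
  by (rule has_field_derivative_transform_within_open[of _ _ _ "{d<..}"]) (auto simp: eq d_def)
qed

definition radial_integral :: "real^'n => real => (real^'n => complex) => complex" where
 "radial_integral y s g = (LBINT z:UB. g z * of_real (bump s (sg y z) / (dl z) ^ CARD('n)))"

lemma bump_sg_support:
 assumes "y \<in> UB" "0 < s" "s <= 1/16" "z \<in> UB - cball 0 (sqrt ((1 + (norm y)^2) / 2))"
 shows "s < sg y z" "bump s (sg y z) = 0"
proof -
 have "1/16 < sg y z" using sg_support[of y "norm y" z] assms by (force simp: not_le)
 thus "s < sg y z" "bump s (sg y z) = 0" using assms by (auto intro: bump_zero)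
qed

lemma sg_cball:
 assumes "y \<in> UB"
 shows "compact (cball 0 (sqrt ((1 + (norm y)^2) / 2)) :: (real^'n) set)"
  "cball 0 (sqrt ((1 + (norm y)^2) / 2)) \<subseteq> (UB :: (real^'n) set)"
proof -
 have "sqrt ((1 + (norm y)^2) / 2) < 1" using assms by (intro sg_support_radius) auto
 thus "cball 0 (sqrt ((1 + (norm y)^2) / 2)) \<subseteq> (UB :: (real^'n) set)"
  by (auto simp del: real_sqrt_lt_1_iff)
qed auto

lemma continuous_on_bump_sg:
 assumes "y \<in> UB"
 shows "continuous_on UB (%z. bump s (sg y z) / (dl (z::real^'n)) ^ CARD('n))"
proof -
 have "continuous_on UB (%z. bump s (sg y z))"
  by (rule continuous_on_compose2[OF continuous_on_bump(1) has_partials_continuous[OF has_partials_sg] subset_UNIV])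
 thus ?thesis by (intro continuous_intros) (auto simp: power2_eq_1_iff)
qed

lemma radial_integrable:
 fixes g :: "real^'n => complex"
 assumes "y \<in> UB" "0 < s" "s <= 1/16" "continuous_on UB g"
 shows "set_integrable lborel UB (%z. g z * of_real (bump s (sg y z) / (dl z) ^ CARD('n)))"
proof (rule integrable_compact_support[OF open_ball sg_cball[OF assms(1)]])
 show "continuous_on UB (%z. g z * of_real (bump s (sg y z) / (dl z) ^ CARD('n)))"
  by (intro continuous_intros assms(4) continuous_on_of_real continuous_on_bump_sg assms(1))
qed (use bump_sg_support(2)[OF assms(1-3)] in auto)

text \<open>With t = (sinh (d/2))^2 the hyperbolic volume element is a constant times sqrt (t (1 +
  t))^(n-2) dt. The interval starts at -1 to have 0 in its interior; for positive s the bump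
  vanishes at negative t.\<close>

definition radial_mass :: "nat => real => real" where
 "radial_mass n s = integral {-1..1} (%t. sqrt (t * (1 + t)) ^ (n - 2) * bump s t)"

lemma radial_mass_pos:
 assumes "0 < s" "s <= 1" shows "0 < radial_mass n s"
proof -
 let ?f = "%t. sqrt (t * (1 + t)) ^ (n - 2) * bump s t"
 have nn: "?f t \<ge> 0" if "t \<in> cbox (-1) 1" for t
 proof (cases "t <= 0")
  case True
  thus ?thesis using assms by (simp add: bump_zero)
 next
  case False
  thus ?thesis by (simp add: bump_nonneg)
 qed
 have c: "continuous_on (cbox (-1) 1) ?f" by (intro continuous_intros)
 have "?f ((3/4) * s) > 0" using assms by (intro mult_pos_pos bump_pos zero_less_power) auto
 moreover have "(3/4) * s \<in> cbox (-1) 1" using assms by simp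
 moreover have "box (-1) (1::real) \<noteq> {}" by simp
 ultimately have "integral (cbox (-1) 1) ?f \<noteq> 0"
  using integral_cbox_eq_0_iff[OF c _ nn] by (metis less_irrefl)
 moreover have "integral (cbox (-1) 1) ?f \<ge> 0"
  using nn by (intro Henstock_Kurzweil_Integration.integral_nonneg integrable_continuous c) auto
 ultimately show ?thesis by (simp add: radial_mass_def)
qed

text \<open>With \<open>q = sqrt (t (1 + t))\<close> the radial part of \<open>hyp_laplacian\<close> is \<open>4 q\<^sup>2\<^sup>-\<^sup>n (q\<^sup>n h')'\<close>, so two bumps
 differ, up to normalisation, by the Laplacian of a compactly supported radial function.\<close>

lemma radial_integral_scaling:
 fixes g :: "real^'n => complex"
 assumes n: "2 <= CARD('n)" and g: "g \<in> h_harmonic" and y: "y \<in> UB"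
  and s: "0 < s" "s < S" "S <= 1/16"
 shows "of_real (radial_mass CARD('n) S) * radial_integral y s g = of_real (radial_mass CARD('n) s) * radial_integral y S g"
proof -
 let ?n = "CARD('n)"
 define q where "q t = sqrt (t * (1 + t))" for t
 define a b where "a = radial_mass ?n S" and "b = radial_mass ?n s"
 \<comment> \<open>This combination has radial mass a b - b a = 0. With V = q^n h' the equation 4
   q^(2-n) (q^n h')' = 4 H reads V' = q^(n-2) H = \<omega>.\<close>
 define H where "H t = a * bump s t - b * bump S t" for t
 define \<omega> where "\<omega> t = q t ^ (?n - 2) * H t" for t
 have cq: "continuous_on A q" for A unfolding q_def[abs_def] by (intro continuous_intros)
 have c\<omega>: "continuous_on UNIV \<omega>" unfolding \<omega>_def[abs_def] H_def[abs_def] by (intro continuous_intros cq)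
 have z\<omega>: "\<omega> t = 0" if "t <= s/2 \<or> S <= t" for t
 proof -
  have "bump s t = 0" "bump S t = 0" using that s by (auto intro!: bump_zero)
  thus ?thesis by (simp add: \<omega>_def H_def)
 qed
 have zS: "\<omega> t = 0" if "S <= t" for t using z\<omega> that by simp
 obtain V where "(\<forall>t. (V has_real_derivative \<omega> t) (at t)) \<and> (\<forall>t\<ge>S. V t = 0) \<and> (\<forall>t\<le>S. V t = - integral {t..S} \<omega>)"
  using antiderivative_exists[OF c\<omega> zS] ..
 hence V: "!!t. (V has_real_derivative \<omega> t) (at t)" "!!t. S <= t ==> V t = 0"
  "!!t. t <= S ==> V t = - integral {t..S} \<omega>" by auto
 \<comment> \<open>Zero total mass makes the antiderivative vanish below s/2 as well as above S, so
   V / q^n is harmless at t = 0 in spite of its singular denominator.\<close>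
 have V0: "V t = 0" if "t <= s/2" for t
 proof -
  have "(V has_real_derivative 0) (at x within {..s/2})" if "x \<in> {..s/2}" for x
   using has_field_derivative_at_within[OF V(1), of x] z\<omega>[of x] that by simp
  from has_field_derivative_zero_constant[OF _ this] obtain c where c: "!!x. x <= s/2 ==> V x = c" by auto
  have "V t = V (-1)" using c[of t] c[of "-1"] that s by simp
  also have "... = - integral {-1..S} \<omega>" using s by (intro V(3)) auto
  also have "integral {-1..S} \<omega> = integral {-1..1} \<omega>"
  proof -
   have "integral {S..1} \<omega> = integral {S..1} (%x. 0)"
    by (intro Henstock_Kurzweil_Integration.integral_cong) (simp add: z\<omega>)
   thus ?thesis
    using Henstock_Kurzweil_Integration.integral_combine[of "-1" S 1 \<omega>] s
     integrable_continuous_real[OF continuous_on_subset[OF c\<omega> subset_UNIV]] by simp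
  qed
  also have "integral {-1..1} \<omega> = a * b - b * a"
  proof -
   have 1: "(%t. q t ^ (?n - 2) * bump r t) integrable_on {-1..1}" for r
    by (intro integrable_continuous_real continuous_intros cq)
   have "integral {-1..1} \<omega> = integral {-1..1} (%t. a * (q t ^ (?n - 2) * bump s t) - b * (q t ^ (?n - 2) * bump S t))"
    by (rule arg_cong[where f="integral _"]) (auto simp: \<omega>_def H_def algebra_simps fun_eq_iff)
   also have "... = a * integral {-1..1} (%t. q t ^ (?n - 2) * bump s t) - b * integral {-1..1} (%t. q t ^ (?n - 2) * bump S t)"
    by (subst Henstock_Kurzweil_Integration.integral_diff) (auto intro!: integrable_on_mult_right 1)
   finally show ?thesis by (simp add: a_def b_def radial_mass_def q_def)
  qed
  finally show ?thesis by simp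
 qed
 define h1 where "h1 t = V t / q t ^ ?n" for t
 define h2 where "h2 t = \<omega> t / q t ^ ?n - real ?n * (1 + 2 * t) * V t / (2 * q t ^ (?n + 2))" for t
 have qpos: "q t > 0" if "t > 0" for t using that by (simp add: q_def)
 have dq: "(q has_real_derivative (1 + 2 * t) / (2 * q t)) (at t)" if "t > 0" for t
 proof -
  have "\<not> t * (1 + t) < 0" using that mult_pos_pos[of t "1 + t"] by linarith
  thus ?thesis
   unfolding q_def[abs_def] using that by (auto intro!: derivative_eq_intros simp: divide_simps)
 qed
 have h1: "(h1 has_real_derivative h2 t) (at t)" for t
 proof (cases "t < s/2")
  case True
  have "h2 t = 0" using V0[of t] z\<omega>[of t] True by (simp add: h2_def)
  hence "((%t. 0) has_real_derivative h2 t) (at t)" by simp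
  thus ?thesis
   by (rule has_field_derivative_transform_within_open[of _ _ _ "{..<s/2}"]) (use True in \<open>auto simp: h1_def V0\<close>)
 next
  case False
  hence t: "t > 0" using s by simp
  have "((%t. q t ^ ?n) has_real_derivative real ?n * ((1 + 2 * t) / (2 * q t) * q t ^ (?n - Suc 0))) (at t)"
   by (rule DERIV_power[OF dq[OF t]])
  from DERIV_divide[OF V(1) this] qpos[OF t]
  have "(h1 has_real_derivative (\<omega> t * q t ^ ?n - V t * (real ?n * ((1 + 2 * t) / (2 * q t) * q t ^ (?n - Suc 0)))) / (q t ^ ?n * q t ^ ?n)) (at t)"
   unfolding h1_def[abs_def] by simp
  moreover have "(\<omega> t * q t ^ ?n - V t * (real ?n * ((1 + 2 * t) / (2 * q t) * q t ^ (?n - Suc 0)))) / (q t ^ ?n * q t ^ ?n) = h2 t"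
  proof -
   have e: "q t ^ ?n = q t * q t ^ (?n - Suc 0)" using n power_minus_mult[of ?n "q t"] by (simp add: mult.commute)
   define Q where "Q = q t ^ (?n - Suc 0)"
   have Q: "Q \<noteq> 0" "q t \<noteq> 0" using qpos[OF t] by (auto simp: Q_def)
   show ?thesis
    unfolding h2_def power_add e Q_def[symmetric] using Q
     by (simp add: divide_simps power2_eq_square) (simp add: algebra_simps)
  qed
  ultimately show ?thesis by simp
 qed
 have ch1: "continuous_on UNIV h1" by (rule DERIV_continuous_on[OF has_field_derivative_at_within[OF h1]])
 have zh1: "h1 t = 0" if "S <= t" for t using that V(2) by (simp add: h1_def)
 obtain h where "(\<forall>t. (h has_real_derivative h1 t) (at t)) \<and> (\<forall>t\<ge>S. h t = 0) \<and> (\<forall>t\<le>S. h t = - integral {t..S} h1)"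
  using antiderivative_exists[OF ch1 zh1] ..
 hence h: "!!t. (h has_real_derivative h1 t) (at t)" "!!t. S <= t ==> h t = 0" by auto
 have ch2: "continuous_on {0..} h2"
 proof -
  have "continuous_on {0..s/2} h2"
   by (rule continuous_on_eq[OF continuous_on_const[of _ 0]]) (auto simp: h2_def V0 z\<omega>)
  moreover have cV: "continuous_on A V" for A
   by (rule DERIV_continuous_on[OF has_field_derivative_at_within[OF V(1)]])
  have "continuous_on {s/2..} h2"
  proof -
   have qn: "q t \<noteq> 0" if "s/2 <= t" for t using qpos[of t] s that by simp
   show ?thesis unfolding h2_def[abs_def]
    by (intro continuous_intros cq cV continuous_on_subset[OF c\<omega> subset_UNIV]) (simp_all add: qn)
  qed
  ultimately have "continuous_on ({0..s/2} \<union> {s/2..}) h2"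
   by (intro continuous_on_closed_Un) auto
  moreover have "{0..s/2} \<union> {s/2..} = {0..}" using s by auto
  ultimately show ?thesis by simp
 qed
 have eqH: "4 * (t * (1 + t) * h2 t + real ?n * (t + 1/2) * h1 t) = 4 * H t" if "0 <= t" for t
 proof (cases "t = 0")
  case True
  thus ?thesis using s by (simp add: h1_def V0 H_def bump_zero)
 next
  case False
  hence t: "t > 0" using that by simp
  have "0 <= t * (1 + t)" using t by (intro mult_nonneg_nonneg) auto
  hence q2: "t * (1 + t) = (q t)^2" by (simp only: q_def real_sqrt_pow2)
  have e: "q t ^ ?n = (q t)^2 * q t ^ (?n - 2)" using n by (metis le_add_diff_inverse power_add)
  define Q where "Q = q t ^ (?n - 2)"
  have Q: "Q \<noteq> 0" "q t \<noteq> 0" using qpos[OF t] by (auto simp: Q_def)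
  show ?thesis unfolding h2_def h1_def \<omega>_def power_add e Q_def[symmetric] q2 using Q
   by (simp add: divide_simps power2_eq_square)
 qed
 note P = has_partials_sg_compose[OF y h(1) h1 ch2]
 have "(LBINT z:UB. g z * hyp_laplacian (%z. complex_of_real (h (sg y z))) z / of_real ((dl z) ^ ?n)) = 0"
 proof (rule green_identity[OF n g P(1,2) sg_cball[OF y]])
  fix z :: "real^'n" assume z: "z \<in> UB - cball 0 (sqrt ((1 + (norm y)^2) / 2))"
  hence "S < sg y z" using bump_sg_support(1)[OF y _ s(3)] s by simp
  thus "complex_of_real (h (sg y z)) = 0" using h(2) by simp
 qed
 also have "(LBINT z:UB. g z * hyp_laplacian (%z. complex_of_real (h (sg y z))) z / of_real ((dl z) ^ ?n))
  = (LBINT z:UB. of_real (4 * a) * (g z * of_real (bump s (sg y z) / (dl z) ^ ?n)) -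
    of_real (4 * b) * (g z * of_real (bump S (sg y z) / (dl z) ^ ?n)))"
 proof (rule set_lebesgue_integral_cong)
  show "\<forall>z. z \<in> UB --> g z * hyp_laplacian (%z. complex_of_real (h (sg y z))) z / of_real ((dl z) ^ ?n)
   = of_real (4 * a) * (g z * of_real (bump s (sg y z) / (dl z) ^ ?n)) -
    of_real (4 * b) * (g z * of_real (bump S (sg y z) / (dl z) ^ ?n))"
  proof (intro allI impI)
   fix z assume z: "z \<in> (UB :: (real^'n) set)"
   show "g z * hyp_laplacian (%z. complex_of_real (h (sg y z))) z / of_real ((dl z) ^ ?n)
   = of_real (4 * a) * (g z * of_real (bump s (sg y z) / (dl z) ^ ?n)) -
    of_real (4 * b) * (g z * of_real (bump S (sg y z) / (dl z) ^ ?n))"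
    unfolding P(3)[OF z] eqH[OF sg_nonneg[OF y z]] H_def
    by (simp add: algebra_simps diff_divide_distrib)
  qed
 qed auto
 also have "... = of_real (4 * a) * radial_integral y s g - of_real (4 * b) * radial_integral y S g"
 proof -
  have "set_integrable lborel UB (%z. of_real (4 * a) * (g z * of_real (bump s (sg y z) / (dl z) ^ ?n)))"
   "set_integrable lborel UB (%z. of_real (4 * b) * (g z * of_real (bump S (sg y z) / (dl z) ^ ?n)))"
   using s by (intro set_integrable_mult_right radial_integrable y h_harmonic_continuous g; simp)+
  from set_integral_diff(2)[OF this] show ?thesis
   unfolding radial_integral_def set_integral_mult_right .
 qed
 finally show ?thesis by (simp add: a_def b_def)
qed

lemma const_h_harmonic: "(%x. c) \<in> h_harmonic"
 by (rule h_harmonicI[OF has_partials_const has_partials_const]) simp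

lemma radial_integral_1:
 "radial_integral y s (%z. 1) = of_real (LBINT z:UB. bump s (sg y z) / (dl (z::real^'n)) ^ CARD('n))"
 unfolding radial_integral_def by (simp only: mult_1 set_integral_complex_of_real)

text \<open>The value 1/128 = (1/8) (1/16) is the largest for which \<open>sg_triangle\<close> keeps
  two points, both within it of a third, in the range sg <= 1/16 of
  \<open>sg_comparable\<close>.\<close>

definition ball_mass :: "real^'n => real" where
 "ball_mass y = (LBINT z:UB. bump (1/128) (sg y z) / (dl z) ^ CARD('n))"

text \<open>For small s the average against the bump at s differs from g y by at most \<epsilon>, by
  continuity. \<open>radial_integral_scaling\<close>, applied to g and to 1, makes the quotient of
  the two integrals independent of s, so the estimate carries over to 1/128 for every
  \<epsilon>.\<close>

lemma radial_mean_value: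
 fixes g :: "real^'n => complex"
 assumes n: "2 <= CARD('n)" and g: "g \<in> h_harmonic" and y: "y \<in> UB"
 shows "radial_integral y (1/128) g = g y * of_real (ball_mass y)"
proof -
 let ?n = "CARD('n)"
 define m where "m = radial_mass ?n"
 define J where "J s = (LBINT z:UB. bump s (sg y z) / (dl (z::real^'n)) ^ ?n)" for s
 let ?S = "1/128::real"
 note cg = h_harmonic_continuous[OF g]
 have Jint: "set_integrable lborel UB (%z. bump s (sg y z) / (dl (z::real^'n)) ^ ?n)" if "0 < s" "s <= ?S" for s
  by (rule integrable_compact_support[OF open_ball sg_cball[OF y] continuous_on_bump_sg[OF y]])
   (use that bump_sg_support(2)[OF y] in auto)
 have nn: "0 <= bump s (sg y z) / (dl (z::real^'n)) ^ ?n" if "z \<in> UB" for s z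
  using dl_pos[OF that] bump_nonneg by simp
 have key: "cmod (radial_integral y ?S g - g y * of_real (J ?S)) <= \<epsilon> * J ?S" if e: "\<epsilon> > 0" for \<epsilon>
 proof -
  obtain d where d: "d > 0" "!!z. z \<in> UB ==> dist z y < d ==> dist (g z) (g y) < \<epsilon>"
   using cg y e unfolding continuous_on_iff by metis
  define s where "s = min (d^2) (1/256)"
  have s: "0 < s" "s < ?S" using d(1) by (auto simp: s_def)
  have le: "cmod (g z - g y) * (bump s (sg y z) / (dl z) ^ ?n) <= \<epsilon> * (bump s (sg y z) / (dl z) ^ ?n)"
   if z: "z \<in> UB" for z
  proof (cases "sg y z < s")
   case True
   have "(norm (z - y))^2 = sg y z * ((dl y) * (dl z))" by (rule sg_eq[OF y z])
   also have "... <= sg y z * (1 * 1)" using dl_pos[OF y] dl_pos[OF z]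
    by (intro mult_left_mono mult_mono sg_nonneg y z) auto
   also have "... < d^2" using True by (simp add: s_def)
   finally have "norm (z - y) < d" using d(1) by (simp add: power2_less_imp_less)
   hence "cmod (g z - g y) <= \<epsilon>" using d(2)[OF z] by (simp add: dist_norm)
   thus ?thesis using nn[OF z] by (intro mult_right_mono)
  next
   case False
   thus ?thesis using s by (simp add: bump_zero)
  qed
  have "radial_integral y s g - g y * of_real (J s) = (LBINT z:UB. (g z - g y) * of_real (bump s (sg y z) / (dl z) ^ ?n))"
  proof -
   have "g y * of_real (J s) = (LBINT z:UB. g y * of_real (bump s (sg y z) / (dl z) ^ ?n))"
    unfolding J_def set_integral_complex_of_real[symmetric] by (rule set_integral_mult_right[symmetric])
   thus ?thesis
    unfolding radial_integral_def using s
    by (simp only: set_integral_diff(2)[OF radial_integrable[OF y s(1) _ cg] radial_integrable[OF y s(1) _ continuous_on_const], symmetric] left_diff_distrib)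
  qed
  also have "cmod ... <= (LBINT z:UB. cmod ((g z - g y) * of_real (bump s (sg y z) / (dl z) ^ ?n)))"
   using s by (intro set_integral_norm_bound radial_integrable[OF y] continuous_intros cg) auto
  also have "... <= (LBINT z:UB. \<epsilon> * (bump s (sg y z) / (dl z) ^ ?n))"
  proof (rule set_integral_mono)
   have "set_integrable lborel UB (%z. (g z - g y) * of_real (bump s (sg y z) / (dl z) ^ ?n))"
    using s by (intro radial_integrable[OF y] continuous_intros cg) auto
   thus "set_integrable lborel UB (%z. cmod ((g z - g y) * of_real (bump s (sg y z) / (dl z) ^ ?n)))"
    by (rule set_integrable_norm)
   show "set_integrable lborel UB (%z. \<epsilon> * (bump s (sg y z) / (dl (z::real^'n)) ^ ?n))"
    using Jint[of s] s by (intro set_integrable_mult_right) auto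
   show "cmod ((g z - g y) * of_real (bump s (sg y z) / (dl z) ^ ?n)) <= \<epsilon> * (bump s (sg y z) / (dl z) ^ ?n)"
    if "z \<in> UB" for z
    using le[OF that] nn[OF that, of s] by (simp only: norm_mult norm_of_real abs_of_nonneg)
  qed
  also have "... = \<epsilon> * J s" unfolding J_def by (rule set_integral_mult_right)
  finally have 1: "cmod (radial_integral y s g - g y * of_real (J s)) <= \<epsilon> * J s" .
  have r1: "of_real (m ?S) * radial_integral y s g = of_real (m s) * radial_integral y ?S g"
   using radial_integral_scaling[OF n g y s] by (simp add: m_def)
  have "of_real (m ?S) * complex_of_real (J s) = of_real (m s) * of_real (J ?S)"
   using radial_integral_scaling[OF n const_h_harmonic[of 1] y s] by (simp add: m_def radial_integral_1 J_def)
  hence r2: "m ?S * J s = m s * J ?S" by (simp only: of_real_mult[symmetric] of_real_eq_iff)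
  have ms: "m s > 0" "m ?S > 0" using s by (auto simp: m_def intro!: radial_mass_pos)
  have "m s * cmod (radial_integral y ?S g - g y * of_real (J ?S)) = cmod (of_real (m s) * radial_integral y ?S g - g y * of_real (m s * J ?S))"
  proof -
   have "of_real (m s) * radial_integral y ?S g - g y * of_real (m s * J ?S) = of_real (m s) * (radial_integral y ?S g - g y * of_real (J ?S))"
    by (simp add: algebra_simps)
   thus ?thesis using ms by (simp add: norm_mult)
  qed
  also have "... = m ?S * cmod (radial_integral y s g - g y * of_real (J s))"
  proof -
   have "of_real (m s) * radial_integral y ?S g - g y * of_real (m s * J ?S) = of_real (m ?S) * (radial_integral y s g - g y * of_real (J s))"
    unfolding r1[symmetric] r2[symmetric] by (simp add: algebra_simps)
   thus ?thesis using ms by (simp add: norm_mult)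
  qed
  also have "... <= m ?S * (\<epsilon> * J s)" using 1 ms by (intro mult_left_mono) auto
  also have "... = m s * (\<epsilon> * J ?S)" using r2 by (simp add: mult.left_commute)
  finally show ?thesis using ms by simp
 qed
 have J0: "J ?S \<ge> 0" unfolding J_def set_lebesgue_integral_def by (intro Bochner_Integration.integral_nonneg) (use nn in \<open>auto simp: indicator_def\<close>)
 have "cmod (radial_integral y ?S g - g y * of_real (J ?S)) <= 0"
 proof (rule field_le_epsilon)
  fix e :: real assume e: "e > 0"
  have "cmod (radial_integral y ?S g - g y * of_real (J ?S)) <= (e / (J ?S + 1)) * J ?S"
   using e J0 by (intro key) auto
  also have "... <= 0 + e" using e J0 by (simp add: field_simps)
  finally show "cmod (radial_integral y ?S g - g y * of_real (J ?S)) <= 0 + e" .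
 qed
 thus ?thesis by (simp add: J_def ball_mass_def)
qed

text \<open>The support in z moves with y, but for y in a ball about 0 it stays in one compact set
  by \<open>sg_support\<close>; differentiability and continuity are local, so this
  suffices.\<close>

lemma has_partials_kernel_integral:
 fixes F :: "real^'n => real^'n => 'c::euclidean_space"
 assumes D: "!!z. z \<in> UB ==> has_partials (%y. F y z) (%i y. F1 i y z) UB"
  and cF: "continuous_on (UB \<times> UB) (%(y, z). F y z)"
  and cF1: "!!i. continuous_on (UB \<times> UB) (%(y, z). F1 i y z)"
  and zero: "!!y z. y \<in> UB ==> z \<in> UB ==> 1/16 < sg y z ==> F y z = 0"
 shows "has_partials (%y. LBINT z:UB. F y z) (%i y. LBINT z:UB. F1 i y z) UB"
proof -
 let ?F' = "%y z v. \<Sum>i\<in>UNIV. v$i *\<^sub>R F1 i y z"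
 have nbhd: "\<exists>U K. open U \<and> convex U \<and> y \<in> U \<and> U \<subseteq> UB \<and> compact K \<and> K \<subseteq> (UB :: (real^'n) set) \<and>
  (\<forall>p\<in>U. \<forall>z\<in>UB - K. F p z = 0)" if y: "y \<in> UB" for y
 proof (intro exI conjI ballI)
  define \<rho> where "\<rho> = (1 + norm y) / 2"
  have \<rho>: "0 <= \<rho>" "\<rho> < 1" "norm y < \<rho>" using y by (auto simp: \<rho>_def)
  show "y \<in> ball 0 \<rho>" using \<rho> by simp
  show "ball 0 \<rho> \<subseteq> (UB :: (real^'n) set)" using \<rho> by auto
  show "cball 0 (sqrt ((1 + \<rho>^2) / 2)) \<subseteq> (UB :: (real^'n) set)"
   using sg_support_radius[OF \<rho>(1,2)] by (auto simp del: real_sqrt_lt_1_iff)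
  fix p z assume p: "p \<in> (ball 0 \<rho> :: (real^'n) set)" and z: "z \<in> (UB :: (real^'n) set) - cball 0 (sqrt ((1 + \<rho>^2) / 2))"
  have "1/16 < sg p z"
  proof (rule ccontr)
   assume "\<not> 1/16 < sg p z"
   hence "sg p z <= 1/16" by simp
   with sg_support[of p \<rho> z] p z \<rho> show False by simp
  qed
  thus "F p z = 0" using p z \<rho> by (intro zero) auto
 qed (auto)
 have D': "((%y. F y z) has_derivative ?F' p z) (at p)" if "p \<in> UB" "z \<in> UB" for p z
  using has_partialsD(1)[OF D[OF that(2)] that(1)] .
 have cF': "continuous_on (UB \<times> UB) (%(y, z). ?F' y z v)" for v
  unfolding split_beta by (intro continuous_intros continuous_on_sum cF1[unfolded split_beta])
 have cFp: "continuous_on UB (F p)" if "p \<in> UB" for p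
  using continuous_on_compose2[OF cF, of UB "%z. (p, z)"] that by (force intro!: continuous_intros)
 show ?thesis
 proof (rule has_partialsI)
  fix y :: "real^'n" assume y: "y \<in> UB"
  from nbhd[OF y] obtain U K where U: "open U" "convex U" "y \<in> U" "U \<subseteq> UB" and K: "compact K" "K \<subseteq> (UB :: (real^'n) set)"
   and z: "!!p z. p \<in> U ==> z \<in> UB - K ==> F p z = 0" by blast
  show "((%y. LBINT z:UB. F y z) has_derivative (%v. LBINT z:UB. ?F' y z v)) (at y)"
   by (rule has_derivative_integral_compact_support(1)[OF U(1,2) open_ball bounded_ball K _ _ D' z U(3)])
    (use U in \<open>auto intro!: cFp continuous_on_subset[OF cF']\<close>)
 next
  show "(LBINT z:UB. F1 i y z) = (LBINT z:UB. ?F' y z (axis i 1))" for y i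
   by (simp add: sum_axis)
 next
  fix i
  show "continuous_on UB (%y. LBINT z:UB. F1 i y z)"
  proof (rule continuous_at_imp_continuous_on, rule ballI)
   fix y :: "real^'n" assume y: "y \<in> UB"
   from nbhd[OF y] obtain U K where U: "open U" "convex U" "y \<in> U" "U \<subseteq> UB" and K: "compact K" "K \<subseteq> (UB :: (real^'n) set)"
    and z: "!!p z. p \<in> U ==> z \<in> UB - K ==> F p z = 0" by blast
   have z1: "?F' p w v = 0" if "p \<in> U" "w \<in> UB - K" for p w v
    by (rule has_derivative_integral_compact_support(2)[OF U(1,2) open_ball bounded_ball K _ _ D' z U(3) that])
     (use U in \<open>auto intro!: cFp continuous_on_subset[OF cF']\<close>)
   have "continuous_on U (%y. LBINT z:UB. F1 i y z)"
   proof (rule continuous_on_integral_compact_support[OF U(1) open_ball bounded_ball K])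
    show "continuous_on (U \<times> UB) (%(y, z). F1 i y z)"
     using U by (intro continuous_on_subset[OF cF1]) auto
    show "F1 i p w = 0" if "p \<in> U" "w \<in> UB - K" for p w
     using z1[OF that, of "axis i 1"] by (simp add: sum_axis)
   qed
   thus "isCont (%y. LBINT z:UB. F1 i y z) y"
    using U continuous_on_eq_continuous_at by blast
  qed
 qed
qed

section \<open>Independence of the averaging mass from the centre\<close>

lemma continuous_on_sg_compose:
 fixes h :: "real => real"
 assumes "continuous_on UNIV h" shows "continuous_on (UB \<times> UB) (%(y, z). h (sg y z))"
 using continuous_on_compose2[OF assms continuous_on_sg] by (simp add: split_beta)

lemma continuous_on_snd_ball:
 assumes "continuous_on UB f" shows "continuous_on (UB \<times> UB) (%(y, z). f z)"
 unfolding split_beta by (rule continuous_on_compose2[OF assms continuous_on_snd]) auto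

lemma continuous_on_swap_ball:
 assumes "continuous_on (UB \<times> UB) (%(y, z). f y z)"
 shows "continuous_on (UB \<times> UB) (%(y, z). f z y)"
 using continuous_on_compose2[OF assms, of "UB \<times> UB" "%(y, z). (z, y)"]
 by (force simp: split_beta intro!: continuous_intros)

text \<open>The vector fields \<open>V\<^sub>i(z) = (1 + |z|\<^sup>2) e\<^sub>i - 2 z\<^sub>i z\<close> generate hyperbolic translations. They leave
 \<open>sg\<close> and the invariant measure unchanged.\<close>

definition killing :: "'n => 'n => real^'n => real" where
 "killing i k z = (1 + (norm z)^2) * (if k = i then 1 else 0) - 2 * z$i * z$k"

lemma sum_killing:
 fixes z :: "real^'n"
 shows "(\<Sum>k\<in>UNIV. killing i k z * c$k) = (1 + (norm z)^2) * c$i - 2 * z$i * (z \<bullet> c)"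
proof -
 have "(\<Sum>k\<in>UNIV. killing i k z * c$k) = (\<Sum>k\<in>UNIV. (1 + (norm z)^2) * (if k = i then c$k else 0) - 2 * z$i * (z$k * c$k))"
  by (rule sum.cong) (auto simp: killing_def algebra_simps)
 also have "... = (1 + (norm z)^2) * c$i - 2 * z$i * (z \<bullet> c)"
  by (simp add: sum_subtractf sum_distrib_left[symmetric] sum_inner)
 finally show ?thesis .
qed

lemma killing_sg1:
 fixes y z :: "real^'n"
 assumes y: "y \<in> UB" and z: "z \<in> UB"
 shows "(\<Sum>k\<in>UNIV. killing i k z * sg1 y k z) =
  2 * ((1 + (norm z)^2) * (z$i - y$i) - z$i * ((norm z)^2 - (norm y)^2)) / ((dl y) * (dl z))"
proof -
 define A B N where "A = dl y" and "B = dl z" and "N = (norm (z - y))^2"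
 have A: "A \<noteq> 0" and B: "B \<noteq> 0" using dl_pos[OF y] dl_pos[OF z] by (simp_all add: A_def B_def)
 have s1: "sg1 y k z = ((2 * N / (A * B^2)) *\<^sub>R z + (2 / (A * B)) *\<^sub>R (z - y)) $ k" for k
  unfolding sg1_def A_def[symmetric] B_def[symmetric] N_def[symmetric] using A B
  by (simp del: vector_minus_component add: divide_simps power2_eq_square)
 have zz: "z \<bullet> z = 1 - B" "(norm z)^2 = 1 - B" "(norm y)^2 = 1 - A" by (simp_all add: A_def B_def power2_norm_eq_inner)
 have c: "z \<bullet> (z - y) = (A - B + N) / 2"
  unfolding A_def B_def N_def power2_norm_eq_inner by (simp add: inner_diff algebra_simps inner_commute)
 have "(\<Sum>k\<in>UNIV. killing i k z * sg1 y k z) = (1 + (1 - B)) * (2 * N / (A * B^2) * z$i + 2 / (A * B) * (z$i - y$i))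
   - 2 * z$i * (2 * N / (A * B^2) * (1 - B) + 2 / (A * B) * ((A - B + N) / 2))"
  unfolding s1 sum_killing zz(2) inner_add_right inner_scaleR_right c zz(1) by simp
 also have "... = 2 * ((1 + (1 - B)) * (z$i - y$i) - z$i * ((1 - B) - (1 - A))) / (A * B)"
  using A B by (simp add: divide_simps power2_eq_square) algebra
 finally show ?thesis by (simp add: A_def B_def)
qed

text \<open>The closed form in \<open>killing_sg1\<close> is antisymmetric in y and z. It lets a
  derivative in the centre y be traded for one in the integration variable z.\<close>

lemma killing_sg_invariant:
 fixes y z :: "real^'n"
 assumes y: "y \<in> UB" and z: "z \<in> UB"
 shows "(\<Sum>k\<in>UNIV. killing i k z * sg1 y k z) + (\<Sum>k\<in>UNIV. killing i k y * sg1 z k y) = 0"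
 unfolding killing_sg1[OF y z] killing_sg1[OF z y]
 by (simp add: mult.commute[of "dl y"] add_divide_distrib[symmetric]) (simp add: algebra_simps)

lemma has_partials_killing:
 fixes i k :: "'n::finite"
 shows "has_partials (killing i k) (%j z. 2 * z$j * (if k = i then 1 else 0) - 2 * ((if j = i then 1 else 0) * z$k + z$i * (if j = k then 1 else 0))) S"
proof -
 have "has_partials (%z. (if k = i then 1 else 0) + (if k = i then 1 else 0) * (norm (z - 0))^2 - 2 * (z$i * z$k))
  (%j z. (0 + (if k = i then 1 else 0) * (2 * (z - 0)$j)) - 2 * (z$i * (if j = k then 1 else 0) + (if j = i then 1 else 0) * z$k)) S"
  by (intro has_partials_diff has_partials_add has_partials_const has_partials_cmult has_partials_norm_sq has_partials_mult has_partials_nth)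
 moreover have "(%z. (if k = i then 1 else 0) + (if k = i then 1 else 0) * (norm (z - 0))^2 - 2 * (z$i * z$k)) = killing i k"
  by (auto simp: killing_def fun_eq_iff)
 ultimately show ?thesis by (simp add: algebra_simps)
qed

lemma has_partials_real_sg_compose:
 fixes y :: "real^'n"
 assumes "!!t. (h has_real_derivative h1 t) (at t)" "continuous_on UNIV h1"
 shows "has_partials (%z. h (sg y z)) (%i z. sg1 y i z * h1 (sg y z)) UB"
 using has_partials_compose_real[OF has_partials_sg, of h h1 y] assms
 by (simp add: has_real_derivative_iff_has_vector_derivative continuous_on_subset)

lemma has_partials_ball_mass:
 "has_partials ball_mass (%i y. LBINT z:UB. sg1 z i y * bump1 (1/128) (sg y z) / (dl (z::real^'n)) ^ CARD('n)) UB"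
 unfolding ball_mass_def[abs_def]
proof (rule has_partials_kernel_integral)
 let ?w = "%z::real^'n. 1 / (dl z) ^ CARD('n)"
 fix z :: "real^'n" assume z: "z \<in> UB"
 show "has_partials (%y. bump (1/128) (sg y z) / (dl z) ^ CARD('n))
   (%i y. sg1 z i y * bump1 (1/128) (sg y z) / (dl z) ^ CARD('n)) UB"
  using has_partials_cmult[OF has_partials_real_sg_compose[OF DERIV_bump continuous_on_bump(2)], of "?w z" "1/128" z]
  by (simp add: sg_sym[of z])
next
 have w: "continuous_on (UB \<times> UB) (%(y, z::real^'n). 1 / (dl z) ^ CARD('n))"
  by (rule continuous_on_snd_ball[OF has_partials_continuous[OF has_partials_weight]])
 show "continuous_on (UB \<times> UB) (%(y, z::real^'n). bump (1/128) (sg y z) / (dl z) ^ CARD('n))"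
  using continuous_on_mult[OF continuous_on_sg_compose[OF continuous_on_bump(1)] w] by (simp add: split_beta)
 show "continuous_on (UB \<times> UB) (%(y, z::real^'n). sg1 z i y * bump1 (1/128) (sg y z) / (dl z) ^ CARD('n))" for i
  using continuous_on_mult[OF continuous_on_mult[OF continuous_on_swap_ball[OF continuous_on_sg1] continuous_on_sg_compose[OF continuous_on_bump(2)]] w]
  by (simp add: split_beta)
qed (auto simp: bump_zero)

text \<open>Divergence theorem for the i-th field times bump (sg y z) / (1 - |z|^2)^n. The
  divergence of the field is -2 n z_i and its product with z is (1 - |z|^2) z_i, so the derivatives
  of field and weight cancel and only that of the bump is left.\<close>

lemma integral_killing_eq_0:
 fixes y :: "real^'n"
 assumes y: "y \<in> UB"
 shows "(LBINT z:UB. (\<Sum>k\<in>UNIV. killing i k z * sg1 y k z) * bump1 (1/128) (sg y z) / (dl z) ^ CARD('n)) = 0"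
proof -
 let ?n = "CARD('n)"
 let ?w = "%z::real^'n. 1 / (dl z) ^ ?n"
 let ?w1 = "%k z::real^'n. 2 * z$k * (real ?n / (dl z) ^ (?n + 1))"
 let ?b = "%z. bump (1/128) (sg y z)" and ?b1 = "%z. bump1 (1/128) (sg y z)"
 let ?V1 = "%k j z::real^'n. 2 * z$j * (if k = i then 1 else 0) - 2 * ((if j = i then 1 else 0) * z$k + z$i * (if j = k then 1 else 0))"
 note hu = has_partials_mult[OF has_partials_killing[of i] has_partials_mult[OF has_partials_weight[of ?n] has_partials_real_sg_compose[OF DERIV_bump continuous_on_bump(2), of "1/128" y]]]
 have "(LBINT z:UB. (\<Sum>k\<in>UNIV. killing i k z * (?w z * (sg1 y k z * ?b1 z) + ?w1 k z * ?b z) + ?V1 k k z * (?w z * ?b z))) = 0"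
  by (rule integral_divergence_eq_0(2)[OF hu sg_cball[OF y]]) (use bump_sg_support(2)[OF y] in auto)
 also have "(LBINT z:UB. (\<Sum>k\<in>UNIV. killing i k z * (?w z * (sg1 y k z * ?b1 z) + ?w1 k z * ?b z) + ?V1 k k z * (?w z * ?b z))) =
  (LBINT z:UB. (\<Sum>k\<in>UNIV. killing i k z * sg1 y k z) * bump1 (1/128) (sg y z) / (dl z) ^ ?n)"
 proof (rule set_lebesgue_integral_cong, simp, intro allI impI)
  fix z :: "real^'n" assume z: "z \<in> UB"
  define B where "B = dl z"
  have B: "B \<noteq> 0" using dl_pos[OF z] by (simp add: B_def)
  have zz: "(norm z)^2 = 1 - B" "z \<bullet> z = 1 - B" by (simp_all add: B_def power2_norm_eq_inner)
  have 1: "(\<Sum>k\<in>UNIV. killing i k z * z$k) = B * z$i"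
   unfolding sum_killing zz by (simp add: algebra_simps)
  have 2: "(\<Sum>k\<in>UNIV. ?V1 k k z) = - 2 * real ?n * z$i"
  proof -
   have "(\<Sum>k\<in>UNIV. ?V1 k k z) = (\<Sum>k\<in>(UNIV::'n set). - 2 * z$i)"
    by (rule sum.cong) auto
   thus ?thesis by simp
  qed
  have "(\<Sum>k\<in>UNIV. killing i k z * (?w z * (sg1 y k z * ?b1 z) + ?w1 k z * ?b z) + ?V1 k k z * (?w z * ?b z))
   = (\<Sum>k\<in>UNIV. (?w z * ?b1 z) * (killing i k z * sg1 y k z) + (2 * (real ?n / B ^ (?n + 1)) * ?b z) * (killing i k z * z$k) + (?w z * ?b z) * ?V1 k k z)"
   by (rule sum.cong) (simp_all only: B_def[symmetric] algebra_simps)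
  also have "... = (?w z * ?b1 z) * (\<Sum>k\<in>UNIV. killing i k z * sg1 y k z) + (2 * (real ?n / B ^ (?n + 1)) * ?b z) * (B * z$i) + (?w z * ?b z) * (- 2 * real ?n * z$i)"
   by (simp only: sum.distrib sum_distrib_left[symmetric] 1 2)
  also have "... = (\<Sum>k\<in>UNIV. killing i k z * sg1 y k z) * bump1 (1/128) (sg y z) / B ^ ?n"
   unfolding B_def[symmetric] using B by (simp add: field_simps)
  finally show "(\<Sum>k\<in>UNIV. killing i k z * (?w z * (sg1 y k z * ?b1 z) + ?w1 k z * ?b z) + ?V1 k k z * (?w z * ?b z))
   = (\<Sum>k\<in>UNIV. killing i k z * sg1 y k z) * bump1 (1/128) (sg y z) / (dl z) ^ ?n" by (simp only: B_def)
 qed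
 finally show ?thesis .
qed

lemma bump_sg_integrable:
 fixes f :: "real^'n => 'c::euclidean_space"
 assumes y: "y \<in> UB" and f: "continuous_on UB f"
  and h: "continuous_on UNIV h" "!!t. 1/128 <= t ==> h t = 0"
 shows "set_integrable lborel UB (%z. h (sg y z) *\<^sub>R f z)"
proof (rule integrable_compact_support[OF open_ball sg_cball[OF y]])
 show "continuous_on UB (%z. h (sg y z) *\<^sub>R f z)"
  by (intro continuous_intros f continuous_on_compose2[OF h(1) has_partials_continuous[OF has_partials_sg] subset_UNIV])
 fix z :: "real^'n" assume "z \<in> UB - cball 0 (sqrt ((1 + (norm y)^2) / 2))"
 hence "1/128 < sg y z" using bump_sg_support(1)[OF y, of "1/128"] by simp
 thus "h (sg y z) *\<^sub>R f z = 0" by (simp add: h(2))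
qed

text \<open>The derivative \<open>D\<close> of the mass is annihilated by all n fields: each is
  moved from y to z by \<open>killing_sg_invariant\<close>, and then
  \<open>integral_killing_eq_0\<close> applies.\<close>

lemma ball_mass_const:
 fixes y :: "real^'n"
 assumes y: "y \<in> UB"
 shows "ball_mass y = ball_mass (0::real^'n)"
proof -
 let ?J1 = "%i y. LBINT z:UB. sg1 z i y * bump1 (1/128) (sg y z) / (dl (z::real^'n)) ^ CARD('n)"
 have J1: "?J1 i y = 0" if y: "y \<in> UB" for i and y :: "real^'n"
 proof -
  define D where "D = (\<chi> i. ?J1 i y)"
  have cs: "continuous_on UB (%z. sg1 z i y / (dl (z::real^'n)) ^ CARD('n))" for i
  proof -
   have "continuous_on UB (%z. sg1 z i y)"
    using continuous_on_compose2[OF continuous_on_sg1, of UB "%z. (z, y)" i] y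
    by (force intro!: continuous_intros)
   from continuous_on_mult[OF this has_partials_continuous[OF has_partials_weight, of "CARD('n)"]]
   show ?thesis by simp
  qed
  have int: "set_integrable lborel UB (%z. sg1 z i y * bump1 (1/128) (sg y z) / (dl (z::real^'n)) ^ CARD('n))" for i
   using bump_sg_integrable[OF y cs continuous_on_bump(2), of "1/128" i] by (simp add: bump_zero mult.commute)
  have "(\<Sum>k\<in>UNIV. killing i k y * D$k) = 0" for i
  proof -
   have "(\<Sum>k\<in>UNIV. killing i k y * D$k) = (\<Sum>k\<in>UNIV. LBINT z:UB. killing i k y * (sg1 z k y * bump1 (1/128) (sg y z) / (dl (z::real^'n)) ^ CARD('n)))"
    by (simp only: D_def vec_lambda_beta set_integral_mult_right)
   also have "... = (LBINT z:UB. (\<Sum>k\<in>UNIV. killing i k y * (sg1 z k y * bump1 (1/128) (sg y z) / (dl (z::real^'n)) ^ CARD('n))))"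
    using set_integrable_mult_right[OF int]
    unfolding set_lebesgue_integral_def set_integrable_def scaleR_sum_right
    by (subst Bochner_Integration.integral_sum) auto
   also have "... = (LBINT z:UB. (-1) * ((\<Sum>k\<in>UNIV. killing i k z * sg1 y k z) * bump1 (1/128) (sg y z) / (dl z) ^ CARD('n)))"
   proof (rule set_lebesgue_integral_cong, simp, intro allI impI)
    fix z :: "real^'n" assume z: "z \<in> UB"
    have "(\<Sum>k\<in>UNIV. killing i k y * (sg1 z k y * bump1 (1/128) (sg y z) / (dl z) ^ CARD('n)))
     = (\<Sum>k\<in>UNIV. killing i k y * sg1 z k y) * (bump1 (1/128) (sg y z) / (dl z) ^ CARD('n))"
     unfolding sum_distrib_right by (rule sum.cong) auto
    also have "(\<Sum>k\<in>UNIV. killing i k y * sg1 z k y) = - (\<Sum>k\<in>UNIV. killing i k z * sg1 y k z)"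
     using killing_sg_invariant[OF y z, of i] by simp
    finally show "(\<Sum>k\<in>UNIV. killing i k y * (sg1 z k y * bump1 (1/128) (sg y z) / (dl z) ^ CARD('n)))
     = (-1) * ((\<Sum>k\<in>UNIV. killing i k z * sg1 y k z) * bump1 (1/128) (sg y z) / (dl z) ^ CARD('n))" by simp
   qed
   also have "... = 0" unfolding set_integral_mult_right integral_killing_eq_0[OF y] by simp
   finally show ?thesis .
  qed
  hence e: "(1 + (norm y)^2) * D$i - 2 * y$i * (y \<bullet> D) = 0" for i unfolding sum_killing .
  \<comment> \<open>The n fields span at every point: contraction with y gives (1 - |y|^2) (y . D) =
    0, after which (1 + |y|^2) D_i = 0 remains.\<close>
  have "(\<Sum>i\<in>UNIV. y$i * ((1 + (norm y)^2) * D$i - 2 * y$i * (y \<bullet> D))) = (1 + (norm y)^2) * (y \<bullet> D) - 2 * (y \<bullet> D) * (y \<bullet> y)"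
  proof -
   have "(\<Sum>i\<in>UNIV. y$i * ((1 + (norm y)^2) * D$i - 2 * y$i * (y \<bullet> D))) = (\<Sum>i\<in>UNIV. (1 + (norm y)^2) * (y$i * D$i) - 2 * (y \<bullet> D) * (y$i * y$i))"
    by (rule sum.cong) (auto simp: algebra_simps)
   thus ?thesis by (simp only: sum_subtractf sum_distrib_left[symmetric] sum_inner)
  qed
  hence "(dl y) * (y \<bullet> D) = 0" unfolding e by (simp add: power2_norm_eq_inner[symmetric] algebra_simps)
  hence "y \<bullet> D = 0" using dl_pos[OF y] by simp
  hence "(1 + (norm y)^2) * D$i = 0" using e by simp
  moreover have "1 + (norm y)^2 \<noteq> 0" by (metis add_pos_nonneg less_irrefl zero_le_power2 zero_less_one)
  ultimately have "D$i = 0" by simp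
  thus ?thesis by (simp add: D_def)
 qed
 have "\<exists>c. \<forall>x\<in>UB. ball_mass (x::real^'n) = c"
 proof (rule has_derivative_zero_constant)
  fix x :: "real^'n" assume x: "x \<in> UB"
  have "(ball_mass has_derivative (%v. \<Sum>i\<in>UNIV. v$i *\<^sub>R 0)) (at x)"
   using has_partialsD(1)[OF has_partials_ball_mass x] unfolding J1[OF x] .
  thus "(ball_mass has_derivative (%h. 0)) (at x within UB)"
   by (simp add: has_derivative_at_withinI)
 qed auto
 then obtain c where "!!x::real^'n. x \<in> UB ==> ball_mass x = c" by blast
 from this[OF y] this[of 0] show ?thesis by simp
qed

lemma ball_mass_pos:
 assumes n: "2 <= CARD('n)" shows "0 < ball_mass (0::real^'n)"
proof (rule ccontr)
 assume "\<not> ?thesis"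
 let ?f = "%z::real^'n. bump (1/128) (sg 0 z) / (dl z) ^ CARD('n)"
 have z0: "(0::real^'n) \<in> UB" by simp
 have c: "continuous_on UB ?f" by (rule continuous_on_bump_sg[OF z0])
 have nn: "0 <= ?f z" if "z \<in> UB" for z :: "real^'n"
  using dl_pos[OF that] bump_nonneg by simp
 have i: "set_integrable lborel UB ?f"
  by (rule integrable_compact_support[OF open_ball sg_cball[OF z0] c])
   (use bump_sg_support(2)[OF z0] in auto)
 have "0 <= (LBINT z:UB. ?f z)"
  unfolding set_lebesgue_integral_def by (intro Bochner_Integration.integral_nonneg) (use nn in \<open>auto simp: indicator_def\<close>)
 with \<open>\<not> ?thesis\<close> have "(LBINT z:UB. ?f z) = 0" by (simp add: ball_mass_def)
 hence ae: "AE z in lborel. indicator UB z *\<^sub>R ?f z = 0"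
  unfolding set_lebesgue_integral_def
  by (subst (asm) integral_nonneg_eq_0_iff_AE) (use i nn in \<open>auto simp: set_integrable_def indicator_def\<close>)
 \<comment> \<open>Chosen so that t^2 / (1 - t^2) lies strictly between 1/256 and 1/128, where the
   bump is positive.\<close>
 define t where "t = (sqrt (3/4/131)::real)"
 have t2: "t^2 = 3/4/131" by (simp add: t_def)
 obtain k :: 'n where True by blast
 define p :: "real^'n" where "p = t *\<^sub>R axis k 1"
 have np: "norm p = t" by (simp add: p_def t_def)
 have pb: "p \<in> UB" by (simp add: np t_def)
 have "?f p > 0"
 proof -
  have "sg 0 p = t^2 / (1 - t^2)" by (simp add: sg_def np)
  also have "... = (3/4/131) / (1 - 3/4/131)" by (simp only: t2)
  finally have "bump (1/128) (sg 0 p) > 0" by (intro bump_pos) auto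
  thus ?thesis using dl_pos[OF pb] by simp
 qed
 define Pos where "Pos = {z\<in>UB. ?f z \<in> {0<..}}"
 have "open Pos" unfolding Pos_def using continuous_open_preimage[OF c open_ball open_greaterThan, of 0]
  by (simp add: vimage_def Int_def)
 moreover have "p \<in> Pos" using \<open>?f p > 0\<close> pb by (simp add: Pos_def)
 ultimately have "\<not> negligible Pos" using open_not_negligible by blast
 moreover have "Pos \<in> null_sets lborel"
 proof (rule AE_iff_null_sets[THEN iffD2])
  show "Pos \<in> sets lborel" using \<open>open Pos\<close> by simp
  show "AE z in lborel. z \<notin> Pos" using ae by eventually_elim (auto simp: Pos_def indicator_def power2_eq_1_iff)
 qed
 ultimately show False by (simp add: negligible_iff_null_sets null_sets_completionI)
qed

section \<open>Limits and weighted measures\<close>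

text \<open>Normalised by the mass at 0, which by \<open>ball_mass_const\<close> is the mass at
  every y; the reference measure is (1 - |z|^2)^(-n) dz.\<close>

definition lk :: "real^'n => real^'n => real" where
 "lk y z = bump (1/128) (sg y z) / ball_mass (0 :: real^'n)"

lemma lk_zero: "1/128 <= sg y z ==> lk y z = 0"
 by (simp add: lk_def bump_zero)

lemma lk_nonneg: "2 <= CARD('n) ==> 0 <= lk y (z::real^'n)"
 using ball_mass_pos[where 'n='n] bump_nonneg by (simp add: lk_def)

lemma lk_mean_value:
 fixes g :: "real^'n => complex"
 assumes n: "2 <= CARD('n)" and g: "g \<in> h_harmonic" and y: "y \<in> UB"
 shows "g y = (LBINT z:UB. g z * of_real (lk y z / (dl z) ^ CARD('n)))"
proof -
 have J: "ball_mass (0::real^'n) \<noteq> 0" using ball_mass_pos[OF n] by simp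
 have "(LBINT z:UB. g z * of_real (lk y z / (dl z) ^ CARD('n)))
  = (LBINT z:UB. of_real (1 / ball_mass (0::real^'n)) * (g z * of_real (bump (1/128) (sg y z) / (dl z) ^ CARD('n))))"
  by (rule arg_cong[where f="set_lebesgue_integral lborel UB"]) (simp add: lk_def fun_eq_iff)
 also have "... = of_real (1 / ball_mass (0::real^'n)) * radial_integral y (1/128) g"
  unfolding radial_integral_def by (rule set_integral_mult_right)
 also have "... = g y"
  unfolding radial_mean_value[OF n g y] ball_mass_const[OF y] using J by simp
 finally show ?thesis ..
qed

text \<open>All derivatives fall on the bump, so any continuous \<phi> becomes C2. By the symmetry
  of \<open>sg\<close> the partials in y are \<open>sg1 z i y\<close> and
  \<open>sg2 z i j y\<close>, with the points exchanged.\<close>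

lemma has_partials_smoothing:
 fixes \<phi> :: "real^'n => complex"
 assumes \<phi>: "continuous_on UB \<phi>"
 shows "has_partials (%y. LBINT z:UB. \<phi> z * of_real (bump (1/128) (sg y z)))
   (%i y. LBINT z:UB. \<phi> z * of_real (sg1 z i y * bump1 (1/128) (sg y z))) UB" (is ?A)
  and "!!i. has_partials (%y. LBINT z:UB. \<phi> z * of_real (sg1 z i y * bump1 (1/128) (sg y z)))
   (%j y. LBINT z:UB. \<phi> z * of_real (sg2 z i j y * bump1 (1/128) (sg y z) + sg1 z i y * sg1 z j y * bump2 (1/128) (sg y z))) UB" (is "!!i. ?B i")
proof -
 have P: "has_partials (%y. complex_of_real (bump (1/128) (sg y z))) (%i y. of_real (sg1 z i y * bump1 (1/128) (sg y z))) UB"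
  "!!i. has_partials (%y. complex_of_real (sg1 z i y * bump1 (1/128) (sg y z)))
   (%j y. of_real (sg2 z i j y * bump1 (1/128) (sg y z) + sg1 z i y * sg1 z j y * bump2 (1/128) (sg y z))) UB"
  if "z \<in> UB" for z :: "real^'n"
  using has_partials_sg_compose(1,2)[OF that DERIV_bump[of "1/128"] DERIV_bump1 continuous_on_bump(3)]
  by (simp_all add: sg_sym[of z])
 note cs = continuous_on_snd_ball[OF \<phi>] continuous_on_swap_ball[OF continuous_on_sg1] continuous_on_swap_ball[OF continuous_on_sg2]
  continuous_on_sg_compose[OF continuous_on_bump(1)] continuous_on_sg_compose[OF continuous_on_bump(2)] continuous_on_sg_compose[OF continuous_on_bump(3)]
 show ?A
 proof (rule has_partials_kernel_integral)
  show "has_partials (%y. \<phi> z * of_real (bump (1/128) (sg y z))) (%i y. \<phi> z * of_real (sg1 z i y * bump1 (1/128) (sg y z))) UB"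
   if "z \<in> UB" for z
   by (rule has_partials_cmult[OF P(1)[OF that]])
  show "continuous_on (UB \<times> UB) (%(y, z). \<phi> z * of_real (bump (1/128) (sg y z)))"
   unfolding split_beta by (intro continuous_intros continuous_on_of_real cs[unfolded split_beta])
  show "continuous_on (UB \<times> UB) (%(y, z). \<phi> z * of_real (sg1 z i y * bump1 (1/128) (sg y z)))" for i
   unfolding split_beta by (intro continuous_intros continuous_on_of_real cs[unfolded split_beta])
 qed (simp add: bump_zero)
 show "?B i" for i
 proof (rule has_partials_kernel_integral)
  show "has_partials (%y. \<phi> z * of_real (sg1 z i y * bump1 (1/128) (sg y z)))
    (%j y. \<phi> z * of_real (sg2 z i j y * bump1 (1/128) (sg y z) + sg1 z i y * sg1 z j y * bump2 (1/128) (sg y z))) UB"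
   if "z \<in> UB" for z
   by (rule has_partials_cmult[OF P(2)[OF that]])
  show "continuous_on (UB \<times> UB) (%(y, z). \<phi> z * of_real (sg1 z i y * bump1 (1/128) (sg y z)))"
   unfolding split_beta by (intro continuous_intros continuous_on_of_real cs[unfolded split_beta])
  show "continuous_on (UB \<times> UB) (%(y, z). \<phi> z * of_real (sg2 z i j y * bump1 (1/128) (sg y z) + sg1 z i y * sg1 z j y * bump2 (1/128) (sg y z)))" for j
   unfolding split_beta by (intro continuous_intros continuous_on_of_real cs[unfolded split_beta])
 qed (simp add: bump_zero)
qed

lemma tendsto_set_integral_uniform:
 fixes f :: "nat => 'a::euclidean_space => complex"
 assumes K: "open \<Omega>" "compact K" "K \<subseteq> \<Omega>" and w: "continuous_on \<Omega> w" "!!z. z \<in> \<Omega> - K ==> w z = 0"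
  and f: "!!j. continuous_on \<Omega> (f j)" and g: "continuous_on \<Omega> g" and u: "uniform_limit K f g sequentially"
 shows "(%j. LBINT z:\<Omega>. f j z * w z) \<longlonglongrightarrow> (LBINT z:\<Omega>. g z * w z)"
proof (rule tendstoI)
 fix e :: real assume e: "e > 0"
 have int: "set_integrable lborel \<Omega> (%z. h z * w z)" if "continuous_on \<Omega> h" for h
  by (rule integrable_compact_support[OF K]) (use w that in \<open>auto intro!: continuous_intros\<close>)
 have iw: "set_integrable lborel \<Omega> (%z. cmod (w z))" using int[OF continuous_on_const[of _ 1]] set_integrable_norm by fastforce
 define C where "C = (LBINT z:\<Omega>. cmod (w z))"
 have C: "C \<ge> 0" unfolding C_def set_lebesgue_integral_def by (intro Bochner_Integration.integral_nonneg) auto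
 have "\<forall>\<^sub>F j in sequentially. \<forall>z\<in>K. dist (f j z) (g z) < e / (C + 1)"
  using u e C unfolding uniform_limit_iff by (auto intro: divide_pos_pos)
 thus "\<forall>\<^sub>F j in sequentially. dist (LBINT z:\<Omega>. f j z * w z) (LBINT z:\<Omega>. g z * w z) < e"
 proof eventually_elim
  case (elim j)
  have "dist (LBINT z:\<Omega>. f j z * w z) (LBINT z:\<Omega>. g z * w z) = cmod (LBINT z:\<Omega>. f j z * w z - g z * w z)"
   unfolding dist_norm by (subst set_integral_diff(2)[OF int[OF f] int[OF g]]) simp
  also have "... <= (LBINT z:\<Omega>. cmod (f j z * w z - g z * w z))"
   by (intro set_integral_norm_bound set_integral_diff(1) int f g)
  also have "... <= (LBINT z:\<Omega>. e / (C + 1) * cmod (w z))"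
  proof (rule set_integral_mono)
   show "set_integrable lborel \<Omega> (%z. cmod (f j z * w z - g z * w z))"
    by (intro set_integrable_norm set_integral_diff(1) int f g)
   show "set_integrable lborel \<Omega> (%z. e / (C + 1) * cmod (w z))" using iw by (intro set_integrable_mult_right)
   fix z assume z: "z \<in> \<Omega>"
   show "cmod (f j z * w z - g z * w z) <= e / (C + 1) * cmod (w z)"
   proof (cases "z \<in> K")
    case True
    have "cmod (f j z * w z - g z * w z) = cmod (f j z - g z) * cmod (w z)" by (simp add: left_diff_distrib[symmetric] norm_mult)
    moreover have "cmod (f j z - g z) <= e / (C + 1)" using elim True by (auto simp: dist_norm less_imp_le)
    ultimately show ?thesis by (simp only: mult_right_mono norm_ge_zero)
   qed (use w z in simp)
  qed
  also have "... = e / (C + 1) * C" unfolding C_def by (rule set_integral_mult_right)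
  also have "... < e" using e C by (simp add: field_simps)
  finally show ?case .
 qed
qed

lemma uniform_limit_compact_continuous_on:
 fixes f :: "nat => real^'n => complex"
 assumes "!!j. continuous_on UB (f j)"
  "!!K. compact K ==> K \<subseteq> UB ==> uniform_limit K f g sequentially"
 shows "continuous_on UB g"
proof (rule continuous_at_imp_continuous_on, rule ballI)
 fix x :: "real^'n" assume x: "x \<in> UB"
 then obtain e where e: "e > 0" "cball x e \<subseteq> UB" using open_contains_cball open_ball by metis
 have "continuous_on (cball x e) g"
  by (rule uniform_limit_theorem[OF _ assms(2)[OF compact_cball e(2)]])
   (auto intro!: always_eventually continuous_on_subset[OF assms(1) e(2)])
 thus "isCont g x" using e(1) by (intro continuous_on_interior[of "cball x e"]) auto
qed

text \<open>The limit inherits the mean value formula, hence is a smoothing of itself and C2. Its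
  Laplacian in y is an integral of g against a function \<open>H\<close> of \<open>sg y z\<close>.
  The same \<open>H\<close> is the Laplacian of the bump in z, so the integrals with f j vanish by
  \<open>green_identity\<close>, and so does their limit.\<close>

lemma h_harmonic_uniform_limit:
 fixes f :: "nat => real^'n => complex"
 assumes n: "2 <= CARD('n)" and f: "!!j. f j \<in> h_harmonic"
  and u: "!!K. compact K ==> K \<subseteq> UB ==> uniform_limit K f g sequentially"
 shows "g \<in> h_harmonic"
proof -
 let ?n = "CARD('n)" let ?B = "%z::real^'n. dl z"
 let ?b = "bump (1/128)" and ?b1 = "bump1 (1/128)" and ?b2 = "bump2 (1/128)"
 define J where "J = ball_mass (0::real^'n)"
 have J: "J \<noteq> 0" using ball_mass_pos[OF n] by (simp add: J_def)
 have cg: "continuous_on UB g"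
  by (rule uniform_limit_compact_continuous_on[OF h_harmonic_continuous[OF f] u])
 define \<phi> where "\<phi> z = g z * of_real (1 / ?B z ^ ?n / J)" for z
 have c\<phi>: "continuous_on UB \<phi>"
  unfolding \<phi>_def using J by (intro continuous_intros cg continuous_on_of_real) (auto simp: power2_eq_1_iff)
 have lim: "(%j. LBINT z:UB. f j z * of_real (h (sg y z) / ?B z ^ ?n / J)) \<longlonglongrightarrow> (LBINT z:UB. g z * of_real (h (sg y z) / ?B z ^ ?n / J))"
  if y: "y \<in> UB" and h: "continuous_on UNIV h" "!!t. 1/128 <= t ==> h t = 0" for y h
 proof (rule tendsto_set_integral_uniform[OF open_ball sg_cball[OF y] _ _ h_harmonic_continuous[OF f] cg u[OF sg_cball[OF y]]])
  have "continuous_on UB (%z. h (sg y z))"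
   by (rule continuous_on_compose2[OF h(1) has_partials_continuous[OF has_partials_sg] subset_UNIV])
  thus "continuous_on UB (%z. complex_of_real (h (sg y z) / ?B z ^ ?n / J))"
   using J by (intro continuous_intros continuous_on_of_real) (auto simp: power2_eq_1_iff)
  show "complex_of_real (h (sg y z) / ?B z ^ ?n / J) = 0" if "z \<in> UB - cball 0 (sqrt ((1 + (norm y)^2) / 2))" for z
   using bump_sg_support(1)[OF y, of "1/128" z] that by (simp add: h(2))
 qed
 have g_eq: "g y = (LBINT z:UB. \<phi> z * of_real (?b (sg y z)))" if y: "y \<in> UB" for y
 proof -
  have "(%j. f j y) \<longlonglongrightarrow> g y"
   using u[of "{y}"] y by (auto simp: tendsto_uniform_limitI dest: tendsto_uniform_limitI)
  moreover have "f j y = (LBINT z:UB. f j z * of_real (?b (sg y z) / ?B z ^ ?n / J))" for j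
   using lk_mean_value[OF n f y, of j] by (simp add: lk_def J_def mult.commute)
  hence "(%j. f j y) \<longlonglongrightarrow> (LBINT z:UB. g z * of_real (?b (sg y z) / ?B z ^ ?n / J))"
   using lim[OF y continuous_on_bump(1), of "1/128"] by (simp add: bump_zero)
  ultimately have "g y = (LBINT z:UB. g z * of_real (?b (sg y z) / ?B z ^ ?n / J))"
   by (rule LIMSEQ_unique)
  thus ?thesis by (simp add: \<phi>_def mult.commute)
 qed
 let ?G1 = "%i y. LBINT z:UB. \<phi> z * of_real (sg1 z i y * ?b1 (sg y z))"
 let ?G2 = "%i j y. LBINT z:UB. \<phi> z * of_real (sg2 z i j y * ?b1 (sg y z) + sg1 z i y * sg1 z j y * ?b2 (sg y z))"
 note S = has_partials_smoothing[OF c\<phi>]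
 have G: "has_partials g ?G1 UB"
  by (rule has_partials_cong[OF S(1) open_ball]) (auto simp: g_eq)
 show ?thesis
 proof (rule h_harmonicI[OF G S(2)])
  fix y :: "real^'n" assume y: "y \<in> UB"
  define H where "H t = 4 * (t * (1 + t) * ?b2 t + real ?n * (t + 1/2) * ?b1 t)" for t
  have int: "set_integrable lborel UB (%z. \<phi> z * of_real (c z * h (sg y z)))"
   if "continuous_on UB c" "continuous_on UNIV h" "!!t. 1/128 <= t ==> h t = 0" for c h
  proof -
   have "set_integrable lborel UB (%z. h (sg y z) *\<^sub>R (\<phi> z * of_real (c z)))"
    by (rule bump_sg_integrable[OF y _ that(2,3)]) (intro continuous_intros c\<phi> continuous_on_of_real that)
   thus ?thesis by (simp add: scaleR_conv_of_real mult_ac)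
  qed
  have c1: "continuous_on UB (%z. sg1 z i y)" for i
   using continuous_on_compose2[OF continuous_on_sg1, of UB "%z. (z, y)" i] y by (force intro!: continuous_intros)
  have c2: "continuous_on UB (%z. sg2 z i j y)" for i j
   using continuous_on_compose2[OF continuous_on_sg2, of UB "%z. (z, y)" i j] y by (force intro!: continuous_intros)
  have i1: "set_integrable lborel UB (%z. \<phi> z * of_real (sg1 z i y * ?b1 (sg y z)))" for i
   by (intro int c1 continuous_on_bump) (simp add: bump_zero)
  have i2: "set_integrable lborel UB (%z. \<phi> z * of_real (sg2 z i i y * ?b1 (sg y z) + sg1 z i y * sg1 z i y * ?b2 (sg y z)))" for i
  proof -
   have "set_integrable lborel UB (%z. \<phi> z * of_real (sg2 z i i y * ?b1 (sg y z)) + \<phi> z * of_real (sg1 z i y * sg1 z i y * ?b2 (sg y z)))"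
    by (intro set_integral_add(1) int c1 c2 continuous_on_bump continuous_on_mult) (simp_all add: bump_zero)
   thus ?thesis by (simp add: distrib_left)
  qed
  have "of_real ((?B y)^2) * (\<Sum>i\<in>UNIV. ?G2 i i y) + of_real (2 * (real ?n - 2) * ?B y) * (\<Sum>i\<in>UNIV. of_real (y $ i) * ?G1 i y)
   = (LBINT z:UB. of_real ((?B y)^2) * (\<Sum>i\<in>UNIV. \<phi> z * of_real (sg2 z i i y * ?b1 (sg y z) + sg1 z i y * sg1 z i y * ?b2 (sg y z)))
     + of_real (2 * (real ?n - 2) * ?B y) * (\<Sum>i\<in>UNIV. of_real (y$i) * (\<phi> z * of_real (sg1 z i y * ?b1 (sg y z)))))"
  proof -
   have s1: "set_integrable lborel UB (%z. \<Sum>i\<in>UNIV. \<phi> z * of_real (sg2 z i i y * ?b1 (sg y z) + sg1 z i y * sg1 z i y * ?b2 (sg y z)))"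
    using i2 unfolding set_integrable_def scaleR_sum_right by (intro Bochner_Integration.integrable_sum)
   have e1: "(\<Sum>i\<in>UNIV. ?G2 i i y) = (LBINT z:UB. (\<Sum>i\<in>UNIV. \<phi> z * of_real (sg2 z i i y * ?b1 (sg y z) + sg1 z i y * sg1 z i y * ?b2 (sg y z))))"
    using i2 unfolding set_integrable_def set_lebesgue_integral_def scaleR_sum_right by (subst Bochner_Integration.integral_sum) auto
   have i1': "set_integrable lborel UB (%z. of_real (y$i) * (\<phi> z * of_real (sg1 z i y * ?b1 (sg y z))))" for i
    using i1 by (intro set_integrable_mult_right)
   have s2: "set_integrable lborel UB (%z. \<Sum>i\<in>UNIV. of_real (y$i) * (\<phi> z * of_real (sg1 z i y * ?b1 (sg y z))))"
    using i1' unfolding set_integrable_def scaleR_sum_right by (intro Bochner_Integration.integrable_sum)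
   have e2: "(\<Sum>i\<in>UNIV. of_real (y$i) * ?G1 i y) = (LBINT z:UB. (\<Sum>i\<in>UNIV. of_real (y$i) * (\<phi> z * of_real (sg1 z i y * ?b1 (sg y z)))))"
    unfolding set_integral_mult_right[symmetric]
    using i1' unfolding set_integrable_def set_lebesgue_integral_def scaleR_sum_right by (subst Bochner_Integration.integral_sum) auto
   have "set_integrable lborel UB (%z. of_real ((?B y)^2) * (\<Sum>i\<in>UNIV. \<phi> z * of_real (sg2 z i i y * ?b1 (sg y z) + sg1 z i y * sg1 z i y * ?b2 (sg y z))))"
    "set_integrable lborel UB (%z. of_real (2 * (real ?n - 2) * ?B y) * (\<Sum>i\<in>UNIV. of_real (y$i) * (\<phi> z * of_real (sg1 z i y * ?b1 (sg y z)))))"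
    using s1 s2 by (intro set_integrable_mult_right; simp)+
   from set_integral_add(2)[OF this] show ?thesis unfolding e1 e2 set_integral_mult_right by simp
  qed
  also have "... = (LBINT z:UB. g z * of_real (H (sg y z) / ?B z ^ ?n / J))"
  proof (rule set_lebesgue_integral_cong, simp, intro allI impI)
   fix z :: "real^'n" assume z: "z \<in> UB"
   have "of_real ((?B y)^2) * (\<Sum>i\<in>UNIV. \<phi> z * of_real (sg2 z i i y * ?b1 (sg y z) + sg1 z i y * sg1 z i y * ?b2 (sg y z)))
     + of_real (2 * (real ?n - 2) * ?B y) * (\<Sum>i\<in>UNIV. of_real (y$i) * (\<phi> z * of_real (sg1 z i y * ?b1 (sg y z))))
    = \<phi> z * of_real ((?B y)^2 * (\<Sum>i\<in>UNIV. sg2 z i i y * ?b1 (sg z y) + sg1 z i y * sg1 z i y * ?b2 (sg z y))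
     + 2 * (real ?n - 2) * ?B y * (\<Sum>i\<in>UNIV. y$i * (sg1 z i y * ?b1 (sg z y))))"
    by (simp add: sg_sym[of z] sum_distrib_left distrib_left mult_ac)
   also have "... = \<phi> z * of_real (H (sg y z))"
    unfolding sg_laplacian[OF z y] by (simp add: H_def sg_sym[of z])
   finally show "of_real ((?B y)^2) * (\<Sum>i\<in>UNIV. \<phi> z * of_real (sg2 z i i y * ?b1 (sg y z) + sg1 z i y * sg1 z i y * ?b2 (sg y z)))
     + of_real (2 * (real ?n - 2) * ?B y) * (\<Sum>i\<in>UNIV. of_real (y$i) * (\<phi> z * of_real (sg1 z i y * ?b1 (sg y z))))
     = g z * of_real (H (sg y z) / ?B z ^ ?n / J)" by (simp add: \<phi>_def mult.commute)
  qed
  also have "... = 0"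
  proof -
   have cH: "continuous_on UNIV H" unfolding H_def[abs_def] by (intro continuous_intros)
   have zH: "H t = 0" if "1/128 <= t" for t using that by (simp add: H_def bump_zero)
   have "(LBINT z:UB. f j z * of_real (H (sg y z) / ?B z ^ ?n / J)) = 0" for j
   proof -
    note P = has_partials_sg_compose[OF y DERIV_bump[of "1/128"] DERIV_bump1 continuous_on_bump(3)]
    have "(LBINT z:UB. f j z * hyp_laplacian (%z. complex_of_real (?b (sg y z))) z / of_real (?B z ^ ?n)) = 0"
     by (rule green_identity[OF n f P(1,2) sg_cball[OF y]]) (use bump_sg_support(2)[OF y] in auto)
    also have "(LBINT z:UB. f j z * hyp_laplacian (%z. complex_of_real (?b (sg y z))) z / of_real (?B z ^ ?n))
     = (LBINT z:UB. of_real J * (f j z * of_real (H (sg y z) / ?B z ^ ?n / J)))"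
     by (rule set_lebesgue_integral_cong) (use J in \<open>auto simp: P(3)[unfolded mem_ball] H_def\<close>)
    finally show ?thesis using J unfolding set_integral_mult_right by simp
   qed
   hence "(%j. 0) \<longlonglongrightarrow> (LBINT z:UB. g z * of_real (H (sg y z) / ?B z ^ ?n / J))"
    using lim[OF y cH zH] by simp
   thus ?thesis using LIMSEQ_unique tendsto_const by blast
  qed
  finally show "of_real ((?B y)^2) * (\<Sum>i\<in>UNIV. ?G2 i i y) + of_real (2 * (real ?n - 2) * ?B y) * (\<Sum>i\<in>UNIV. of_real (y $ i) * ?G1 i y) = 0" .
 qed
qed

section \<open>Integrals against \<open>nu_weighted\<close> as Lebesgue integrals\<close>

definition nu_const :: "'n::finite itself => real" where
 "nu_const _ = 1 / measure lborel (UB :: (real^'n) set)"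

lemma nu_const_pos: "0 < nu_const TYPE('n::finite)"
proof -
 have "measure lborel (UB :: (real^'n) set) > 0"
  using content_ball_pos[of 1 "0::real^'n"] by simp
 thus ?thesis by (simp add: nu_const_def)
qed

lemma nu_weighted_density:
 "(nu_weighted \<alpha> :: (real^'n) measure) = density (lebesgue_on UB) (%x. ennreal (nu_const TYPE('n) * (dl x) powr \<alpha>))"
proof -
 let ?L = "lebesgue_on (UB :: (real^'n) set)"
 have em: "emeasure ?L UB = ennreal (measure lborel (UB :: (real^'n) set))"
 proof -
  have "emeasure ?L UB = emeasure lebesgue (UB :: (real^'n) set)"
   by (rule emeasure_restrict_space) auto
  also have "... = emeasure lborel (UB :: (real^'n) set)" by simp
  also have "... = ennreal (measure lborel (UB :: (real^'n) set))"
   using emeasure_bounded_finite[OF bounded_ball, of "0::real^'n" 1] by (intro emeasure_eq_ennreal_measure) auto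
  finally show ?thesis .
 qed
 have pos: "measure lborel (UB :: (real^'n) set) > 0" using nu_const_pos[where 'n='n] by (simp add: nu_const_def zero_less_measure_iff)
 have [measurable]: "UB \<in> sets ?L" by (simp add: sets_restrict_space_iff)
 have nu: "(nu :: (real^'n) measure) = density ?L (%x. ennreal (nu_const TYPE('n)))"
  unfolding nu_def uniform_measure_def
 proof (rule density_cong)
  show "AE x in ?L. indicator UB x / emeasure ?L UB = ennreal (nu_const TYPE('n))"
   unfolding em using pos by (intro AE_I2) (auto simp: nu_const_def divide_ennreal[symmetric] ennreal_1[symmetric] simp del: ennreal_1)
 qed measurable
 have m: "(%x::real^'n. ennreal ((dl x) powr \<alpha>)) \<in> borel_measurable ?L"
  by (intro measurable_restrict_space1 measurable_completion) measurable
 show ?thesis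
  unfolding nu_weighted_def nu
  by (subst density_density_eq) (auto simp: m ennreal_mult' less_imp_le[OF nu_const_pos])
qed

lemma space_nu_weighted [simp]: "space (nu_weighted \<alpha> :: (real^'n) measure) = UB"
 by (simp add: nu_weighted_density space_restrict_space)

lemma sets_nu_weighted: "sets (nu_weighted \<alpha> :: (real^'n) measure) = sets (lebesgue_on UB)"
 by (simp add: nu_weighted_density)

lemma measurable_nu_weighted:
 fixes f :: "real^'n => 'c::euclidean_space"
 assumes "set_borel_measurable lborel UB f"
 shows "f \<in> borel_measurable (nu_weighted \<alpha>)"
proof -
 have "(%x. indicator UB x *\<^sub>R f x) \<in> borel_measurable lebesgue"
  by (rule measurable_completion[OF assms[unfolded set_borel_measurable_def]])
 hence "f \<in> borel_measurable (lebesgue_on UB)"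
  by (subst borel_measurable_restrict_space_iff) auto
 thus ?thesis using measurable_cong_sets[OF sets_nu_weighted refl] by blast
qed

lemma continuous_measurable:
 fixes f :: "real^'n => 'c::euclidean_space"
 assumes "continuous_on UB f"
 shows "set_borel_measurable lborel UB f" "f \<in> borel_measurable (nu_weighted \<alpha>)"
proof -
 show "set_borel_measurable lborel UB f"
  using borel_measurable_continuous_on_indicator[OF _ assms] by (simp add: set_borel_measurable_def)
 thus "f \<in> borel_measurable (nu_weighted \<alpha>)" by (rule measurable_nu_weighted)
qed

lemma integral_nu_weighted:
 fixes f :: "real^'n => 'c::euclidean_space"
 assumes f: "set_borel_measurable lborel UB f"
 shows "integrable (nu_weighted \<alpha>) f \<longleftrightarrow> set_integrable lborel UB (%x. (dl x) powr \<alpha> *\<^sub>R f x)"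
  and "(\<integral>x. f x \<partial>nu_weighted \<alpha>) = nu_const TYPE('n) *\<^sub>R (LBINT x:UB. (dl x) powr \<alpha> *\<^sub>R f x)"
proof -
 let ?w = "%x::real^'n. nu_const TYPE('n) * (dl x) powr \<alpha>"
 have fm: "f \<in> borel_measurable (lebesgue_on UB)"
  using measurable_nu_weighted[OF f, of \<alpha>] measurable_cong_sets[OF sets_nu_weighted refl] by blast
 have w: "?w \<in> borel_measurable (lebesgue_on UB)"
  by (intro measurable_restrict_space1 measurable_completion) measurable
 have nn: "AE x in lebesgue_on UB. 0 <= ?w x" using less_imp_le[OF nu_const_pos[where 'n='n]] by simp
 have eq: "(%x. indicator UB x *\<^sub>R (?w x *\<^sub>R f x)) = (%x. nu_const TYPE('n) *\<^sub>R (indicator UB x *\<^sub>R ((dl x) powr \<alpha> *\<^sub>R f x)))"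
  by (auto simp: fun_eq_iff)
 have bm: "(%x. indicator UB x *\<^sub>R ((dl x) powr \<alpha> *\<^sub>R f x)) \<in> borel_measurable lborel"
 proof -
  have "(%x. (dl x) powr \<alpha> *\<^sub>R (indicator UB x *\<^sub>R f x)) \<in> borel_measurable lborel"
   using f unfolding set_borel_measurable_def by measurable
  thus ?thesis by (simp add: mult.commute)
 qed
 have bm': "(%x. indicator UB x *\<^sub>R (?w x *\<^sub>R f x)) \<in> borel_measurable lborel"
  unfolding eq by (rule borel_measurable_scaleR[OF borel_measurable_const bm])
 have nz: "nu_const TYPE('n) \<noteq> 0" using nu_const_pos[where 'n='n] by simp
 have "integrable (nu_weighted \<alpha>) f \<longleftrightarrow> integrable lborel (%x. indicator UB x *\<^sub>R (?w x *\<^sub>R f x))"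
  unfolding nu_weighted_density integrable_density[OF fm w nn]
  by (subst integrable_restrict_space) (simp, rule integrable_completion[OF bm'])
 also have "... \<longleftrightarrow> set_integrable lborel UB (%x. (dl x) powr \<alpha> *\<^sub>R f x)"
  unfolding eq set_integrable_def
 proof
  let ?h = "%x. indicator UB x *\<^sub>R ((dl x) powr \<alpha> *\<^sub>R f x)"
  assume "integrable lborel (%x. nu_const TYPE('n) *\<^sub>R ?h x)"
  from integrable_scaleR_right[OF this, of "1 / nu_const TYPE('n)"] nz show "integrable lborel ?h" by simp
 qed (rule integrable_scaleR_right)
 finally show "integrable (nu_weighted \<alpha>) f \<longleftrightarrow> set_integrable lborel UB (%x. (dl x) powr \<alpha> *\<^sub>R f x)" .
 show "(\<integral>x. f x \<partial>nu_weighted \<alpha>) = nu_const TYPE('n) *\<^sub>R (LBINT x:UB. (dl x) powr \<alpha> *\<^sub>R f x)"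
 proof -
  have "(\<integral>x. f x \<partial>nu_weighted \<alpha>) = (\<integral>x. ?w x *\<^sub>R f x \<partial>lebesgue_on UB)"
   unfolding nu_weighted_density by (rule integral_density[OF fm w nn])
  also have "... = (\<integral>x. indicator UB x *\<^sub>R (?w x *\<^sub>R f x) \<partial>lebesgue)"
   by (rule integral_restrict_space) simp
  also have "... = (\<integral>x. indicator UB x *\<^sub>R (?w x *\<^sub>R f x) \<partial>lborel)"
   by (rule integral_completion[OF bm'])
  also have "... = nu_const TYPE('n) *\<^sub>R (LBINT x:UB. (dl x) powr \<alpha> *\<^sub>R f x)"
   unfolding eq set_lebesgue_integral_def by (rule integral_scaleR_right)
  finally show ?thesis .
 qed
qed

section \<open>Radial cutoffs and integrability of the weights\<close>

definition cutoff :: "real => real => real" where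
 "cutoff \<epsilon> t = (if t < 1 then (max 0 (1 - \<epsilon> / (1 - t)))^2 else 0)"

definition cutoff' :: "real => real => real" where
 "cutoff' \<epsilon> t = - 2 * max 0 (1 - \<epsilon> / (1 - t)) * (\<epsilon> / (1 - t)^2)"

lemma cutoff_bounds: "0 < \<epsilon> ==> 0 <= cutoff \<epsilon> t" "0 < \<epsilon> ==> cutoff \<epsilon> t <= 1"
proof -
 assume e: "0 < \<epsilon>"
 show "0 <= cutoff \<epsilon> t" by (simp add: cutoff_def)
 have "max 0 (1 - \<epsilon> / (1 - t)) <= 1" if "t < 1" using that e by simp
 thus "cutoff \<epsilon> t <= 1" by (auto simp: cutoff_def power_le_one)
qed

lemma cutoff_zero:
 assumes "0 < \<epsilon>" "1 - \<epsilon> <= t" shows "cutoff \<epsilon> t = 0" "t < 1 ==> cutoff' \<epsilon> t = 0"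
proof -
 have "1 - \<epsilon> / (1 - t) <= 0" if "t < 1" using that assms by (simp add: divide_simps)
 thus "cutoff \<epsilon> t = 0" "t < 1 ==> cutoff' \<epsilon> t = 0" by (simp_all add: cutoff_def cutoff'_def)
qed

text \<open>\<open>max 0 (1 - \<epsilon> / (1 - t))\<close> vanishes unless \<epsilon> < 1 - t.
  Cutting off at the scale 1 - t makes (1 - t) |cutoff'| at most 2 for all \<epsilon>, a dominating
  bound; the sign serves to discard a term in \<open>weight_integrable\<close>.\<close>

lemma cutoff'_bounds:
 assumes "0 < \<epsilon>" "t < 1" shows "cutoff' \<epsilon> t <= 0" "- 2 / (1 - t) <= cutoff' \<epsilon> t"
proof -
 define m where "m = max 0 (1 - \<epsilon> / (1 - t))"
 have m: "0 <= m" by (simp add: m_def)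
 show "cutoff' \<epsilon> t <= 0" using assms m by (simp add: cutoff'_def m_def[symmetric])
 have "m * (\<epsilon> / (1 - t)) <= 1"
 proof (cases "\<epsilon> / (1 - t) <= 1")
  case True
  moreover have "m <= 1" using assms by (simp add: m_def)
  ultimately show ?thesis using m assms by (intro mult_le_one) auto
 next
  case False thus ?thesis by (simp add: m_def)
 qed
 hence "m * (\<epsilon> / (1 - t)) * (2 / (1 - t)) <= 1 * (2 / (1 - t))"
  using assms by (intro mult_right_mono) auto
 thus "- 2 / (1 - t) <= cutoff' \<epsilon> t"
  by (simp add: cutoff'_def m_def[symmetric] power2_eq_square mult_ac)
qed

lemma DERIV_cutoff:
 assumes "t < 1" shows "(cutoff \<epsilon> has_real_derivative cutoff' \<epsilon> t) (at t)"
proof -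
 have "((%t. 1 - \<epsilon> / (1 - t)) has_real_derivative - (\<epsilon> / (1 - t)^2)) (at t)"
  using assms by (auto intro!: derivative_eq_intros simp: power2_eq_square)
 from DERIV_chain2[OF DERIV_max_power[of 0] this]
 have "((%t. (max 0 (1 - \<epsilon> / (1 - t)))^2) has_real_derivative cutoff' \<epsilon> t) (at t)"
  by (simp add: cutoff'_def power2_eq_square)
 thus ?thesis
  by (rule has_field_derivative_transform_within_open[of _ _ _ "{..<1}"]) (use assms in \<open>auto simp: cutoff_def\<close>)
qed

lemma cutoff_tendsto:
 assumes "t < 1"
 shows "(%j. cutoff (1 / real (Suc j)) t) \<longlonglongrightarrow> 1" "(%j. cutoff' (1 / real (Suc j)) t) \<longlonglongrightarrow> 0"
proof -
 have 0: "(%j. 1 / real (Suc j)) \<longlonglongrightarrow> 0" using LIMSEQ_inverse_real_of_nat by (simp add: inverse_eq_divide)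
 have "(%j. (max 0 (1 - (1 / real (Suc j)) / (1 - t)))^2) \<longlonglongrightarrow> (max 0 (1 - 0 / (1 - t)))^2"
  using assms by (intro tendsto_intros 0) auto
 thus "(%j. cutoff (1 / real (Suc j)) t) \<longlonglongrightarrow> 1" using assms by (simp add: cutoff_def)
 have "(%j. - 2 * max 0 (1 - (1 / real (Suc j)) / (1 - t)) * ((1 / real (Suc j)) / (1 - t)^2)) \<longlonglongrightarrow> - 2 * max 0 (1 - 0 / (1 - t)) * (0 / (1 - t)^2)"
  using assms by (intro tendsto_intros 0) auto
 thus "(%j. cutoff' (1 / real (Suc j)) t) \<longlonglongrightarrow> 0" by (simp add: cutoff'_def)
qed

text \<open>The exponent is \<beta> + 1 because differentiation in t gives back the weight (1 -
  t)^\<beta>. The value 0 for t >= 1 makes it continuous on the whole line, as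
  \<open>radial_derivative_symmetric\<close> requires of its weight.\<close>

definition cw :: "real => real => real => real" where
 "cw \<beta> \<epsilon> t = (if t < 1 then (1 - t) powr (\<beta> + 1) * cutoff \<epsilon> t else 0)"

definition cw' :: "real => real => real => real" where
 "cw' \<beta> \<epsilon> t = (1 - t) powr (\<beta> + 1) * cutoff' \<epsilon> t - (\<beta> + 1) * (1 - t) powr \<beta> * cutoff \<epsilon> t"

lemma DERIV_cw: "t < 1 ==> (cw \<beta> \<epsilon> has_real_derivative cw' \<beta> \<epsilon> t) (at t)"
proof -
 assume t: "t < 1"
 have "((%t. (1 - t) powr (\<beta> + 1)) has_real_derivative - ((\<beta> + 1) * (1 - t) powr \<beta>)) (at t)"
  using t by (auto intro!: derivative_eq_intros)
 from DERIV_mult[OF this DERIV_cutoff[OF t]]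
 have "((%t. (1 - t) powr (\<beta> + 1) * cutoff \<epsilon> t) has_real_derivative cw' \<beta> \<epsilon> t) (at t)"
  by (simp add: cw'_def algebra_simps)
 thus ?thesis
  by (rule has_field_derivative_transform_within_open[of _ _ _ "{..<1}"]) (use t in \<open>auto simp: cw_def\<close>)
qed

lemma cw_zero: "0 < \<epsilon> ==> 1 - \<epsilon> <= t ==> cw \<beta> \<epsilon> t = 0"
 by (simp add: cw_def cutoff_zero)

lemma continuous_on_cw:
 assumes e: "0 < \<epsilon>" shows "continuous_on UNIV (cw \<beta> \<epsilon>)"
proof -
 have "continuous_on {..<1} (cw \<beta> \<epsilon>)"
  using DERIV_cw by (intro continuous_at_imp_continuous_on ballI) (auto intro: DERIV_isCont)
 moreover have "continuous_on {1 - \<epsilon><..} (cw \<beta> \<epsilon>)"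
  by (rule continuous_on_eq[OF continuous_on_const[of _ 0]]) (use e in \<open>auto simp: cw_zero\<close>)
 ultimately have "continuous_on ({..<1} \<union> {1 - \<epsilon><..}) (cw \<beta> \<epsilon>)"
  by (intro continuous_on_open_Un) auto
 moreover have "{..<1} \<union> {1 - \<epsilon><..} = UNIV" using e by auto
 ultimately show ?thesis by simp
qed

lemma continuous_on_cutoff':
 "continuous_on {..<1} (cutoff' \<epsilon>)"
 unfolding cutoff'_def[abs_def] by (intro continuous_intros) auto

lemma continuous_on_cw': "continuous_on {..<1} (cw' \<beta> \<epsilon>)"
proof -
 have "continuous_on {..<1} (cutoff \<epsilon>)"
  using DERIV_cutoff by (intro continuous_at_imp_continuous_on ballI) (auto intro: DERIV_isCont)
 thus ?thesis
  unfolding cw'_def[abs_def] by (intro continuous_intros continuous_on_cutoff') auto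
qed

lemma cutoff_support:
 assumes "0 < \<epsilon>" "z \<in> (UB :: (real^'n) set) - cball 0 (sqrt (max 0 (1 - \<epsilon>)))"
 shows "1 - \<epsilon> <= (norm z)^2"
proof -
 have "sqrt (max 0 (1 - \<epsilon>)) <= norm z" using assms by simp
 thus ?thesis using sqrt_le_D by fastforce
qed

lemma cutoff_cball:
 assumes "0 < \<epsilon>"
 shows "compact (cball 0 (sqrt (max 0 (1 - \<epsilon>))) :: (real^'n) set)" "cball 0 (sqrt (max 0 (1 - \<epsilon>))) \<subseteq> (UB :: (real^'n) set)"
proof -
 have "sqrt (max 0 (1 - \<epsilon>)) < 1" using assms by simp
 thus "cball 0 (sqrt (max 0 (1 - \<epsilon>))) \<subseteq> (UB :: (real^'n) set)"
  by (auto simp del: real_sqrt_lt_1_iff)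
qed auto

text \<open>The divergence theorem for \<open>x F(x) W(|x|\<^sup>2)\<close>, where \<open>W = cw \<beta> \<epsilon>\<close>.\<close>

lemma integral_radial_field:
 fixes F :: "real^'n => complex"
 assumes F: "has_partials F F1 UB" and e: "0 < \<epsilon>"
 shows "set_integrable lborel UB (%z. of_real (cw \<beta> \<epsilon> ((norm z)^2)) * (\<Sum>i\<in>UNIV. of_real (z$i) * F1 i z))"
  and "(LBINT z:UB. of_real (cw \<beta> \<epsilon> ((norm z)^2)) * (\<Sum>i\<in>UNIV. of_real (z$i) * F1 i z))
   = - (LBINT z:UB. of_real (real CARD('n) * cw \<beta> \<epsilon> ((norm z)^2) + 2 * (norm z)^2 * cw' \<beta> \<epsilon> ((norm z)^2)) * F z)"
proof -
 let ?W = "%z::real^'n. complex_of_real (cw \<beta> \<epsilon> ((norm (z - 0))^2))"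
 let ?W1 = "%i z::real^'n. complex_of_real ((2 * (z - 0)$i) *\<^sub>R cw' \<beta> \<epsilon> ((norm (z - 0))^2))"
 have hW: "has_partials ?W ?W1 UB"
 proof (intro has_partials_bounded_linear[OF bounded_linear_of_real] has_partials_compose_real[OF has_partials_norm_sq])
  show "(cw \<beta> \<epsilon> has_vector_derivative cw' \<beta> \<epsilon> ((norm (x - 0))^2)) (at ((norm (x - 0))^2))" if "x \<in> UB" for x :: "real^'n"
   using DERIV_cw[of "(norm x)^2"] norm_sq_less_1[OF that] by (simp add: has_real_derivative_iff_has_vector_derivative)
  show "continuous_on ((%x::real^'n. (norm (x - 0))^2) ` UB) (cw' \<beta> \<epsilon>)"
   by (rule continuous_on_subset[OF continuous_on_cw']) (use norm_sq_less_1 in auto)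
 qed
 let ?x = "%i z::real^'n. complex_of_real (z$i)" and ?x1 = "%i j z::real^'n. complex_of_real (if j = i then 1 else 0)"
 have hx: "has_partials (?x i) (?x1 i) UB" for i
  by (rule has_partials_bounded_linear[OF bounded_linear_of_real has_partials_nth])
 note hu = has_partials_mult[OF hx has_partials_mult[OF F hW]]
 note K = cutoff_cball[OF e, where 'n='n]
 have z0: "cw \<beta> \<epsilon> ((norm z)^2) = 0" if "z \<in> UB - cball 0 (sqrt (max 0 (1 - \<epsilon>)))" for z :: "real^'n"
  by (rule cw_zero[OF e cutoff_support[OF e that]])
 have z1: "cw' \<beta> \<epsilon> ((norm z)^2) = 0" if "z \<in> UB - cball 0 (sqrt (max 0 (1 - \<epsilon>)))" for z :: "real^'n"
  using cutoff_zero[OF e cutoff_support[OF e that]] norm_sq_less_1[of z] that by (simp add: cw'_def)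
 have cF: "continuous_on UB F" by (rule has_partials_continuous[OF F])
 have cW: "continuous_on UB (%z::real^'n. cw \<beta> \<epsilon> ((norm z)^2))"
  by (rule continuous_on_compose2[OF continuous_on_cw[OF e]]) (auto intro!: continuous_intros)
 have cW': "continuous_on UB (%z::real^'n. cw' \<beta> \<epsilon> ((norm z)^2))"
  by (rule continuous_on_compose2[OF continuous_on_cw']) (use norm_sq_less_1 in \<open>auto intro!: continuous_intros\<close>)
 let ?A = "%z. of_real (cw \<beta> \<epsilon> ((norm z)^2)) * (\<Sum>i\<in>UNIV. of_real (z$i) * F1 i z)"
 let ?B = "%z. of_real (real CARD('n) * cw \<beta> \<epsilon> ((norm z)^2) + 2 * (norm z)^2 * cw' \<beta> \<epsilon> ((norm z)^2)) * F z"
 show iA: "set_integrable lborel UB ?A"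
  by (rule integrable_compact_support[OF open_ball K])
   (use z0 in \<open>auto intro!: continuous_intros continuous_on_of_real cW has_partialsD(2)[OF F]\<close>)
 have iB: "set_integrable lborel UB ?B"
  by (rule integrable_compact_support[OF open_ball K])
   (use z0 z1 in \<open>auto intro!: continuous_intros continuous_on_of_real cW cW' cF\<close>)
 have "(LBINT z:UB. (\<Sum>i\<in>UNIV. ?x i z * (F z * ?W1 i z + F1 i z * ?W z) + ?x1 i i z * (F z * ?W z))) = 0"
  by (rule integral_divergence_eq_0(2)[OF hu K]) (use z0 in auto)
 also have "(LBINT z:UB. (\<Sum>i\<in>UNIV. ?x i z * (F z * ?W1 i z + F1 i z * ?W z) + ?x1 i i z * (F z * ?W z))) = (LBINT z:UB. ?A z + ?B z)"
 proof (rule set_lebesgue_integral_cong, simp, intro allI impI)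
  fix z :: "real^'n"
  have n2: "(norm z)^2 = (\<Sum>i\<in>UNIV. z$i * z$i)" by (simp add: power2_norm_eq_inner inner_vec_def)
  have "(\<Sum>i\<in>UNIV. ?x i z * (F z * ?W1 i z + F1 i z * ?W z) + ?x1 i i z * (F z * ?W z))
   = (\<Sum>i\<in>UNIV. (2 * of_real (cw' \<beta> \<epsilon> ((norm z)^2)) * F z) * of_real (z$i * z$i) + of_real (cw \<beta> \<epsilon> ((norm z)^2)) * (of_real (z$i) * F1 i z) + F z * ?W z)"
   by (rule sum.cong) (simp_all add: algebra_simps)
  also have "... = (2 * of_real (cw' \<beta> \<epsilon> ((norm z)^2)) * F z) * of_real ((norm z)^2) + ?A z + of_nat CARD('n) * (F z * ?W z)"
   unfolding n2 of_real_sum by (simp only: sum.distrib sum_distrib_left[symmetric] sum_constant) (simp only: ac_simps)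
  finally show "(\<Sum>i\<in>UNIV. ?x i z * (F z * ?W1 i z + F1 i z * ?W z) + ?x1 i i z * (F z * ?W z)) = ?A z + ?B z"
   by (simp add: algebra_simps)
 qed
 also have "... = (LBINT z:UB. ?A z) + (LBINT z:UB. ?B z)" by (rule set_integral_add(2)[OF iA iB])
 finally show "(LBINT z:UB. ?A z) = - (LBINT z:UB. ?B z)" by (simp add: eq_neg_iff_add_eq_0)
qed

lemma Fatou_real:
 fixes f :: "nat => 'a => real"
 assumes f: "!!j. integrable M (f j)" and nn: "!!j x. x \<in> space M ==> 0 <= f j x"
  and lim: "!!x. x \<in> space M ==> (%j. f j x) \<longlonglongrightarrow> u x"
  and C: "!!j. (\<integral>x. f j x \<partial>M) <= C" and u: "u \<in> borel_measurable M"
 shows "integrable M u" "(\<integral>x. u x \<partial>M) <= C"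
proof -
 have unn: "0 <= u x" if "x \<in> space M" for x
  by (rule LIMSEQ_le_const[OF lim[OF that]]) (use nn that in auto)
 have C0: "0 <= C" using C[of 0] nn by (meson Bochner_Integration.integral_nonneg order_trans)
 have "(\<integral>\<^sup>+x. ennreal (u x) \<partial>M) = (\<integral>\<^sup>+x. liminf (%j. ennreal (f j x)) \<partial>M)"
 proof (rule nn_integral_cong)
  fix x assume "x \<in> space M"
  hence "(%j. ennreal (f j x)) \<longlonglongrightarrow> ennreal (u x)" using lim by (intro tendsto_ennrealI)
  thus "ennreal (u x) = liminf (%j. ennreal (f j x))"
   using lim_imp_Liminf trivial_limit_sequentially by metis
 qed
 also have "... <= liminf (%j. \<integral>\<^sup>+x. ennreal (f j x) \<partial>M)"
  using f by (intro nn_integral_liminf) auto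
 also have "... = liminf (%j. ennreal (\<integral>x. f j x \<partial>M))"
  by (rule arg_cong[where f=liminf]) (auto simp: fun_eq_iff nn intro!: nn_integral_eq_integral f AE_I2)
 also have "... <= limsup (%j. ennreal (\<integral>x. f j x \<partial>M))"
  by (rule Liminf_le_Limsup) simp
 also have "... <= ennreal C"
  by (rule Limsup_bounded) (auto intro!: always_eventually ennreal_leI C)
 finally have le: "(\<integral>\<^sup>+x. ennreal (u x) \<partial>M) <= ennreal C" .
 have "(\<integral>\<^sup>+x. ennreal (norm (u x)) \<partial>M) = (\<integral>\<^sup>+x. ennreal (u x) \<partial>M)"
  by (rule nn_integral_cong) (simp add: unn)
 thus "integrable M u"
  using le u by (intro integrableI_bounded) (auto intro: le_less_trans)
 show "(\<integral>x. u x \<partial>M) <= C" by (rule integral_real_bounded[OF C0 le])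
qed

lemma continuous_set_measurable:
 fixes f :: "real^'n => 'c::euclidean_space"
 shows "continuous_on UB f ==> set_borel_measurable lborel UB f"
 by (rule continuous_measurable(1))

lemma continuous_on_weight_powr: "continuous_on UB (%z::real^'n. (dl z) powr \<beta>)"
 by (intro continuous_intros) (auto simp: power2_eq_1_iff)

text \<open>Taking \<open>F = 1\<close> in \<open>integral_radial_field\<close> bounds the integrals of \<open>(1 - |x|\<^sup>2)\<^sup>\<beta>\<close> without
 polar coordinates.\<close>

lemma weight_integrable:
 assumes \<beta>: "-1 < \<beta>"
 shows "set_integrable lborel UB (%z::real^'n. (dl z) powr \<beta>)"
proof -
 define u where "u z = (norm z)^2 * (dl z) powr \<beta>" for z :: "real^'n"
 define e where "e j = 1 / real (Suc j)" for j
 have e: "0 < e j" for j by (simp add: e_def)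
 define V where "V = measure lborel (UB :: (real^'n) set)"
 let ?c = "%j z::real^'n. cutoff (e j) ((norm z)^2)"
 have cc: "continuous_on UB (%z::real^'n. cutoff (e j) ((norm z)^2))" for j
 proof -
  have "continuous_on {..<1} (cutoff (e j))"
   using DERIV_cutoff by (intro continuous_at_imp_continuous_on ballI) (auto intro: DERIV_isCont)
  thus ?thesis
   by (rule continuous_on_compose2) (use norm_sq_less_1 in \<open>auto intro!: continuous_intros\<close>)
 qed
 have cu: "continuous_on UB u" unfolding u_def[abs_def] by (intro continuous_intros continuous_on_weight_powr)
 have iu: "set_integrable lborel UB (%z. ?c j z * u z)" for j
  by (rule integrable_compact_support[OF open_ball cutoff_cball[OF e[of j]]])
   (use cutoff_zero(1)[OF e cutoff_support[OF e]] in \<open>auto intro!: continuous_intros cc cu\<close>)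
 have iw: "set_integrable lborel UB (%z::real^'n. cw \<beta> (e j) ((norm z)^2))" for j
  by (rule integrable_compact_support[OF open_ball cutoff_cball[OF e[of j]]])
   (use cw_zero[OF e cutoff_support[OF e]] in \<open>auto intro!: continuous_on_compose2[OF continuous_on_cw[OF e]] continuous_intros\<close>)
 have i1: "set_integrable lborel UB (%z::real^'n. 1::real)"
  unfolding set_integrable_def using emeasure_bounded_finite[OF bounded_ball, of "0::real^'n" 1] by simp
 have bound: "(LBINT z:UB. ?c j z * u z) <= real CARD('n) * V / (2 * (\<beta> + 1))" for j
 proof -
  define d where "d z = 2 * (norm z)^2 * (dl z) powr (\<beta> + 1) * cutoff' (e j) ((norm z)^2)" for z :: "real^'n"
  have cd: "continuous_on UB d" unfolding d_def[abs_def]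
   by (intro continuous_intros continuous_on_weight_powr continuous_on_compose2[OF continuous_on_cutoff'])
    (use norm_sq_less_1 in auto)
  have id: "set_integrable lborel UB d"
   by (rule integrable_compact_support[OF open_ball cutoff_cball[OF e[of j]] cd])
    (use cutoff_zero(2)[OF e cutoff_support[OF e]] norm_sq_less_1 in \<open>auto simp: d_def\<close>)
  have "complex_of_real 0 = - (LBINT z:UB. of_real (real CARD('n) * cw \<beta> (e j) ((norm (z::real^'n))^2) + 2 * (norm z)^2 * cw' \<beta> (e j) ((norm z)^2)) * 1)"
   using integral_radial_field(2)[OF has_partials_const[of 1] e, of \<beta> j] by (simp add: set_lebesgue_integral_def)
  hence "complex_of_real (LBINT z:UB. real CARD('n) * cw \<beta> (e j) ((norm (z::real^'n))^2) + 2 * (norm z)^2 * cw' \<beta> (e j) ((norm z)^2)) = 0"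
   unfolding mult_1_right set_integral_complex_of_real by simp
  hence "0 = (LBINT z:UB. real CARD('n) * cw \<beta> (e j) ((norm (z::real^'n))^2) + 2 * (norm z)^2 * cw' \<beta> (e j) ((norm z)^2))" by simp
  also have "... = (LBINT z:UB. real CARD('n) * cw \<beta> (e j) ((norm z)^2) + (d z - (2 * (\<beta> + 1)) * (?c j z * u z)))"
   by (rule set_lebesgue_integral_cong) (auto simp: cw'_def d_def u_def algebra_simps)
  also have "... = real CARD('n) * (LBINT z:UB. cw \<beta> (e j) ((norm (z::real^'n))^2)) + ((LBINT z:UB. d z) - (2 * (\<beta> + 1)) * (LBINT z:UB. ?c j z * u z))"
  proof -
   have "set_integrable lborel UB (%z. (2 * (\<beta> + 1)) * (?c j z * u z))"
    "set_integrable lborel UB (%z::real^'n. real CARD('n) * cw \<beta> (e j) ((norm z)^2))"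
    using iu iw by (intro set_integrable_mult_right; simp)+
   thus ?thesis
    by (simp only: set_integral_add(2) set_integral_diff id set_integral_mult_right)
  qed
  finally have "(2 * (\<beta> + 1)) * (LBINT z:UB. ?c j z * u z) = real CARD('n) * (LBINT z:UB. cw \<beta> (e j) ((norm (z::real^'n))^2)) + (LBINT z:UB. d z)" by simp
  also have "(LBINT z:UB. d z) <= (LBINT z:(UB::(real^'n) set). 0)"
  proof (rule set_integral_mono[OF id])
   fix z :: "real^'n" assume z: "z \<in> UB"
   show "d z <= 0" using cutoff'_bounds(1)[OF e norm_sq_less_1[OF z], of j] by (simp add: d_def mult_nonneg_nonpos)
  qed (simp add: set_integrable_def)
  also have "(LBINT z:UB. cw \<beta> (e j) ((norm (z::real^'n))^2)) <= (LBINT z:(UB::(real^'n) set). 1)"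
  proof (rule set_integral_mono[OF iw i1])
   fix z :: "real^'n" assume z: "z \<in> UB"
   have "(dl z) powr (\<beta> + 1) <= 1 powr (\<beta> + 1)"
    using dl_pos[OF z] \<beta> by (intro powr_mono2) auto
   thus "cw \<beta> (e j) ((norm z)^2) <= 1"
    using cutoff_bounds[OF e[of j], of "(norm z)^2"] by (auto simp: cw_def intro!: mult_le_one)
  qed
  also have "(LBINT z:(UB::(real^'n) set). 1) = V" by (simp add: V_def set_lebesgue_integral_def)
  finally show ?thesis using \<beta> by (simp add: field_simps set_lebesgue_integral_def)
 qed
 have Iu: "set_integrable lborel UB u"
  unfolding set_integrable_def
 proof (rule Fatou_real(1)[where C = "real CARD('n) * V / (2 * (\<beta> + 1))" and f = "%j z. indicator UB z *\<^sub>R (?c j z * u z)"])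
  show "integrable lborel (%z. indicator UB z *\<^sub>R (?c j z * u z))" for j
   using iu[of j] unfolding set_integrable_def .
  show "0 <= indicator UB z *\<^sub>R (?c j z * u z)" for j and z :: "real^'n"
   using cutoff_bounds(1)[OF e[of j]] by (simp add: u_def)
  show "(LBINT z. indicator UB z *\<^sub>R (?c j z * u z)) <= real CARD('n) * V / (2 * (\<beta> + 1))" for j
   using bound[of j] unfolding set_lebesgue_integral_def .
  show "(%z. indicator UB z *\<^sub>R u z) \<in> borel_measurable lborel"
   using continuous_set_measurable[OF cu] unfolding set_borel_measurable_def .
  fix z :: "real^'n"
  show "(%j. indicator UB z *\<^sub>R (?c j z * u z)) \<longlonglongrightarrow> indicator UB z *\<^sub>R u z"
  proof (cases "z \<in> UB")
   case True
   have "(%j. ?c j z * u z) \<longlonglongrightarrow> 1 * u z"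
    unfolding e_def by (intro tendsto_intros cutoff_tendsto(1) norm_sq_less_1[OF True])
   thus ?thesis using True by simp
  qed simp
 qed
 \<comment> \<open>The factor |z|^2 in \<open>u\<close> costs something only near the origin: u is
   at least half the weight where 1 - |z|^2 <= 1/2, and elsewhere the weight is at most
   2^|\<beta>|.\<close>
 have "set_integrable lborel UB (%z. 2 powr \<bar>\<beta>\<bar> + 2 * u z)"
  using i1 Iu by (intro set_integral_add(1) set_integrable_mult_right) (simp_all add: set_integrable_def)
 thus ?thesis
 proof (rule set_integrable_bound)
  show "set_borel_measurable lborel UB (%z::real^'n. (dl z) powr \<beta>)"
   by (rule continuous_set_measurable[OF continuous_on_weight_powr])
  show "AE z in lborel. z \<in> UB --> norm ((dl z) powr \<beta>) <= norm (2 powr \<bar>\<beta>\<bar> + 2 * u z)"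
  proof (intro AE_I2 impI)
   fix z :: "real^'n" assume z: "z \<in> UB"
   define b where "b = dl z"
   have b: "0 < b" "b <= 1" using dl_pos[OF z] by (auto simp: b_def)
   have u: "u z = (1 - b) * b powr \<beta>" by (simp add: u_def b_def)
   have "b powr \<beta> <= 2 powr \<bar>\<beta>\<bar> + 2 * u z"
   proof (cases "b <= 1/2")
    case True
    hence "1 * b powr \<beta> <= (2 * (1 - b)) * b powr \<beta>" by (intro mult_right_mono) auto
    hence "b powr \<beta> <= 2 * u z" by (simp add: u algebra_simps)
    thus ?thesis using powr_ge_zero[of 2 "\<bar>\<beta>\<bar>"] by linarith
   next
    case False
    have "b powr \<beta> <= 2 powr \<bar>\<beta>\<bar>"
    proof (cases "\<beta> \<ge> 0")
     case True
     hence "b powr \<beta> <= 1" using powr_mono2[of \<beta> b 1] b by simp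
     also have "1 <= 2 powr \<bar>\<beta>\<bar>" by (simp add: ge_one_powr_ge_zero)
     finally show ?thesis .
    next
     case b': False
     have "b powr \<beta> <= (1/2) powr \<beta>" using False b' by (intro powr_mono2') auto
     also have "(1/2::real) powr \<beta> = 2 powr \<bar>\<beta>\<bar>" using b' by (simp add: powr_divide powr_minus_divide[of 2 "\<beta>", symmetric])
     finally show ?thesis .
    qed
    moreover have "0 <= u z" using b by (simp add: u)
    ultimately show ?thesis by simp
   qed
   thus "norm ((dl z) powr \<beta>) <= norm (2 powr \<bar>\<beta>\<bar> + 2 * u z)" by (simp add: b_def)
  qed
 qed
qed

section \<open>Weighted Bergman spaces\<close>

lemma h_harmonic_add:
 fixes f g :: "real^'n => complex"
 assumes "f \<in> h_harmonic" "g \<in> h_harmonic" shows "(%x. f x + g x) \<in> h_harmonic"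
proof (rule h_harmonicI[OF has_partials_add[OF assms[THEN h_harmonicD(1)]] has_partials_add[OF assms[THEN h_harmonicD(2)]]])
 fix x :: "real^'n" assume x: "x \<in> UB"
 show "of_real ((dl x)^2) * (\<Sum>i\<in>UNIV. pderivative i (pderivative i f) x + pderivative i (pderivative i g) x)
   + of_real (2 * (real CARD('n) - 2) * (dl x)) * (\<Sum>i\<in>UNIV. of_real (x $ i) * (pderivative i f x + pderivative i g x)) = 0"
  using arg_cong2[OF assms(1)[THEN h_harmonicD(3), OF x] assms(2)[THEN h_harmonicD(3), OF x], of "(+)"]
  by (simp add: sum.distrib distrib_left) (simp only: ac_simps)
qed

lemma h_harmonic_cmult:
 fixes f :: "real^'n => complex"
 assumes "f \<in> h_harmonic" shows "(%x. c * f x) \<in> h_harmonic"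
proof (rule h_harmonicI[OF has_partials_cmult[OF assms[THEN h_harmonicD(1)]] has_partials_cmult[OF assms[THEN h_harmonicD(2)]]])
 fix x :: "real^'n" assume x: "x \<in> UB"
 have "of_real ((dl x)^2) * (\<Sum>i\<in>UNIV. c * pderivative i (pderivative i f) x)
   + of_real (2 * (real CARD('n) - 2) * (dl x)) * (\<Sum>i\<in>UNIV. of_real (x $ i) * (c * pderivative i f x))
   = c * (of_real ((dl x)^2) * (\<Sum>i\<in>UNIV. pderivative i (pderivative i f) x)
   + of_real (2 * (real CARD('n) - 2) * (dl x)) * (\<Sum>i\<in>UNIV. of_real (x $ i) * pderivative i f x))"
  by (simp only: sum_distrib_left distrib_left) (simp only: ac_simps)
 thus "of_real ((dl x)^2) * (\<Sum>i\<in>UNIV. c * pderivative i (pderivative i f) x)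
   + of_real (2 * (real CARD('n) - 2) * (dl x)) * (\<Sum>i\<in>UNIV. of_real (x $ i) * (c * pderivative i f x)) = 0"
  by (simp only: h_harmonicD(3)[OF assms x] mult_zero_right)
qed

lemma h_harmonic_diff:
 "f \<in> h_harmonic ==> g \<in> h_harmonic ==> (%x. f x - g x) \<in> h_harmonic"
 using h_harmonic_add[of f "%x. (-1) * g x"] h_harmonic_cmult[of g "-1"] by simp

lemma h_harmonic_cnj:
 fixes f :: "real^'n => complex"
 assumes "f \<in> h_harmonic" shows "(%x. cnj (f x)) \<in> h_harmonic"
proof (rule h_harmonicI[OF has_partials_bounded_linear[OF bounded_linear_cnj assms[THEN h_harmonicD(1)]]
   has_partials_bounded_linear[OF bounded_linear_cnj assms[THEN h_harmonicD(2)]]])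
 fix x :: "real^'n" assume x: "x \<in> UB"
 show "of_real ((dl x)^2) * (\<Sum>i\<in>UNIV. cnj (pderivative i (pderivative i f) x))
   + of_real (2 * (real CARD('n) - 2) * (dl x)) * (\<Sum>i\<in>UNIV. of_real (x $ i) * cnj (pderivative i f x)) = 0"
  using arg_cong[OF assms(1)[THEN h_harmonicD(3), OF x], of cnj] by simp
qed

lemma h_harmonic_cong:
 assumes "f \<in> h_harmonic" "!!x. x \<in> UB ==> f x = g x" shows "g \<in> h_harmonic"
proof -
 have 1: "has_partials g (%i. pderivative i f) UB"
  by (rule has_partials_cong[OF h_harmonicD(1)[OF assms(1)] open_ball]) (auto simp: assms(2))
 show ?thesis by (rule h_harmonicI[OF 1 h_harmonicD(2)[OF assms(1)]]) (rule h_harmonicD(3)[OF assms(1)])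
qed

lemma has_partials_sum:
 fixes f :: "'a => real^'n => 'c::real_normed_vector"
 assumes "!!k. k \<in> A ==> has_partials (f k) (f1 k) S"
 shows "has_partials (%x. \<Sum>k\<in>A. f k x) (%i x. \<Sum>k\<in>A. f1 k i x) S"
proof (cases "finite A")
 case True
 thus ?thesis using assms
  by (induction A) (auto intro: has_partials_const has_partials_add)
qed (simp add: has_partials_const)

lemma has_partials_orthogonal:
 fixes f :: "real^'n => 'c::real_normed_vector" and U :: "real^'n => real^'n"
 assumes f: "has_partials f f1 UB" and U: "orthogonal_transformation U"
 shows "has_partials (%x. f (U x)) (%i x. \<Sum>j\<in>UNIV. U (axis i 1) $ j *\<^sub>R f1 j (U x)) UB"
proof (rule has_partialsI)
 have bl: "bounded_linear U" using U orthogonal_transformation_linear linear_conv_bounded_linear by blast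
 have Ub: "U x \<in> UB" if "x \<in> UB" for x using that orthogonal_transformation_norm[OF U] by simp
 fix x :: "real^'n" assume x: "x \<in> UB"
 show "((%x. f (U x)) has_derivative (%v. \<Sum>j\<in>UNIV. U v $ j *\<^sub>R f1 j (U x))) (at x)"
  by (rule has_derivative_compose[OF bounded_linear_imp_has_derivative[OF bl] has_partialsD(1)[OF f Ub[OF x]]])
next
 have cU: "continuous_on A U" for A using U orthogonal_transformation_linear linear_continuous_on linear_conv_bounded_linear by blast
 show "continuous_on UB (%x. \<Sum>j\<in>UNIV. U (axis i 1) $ j *\<^sub>R f1 j (U x))" for i
  by (intro continuous_intros continuous_on_compose2[OF has_partialsD(2)[OF f] cU])
   (auto simp: orthogonal_transformation_norm[OF U])
qed auto

lemma orthogonal_columns: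
 fixes U :: "real^'n => real^'n"
 assumes U: "orthogonal_transformation U"
 shows "(\<Sum>i\<in>UNIV. U (axis i 1) $ j * U (axis i 1) $ k) = (if j = k then 1 else 0)"
proof -
 have "orthogonal_matrix (matrix U)" using U orthogonal_transformation_matrix by blast
 hence "matrix U ** transpose (matrix U) = mat 1" by (simp add: orthogonal_matrix_def)
 hence "(matrix U ** transpose (matrix U)) $ j $ k = (mat 1 :: real^'n^'n) $ j $ k" by simp
 thus ?thesis by (simp add: matrix_matrix_mult_def transpose_def matrix_def mat_def)
qed

lemma linear_component_sum:
 fixes U :: "real^'n => real^'n"
 assumes "linear U" shows "(\<Sum>i\<in>UNIV. x$i * U (axis i 1) $ j) = U x $ j"
proof -
 have "U x = U (\<Sum>i\<in>UNIV. x$i *\<^sub>R axis i 1)"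
  using basis_expansion[of x] by (simp add: scalar_mult_eq_scaleR)
 also have "... = (\<Sum>i\<in>UNIV. x$i *\<^sub>R U (axis i 1))"
  by (simp add: linear_sum[OF assms] linear_cmul[OF assms])
 finally show ?thesis by simp
qed

lemma h_harmonic_orthogonal:
 fixes f :: "real^'n => complex" and U :: "real^'n => real^'n"
 assumes f: "f \<in> h_harmonic" and U: "orthogonal_transformation U"
 shows "(%x. f (U x)) \<in> h_harmonic"
proof -
 let ?u = "%i j. U (axis i 1) $ j"
 have lin: "linear U" using U orthogonal_transformation_linear by blast
 note P1 = has_partials_orthogonal[OF h_harmonicD(1)[OF f] U]
 have P2: "has_partials (%x. \<Sum>j\<in>UNIV. ?u i j *\<^sub>R pderivative j f (U x))
   (%l x. \<Sum>j\<in>UNIV. ?u i j *\<^sub>R (\<Sum>k\<in>UNIV. ?u l k *\<^sub>R pderivative k (pderivative j f) (U x))) UB" for i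
  by (rule has_partials_sum, rule has_partials_bounded_linear[OF bounded_linear_scaleR_right],
    rule has_partials_orthogonal[OF h_harmonicD(2)[OF f] U])
 show ?thesis
 proof (rule h_harmonicI[OF P1 P2])
  fix x :: "real^'n" assume x: "x \<in> UB"
  let ?f2 = "%j k. pderivative k (pderivative j f) (U x)"
  have Ux: "U x \<in> UB" "norm (U x) = norm x" using x orthogonal_transformation_norm[OF U] by auto
  have "(\<Sum>i\<in>UNIV. \<Sum>j\<in>UNIV. ?u i j *\<^sub>R (\<Sum>k\<in>UNIV. ?u i k *\<^sub>R ?f2 j k)) = (\<Sum>i\<in>UNIV. \<Sum>j\<in>UNIV. \<Sum>k\<in>UNIV. (?u i j * ?u i k) *\<^sub>R ?f2 j k)"
   by (simp add: scaleR_sum_right)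
  also have "... = (\<Sum>j\<in>UNIV. \<Sum>k\<in>UNIV. \<Sum>i\<in>UNIV. (?u i j * ?u i k) *\<^sub>R ?f2 j k)"
   by (subst sum.swap, rule sum.cong[OF refl], rule sum.swap)
  also have "... = (\<Sum>j\<in>UNIV. \<Sum>k\<in>UNIV. (if j = k then 1 else 0) *\<^sub>R ?f2 j k)"
   by (simp only: scaleR_sum_left[symmetric] orthogonal_columns[OF U])
  also have "... = (\<Sum>j\<in>UNIV. ?f2 j j)"
   by (rule sum.cong[OF refl]) (simp add: if_distrib[of "%c. c *\<^sub>R _"] cong: if_cong)
  finally have L: "(\<Sum>i\<in>UNIV. \<Sum>j\<in>UNIV. ?u i j *\<^sub>R (\<Sum>k\<in>UNIV. ?u i k *\<^sub>R ?f2 j k)) = (\<Sum>j\<in>UNIV. ?f2 j j)" .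
  have "(\<Sum>i\<in>UNIV. of_real (x$i) * (\<Sum>j\<in>UNIV. ?u i j *\<^sub>R pderivative j f (U x))) = (\<Sum>i\<in>UNIV. \<Sum>j\<in>UNIV. (x$i * ?u i j) *\<^sub>R pderivative j f (U x))"
   by (simp add: sum_distrib_left scaleR_conv_of_real mult.assoc)
  also have "... = (\<Sum>j\<in>UNIV. (\<Sum>i\<in>UNIV. x$i * ?u i j) *\<^sub>R pderivative j f (U x))"
   by (subst sum.swap) (simp add: scaleR_sum_left)
  also have "... = (\<Sum>j\<in>UNIV. of_real (U x $ j) * pderivative j f (U x))"
   by (simp add: linear_component_sum[OF lin] scaleR_conv_of_real)
  finally have E: "(\<Sum>i\<in>UNIV. of_real (x$i) * (\<Sum>j\<in>UNIV. ?u i j *\<^sub>R pderivative j f (U x))) = (\<Sum>j\<in>UNIV. of_real (U x $ j) * pderivative j f (U x))" .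
  show "of_real ((dl x)^2) * (\<Sum>i\<in>UNIV. \<Sum>j\<in>UNIV. ?u i j *\<^sub>R (\<Sum>k\<in>UNIV. ?u i k *\<^sub>R ?f2 j k))
   + of_real (2 * (real CARD('n) - 2) * (dl x)) * (\<Sum>i\<in>UNIV. of_real (x$i) * (\<Sum>j\<in>UNIV. ?u i j *\<^sub>R pderivative j f (U x))) = 0"
   unfolding L E using h_harmonicD(3)[OF f Ux(1)] by (simp only: Ux(2))
 qed
qed

lemma powr_comparable:
 fixes a b :: real
 assumes "0 < a" "0 < b" "a <= 2 * b" "b <= 2 * a"
 shows "a powr \<gamma> <= 2 powr \<bar>\<gamma>\<bar> * b powr \<gamma>"
proof (cases "\<gamma> \<ge> 0")
 case True
 hence "a powr \<gamma> <= (2 * b) powr \<gamma>" using assms by (intro powr_mono2) auto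
 thus ?thesis using True assms by (simp add: powr_mult)
next
 case False
 hence "a powr \<gamma> <= (b / 2) powr \<gamma>" using assms by (intro powr_mono2') auto
 also have "(b / 2) powr \<gamma> = 2 powr \<bar>\<gamma>\<bar> * b powr \<gamma>" using False assms by (simp add: powr_divide powr_minus_divide)
 finally show ?thesis .
qed

lemma exists_bump_bound: "\<exists>C>0. \<forall>t. bump (1/128) t <= C \<and> \<bar>bump1 (1/128) t\<bar> <= C"
proof -
 have "compact (bump (1/128) ` {0..1/128})" "compact (bump1 (1/128) ` {0..1/128})"
  by (intro compact_continuous_image continuous_on_bump compact_Icc)+
 hence "bounded (bump (1/128) ` {0..1/128})" "bounded (bump1 (1/128) ` {0..1/128})"
  using compact_imp_bounded by auto
 then obtain C1 C2 where "\<forall>u\<in>bump (1/128) ` {0..1/128}. norm u <= C1" "\<forall>u\<in>bump1 (1/128) ` {0..1/128}. norm u <= C2"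
  unfolding bounded_iff by blast
 hence C: "\<bar>bump (1/128) t\<bar> <= C1" "\<bar>bump1 (1/128) t\<bar> <= C2" if "t \<in> {0..1/128}" for t
  using that by (simp_all only: ball_simps real_norm_def)
 define C where "C = max 1 (max C1 C2)"
 have "bump (1/128) t <= C \<and> \<bar>bump1 (1/128) t\<bar> <= C" for t
 proof (cases "t \<in> {0..1/128}")
  case True thus ?thesis using C[OF True] by (auto simp: C_def)
 next
  case False thus ?thesis by (auto simp: C_def bump_zero)
 qed
 moreover have "C > 0" by (simp add: C_def)
 ultimately show ?thesis by blast
qed

lemma bump_lipschitz:
 assumes "!!t. \<bar>bump1 (1/128) t\<bar> <= C"
 shows "\<bar>bump (1/128) s - bump (1/128) t\<bar> <= C * \<bar>s - t\<bar>"
 using field_differentiable_bound[of UNIV "bump (1/128)" "bump1 (1/128)" C s t] DERIV_bump assms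
 by (auto simp: has_field_derivative_at_within)

section \<open>The mean value kernel with respect to the weighted measure, and the inner
  product\<close>

locale bergman =
 fixes \<alpha> :: real and N :: "'n::finite itself"
 assumes n: "2 <= CARD('n)" and alpha: "-1 < \<alpha>"
begin

abbreviation wi :: "real^'n => real" where "wi x \<equiv> dl x powr (- real CARD('n) - \<alpha>)"
abbreviation M :: "(real^'n) measure" where "M \<equiv> nu_weighted \<alpha>"
abbreviation B2 :: "(real^'n => complex) set" where "B2 \<equiv> bergman_space \<alpha>"

text \<open>\<open>lk\<close> rewritten as a density with respect to \<open>M\<close>: the measure
  (1 - |z|^2)^(-n) dz is \<open>wi z / nu_const\<close> times dM. So \<open>kd y\<close> is a
  probability density (\<open>kd_mass\<close>).\<close>

definition kd :: "real^'n => real^'n => real" where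
 "kd y z = lk y z * wi z / nu_const TYPE('n)"

lemma finite_measure_M: "finite_measure M"
proof -
 have "integrable M (%x. 1::real)"
  using weight_integrable[OF alpha]
  by (subst integral_nu_weighted(1)) (auto intro: continuous_set_measurable)
 thus ?thesis by (intro finite_measureI) (auto simp: integrable_iff_bounded)
qed

lemma kd_nonneg: "0 <= kd y z"
 using lk_nonneg[OF n] nu_const_pos[where 'n='n] by (simp add: kd_def)

lemma kd_zero: "1/128 <= sg y z ==> kd y z = 0" by (simp add: kd_def lk_zero)

lemma continuous_on_kd: "y \<in> UB ==> continuous_on UB (kd y)"
 unfolding kd_def[abs_def] lk_def using nu_const_pos[where 'n='n] ball_mass_pos[OF n]
 by (intro continuous_intros continuous_on_weight_powr continuous_on_compose2[OF continuous_on_bump(1) has_partials_continuous[OF has_partials_sg]]) auto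

lemma kd_weight:
 assumes "z \<in> UB"
 shows "nu_const TYPE('n) * ((dl z) powr \<alpha> * kd y z) = lk y z / (dl z) ^ CARD('n)"
proof -
 have b: "0 < dl z" by (rule dl_pos[OF assms])
 have "(dl z) powr \<alpha> * wi z = (dl z) powr (- real CARD('n))"
  unfolding powr_add[symmetric] by simp
 also have "... = 1 / (dl z) ^ CARD('n)" using b by (simp add: powr_minus_divide powr_realpow)
 finally have e: "(dl z) powr \<alpha> * wi z = 1 / (dl z) ^ CARD('n)" .
 have "nu_const TYPE('n) * ((dl z) powr \<alpha> * kd y z)
  = lk y z * ((dl z) powr \<alpha> * wi z)"
  using nu_const_pos[where 'n='n] by (simp add: kd_def)
 thus ?thesis unfolding e by simp
qed

lemma kd_integrable:
 fixes f :: "real^'n => 'c::euclidean_space"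
 assumes y: "y \<in> UB" and f: "continuous_on UB f"
 shows "integrable M (%z. kd y z *\<^sub>R f z)"
  "(\<integral>z. kd y z *\<^sub>R f z \<partial>M) = (LBINT z:UB. (lk y z / (dl z) ^ CARD('n)) *\<^sub>R f z)"
proof -
 have c: "continuous_on UB (%z. kd y z *\<^sub>R f z)"
  by (intro continuous_intros continuous_on_kd y f)
 note m = continuous_set_measurable[OF c]
 have "set_integrable lborel UB (%z. (dl z) powr \<alpha> *\<^sub>R (kd y z *\<^sub>R f z))"
 proof (rule integrable_compact_support[OF open_ball sg_cball[OF y]])
  show "continuous_on UB (%z. (dl z) powr \<alpha> *\<^sub>R (kd y z *\<^sub>R f z))"
   by (intro continuous_intros continuous_on_weight_powr c)
  fix z :: "real^'n" assume "z \<in> UB - cball 0 (sqrt ((1 + (norm y)^2) / 2))"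
  hence "1/128 < sg y z" using bump_sg_support(1)[OF y, of "1/128"] by simp
  thus "(dl z) powr \<alpha> *\<^sub>R (kd y z *\<^sub>R f z) = 0" by (simp add: kd_zero)
 qed
 thus "integrable M (%z. kd y z *\<^sub>R f z)" using integral_nu_weighted(1)[OF m] by blast
 have "(\<integral>z. kd y z *\<^sub>R f z \<partial>M) = (LBINT z:UB. nu_const TYPE('n) *\<^sub>R ((dl z) powr \<alpha> *\<^sub>R (kd y z *\<^sub>R f z)))"
  unfolding integral_nu_weighted(2)[OF m] by (rule set_integral_scaleR_right[symmetric])
 also have "... = (LBINT z:UB. (lk y z / (dl z) ^ CARD('n)) *\<^sub>R f z)"
  by (rule set_lebesgue_integral_cong) (auto simp: kd_weight[symmetric])
 finally show "(\<integral>z. kd y z *\<^sub>R f z \<partial>M) = (LBINT z:UB. (lk y z / (dl z) ^ CARD('n)) *\<^sub>R f z)" .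
qed

lemma kd_mean_value:
 assumes "g \<in> h_harmonic" "y \<in> UB"
 shows "g y = (\<integral>z. kd y z *\<^sub>R g z \<partial>M)"
 unfolding kd_integrable(2)[OF assms(2) h_harmonic_continuous[OF assms(1)]]
 using lk_mean_value[OF n assms] by (simp only: scaleR_conv_of_real mult.commute)

lemma kd_mass:
 assumes y: "y \<in> UB" shows "integrable M (kd y)" "(\<integral>z. kd y z \<partial>M) = 1"
proof -
 show i: "integrable M (kd y)" using kd_integrable(1)[OF y continuous_on_const[of _ "1::real"]] by simp
 have "complex_of_real (\<integral>z. kd y z \<partial>M) = 1"
  using kd_mean_value[OF const_h_harmonic[of 1] y] by (simp add: scaleR_conv_of_real)
 thus "(\<integral>z. kd y z \<partial>M) = 1" by (simp only: of_real_eq_1_iff)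
qed

text \<open>Jensen's inequality from the nonnegative variance of |g| under the probability density
  \<open>kd y\<close>.\<close>

lemma kd_jensen:
 assumes g: "g \<in> h_harmonic" and y: "y \<in> UB"
 shows "(cmod (g y))^2 <= (\<integral>z. kd y z * (cmod (g z))^2 \<partial>M)"
proof -
 note cg = h_harmonic_continuous[OF g]
 have i1: "integrable M (%z. kd y z * cmod (g z))" using kd_integrable(1)[OF y, of "%z. cmod (g z)"] cg by (simp add: continuous_on_norm)
 have i2: "integrable M (%z. kd y z * (cmod (g z))^2)" using kd_integrable(1)[OF y, of "%z. (cmod (g z))^2"] cg by (simp add: continuous_on_norm continuous_on_power)
 define c where "c = (\<integral>z. kd y z * cmod (g z) \<partial>M)"
 have "cmod (g y) <= (\<integral>z. cmod (kd y z *\<^sub>R g z) \<partial>M)"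
  using integral_norm_bound[of M "%z. kd y z *\<^sub>R g z"] kd_mean_value[OF g y] by simp
 also have "... = c" unfolding c_def by (simp add: kd_nonneg)
 finally have 1: "cmod (g y) <= c" .
 have "0 <= (\<integral>z. kd y z * (cmod (g z) - c)^2 \<partial>M)"
  by (intro Bochner_Integration.integral_nonneg mult_nonneg_nonneg kd_nonneg) auto
 also have "... = (\<integral>z. kd y z * (cmod (g z))^2 - 2 * c * (kd y z * cmod (g z)) + c^2 * kd y z \<partial>M)"
  by (rule Bochner_Integration.integral_cong) (auto simp: power2_diff algebra_simps power2_eq_square)
 also have "... = (\<integral>z. kd y z * (cmod (g z))^2 \<partial>M) - 2 * c * c + c^2 * 1"
  using i1 i2 kd_mass[OF y] by (simp add: c_def)
 finally have "c^2 <= (\<integral>z. kd y z * (cmod (g z))^2 \<partial>M)" by (simp add: power2_eq_square)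
 moreover have "(cmod (g y))^2 <= c^2" using 1 by (intro power_mono) auto
 ultimately show ?thesis by simp
qed

text \<open>The second bound replaces the weight at z by the one at y; where \<open>kd\<close> is
  not zero, sg < 1/128 makes the two comparable.\<close>

lemma kd_bound:
 obtains C where "0 < C"
  "!!y z. z \<in> UB ==> kd y z <= C * wi z"
  "!!y z. y \<in> UB ==> z \<in> UB ==> kd y z <= C * wi y"
proof -
 obtain D where D: "D > 0" "!!t. bump (1/128) t <= D" using exists_bump_bound by blast
 have J: "ball_mass (0::real^'n) > 0" "nu_const TYPE('n) > 0" by (rule ball_mass_pos[OF n]) (rule nu_const_pos)
 define C0 where "C0 = D / ball_mass (0::real^'n) / nu_const TYPE('n)"
 have C0: "C0 > 0" using D J by (simp add: C0_def)
 let ?g = "- real CARD('n) - \<alpha>"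
 have b: "kd y z <= C0 * (dl z) powr ?g" for y z
 proof -
  have "lk y z <= D / ball_mass (0::real^'n)" using D J by (simp add: lk_def divide_right_mono)
  hence "kd y z <= D / ball_mass (0::real^'n) * (dl z) powr ?g / nu_const TYPE('n)"
   unfolding kd_def using J by (intro divide_right_mono mult_right_mono) auto
  thus ?thesis by (simp add: C0_def)
 qed
 show ?thesis
 proof (rule that[of "C0 * 2 powr \<bar>?g\<bar>"])
  show "C0 * 2 powr \<bar>?g\<bar> > 0" using C0 by simp
  have "1 <= 2 powr \<bar>?g\<bar>" by (simp add: ge_one_powr_ge_zero)
  hence "C0 * 1 <= C0 * 2 powr \<bar>?g\<bar>" using C0 by (intro mult_left_mono) auto
  thus "kd y z <= C0 * 2 powr \<bar>?g\<bar> * (dl z) powr ?g" for y z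
   using b[of y z] mult_right_mono[of "C0 * 1" "C0 * 2 powr \<bar>?g\<bar>" "(dl z) powr ?g"] by simp
  show "kd y z <= C0 * 2 powr \<bar>?g\<bar> * (dl y) powr ?g" if y: "y \<in> UB" and z: "z \<in> UB" for y z
  proof (cases "1/128 <= sg y z")
   case True
   thus ?thesis using C0 by (simp add: kd_zero)
  next
   case False
   hence "(dl z) powr ?g <= 2 powr \<bar>?g\<bar> * (dl y) powr ?g"
    using sg_comparable[OF y z] sg_comparable[OF z y]
    by (intro powr_comparable dl_pos y z) (auto simp: sg_sym)
   hence "C0 * (dl z) powr ?g <= C0 * (2 powr \<bar>?g\<bar> * (dl y) powr ?g)"
    using C0 by (intro mult_left_mono) auto
   thus ?thesis using b[of y z] by (simp add: mult.assoc)
  qed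
 qed
qed

definition nsq :: "(real^'n => complex) => real" where "nsq f = (\<integral>z. (cmod (f z))^2 \<partial>M)"
definition ip :: "(real^'n => complex) => (real^'n => complex) => complex" where
 "ip f g = (\<integral>z. f z * cnj (g z) \<partial>M)"

lemma B2D:
 assumes "f \<in> B2" shows "f \<in> h_harmonic" "integrable M (%z. (cmod (f z))^2)" "continuous_on UB f" "f \<in> borel_measurable M"
 using assms h_harmonic_continuous by (auto simp: bergman_space_def)

lemma B2I: "f \<in> h_harmonic ==> integrable M (%z. (cmod (f z))^2) ==> f \<in> B2"
 using continuous_measurable(2)[OF h_harmonic_continuous] by (auto simp: bergman_space_def)

lemma nsq_nonneg: "0 <= nsq f" by (simp add: nsq_def)

lemma L2_mult_integrable:
 fixes f g :: "real^'n => complex"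
 assumes "f \<in> borel_measurable M" "g \<in> borel_measurable M" "integrable M (%z. (cmod (f z))^2)" "integrable M (%z. (cmod (g z))^2)"
 shows "integrable M (%z. f z * g z)" "integrable M (%z. f z * cnj (g z))" "integrable M (%z. cmod (f z) * cmod (g z))"
proof -
 have i: "integrable M (%z. ((cmod (f z))^2 + (cmod (g z))^2) / 2)" using assms by simp
 have m: "(%z. cnj (g z)) \<in> borel_measurable M"
  by (rule measurable_compose[OF assms(2) borel_measurable_continuous_onI[OF continuous_on_cnj[OF continuous_on_id]]])
 have b: "cmod (f z) * cmod (g z) <= ((cmod (f z))^2 + (cmod (g z))^2) / 2" for z
  using sum_squares_bound[of "cmod (f z)" "cmod (g z)"] by simp
 show "integrable M (%z. f z * g z)" "integrable M (%z. f z * cnj (g z))" "integrable M (%z. cmod (f z) * cmod (g z))"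
  by (rule Bochner_Integration.integrable_bound[OF i]; use b assms m in \<open>auto simp: norm_mult intro!: borel_measurable_times borel_measurable_norm\<close>)+
qed

lemma B2_mult_integrable:
 assumes "f \<in> B2" "g \<in> B2"
 shows "integrable M (%z. f z * g z)" "integrable M (%z. f z * cnj (g z))" "integrable M (%z. cmod (f z) * cmod (g z))"
 using L2_mult_integrable[OF B2D(4)[OF assms(1)] B2D(4)[OF assms(2)] B2D(2)[OF assms(1)] B2D(2)[OF assms(2)]] by auto

lemma cmod_add_sq: "(cmod (a + b))^2 = (cmod a)^2 + (cmod b)^2 + 2 * Re (a * cnj b)"
 unfolding cmod_power2 by (simp add: power2_eq_square algebra_simps)

lemma B2_add: assumes "f \<in> B2" "g \<in> B2" shows "(%z. f z + g z) \<in> B2"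
proof (rule B2I)
 show "integrable M (%z. (cmod (f z + g z))^2)"
  unfolding cmod_add_sq
  by (intro Bochner_Integration.integrable_add integrable_mult_right integrable_Re B2D(2) B2_mult_integrable(2) assms)
qed (intro h_harmonic_add B2D(1) assms)

lemma B2_cmult: assumes "f \<in> B2" shows "(%z. c * f z) \<in> B2"
 using B2D(2)[OF assms] by (intro B2I h_harmonic_cmult B2D(1)[OF assms]) (simp add: norm_mult power_mult_distrib)

lemma B2_diff: assumes "f \<in> B2" "g \<in> B2" shows "(%z. f z - g z) \<in> B2"
 using B2_add[OF assms(1) B2_cmult[OF assms(2), of "-1"]] by simp

lemma B2_cnj: assumes "f \<in> B2" shows "(%z. cnj (f z)) \<in> B2"
 using B2D(2)[OF assms] by (intro B2I h_harmonic_cnj B2D(1)[OF assms]) simp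

lemma B2_const: "(%z. c) \<in> B2"
 using finite_measure_M by (intro B2I const_h_harmonic) (simp add: finite_measure.integrable_const)

lemma B2_cong: assumes "f \<in> B2" "!!z. z \<in> UB ==> f z = g z" shows "g \<in> B2"
proof (rule B2I)
 show "g \<in> h_harmonic" by (rule h_harmonic_cong[OF B2D(1)[OF assms(1)] assms(2)])
 show "integrable M (%z. (cmod (g z))^2)"
  by (rule Bochner_Integration.integrable_cong[THEN iffD1, OF refl _ B2D(2)[OF assms(1)]]) (use assms(2) in auto)
qed

lemma nsq_add: assumes "f \<in> B2" "g \<in> B2" shows "nsq (%z. f z + g z) = nsq f + nsq g + 2 * Re (ip f g)"
proof -
 define r where "r z = Re (f z * cnj (g z))" for z
 have r: "integrable M r" unfolding r_def[abs_def] by (intro integrable_Re B2_mult_integrable(2) assms)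
 have "Re (ip f g) = (\<integral>z. r z \<partial>M)"
  unfolding ip_def r_def using integral_Re[OF B2_mult_integrable(2)[OF assms]] by simp
 thus ?thesis
  unfolding nsq_def cmod_add_sq r_def[symmetric]
  using B2D(2)[OF assms(1)] B2D(2)[OF assms(2)] r by simp
qed

lemma nsq_cmult: "nsq (%z. c * f z) = (cmod c)^2 * nsq f"
 unfolding nsq_def by (simp add: norm_mult power_mult_distrib)

lemma ip_add_left: assumes "f \<in> B2" "g \<in> B2" "h \<in> B2" shows "ip (%z. f z + g z) h = ip f h + ip g h"
 unfolding ip_def using B2_mult_integrable(2)[OF assms(1,3)] B2_mult_integrable(2)[OF assms(2,3)] by (simp add: distrib_right)

lemma ip_cmult_left: "ip (%z. c * f z) h = c * ip f h"
 unfolding ip_def by (simp add: mult.assoc)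

lemma ip_cmult_right: "ip f (%z. c * h z) = cnj c * ip f h"
 unfolding ip_def by (simp add: mult.left_commute)

lemma ip_cnj: "cnj (ip f g) = ip g f"
 unfolding ip_def using integral_bounded_linear'[OF bounded_linear_cnj bounded_linear_cnj, of M "%z. f z * cnj (g z)"]
 by (simp add: mult.commute)

lemma ip_self: "ip f f = of_real (nsq f)"
 unfolding ip_def nsq_def complex_norm_square[symmetric] of_real_power[symmetric] by (rule integral_complex_of_real)

lemma evaluation_bound:
 obtains C where "0 < C" "!!g y. g \<in> B2 ==> y \<in> UB ==> (cmod (g y))^2 <= C * wi y * nsq g"
proof -
 obtain C where C: "0 < C" "!!y z. y \<in> UB ==> z \<in> UB ==> kd y z <= C * wi y"
  using kd_bound by metis
 show ?thesis
 proof (rule that[OF C(1)])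
  fix g y assume g: "g \<in> B2" and y: "y \<in> (UB :: (real^'n) set)"
  let ?c = "C * wi y"
  have "(cmod (g y))^2 <= (\<integral>z. kd y z * (cmod (g z))^2 \<partial>M)" by (rule kd_jensen[OF B2D(1)[OF g] y])
  also have "... <= (\<integral>z. ?c * (cmod (g z))^2 \<partial>M)"
  proof (rule integral_mono)
   show "integrable M (%z. kd y z * (cmod (g z))^2)"
    using kd_integrable(1)[OF y, of "%z. (cmod (g z))^2"] B2D(3)[OF g] by (simp add: continuous_on_norm continuous_on_power)
   show "integrable M (%z. ?c * (cmod (g z))^2)" using B2D(2)[OF g] by simp
   show "kd y z * (cmod (g z))^2 <= ?c * (cmod (g z))^2" if "z \<in> space M" for z
    using C(2)[OF y, of z] that by (intro mult_right_mono) auto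
  qed
  also have "... = ?c * nsq g" by (simp add: nsq_def)
  finally show "(cmod (g y))^2 <= ?c * nsq g" .
 qed
qed

section \<open>The reproducing kernel\<close>

lemma nsq_diff: assumes "f \<in> B2" "g \<in> B2" shows "nsq (%z. f z - g z) = nsq f + nsq g - 2 * Re (ip f g)"
 using nsq_add[OF assms(1) B2_cmult[OF assms(2), of "-1"]] nsq_cmult[of "-1" g] ip_cmult_right[of f "-1" g] by simp

lemma ip_diff_right:
 assumes "f \<in> B2" "g \<in> B2" "h \<in> B2" shows "ip f (%z. g z - h z) = ip f g - ip f h"
 unfolding ip_def using B2_mult_integrable(2)[OF assms(1,2)] B2_mult_integrable(2)[OF assms(1,3)]
 by (simp add: right_diff_distrib)

lemma ip_cong: "(!!z. z \<in> UB ==> g z = h z) ==> ip f g = ip f h"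
 unfolding ip_def by (rule Bochner_Integration.integral_cong) auto

text \<open>The discriminant of a quadratic in t. With d = \<open>nsq f\<close> it yields
  Cauchy-Schwarz, with d = 0 the orthogonality of a minimiser in
  \<open>riesz_exists\<close>.\<close>

lemma ip_cmult_nonneg_imp:
 assumes "f \<in> B2" "g \<in> B2" and nn: "!!t. 0 <= (cmod t)^2 * nsq g + 2 * Re (cnj t * ip f g) + d" and d: "0 <= d"
 shows "(cmod (ip f g))^2 <= d * nsq g"
proof -
 define I where "I = ip f g"
 \<comment> \<open>Restricting t to - s I with real s leaves a real quadratic in s.\<close>
 have *: "0 <= s^2 * (cmod I)^2 * nsq g - 2 * s * (cmod I)^2 + d" for s :: real
 proof -
  have r: "Re (cnj (- of_real s * I) * I) = - s * (cmod I)^2"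
   unfolding cmod_power2 by (simp add: power2_eq_square algebra_simps)
  have c: "(cmod (- of_real s * I))^2 = s^2 * (cmod I)^2" by (simp add: norm_mult power_mult_distrib)
  show ?thesis using nn[of "- of_real s * I"] unfolding I_def[symmetric] r c by (simp add: mult_ac)
 qed
 show ?thesis
 proof (cases "nsq g = 0")
  case True
  show ?thesis
  proof (rule ccontr)
   assume "\<not> ?thesis"
   hence I: "(cmod I)^2 > 0" using True by (simp add: I_def)
   hence "I \<noteq> 0" by auto
   \<comment> \<open>For \<open>nsq g = 0\<close> the expression is affine in s, and this s gives it
     the value - d - 2.\<close>
   hence "0 <= - 2 * (d + 1) + d" using *[of "(d + 1) / (cmod I)^2"] True by simp
   thus False using d by simp
  qed
 next
  case False
  hence g: "nsq g > 0" using nsq_nonneg[of g] by simp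
  have "0 <= (1 / nsq g)^2 * (cmod I)^2 * nsq g - 2 * (1 / nsq g) * (cmod I)^2 + d" by (rule *)
  also have "... = d - (cmod I)^2 / nsq g" using g by (simp add: power2_eq_square field_simps)
  finally show ?thesis using g by (simp add: I_def field_simps)
 qed
qed

lemma nsq_add_cmult:
 assumes "f \<in> B2" "g \<in> B2"
 shows "nsq (%z. f z + t * g z) = (cmod t)^2 * nsq g + 2 * Re (cnj t * ip f g) + nsq f"
 using nsq_add[OF assms(1) B2_cmult[OF assms(2), of t]] by (simp only: nsq_cmult ip_cmult_right)

lemma cauchy_schwarz:
 assumes "f \<in> B2" "g \<in> B2" shows "(cmod (ip f g))^2 <= nsq f * nsq g"
proof (rule ip_cmult_nonneg_imp[OF assms _ nsq_nonneg])
 show "0 <= (cmod t)^2 * nsq g + 2 * Re (cnj t * ip f g) + nsq f" for t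
  unfolding nsq_add_cmult[OF assms, symmetric] by (rule nsq_nonneg)
qed

text \<open>\<open>evaluation_bound\<close> turns L2-Cauchy into locally uniformly Cauchy,
  \<open>h_harmonic_uniform_limit\<close> gives the equation, and Fatou the integrability. Pointwise
  convergence is what is recorded; Fatou recovers the norm of the limit where it is wanted.\<close>

lemma B2_complete:
 assumes f: "!!j. f j \<in> B2"
  and cauchy: "!!e. 0 < e ==> \<exists>N. \<forall>i\<ge>N. \<forall>j\<ge>N. nsq (%z. f i z - f j z) < e"
 obtains g where "g \<in> B2" "!!x. x \<in> UB ==> (%j. f j x) \<longlonglongrightarrow> g x"
proof -
 obtain C where C: "0 < C" "!!g y. g \<in> B2 ==> y \<in> UB ==> (cmod (g y))^2 <= C * wi y * nsq g"
  using evaluation_bound by metis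
 define g where "g x = lim (%j. f j x)" for x
 have u: "uniform_limit K f g sequentially" if K: "compact K" "K \<subseteq> UB" for K
 proof -
  have "compact ((%y. wi y) ` K)"
   by (intro compact_continuous_image continuous_on_subset[OF continuous_on_weight_powr K(2)] K)
  then obtain D where D: "\<forall>u\<in>(%y. wi y) ` K. norm u <= D"
   using compact_imp_bounded bounded_iff by metis
  define E where "E = C * (\<bar>D\<bar> + 1)"
  have E: "E > 0" using C(1) by (simp add: E_def)
  have le: "(cmod (h y))^2 <= E * nsq h" if "h \<in> B2" "y \<in> K" for h y
  proof -
   have "wi y <= \<bar>D\<bar> + 1" using D that(2) by force
   hence "C * wi y * nsq h <= E * nsq h"
    unfolding E_def using C(1) nsq_nonneg[of h] by (intro mult_right_mono mult_left_mono) auto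
   thus ?thesis using C(2)[OF that(1), of y] that K by force
  qed
  have "uniformly_Cauchy_on K f"
  proof (rule uniformly_Cauchy_onI)
   fix e :: real assume e: "e > 0"
   obtain N where N: "!!i j. N <= i ==> N <= j ==> nsq (%z. f i z - f j z) < e^2 / E"
    using cauchy[of "e^2 / E"] e E by auto
   show "\<exists>N. \<forall>x\<in>K. \<forall>i\<ge>N. \<forall>j\<ge>N. dist (f i x) (f j x) < e"
   proof (intro exI[of _ N] ballI allI impI)
    fix x i j assume x: "x \<in> K" and ij: "N <= i" "N <= j"
    have "(cmod (f i x - f j x))^2 <= E * nsq (%z. f i z - f j z)" by (rule le[OF B2_diff[OF f f] x])
    also have "... < E * (e^2 / E)" using N[OF ij] E by (intro mult_strict_left_mono) auto
    finally have "(cmod (f i x - f j x))^2 < e^2" using E by simp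
    thus "dist (f i x) (f j x) < e" using e by (simp add: dist_norm power2_less_imp_less)
   qed
  qed
  thus ?thesis
   unfolding g_def[abs_def] using Cauchy_uniformly_convergent uniformly_convergent_uniform_limit_iff by blast
 qed
 have gh: "g \<in> h_harmonic" by (rule h_harmonic_uniform_limit[OF n B2D(1)[OF f] u])
 have pw: "(%j. f j x) \<longlonglongrightarrow> g x" if "x \<in> UB" for x
  using tendsto_uniform_limitI[OF u[of "{x}"], of x] that by simp
 obtain N where N: "!!i j. N <= i ==> N <= j ==> nsq (%z. f i z - f j z) < 1" using cauchy[of 1] by auto
 have "integrable M (%z. (cmod (f N z - g z))^2)"
 proof (rule Fatou_real(1)[where C = 1 and f = "%j z. (cmod (f N z - f (j + N) z))^2"])
  show "integrable M (%z. (cmod (f N z - f (j + N) z))^2)" for j by (rule B2D(2)[OF B2_diff[OF f f]])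
  show "(%j. (cmod (f N x - f (j + N) x))^2) \<longlonglongrightarrow> (cmod (f N x - g x))^2" if "x \<in> space M" for x
   using that by (intro tendsto_intros LIMSEQ_ignore_initial_segment pw) simp
  show "(\<integral>x. (cmod (f N x - f (j + N) x))^2 \<partial>M) <= 1" for j
   using N[of N "j + N"] by (simp add: nsq_def)
  show "(%z. (cmod (f N z - g z))^2) \<in> borel_measurable M"
   by (intro continuous_measurable(2) continuous_intros B2D(3)[OF f] h_harmonic_continuous[OF gh])
 qed auto
 hence "(%z. f N z - g z) \<in> B2" by (intro B2I h_harmonic_diff B2D(1)[OF f] gh)
 from B2_diff[OF f this, of N] have "g \<in> B2" by simp
 thus ?thesis using that pw by blast
qed

text \<open>The kernel is a multiple of the element of least norm among the functions with value 1 at \<open>y\<close>.\<close>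

lemma riesz_exists:
 assumes y: "y \<in> UB"
 shows "\<exists>k\<in>B2. (\<forall>z. z \<notin> UB --> k z = 0) \<and> (\<forall>f\<in>B2. f y = ip f k)"
proof -
 obtain C where C: "0 < C" "!!g y. g \<in> B2 ==> y \<in> UB ==> (cmod (g y))^2 <= C * wi y * nsq g"
  using evaluation_bound by metis
 define S where "S = nsq ` {f \<in> B2. f y = 1}"
 define m where "m = Inf S"
 have ne: "S \<noteq> {}" using B2_const[of 1] by (auto simp: S_def)
 have bb: "bdd_below S" unfolding S_def by (rule bdd_belowI[of _ 0]) (auto simp: nsq_nonneg)
 have m: "m <= nsq f" if "f \<in> B2" "f y = 1" for f
  unfolding m_def by (rule cInf_lower[OF _ bb]) (use that in \<open>auto simp: S_def\<close>)
 have "\<exists>f. f \<in> B2 \<and> f y = 1 \<and> nsq f < m + 1 / real (Suc j)" for j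
 proof -
  have "Inf S < m + 1 / real (Suc j)" by (simp add: m_def)
  thus ?thesis using cInf_lessD[OF ne] by (auto simp: S_def)
 qed
 then obtain f where f: "!!j. f j \<in> B2" "!!j. f j y = 1" "!!j. nsq (f j) < m + 1 / real (Suc j)" by metis
 \<comment> \<open>Parallelogram law: the midpoint of f i and f j has value 1 at y, so its squared
   norm is at least m.\<close>
 have par: "nsq (%z. f i z - f j z) < 2 / real (Suc i) + 2 / real (Suc j)" for i j
 proof -
  have "m <= nsq (%z. (1/2) * (f i z + f j z))"
   by (rule m[OF B2_cmult[OF B2_add[OF f(1) f(1)]]]) (simp add: f(2))
  hence "4 * m <= nsq (%z. f i z + f j z)" unfolding nsq_cmult by (simp add: power2_eq_square norm_divide)
  moreover have "2 / real (Suc k) = 2 * (1 / real (Suc k))" for k by simp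
  ultimately show ?thesis using nsq_add[OF f(1)[of i] f(1)[of j]] nsq_diff[OF f(1)[of i] f(1)[of j]] f(3)[of i] f(3)[of j]
   by linarith
 qed
 have cauchy: "\<exists>N. \<forall>i\<ge>N. \<forall>j\<ge>N. nsq (%z. f i z - f j z) < e" if e: "e > 0" for e
 proof -
  obtain N where N: "inverse (real (Suc N)) < e / 4" using reals_Archimedean[of "e/4"] e by auto
  show ?thesis
  proof (intro exI[of _ N] allI impI)
   fix i j assume ij: "N <= i" "N <= j"
   have "1 / real (Suc k) < e / 4" if "N <= k" for k
   proof -
    have "inverse (real (Suc k)) <= inverse (real (Suc N))" using that by (intro le_imp_inverse_le) auto
    thus ?thesis using N by (simp add: inverse_eq_divide)
   qed
   from this[OF ij(1)] this[OF ij(2)] have "2 * (1 / real (Suc i)) + 2 * (1 / real (Suc j)) < e" by linarith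
   thus "nsq (%z. f i z - f j z) < e" using par[of i j] by simp
  qed
 qed
 obtain g where g: "g \<in> B2" "!!x. x \<in> UB ==> (%j. f j x) \<longlonglongrightarrow> g x"
  using B2_complete[OF f(1) cauchy] by metis
 have gy: "g y = 1" using g(2)[OF y] LIMSEQ_unique[of "%j. f j y" "g y" 1] by (simp add: f(2))
 have gm: "nsq g <= m"
 proof (rule field_le_epsilon)
  fix e :: real assume e: "e > 0"
  obtain J where J: "inverse (real (Suc J)) < e" using reals_Archimedean[OF e] by auto
  show "nsq g <= m + e"
   unfolding nsq_def
  proof (rule Fatou_real(2)[where f = "%j z. (cmod (f (j + J) z))^2"])
   show "integrable M (%z. (cmod (f (j + J) z))^2)" for j by (rule B2D(2)[OF f(1)])
   show "(%j. (cmod (f (j + J) x))^2) \<longlonglongrightarrow> (cmod (g x))^2" if "x \<in> space M" for x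
    using that by (intro tendsto_intros LIMSEQ_ignore_initial_segment g(2)) simp
   show "(\<integral>x. (cmod (f (j + J) x))^2 \<partial>M) <= m + e" for j
   proof -
    have "inverse (real (Suc (j + J))) <= inverse (real (Suc J))" by (intro le_imp_inverse_le) auto
    thus ?thesis using J f(3)[of "j + J"] by (simp add: nsq_def inverse_eq_divide)
   qed
   show "(%z. (cmod (g z))^2) \<in> borel_measurable M"
    by (intro continuous_measurable(2) continuous_intros B2D(3)[OF g(1)])
  qed auto
 qed
 \<comment> \<open>If h y = 0, every g + t h is a competitor, so the norm is least at t = 0 and the
   quadratic inequality applies with d = 0.\<close>
 have orth: "ip g h = 0" if h: "h \<in> B2" "h y = 0" for h
 proof -
  have "(cmod (ip g h))^2 <= 0 * nsq h"
  proof (rule ip_cmult_nonneg_imp[OF g(1) h(1)])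
   fix t
   have "m <= nsq (%z. g z + t * h z)" by (rule m[OF B2_add[OF g(1) B2_cmult[OF h(1)]]]) (simp add: gy h)
   thus "0 <= (cmod t)^2 * nsq h + 2 * Re (cnj t * ip g h) + 0" using nsq_add_cmult[OF g(1) h(1), of t] gm by simp
  qed simp
  thus ?thesis by simp
 qed
 have pos: "nsq g > 0" using C(2)[OF g(1) y] gy nsq_nonneg[of g] by (cases "nsq g = 0") auto
 define k where "k z = (if z \<in> UB then of_real (1 / nsq g) * g z else 0)" for z
 have k: "k \<in> B2" by (rule B2_cong[OF B2_cmult[OF g(1), of "of_real (1 / nsq g)"]]) (simp add: k_def)
 have "h y = ip h k" if h: "h \<in> B2" for h
 proof -
  have "ip g (%z. h z - h y * g z) = 0" by (rule orth[OF B2_diff[OF h B2_cmult[OF g(1)]]]) (simp add: gy)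
  hence "ip (%z. h z - h y * g z) g = 0" using ip_cnj[of g "%z. h z - h y * g z"] by simp
  moreover have "ip (%z. h z + (- h y) * g z) g = ip h g + (- h y) * ip g g"
   using ip_add_left[OF h B2_cmult[OF g(1), of "- h y"] g(1)] by (simp only: ip_cmult_left)
  ultimately have "ip h g = h y * of_real (nsq g)" by (simp add: ip_self)
  moreover have "ip h k = ip h (%z. of_real (1 / nsq g) * g z)" by (rule ip_cong) (simp add: k_def)
  ultimately show ?thesis unfolding ip_cmult_right using pos by simp
 qed
 thus ?thesis using k by (intro bexI[of _ k]) (auto simp: k_def)
qed

lemma B2_eq_0: assumes "f \<in> B2" "nsq f = 0" "x \<in> UB" shows "f x = 0"
proof -
 obtain C where "0 < C" "!!g y. g \<in> B2 ==> y \<in> UB ==> (cmod (g y))^2 <= C * wi y * nsq g"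
  using evaluation_bound by metis
 from this(2)[OF assms(1,3)] assms(2) show ?thesis by simp
qed

lemma riesz_unique:
 assumes "k1 \<in> B2" "k2 \<in> B2" "!!f. f \<in> B2 ==> ip f k1 = ip f k2" "x \<in> UB"
 shows "k1 x = k2 x"
proof -
 have d: "(%z. k1 z - k2 z) \<in> B2" by (rule B2_diff[OF assms(1,2)])
 have "ip (%z. k1 z - k2 z) (%z. k1 z - k2 z) = 0"
  using ip_diff_right[OF d assms(1,2)] assms(3)[OF d] by simp
 hence "nsq (%z. k1 z - k2 z) = 0" by (simp add: ip_self)
 from B2_eq_0[OF d this assms(4)] show ?thesis by simp
qed

text \<open>Arguments exchanged, so that \<open>bk y\<close> is the element of \<open>B2\<close>
  that represents evaluation at y.\<close>

definition bk :: "real^'n => real^'n => complex" where "bk y x = bergman_kernel \<alpha> x y"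

lemma bk_spec:
 assumes y: "y \<in> UB"
 shows "bk y \<in> B2" "!!f. f \<in> B2 ==> f y = ip f (bk y)"
proof -
 let ?P = "%k. k \<in> B2 \<and> (\<forall>z. z \<notin> UB --> k z = 0) \<and> (\<forall>f\<in>B2. f y = (\<integral>z. f z * cnj (k z) \<partial>M))"
 have "\<exists>!k. ?P k"
 proof (rule ex_ex1I)
  show "\<exists>k. ?P k" using riesz_exists[OF y] unfolding ip_def by blast
  fix k1 k2 assume P: "?P k1" "?P k2"
  show "k1 = k2"
  proof
   fix x show "k1 x = k2 x"
   proof (cases "x \<in> UB")
    case True
    show ?thesis
    proof (rule riesz_unique[OF _ _ _ True])
     show "ip f k1 = ip f k2" if "f \<in> B2" for f
      using P that unfolding ip_def by (metis (no_types, lifting))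
    qed (use P in auto)
   next
    case False
    thus ?thesis using P by simp
   qed
  qed
 qed
 from theI'[OF this] have "?P (bk y)" unfolding bk_def[abs_def] bergman_kernel_def by simp
 thus "bk y \<in> B2" "!!f. f \<in> B2 ==> f y = ip f (bk y)" unfolding ip_def by blast+
qed

lemma bk_unique:
 assumes y: "y \<in> UB" and k: "k \<in> B2" "!!f. f \<in> B2 ==> f y = ip f k" and x: "x \<in> UB"
 shows "k x = bk y x"
proof (rule riesz_unique[OF k(1) bk_spec(1)[OF y] _ x])
 show "ip f k = ip f (bk y)" if "f \<in> B2" for f using k(2)[OF that] bk_spec(2)[OF y that] by simp
qed

definition Rk :: "real^'n => real^'n => real" where "Rk x y = Re (bk y x)"

text \<open>\<open>B2\<close> is closed under conjugation, so the conjugate of \<open>bk y\<close>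
  also represents evaluation at y, and the representing function is unique.\<close>

lemma bk_real:
 assumes y: "y \<in> UB" and x: "x \<in> UB" shows "bk y x = of_real (Rk x y)"
proof -
 have "cnj (bk y x) = bk y x"
 proof (rule bk_unique[OF y B2_cnj[OF bk_spec(1)[OF y]] _ x])
  fix f assume f: "f \<in> B2"
  have "f y = cnj (cnj (f y))" by simp
  also have "cnj (f y) = ip (%z. cnj (f z)) (bk y)" using bk_spec(2)[OF y B2_cnj[OF f]] .
  also have "cnj (ip (%z. cnj (f z)) (bk y)) = ip f (%z. cnj (bk y z))"
   unfolding ip_cnj unfolding ip_def by (simp add: mult.commute)
  finally show "f y = ip f (%z. cnj (bk y z))" .
 qed
 thus ?thesis unfolding Rk_def by (simp add: complex_eq_iff)
qed

lemma ip_bk: assumes "x \<in> UB" "y \<in> UB" shows "ip (bk y) (bk x) = of_real (Rk x y)"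
 using bk_spec(2)[OF assms(1) bk_spec(1)[OF assms(2)]] bk_real[OF assms(2,1)] by simp

lemma Rk_sym: assumes "x \<in> UB" "y \<in> UB" shows "Rk x y = Rk y x"
 using ip_cnj[of "bk y" "bk x"] ip_bk[OF assms] ip_bk[OF assms(2,1)] by simp

lemma nsq_bk: assumes "x \<in> UB" shows "nsq (bk x) = Rk x x"
 using ip_bk[OF assms assms] ip_self[of "bk x"] by simp

text \<open>The constant 1 lies in \<open>B2\<close> and 1 = \<open>ip (%z. 1) (bk x)\<close>, so
  \<open>bk x\<close> is not null.\<close>

lemma Rk_diag_pos: assumes x: "x \<in> UB" shows "0 < Rk x x"
proof -
 have "nsq (bk x) \<noteq> 0"
 proof
  assume 0: "nsq (bk x) = 0"
  have "(1::complex) = ip (%z. 1) (bk x)" by (rule bk_spec(2)[OF x B2_const])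
  also have "... = 0" using cauchy_schwarz[OF B2_const[of 1] bk_spec(1)[OF x]] 0 by simp
  finally show False by simp
 qed
 thus ?thesis using nsq_nonneg[of "bk x"] nsq_bk[OF x] by simp
qed

text \<open>The evaluation bound for \<open>bk x\<close> at x itself: the squared norm is R(x,x)
  again, and one factor cancels.\<close>

lemma Rk_diag_bound:
 obtains C where "0 < C" "!!x. x \<in> UB ==> Rk x x <= C * wi x"
proof -
 obtain C where C: "0 < C" "!!g y. g \<in> B2 ==> y \<in> UB ==> (cmod (g y))^2 <= C * wi y * nsq g"
  using evaluation_bound by metis
 show ?thesis
 proof (rule that[OF C(1)])
  fix x :: "real^'n" assume x: "x \<in> UB"
  have "(Rk x x)^2 <= C * wi x * Rk x x"
   using C(2)[OF bk_spec(1)[OF x] x] bk_real[OF x x] nsq_bk[OF x] by simp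
  thus "Rk x x <= C * wi x"
   using Rk_diag_pos[OF x] by (simp add: power2_eq_square)
 qed
qed

section \<open>Invariance of measure, space and kernel under orthogonal maps\<close>

lemma integral_orthogonal:
 fixes F :: "real^'n => 'c::euclidean_space"
 assumes F: "continuous_on UB F" and U: "orthogonal_transformation U"
 shows "integrable M (%z. F (U z)) \<longleftrightarrow> integrable M F" "(\<integral>z. F (U z) \<partial>M) = (\<integral>z. F z \<partial>M)"
proof -
 have nU: "norm (U x) = norm x" for x using orthogonal_transformation_norm[OF U] .
 have cU: "continuous_on A U" for A using U orthogonal_transformation_linear linear_continuous_on linear_conv_bounded_linear by blast
 have cFU: "continuous_on UB (%z. F (U z))"
  by (intro continuous_on_compose2[OF F cU]) (auto simp: nU)
 note m = continuous_set_measurable[OF F] and mU = continuous_set_measurable[OF cFU]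
 let ?G = "%z. indicator UB z *\<^sub>R ((dl z) powr \<alpha> *\<^sub>R F z)"
 have G: "?G \<in> borel_measurable borel"
 proof -
  have "continuous_on UB (%z. (dl z) powr \<alpha> *\<^sub>R F z)" by (intro continuous_intros continuous_on_weight_powr F)
  from continuous_set_measurable[OF this] show ?thesis by (simp add: set_borel_measurable_def)
 qed
 have Um: "U \<in> lborel \<rightarrow>\<^sub>M borel" using borel_measurable_continuous_onI[OF cU] by simp
 have GU: "?G (U z) = indicator UB z *\<^sub>R ((dl z) powr \<alpha> *\<^sub>R F (U z))" for z
  by (simp add: nU indicator_def)
 show "integrable M (%z. F (U z)) \<longleftrightarrow> integrable M F"
  unfolding integral_nu_weighted(1)[OF m] integral_nu_weighted(1)[OF mU] set_integrable_def GU[symmetric]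
  using integrable_distr_eq[OF Um G] lborel_distr_orthogonal[OF U] by simp
 show "(\<integral>z. F (U z) \<partial>M) = (\<integral>z. F z \<partial>M)"
  unfolding integral_nu_weighted(2)[OF m] integral_nu_weighted(2)[OF mU] set_lebesgue_integral_def GU[symmetric]
  using integral_distr[OF Um G] lborel_distr_orthogonal[OF U] by simp
qed

lemma B2_orthogonal:
 assumes f: "f \<in> B2" and U: "orthogonal_transformation U" shows "(%z. f (U z)) \<in> B2"
proof (rule B2I[OF h_harmonic_orthogonal[OF B2D(1)[OF f] U]])
 have "continuous_on UB (%z. (cmod (f z))^2)" by (intro continuous_intros B2D(3)[OF f])
 from integral_orthogonal(1)[OF this U] B2D(2)[OF f] show "integrable M (%z. (cmod (f (U z)))^2)" by simp
qed

lemma Rk_orthogonal: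
 assumes U: "orthogonal_transformation U" and x: "x \<in> UB" and y: "y \<in> UB"
 shows "Rk (U x) (U y) = Rk x y"
proof -
 have nU: "norm (U x) = norm x" for x using orthogonal_transformation_norm[OF U] .
 have Uy: "U y \<in> UB" using y by (simp add: nU)
 define V where "V = inv U"
 have V: "orthogonal_transformation V" unfolding V_def by (rule orthogonal_transformation_inv[OF U])
 have VU: "V (U z) = z" for z using orthogonal_transformation_inj[OF U] by (simp add: V_def)
 have "bk (U y) (U x) = bk y x"
 proof (rule bk_unique[OF y B2_orthogonal[OF bk_spec(1)[OF Uy] U] _ x])
  fix f assume f: "f \<in> B2"
  have "f y = ip (%z. f (V z)) (bk (U y))" using bk_spec(2)[OF Uy B2_orthogonal[OF f V]] by (simp add: VU)
  also have "... = ip f (%z. bk (U y) (U z))"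
  proof -
   have "continuous_on UB (%z. f (V z) * cnj (bk (U y) z))"
    by (intro continuous_intros B2D(3)[OF B2_orthogonal[OF f V]] B2D(3)[OF bk_spec(1)[OF Uy]])
   from integral_orthogonal(2)[OF this U] show ?thesis by (simp add: ip_def VU)
  qed
  finally show "f y = ip f (%z. bk (U y) (U z))" .
 qed
 thus ?thesis by (simp add: Rk_def)
qed

lemma Rk_CS: assumes "x \<in> UB" "y \<in> UB" shows "(Rk x y)^2 <= Rk x x * Rk y y"
 using cauchy_schwarz[OF bk_spec(1)[OF assms(2)] bk_spec(1)[OF assms(1)]]
 by (simp add: ip_bk[OF assms] nsq_bk[OF assms(1)] nsq_bk[OF assms(2)] mult.commute)

end

section \<open>An ultrahyperbolic equation\<close>

text \<open>Beyond the last point s with f s <= 0 the function is positive, so its derivative there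
  is nonpositive and f cannot rise to a positive value at a.\<close>

lemma nonpos_if_deriv_nonpos:
 fixes f :: "real => real"
 assumes c: "continuous_on {0..a} f" and f0: "f 0 <= 0" and a: "0 <= a"
  and d: "!!s. 0 < s ==> s < a ==> (f has_real_derivative f' s) (at s)"
  and np: "!!s. 0 < s ==> s < a ==> 0 < f s ==> f' s <= 0"
 shows "f a <= 0"
proof (rule ccontr)
 assume "\<not> f a <= 0"
 hence fa: "f a > 0" by simp
 define S where "S = {0..a} \<inter> f -` {..0}"
 have "closed S" unfolding S_def by (rule continuous_closed_preimage[OF c]) auto
 moreover have "bounded S" unfolding S_def by (rule bounded_subset[of "{0..a}"]) auto
 ultimately have cS: "compact S" by (simp add: compact_eq_bounded_closed)
 have "0 \<in> S" using f0 a by (simp add: S_def)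
 then obtain s where s: "s \<in> S" "!!u. u \<in> S ==> u <= s" using compact_attains_sup[OF cS] by auto
 have s': "0 <= s" "f s <= 0" "s < a" using s(1) fa by (auto simp: S_def less_le)
 have pos: "f u > 0" if "s < u" "u <= a" for u
 proof (rule ccontr)
  assume "\<not> f u > 0"
  hence "u \<in> S" using that s' by (simp add: S_def)
  thus False using s(2) that by force
 qed
 have "\<exists>l z. s < z \<and> z < a \<and> (f has_real_derivative l) (at z) \<and> f a - f s = (a - s) * l"
 proof (rule MVT[OF s'(3)])
  show "continuous_on {s..a} f" using s' by (intro continuous_on_subset[OF c]) auto
  show "f differentiable (at x)" if "s < x" "x < a" for x
   using d[of x] that s' by (auto simp: real_differentiable_def)
 qed
 then obtain l z where z: "s < z" "z < a" "(f has_real_derivative l) (at z)" "f a - f s = (a - s) * l" by blast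
 have "l = f' z" using DERIV_unique[OF z(3) d] z s' by simp
 also have "f' z <= 0" using np[of z] pos[of z] z s' by simp
 finally have "(a - s) * l <= 0" using s' by (simp add: mult_nonneg_nonpos)
 thus False using z(4) fa s' by simp
qed

text \<open>\<open>Q\<close> solves an ultrahyperbolic equation in \<open>log r\<close>, \<open>log t\<close>. In the variables
 \<open>\<lambda> = sqrt (r t)\<close> and \<open>\<mu> = sqrt (r / t)\<close> the pair \<open>X = \<lambda> Q\<^sub>\<lambda>\<close>, \<open>Y = \<mu> Q\<^sub>\<mu>\<close> satisfies
 \<open>\<lambda> Y\<^sub>\<lambda> = \<mu> X\<^sub>\<mu> = - (b r - b t) X / 2 - (b r + b t) Y / 2\<close>, which preserves \<open>X \<ge> 0 \<ge> Y\<close>.\<close>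

locale hyperbolic =
 fixes Q Qr Qt Qrr Qrt Qtt :: "real \<times> real => real" and b :: "real => real"
 assumes DQ: "!!p. p \<in> Sq ==> (Q has_derivative (%h. fst h * Qr p + snd h * Qt p)) (at p)"
  and DQr: "!!p. p \<in> Sq ==> (Qr has_derivative (%h. fst h * Qrr p + snd h * Qrt p)) (at p)"
  and DQt: "!!p. p \<in> Sq ==> (Qt has_derivative (%h. fst h * Qrt p + snd h * Qtt p)) (at p)"
  and sym: "!!r t. r \<in> {-1<..<1} ==> t \<in> {-1<..<1} ==> Qt (r, t) = Qr (t, r)"
  and b: "!!r. 0 <= r ==> r < 1 ==> 0 <= b r" "!!r t. 0 <= t ==> t <= r ==> r < 1 ==> b t <= b r"
  and pde: "!!r t. 0 < r ==> r < 1 ==> 0 < t ==> t < 1 ==>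
   r^2 * Qrr (r, t) + r * Qr (r, t) + b r * (r * Qr (r, t)) = t^2 * Qtt (r, t) + t * Qt (r, t) + b t * (t * Qt (r, t))"
  and diag: "!!r. 0 < r ==> r < 1 ==> 0 <= r^2 * Qrr (r, r) + r * Qr (r, r) + b r * (r * Qr (r, r))"
  and CS: "!!r t. r \<in> {0<..<1} ==> t \<in> {0<..<1} ==> 2 * Q (r, t) <= Q (r, r) + Q (t, t)"
begin

lemma curve_deriv:
 assumes "(G has_derivative (%h. fst h * Ga + snd h * Gb)) (at (u s, v s))"
  "(u has_real_derivative u') (at s)" "(v has_real_derivative v') (at s)"
 shows "((%s. G (u s, v s)) has_real_derivative u' * Ga + v' * (Gb::real)) (at s)"
proof -
 have "((%s. (u s, v s)) has_derivative (%h. (u' * h, v' * h))) (at s)"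
  using assms(2,3) unfolding has_field_derivative_def by (intro has_derivative_Pair)
 from has_derivative_compose[OF this assms(1)] show ?thesis
  unfolding has_field_derivative_def by (rule has_derivative_eq_rhs) (auto simp: algebra_simps)
qed

lemma contQr: "continuous_on Sq Qr" and contQt: "continuous_on Sq Qt"
 using has_derivative_continuous[OF DQr] has_derivative_continuous[OF DQt]
 by (auto intro!: continuous_at_imp_continuous_on)

text \<open>By \<open>CS\<close> the function Q(s,s) + Q(t,t) - 2 Q(s,t) of s has its minimum 0 at s
  = t. By \<open>sym\<close> its derivative is 2 Qr(s,s) - 2 Qr(s,t), so its second derivative at t
  is 2 Qrt(t,t).\<close>

lemma Qrt_diag_nonneg:
 assumes t: "0 < t" "t < 1" shows "0 <= Qrt (t, t)"
proof -
 define \<psi> where "\<psi> s = Q (s, s) + Q (t, t) - 2 * Q (s, t)" for s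
 define \<psi>1 where "\<psi>1 s = Qr (s, s) + Qt (s, s) - 2 * Qr (s, t)" for s
 have d1: "(\<psi> has_real_derivative \<psi>1 s) (at s)" if "0 < s" "s < 1" for s
 proof -
  have "((%s. Q (s, s)) has_real_derivative 1 * Qr (s, s) + 1 * Qt (s, s)) (at s)"
   using that by (intro curve_deriv DQ) auto
  moreover have "((%s. Q (s, t)) has_real_derivative 1 * Qr (s, t) + 0 * Qt (s, t)) (at s)"
   using that t by (intro curve_deriv DQ) auto
  ultimately show ?thesis unfolding \<psi>_def[abs_def] \<psi>1_def by (auto intro!: derivative_eq_intros)
 qed
 have d2: "(\<psi>1 has_real_derivative 2 * Qrt (t, t)) (at t)"
 proof -
  have "((%s. Qr (s, s)) has_real_derivative 1 * Qrr (t, t) + 1 * Qrt (t, t)) (at t)"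
   using t by (intro curve_deriv DQr) auto
  moreover have "((%s. Qr (s, t)) has_real_derivative 1 * Qrr (t, t) + 0 * Qrt (t, t)) (at t)"
   using t by (intro curve_deriv DQr) auto
  ultimately have "((%s. 2 * Qr (s, s) - 2 * Qr (s, t)) has_real_derivative 2 * Qrt (t, t)) (at t)"
   by (auto intro!: derivative_eq_intros)
  thus ?thesis
   by (rule has_field_derivative_transform_within_open[of _ _ _ "{0<..<1}"]) (use t sym in \<open>auto simp: \<psi>1_def\<close>)
 qed
 have \<psi>1t: "\<psi>1 t = 0" using sym[of t t] t by (simp add: \<psi>1_def)
 show ?thesis
 proof (rule ccontr)
  assume "\<not> ?thesis"
  hence "2 * Qrt (t, t) < 0" by simp
  from DERIV_neg_dec_right[OF d2 this] obtain d where d: "d > 0" "!!h. 0 < h ==> h < d ==> \<psi>1 (t + h) < \<psi>1 t" by auto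
  define e where "e = min (d/2) ((1 - t)/2)"
  have e: "0 < e" "e < d" "t + e < 1" using d(1) t by (auto simp: e_def min_def field_simps)
  have "\<exists>z. t < z \<and> z < t + e \<and> \<psi> (t + e) - \<psi> t = (t + e - t) * \<psi>1 z"
   using e t by (intro MVT2 d1) auto
  then obtain z where z: "t < z" "z < t + e" "\<psi> (t + e) - \<psi> t = e * \<psi>1 z" by auto
  have "\<psi>1 z < 0" using d(2)[of "z - t"] z e \<psi>1t by simp
  hence "\<psi> (t + e) < 0" using z(3) e(1) mult_pos_neg[of e "\<psi>1 z"] by (simp add: \<psi>_def)
  moreover have "0 <= \<psi> (t + e)" using CS[of "t + e" t] t e by (simp add: \<psi>_def)
  ultimately show False by simp
 qed
qed

text \<open>Where s Qr(s,s) <= 0, \<open>diag\<close> and b >= 0 give s Qrr + Qr >= 0, and with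
  \<open>Qrt_diag_nonneg\<close> the derivative of s Qr(s,s) is nonnegative; this product starts at
  0. The result is the boundary condition on the diagonal for the minimum argument in
  \<open>hyperbolic_signs\<close>.\<close>

lemma Qr_diag_nonneg:
 assumes "0 <= t" "t < 1" shows "0 <= Qr (t, t)"
proof -
 have pos: "0 <= Qr (a, a)" if a: "0 < a" "a < 1" for a
 proof -
  have "- (a * Qr (a, a)) <= 0"
  proof (rule nonpos_if_deriv_nonpos[where f = "%s. - (s * Qr (s, s))" and f' = "%s. - (Qr (s, s) + s * (Qrr (s, s) + Qrt (s, s)))"])
   show "continuous_on {0..a} (%s. - (s * Qr (s, s)))"
    using a by (intro continuous_intros continuous_on_compose2[OF contQr]) auto
   fix s assume s: "0 < s" "s < a"
   have "((%s. Qr (s, s)) has_real_derivative 1 * Qrr (s, s) + 1 * Qrt (s, s)) (at s)"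
    using s a by (intro curve_deriv DQr) auto
   thus "((%s. - (s * Qr (s, s))) has_real_derivative - (Qr (s, s) + s * (Qrr (s, s) + Qrt (s, s)))) (at s)"
    by (auto intro!: derivative_eq_intros)
   assume "0 < - (s * Qr (s, s))"
   hence "s * Qr (s, s) <= 0" by simp
   hence "b s * (s * Qr (s, s)) <= 0" using b(1)[of s] s a by (simp add: mult_nonneg_nonpos)
   hence "0 <= s * (s * Qrr (s, s) + Qr (s, s))"
    using diag[of s] s a by (simp add: power2_eq_square algebra_simps)
   hence "0 <= s * Qrr (s, s) + Qr (s, s)" using s by (simp add: zero_le_mult_iff)
   moreover have "0 <= s * Qrt (s, s)" using Qrt_diag_nonneg[of s] s a by simp
   ultimately show "- (Qr (s, s) + s * (Qrr (s, s) + Qrt (s, s))) <= 0" by (simp add: algebra_simps)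
  qed (use a in auto)
  thus ?thesis using a by (simp add: zero_le_mult_iff)
 qed
 show ?thesis
 proof (cases "t = 0")
  case True
  have "isCont (%s. Qr (s, s)) 0"
  proof -
   have "((%s. Qr (s, s)) has_real_derivative 1 * Qrr (0, 0) + 1 * Qrt (0, 0)) (at 0)"
    by (intro curve_deriv DQr) auto
   thus ?thesis by (rule DERIV_isCont)
  qed
  hence "((%s. Qr (s, s)) \<longlongrightarrow> Qr (0, 0)) (at_right 0)"
   unfolding isCont_def by (rule filterlim_mono) (auto simp: at_within_le_at)
  moreover have "\<forall>\<^sub>F s in at_right 0. 0 <= Qr (s, s)"
   unfolding eventually_at_right_field by (intro exI[of _ 1]) (auto intro: pos)
  ultimately have "0 <= Qr (0, 0)" by (rule tendsto_lowerbound) simp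
  thus ?thesis using True by simp
 qed (use pos assms in auto)
qed

text \<open>At a negative minimum of \<open>exp (- K \<mu>) Q\<^sub>\<lambda>\<close> the two equations contradict each other.\<close>

lemma hyperbolic_signs:
 assumes lb: "0 < lb" and ub: "1 <= ub" and lt: "lb * ub < 1"
  and l: "0 <= l" "l <= lb" and m: "1 <= m" "m <= ub"
 shows "0 <= m * Qr (l * m, l / m) + Qt (l * m, l / m) / m"
  and "l * m * Qr (l * m, l / m) - l / m * Qt (l * m, l / m) <= 0"
proof -
 \<comment> \<open>\<open>x\<close> is the derivative of Q in \<lambda>, that is X / \<lambda>,
   which stays regular at \<lambda> = 0; \<open>Y\<close> is \<mu> times the derivative in
   \<mu>.\<close>
 define x where "x l m = m * Qr (l * m, l / m) + Qt (l * m, l / m) / m" for l m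
 define Y where "Y m l = l * m * Qr (l * m, l / m) - l / m * Qt (l * m, l / m)" for l m
 define b1 where "b1 = b (lb * ub)"
 have dom: "l * m \<in> {-1<..<1} \<and> l / m \<in> {-1<..<1} \<and> 0 <= l / m \<and> l / m <= l * m \<and> l * m <= lb * ub"
  if "0 <= l" "l <= lb" "1 <= m" "m <= ub" for l m
 proof -
  have 1: "l * m <= lb * ub" using that lb by (intro mult_mono) auto
  have "l / m <= l / 1" using that by (intro divide_left_mono) auto
  moreover have "l * 1 <= l * m" using that by (intro mult_left_mono) auto
  ultimately have 2: "l / m <= l * m" by linarith
  have "0 <= l / m" "0 <= l * m" using that by auto
  thus ?thesis using 1 2 lt by (auto intro: less_le_trans[of _ 0] le_less_trans)
 qed
 have b1: "0 <= b1" unfolding b1_def using lb ub lt by (intro b) auto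
 have bb: "0 <= b (l * m) - b (l / m)" "0 <= b (l / m)" "b (l * m) <= b1"
  if "0 <= l" "l <= lb" "1 <= m" "m <= ub" for l m
  using dom[OF that] lt b(1)[of "l / m"] b(2)[of "l / m" "l * m"] b(2)[of "l * m" "lb * ub"]
  by (auto simp: b1_def)
 \<comment> \<open>The left side without its factor l is both the l-derivative of Y
   (\<open>dY\<close>) and m times the m-derivative of x (\<open>dx\<close>), because the terms with
   \<open>Qrt\<close> cancel in both. One equation thus drives both quantities.\<close>
 have deq: "l * (m * (l * (m * Qrr (l * m, l / m)) + Qr (l * m, l / m)) - (Qt (l * m, l / m) + l / m * Qtt (l * m, l / m)) / m)
  = - (b (l * m) - b (l / m)) / 2 * (l * x l m) - (b (l * m) + b (l / m)) / 2 * Y m l"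
  if "0 < l" "l <= lb" "1 <= m" "m <= ub" for l m
 proof -
  have "0 < l * m" "0 < l / m" using that by auto
  moreover have "l * m < 1" "l / m < 1" using dom[of l m] that lt by auto
  ultimately have e: "(l * m)^2 * Qrr (l * m, l / m) + l * m * Qr (l * m, l / m) + b (l * m) * (l * m * Qr (l * m, l / m))
    = (l / m)^2 * Qtt (l * m, l / m) + l / m * Qt (l * m, l / m) + b (l / m) * (l / m * Qt (l * m, l / m))"
   by (intro pde)
  define q1 q2 q3 q4 c1 c2 where "q1 = Qr (l * m, l / m)" and "q2 = Qt (l * m, l / m)" and "q3 = Qrr (l * m, l / m)" and "q4 = Qtt (l * m, l / m)"
   and "c1 = b (l * m)" and "c2 = b (l / m)"
  define k where "k = l / m"
  have lk: "l * q2 / m = k * q2" "l * (l * q4 / m) / m = k^2 * q4" for q2 q4 by (simp_all add: k_def power2_eq_square)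
  have "l * (m * (l * (m * q3) + q1) - (q2 + l / m * q4) / m) = ((l * m)^2 * q3 + l * m * q1) - (k^2 * q4 + k * q2)"
   by (simp add: k_def power2_eq_square algebra_simps add_divide_distrib diff_divide_distrib)
  also have "... = c2 * (k * q2) - c1 * (l * m * q1)"
   unfolding q1_def q2_def q3_def q4_def c1_def c2_def k_def using e by linarith
  also have "... = - (c1 - c2) / 2 * (l * m * q1 + k * q2) - (c1 + c2) / 2 * (l * m * q1 - k * q2)"
   by (simp add: field_simps)
  finally show ?thesis
   unfolding x_def Y_def q1_def[symmetric] q2_def[symmetric] q3_def[symmetric] q4_def[symmetric] c1_def[symmetric] c2_def[symmetric]
   by (simp add: k_def algebra_simps)
 qed
 have dY: "(Y m has_real_derivative (m * (l * (m * Qrr (l * m, l / m)) + Qr (l * m, l / m)) - (Qt (l * m, l / m) + l / m * Qtt (l * m, l / m)) / m)) (at l)"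
  if "0 < l" "l <= lb" "1 <= m" "m <= ub" for l m
 proof -
  have p: "(l * m, l / m) \<in> Sq" using dom[of l m] that by auto
  have u: "((%l. l * m) has_real_derivative m) (at l)" "((%l. l / m) has_real_derivative 1 / m) (at l)"
   using that by (auto intro!: derivative_eq_intros)
  show ?thesis unfolding Y_def[abs_def]
   using that by (auto intro!: derivative_eq_intros curve_deriv[OF DQr[OF p] u] curve_deriv[OF DQt[OF p] u] simp: field_simps)
 qed
 have contY: "continuous_on {0..lb} (Y m)" if "1 <= m" "m <= ub" for m
  unfolding Y_def[abs_def] using that dom[OF _ _ that]
  by (intro continuous_intros continuous_on_compose2[OF contQr] continuous_on_compose2[OF contQt]) auto
 have dx: "((%m. x l m) has_real_derivative
   (m * (l * (m * Qrr (l * m, l / m)) + Qr (l * m, l / m)) - (Qt (l * m, l / m) + l / m * Qtt (l * m, l / m)) / m) / m) (at m)"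
  if "0 <= l" "l <= lb" "1 <= m" "m <= ub" for l m
 proof -
  have p: "(l * m, l / m) \<in> Sq" using dom[of l m] that by auto
  have u: "((%m. l * m) has_real_derivative l) (at m)" "((%m. l / m) has_real_derivative - (l / m^2)) (at m)"
   using that by (auto intro!: derivative_eq_intros simp: power2_eq_square)
  have m: "m \<noteq> 0" using that by simp
  show ?thesis unfolding x_def[abs_def]
   by (rule DERIV_cong[OF DERIV_add[OF DERIV_mult[OF DERIV_ident curve_deriv[OF DQr[OF p] u]]
       DERIV_divide[OF curve_deriv[OF DQt[OF p] u] DERIV_ident m]]])
    (use m in \<open>simp add: field_simps power2_eq_square\<close>)
 qed
 \<comment> \<open>Integration in l from Y = 0 at l = 0. Where Y exceeds the bound it is positive,
   so its own term in \<open>deq\<close> only lowers the derivative, and the other term is at most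
   b1 c l / 2.\<close>
 have Ybound: "Y m l <= b1 / 2 * c * l"
  if lm: "0 <= l" "l <= lb" "1 <= m" "m <= ub" and c: "0 <= c" "!!l. 0 <= l ==> l <= lb ==> - c <= x l m" for l m c
 proof -
  let ?d = "%l. (m * (l * (m * Qrr (l * m, l / m)) + Qr (l * m, l / m)) - (Qt (l * m, l / m) + l / m * Qtt (l * m, l / m)) / m)"
  have "Y m l - b1 / 2 * c * l <= 0"
  proof (rule nonpos_if_deriv_nonpos[where f = "%l. Y m l - b1 / 2 * c * l" and f' = "%l. ?d l - b1 / 2 * c"])
   show "continuous_on {0..l} (%l. Y m l - b1 / 2 * c * l)"
    using lm by (intro continuous_intros continuous_on_subset[OF contY]) auto
   fix s assume s: "0 < s" "s < l"
   have sm: "0 < s" "s <= lb" "1 <= m" "m <= ub" using s lm by auto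
   show "((%l. Y m l - b1 / 2 * c * l) has_real_derivative ?d s - b1 / 2 * c) (at s)"
    by (auto intro!: derivative_eq_intros dY[OF sm])
   assume "0 < Y m s - b1 / 2 * c * s"
   moreover have "0 <= b1 / 2 * c * s" using b1 c(1) s by (intro mult_nonneg_nonneg) auto
   ultimately have Yp: "0 < Y m s" by linarith
   have bs: "0 <= b (s * m) - b (s / m)" "0 <= b (s / m)" "b (s * m) <= b1" using bb[of s m] sm by auto
   have "s * ?d s = - (b (s * m) - b (s / m)) / 2 * (s * x s m) - (b (s * m) + b (s / m)) / 2 * Y m s"
    by (rule deq[OF sm])
   moreover have "- (b (s * m) - b (s / m)) / 2 * (s * x s m) <= b1 / 2 * (s * c)"
   proof -
    have "(b (s * m) - b (s / m)) / 2 * (s * - x s m) <= (b (s * m) - b (s / m)) / 2 * (s * c)"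
     using bs s c(2)[of s] sm by (intro mult_left_mono) auto
    also have "... <= b1 / 2 * (s * c)" using bs s c(1) by (intro mult_right_mono) auto
    finally show ?thesis by (simp add: algebra_simps)
   qed
   moreover have "0 <= (b (s * m) + b (s / m)) / 2 * Y m s" using bs Yp by (intro mult_nonneg_nonneg) auto
   moreover have "s * (b1 / 2 * c) = b1 / 2 * (s * c)" by simp
   ultimately have "s * ?d s <= s * (b1 / 2 * c)" by linarith
   thus "?d s - b1 / 2 * c <= 0" using s by simp
  qed (use lm in \<open>auto simp: Y_def\<close>)
  thus ?thesis by simp
 qed
 have xpos: "0 <= x l m" if lm: "0 <= l" "l <= lb" "1 <= m" "m <= ub" for l m
 proof (rule ccontr)
  assume neg: "\<not> 0 <= x l m"
  \<comment> \<open>Any K > b1^2 / 2 serves: at a minimum of x exp (-K m) with x = -c < 0 the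
    equations give an m-derivative of x of at least - b1^2 c / 2, and the exponential turns this
    into a positive derivative.\<close>
  define K where "K = b1^2 + 1"
  let ?D = "{0..lb} \<times> {1..ub}"
  let ?\<Omega> = "%p. x (fst p) (snd p) * exp (- K * snd p)"
  have "continuous_on ?D ?\<Omega>"
   unfolding x_def using dom
   by (intro continuous_intros continuous_on_compose2[OF contQr] continuous_on_compose2[OF contQt]) (fastforce simp: split_beta)+
  moreover have "compact ?D" by (intro compact_Times) auto
  moreover have "?D \<noteq> {}" using lb ub by auto
  ultimately obtain p where p: "p \<in> ?D" "!!q. q \<in> ?D ==> ?\<Omega> p <= ?\<Omega> q"
   using continuous_attains_inf[of ?D ?\<Omega>] by blast
  obtain l0 m0 where p0: "p = (l0, m0)" by (cases p)
  have d0: "0 <= l0" "l0 <= lb" "1 <= m0" "m0 <= ub" using p(1) p0 by auto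
  have min: "x l0 m0 * exp (- K * m0) <= x l m * exp (- K * m)" if "0 <= l" "l <= lb" "1 <= m" "m <= ub" for l m
   using p(2)[of "(l, m)"] that by (simp add: p0)
  have "x l m * exp (- K * m) < 0" using neg by (simp add: mult_neg_pos)
  hence "x l0 m0 * exp (- K * m0) < 0" using min[OF lm] by linarith
  hence x0: "x l0 m0 < 0" by (simp add: mult_less_0_iff)
  define c where "c = - x l0 m0"
  have c: "c > 0" using x0 by (simp add: c_def)
  \<comment> \<open>There is no negative minimum on two of the edges: x(0,m) = (m + 1/m) Qr(0,0) and
    x(l,1) = 2 Qr(l,l) are nonnegative. Hence m0 > 1, and there is room to step to the left in
    m.\<close>
  have l0: "l0 > 0"
  proof (rule ccontr)
   assume "\<not> l0 > 0"
   hence "l0 = 0" using d0 by simp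
   hence "x l0 m0 = m0 * Qr (0, 0) + Qr (0, 0) / m0" using sym[of 0 0] by (simp add: x_def)
   moreover have "0 <= m0 * Qr (0, 0)" "0 <= Qr (0, 0) / m0" using Qr_diag_nonneg[of 0] d0 by auto
   ultimately show False using x0 by linarith
  qed
  have m0: "m0 > 1"
  proof (rule ccontr)
   assume "\<not> m0 > 1"
   hence m: "m0 = 1" using d0 by simp
   have "lb * 1 <= lb * ub" using ub lb by (intro mult_left_mono) auto
   hence "l0 < 1" using d0 lt by linarith
   hence "x l0 m0 = 2 * Qr (l0, l0)" using m d0 sym[of l0 l0] by (simp add: x_def)
   thus False using Qr_diag_nonneg[of l0] \<open>l0 < 1\<close> d0 x0 by simp
  qed
  have Y0: "Y m0 l0 <= b1 / 2 * c * l0"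
  proof (rule Ybound[OF d0])
   show "- c <= x l m0" if "0 <= l" "l <= lb" for l
    using min[OF that d0(3,4)] by (simp add: c_def)
  qed (use c in simp)
  let ?d = "(m0 * (l0 * (m0 * Qrr (l0 * m0, l0 / m0)) + Qr (l0 * m0, l0 / m0)) - (Qt (l0 * m0, l0 / m0) + l0 / m0 * Qtt (l0 * m0, l0 / m0)) / m0)"
  have bs: "0 <= b (l0 * m0) - b (l0 / m0)" "0 <= b (l0 / m0)" "b (l0 * m0) <= b1" using bb[of l0 m0] d0 by auto
  have "- (b1^2 / 2 * c) * l0 <= l0 * ?d"
  proof -
   have e: "l0 * ?d = - (b (l0 * m0) - b (l0 / m0)) / 2 * (l0 * x l0 m0) - (b (l0 * m0) + b (l0 / m0)) / 2 * Y m0 l0"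
    by (rule deq[OF l0 d0(2-4)])
   have 1: "0 <= (b (l0 * m0) - b (l0 / m0)) / 2 * (l0 * - x l0 m0)" using bs l0 x0 by (intro mult_nonneg_nonneg) auto
   have "(b (l0 * m0) + b (l0 / m0)) / 2 * Y m0 l0 <= (b (l0 * m0) + b (l0 / m0)) / 2 * (b1 / 2 * c * l0)"
    using bs Y0 by (intro mult_left_mono) auto
   also have "... <= b1 * (b1 / 2 * c * l0)" using bs b1 c l0 by (intro mult_right_mono) auto
   finally have 2: "(b (l0 * m0) + b (l0 / m0)) / 2 * Y m0 l0 <= b1 * (b1 / 2 * c * l0)" .
   have "- (u - v) / 2 * (p * q) = (u - v) / 2 * (p * - q)" for u v p q :: real by (simp add: field_simps)
   hence 3: "- (b (l0 * m0) - b (l0 / m0)) / 2 * (l0 * x l0 m0) = (b (l0 * m0) - b (l0 / m0)) / 2 * (l0 * - x l0 m0)"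
    "- (b1^2 / 2 * c) * l0 = - (b1 * (b1 / 2 * c * l0))" by (blast, simp add: power2_eq_square)
   show ?thesis using 1 2 unfolding e 3 by linarith
  qed
  hence "l0 * (- (b1^2 / 2 * c)) <= l0 * ?d" by (simp add: mult.commute)
  hence dge: "- (b1^2 / 2 * c) <= ?d" unfolding mult_le_cancel_left_pos[OF l0] .
  have D: "((%m. x l0 m * exp (- K * m)) has_real_derivative (?d / m0 - K * x l0 m0) * exp (- K * m0)) (at m0)"
   by (auto intro!: derivative_eq_intros dx[OF d0] simp: algebra_simps)
  have "- (b1^2 / 2 * c) <= ?d / m0"
  proof (cases "?d \<ge> 0")
   case True
   have "- (b1^2 / 2 * c) <= 0" using c by simp
   also have "0 <= ?d / m0" using True m0 by (intro divide_nonneg_nonneg) auto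
   finally show ?thesis .
  next
   case False
   have "?d * m0 <= ?d * 1" using False m0 by (intro mult_left_mono_neg) auto
   hence "?d <= ?d / m0" using m0 by (simp add: pos_le_divide_eq)
   thus ?thesis using dge by linarith
  qed
  moreover have "K * c > b1^2 / 2 * c"
  proof -
   have "b1^2 / 2 < K" unfolding K_def using zero_le_power2[of b1] by linarith
   thus ?thesis using c by (rule mult_strict_right_mono)
  qed
  ultimately have "?d / m0 + K * c > 0" by linarith
  hence "0 < (?d / m0 - K * x l0 m0) * exp (- K * m0)" by (simp add: c_def)
  from DERIV_pos_inc_left[OF D this] obtain e where e: "e > 0"
   "!!h. 0 < h ==> h < e ==> x l0 (m0 - h) * exp (- K * (m0 - h)) < x l0 m0 * exp (- K * m0)" by auto
  define h where "h = min (e/2) (m0 - 1)"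
  have h: "0 < h" "h < e" "1 <= m0 - h" "m0 - h <= ub" using e(1) m0 d0 by (auto simp: h_def)
  from e(2)[OF h(1,2)] min[OF d0(1,2) h(3,4)] show False by linarith
 qed
 show "0 <= m * Qr (l * m, l / m) + Qt (l * m, l / m) / m" using xpos[OF l m] by (simp add: x_def)
 show "l * m * Qr (l * m, l / m) - l / m * Qt (l * m, l / m) <= 0"
  using Ybound[OF l m, of 0] xpos m by (simp add: Y_def)
qed

text \<open>With l = sqrt (r t) and m = sqrt (r / t) the point is (l m, l / m). By
  \<open>hyperbolic_signs\<close>, Q decreases along m from the diagonal point m = 1 and increases
  along l from the origin.\<close>

theorem hyperbolic_bound:
 assumes "0 < t" "t <= r" "r < 1"
 shows "Q (0, 0) <= Q (r, t)" "Q (r, t) <= Q (sqrt (r * t), sqrt (r * t))"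
proof -
 define l m where "l = sqrt (r * t)" and "m = sqrt (r / t)"
 have l: "0 < l" and m: "1 <= m" using assms by (auto simp: l_def m_def)
 have lm: "l * m = r" "l / m = t"
  using assms by (simp_all add: l_def m_def real_sqrt_mult[symmetric] real_sqrt_divide[symmetric])
 have lm1: "l * m < 1" using assms by (simp add: lm)
 have dom: "(l' * m', l' / m') \<in> Sq" if "0 <= l'" "l' <= l" "1 <= m'" "m' <= m" for l' m'
 proof -
  have "l' * m' <= l * m" using that l by (intro mult_mono) auto
  moreover have "l' / m' <= l' * m'"
  proof -
   have "l' / m' <= l' / 1" using that by (intro divide_left_mono) auto
   moreover have "l' * 1 <= l' * m'" using that by (intro mult_left_mono) auto
   ultimately show ?thesis by linarith
  qed
  moreover have "0 <= l' / m'" "0 <= l' * m'" using that by auto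
  ultimately show ?thesis using lm1 by (auto intro: less_le_trans[of _ 0])
 qed
 have "Q (l * m, l / m) <= Q (l * 1, l / 1)"
 proof (rule DERIV_nonpos_imp_nonincreasing[of 1 m "%m. Q (l * m, l / m)", OF m])
  fix s assume s: "1 <= s" "s <= m"
  have "((%m. Q (l * m, l / m)) has_real_derivative l * Qr (l * s, l / s) + (- (l / s^2)) * Qt (l * s, l / s)) (at s)"
   using s l by (intro curve_deriv DQ dom) (auto intro!: derivative_eq_intros simp: power2_eq_square)
  moreover have "l * Qr (l * s, l / s) + (- (l / s^2)) * Qt (l * s, l / s) = (l * s * Qr (l * s, l / s) - l / s * Qt (l * s, l / s)) / s"
   using s by (simp add: field_simps power2_eq_square)
  moreover have "... <= 0" using hyperbolic_signs(2)[OF l m lm1, of l s] s l by (intro divide_nonpos_nonneg) auto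
  ultimately show "\<exists>y. ((%m. Q (l * m, l / m)) has_real_derivative y) (at s) \<and> y <= 0" by metis
 qed
 thus "Q (r, t) <= Q (sqrt (r * t), sqrt (r * t))" unfolding lm by (simp add: l_def)
 have "Q (0 * m, 0 / m) <= Q (l * m, l / m)"
 proof (rule DERIV_nonneg_imp_nondecreasing[of 0 l "%l. Q (l * m, l / m)"])
  fix s assume s: "0 <= s" "s <= l"
  have "((%l. Q (l * m, l / m)) has_real_derivative m * Qr (s * m, s / m) + (1 / m) * Qt (s * m, s / m)) (at s)"
   using s m by (intro curve_deriv DQ dom) (auto intro!: derivative_eq_intros)
  moreover have "0 <= m * Qr (s * m, s / m) + (1 / m) * Qt (s * m, s / m)"
   using hyperbolic_signs(1)[OF l m lm1, of s m] s m by simp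
  ultimately show "\<exists>y. ((%l. Q (l * m, l / m)) has_real_derivative y) (at s) \<and> 0 <= y" by blast
 qed (use l in simp)
 thus "Q (0, 0) <= Q (r, t)" unfolding lm by simp
qed

end

section \<open>Bounds for the kernel\<close>

text \<open>\<open>sg\<close> is of second order in the distance, hence \<delta>^2 in the hypothesis
  and \<delta> in the conclusion. All distances to the boundary are comparable to \<open>A\<close>;
  36 is 9 from the numerator divided by 1/4 from the denominator.\<close>

lemma sg_lipschitz:
 fixes x y z :: "real^'n"
 assumes x: "x \<in> UB" and y: "y \<in> UB" and z: "z \<in> UB"
  and s: "sg x z <= 1/16" "sg y z <= 1/16" and d: "sg x y <= \<delta>^2" "0 <= \<delta>" "\<delta>^2 <= 1/16"
 shows "\<bar>sg x z - sg y z\<bar> <= 36 * \<delta>"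
proof -
 define A A' B where "A = dl x" and "A' = dl y" and "B = dl z"
 have A: "A > 0" "A' > 0" "B > 0" using dl_pos x y z by (auto simp: A_def A'_def B_def)
 have cmp: "A' <= 2 * A" "A <= 2 * A'" "B <= 2 * A" "A <= 2 * B" "B <= 2 * A'" "A' <= 2 * B"
  using sg_comparable[OF x y] sg_comparable[OF y x] sg_comparable[OF x z] sg_comparable[OF z x] sg_comparable[OF y z] sg_comparable[OF z y] s d
  by (auto simp: A_def A'_def B_def sg_sym)
 have nxy: "norm (x - y) <= 2 * \<delta> * A"
 proof (rule power2_le_imp_le)
  have "(norm (y - x))^2 = sg x y * (A * A')" using sg_eq[OF x y] by (simp add: A_def A'_def)
  also have "... <= \<delta>^2 * (A * (2 * A))" using d A cmp sg_nonneg[OF x y] by (intro mult_mono) auto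
  also have "... <= (2 * \<delta> * A)^2" using A by (simp add: power2_eq_square)
  finally show "(norm (x - y))^2 <= (2 * \<delta> * A)^2" by (simp add: norm_minus_commute)
 qed (use d A in auto)
 have nxz: "norm (z - x) <= A"
 proof (rule power2_le_imp_le)
  have "(norm (z - x))^2 = sg x z * (A * B)" using sg_eq[OF x z] by (simp add: A_def B_def)
  also have "... <= 1/16 * (A * (2 * A))" using s A cmp sg_nonneg[OF x z] by (intro mult_mono) auto
  also have "... <= A^2" using A by (simp add: power2_eq_square)
  finally show "(norm (z - x))^2 <= A^2" .
 qed (use A in auto)
 have nyz2: "(norm (z - y))^2 <= A^2 / 4"
 proof -
  have "(norm (z - y))^2 = sg y z * (A' * B)" using sg_eq[OF y z] by (simp add: A'_def B_def)
  also have "... <= 1/16 * ((2 * A) * (2 * A))" using s A cmp sg_nonneg[OF y z] by (intro mult_mono) auto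
  finally show ?thesis by (simp add: power2_eq_square)
 qed
 have nyz: "norm (z - y) <= A"
 proof (rule power2_le_imp_le)
  show "(norm (z - y))^2 <= A^2" using nyz2 zero_le_power2[of A] by linarith
 qed (use A in simp)
 define P P' where "P = (norm (z - x))^2" and "P' = (norm (z - y))^2"
 have PP: "\<bar>P - P'\<bar> <= 4 * \<delta> * A^2"
 proof -
  have "P - P' = (norm (z - x) - norm (z - y)) * (norm (z - x) + norm (z - y))"
   by (simp add: P_def P'_def power2_eq_square algebra_simps)
  hence "\<bar>P - P'\<bar> = \<bar>norm (z - x) - norm (z - y)\<bar> * (norm (z - x) + norm (z - y))" by (simp add: abs_mult)
  also have "... <= (2 * \<delta> * A) * (A + A)"
  proof (intro mult_mono)
   have "\<bar>norm (z - x) - norm (z - y)\<bar> <= norm ((z - x) - (z - y))" by (rule norm_triangle_ineq3)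
   also have "... = norm (x - y)" by (simp add: norm_minus_commute)
   finally show "\<bar>norm (z - x) - norm (z - y)\<bar> <= 2 * \<delta> * A" using nxy by simp
  qed (use nxz nyz d A in auto)
  finally show ?thesis by (simp add: power2_eq_square)
 qed
 have AA: "\<bar>A' - A\<bar> <= 4 * \<delta> * A"
  using norm_sq_diff_le[OF y x] nxy by (simp add: A_def A'_def)
 have "\<bar>P * A' - P' * A\<bar> = \<bar>(P - P') * A' + P' * (A' - A)\<bar>" by (simp add: algebra_simps)
 also have "... <= \<bar>P - P'\<bar> * A' + P' * \<bar>A' - A\<bar>"
  using A by (intro order_trans[OF abs_triangle_ineq]) (simp add: abs_mult P'_def)
 also have "... <= (4 * \<delta> * A^2) * (2 * A) + (A^2 / 4) * (4 * \<delta> * A)"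
  using PP AA nyz2 A cmp d by (intro add_mono mult_mono) (auto simp: P'_def)
 finally have num: "\<bar>P * A' - P' * A\<bar> <= 9 * \<delta> * A^3" by (simp add: power2_eq_square power3_eq_cube algebra_simps)
 have den: "A^3 / 4 <= A * A' * B"
 proof -
  have "A * (A / 2) * (A / 2) <= A * A' * B" using A cmp by (intro mult_mono) auto
  thus ?thesis by (simp add: power3_eq_cube)
 qed
 have "sg x z - sg y z = (P * A' - P' * A) / (A * A' * B)"
  using A by (simp add: sg_def P_def[symmetric] P'_def[symmetric] A_def[symmetric] A'_def[symmetric] B_def[symmetric] field_simps)
 hence "\<bar>sg x z - sg y z\<bar> = \<bar>P * A' - P' * A\<bar> / (A * A' * B)" using A by (simp add: abs_divide abs_mult)
 also have "... <= (9 * \<delta> * A^3) / (A^3 / 4)" using num den A d by (intro frac_le) auto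
 also have "... = 36 * \<delta>" using A by simp
 finally show ?thesis .
qed

context bergman begin

lemma kd_lipschitz:
 obtains C where "0 < C"
  "!!x y z \<delta>. x \<in> UB ==> y \<in> UB ==> z \<in> UB ==> sg x y <= \<delta>^2 ==> 0 <= \<delta> ==> \<delta>^2 <= 1/128 ==>
   \<bar>kd x z - kd y z\<bar> <= C * \<delta> * wi z \<and> (1/16 < sg x z --> kd x z - kd y z = 0)"
proof -
 obtain D where D: "D > 0" "!!t. \<bar>bump1 (1/128) t\<bar> <= D" using exists_bump_bound by blast
 define J where "J = ball_mass (0::real^'n) * nu_const TYPE('n)"
 have J: "J > 0" using ball_mass_pos[OF n] nu_const_pos[where 'n='n] by (simp add: J_def)
 have kJ: "kd x z = bump (1/128) (sg x z) * (wi z / J)" for x z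
  by (simp add: kd_def lk_def J_def)
 show ?thesis
 proof (rule that[of "36 * D / J"])
  show "0 < 36 * D / J" using D J by simp
  fix x y z :: "real^'n" and \<delta>
  assume x: "x \<in> UB" and y: "y \<in> UB" and z: "z \<in> UB" and d: "sg x y <= \<delta>^2" "0 <= \<delta>" "\<delta>^2 <= 1/128"
  let ?w = "wi z"
  \<comment> \<open>Unless both kernels vanish at z, one of the two points is within 1/128 of z, and
    \<open>sg_triangle\<close> puts the other within 8/128 = 1/16, the range of
    \<open>sg_lipschitz\<close>.\<close>
  have near: "sg x z <= 1/16 \<and> sg y z <= 1/16" if "\<not> (1/128 <= sg x z \<and> 1/128 <= sg y z)"
  proof -
   have d': "sg x y <= 1/128" "sg y x <= 1/128" using d by (auto simp: sg_sym)
   from that have "sg x z <= 1/128 \<or> sg y z <= 1/128" by auto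
   thus ?thesis using sg_triangle[OF x y z d'(1)] sg_triangle[OF y x z d'(2)] by auto
  qed
  have 1: "\<bar>bump (1/128) (sg x z) - bump (1/128) (sg y z)\<bar> <= D * (36 * \<delta>)"
  proof (cases "1/128 <= sg x z \<and> 1/128 <= sg y z")
   case True
   thus ?thesis using D d by (simp add: bump_zero)
  next
   case False
   have "\<bar>bump (1/128) (sg x z) - bump (1/128) (sg y z)\<bar> <= D * \<bar>sg x z - sg y z\<bar>" by (rule bump_lipschitz[OF D(2)])
   also have "... <= D * (36 * \<delta>)" using near[OF False] D d by (intro mult_left_mono sg_lipschitz x y z) auto
   finally show ?thesis .
  qed
  have "\<bar>kd x z - kd y z\<bar> = \<bar>bump (1/128) (sg x z) - bump (1/128) (sg y z)\<bar> * (?w / J)"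
   unfolding kJ left_diff_distrib[symmetric] using J by (simp add: abs_mult)
  also have "... <= D * (36 * \<delta>) * (?w / J)" using 1 J by (intro mult_right_mono) auto
  finally have "\<bar>kd x z - kd y z\<bar> <= 36 * D / J * \<delta> * ?w" by (simp add: mult_ac)
  moreover have "kd x z - kd y z = 0" if "1/16 < sg x z"
  proof -
   have "1/128 <= sg x z \<and> 1/128 <= sg y z"
   proof (rule ccontr)
    assume "\<not> ?thesis"
    from near[OF this] that show False by simp
   qed
   thus ?thesis by (simp add: kd_zero)
  qed
  ultimately show "\<bar>kd x z - kd y z\<bar> <= 36 * D / J * \<delta> * ?w \<and> (1/16 < sg x z --> kd x z - kd y z = 0)" by blast
 qed
qed

definition nb :: "real^'n => (real^'n) set" where "nb x = {z \<in> UB. sg x z <= 1/16}"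

lemma nb_Int_ball [simp]: "nb x \<inter> UB = nb x"
 by (auto simp: nb_def)

lemma nb_sets: assumes "x \<in> UB" shows "nb x \<in> sets borel" "nb x \<in> sets M"
proof -
 have "closedin (top_of_set UB) (UB \<inter> sg x -` {..1/16})"
  by (intro continuous_closedin_preimage has_partials_continuous[OF has_partials_sg]) auto
 moreover have "UB \<inter> sg x -` {..1/16} = nb x" by (auto simp: nb_def)
 ultimately obtain T where T: "closed T" "nb x = UB \<inter> T" by (auto simp: closedin_closed)
 thus b: "nb x \<in> sets borel" by auto
 show "nb x \<in> sets M"
  unfolding sets_nu_weighted using b by (subst sets_restrict_space_iff) (auto simp: nb_def)
qed

text \<open>\<open>nb x\<close> lies in the Euclidean ball about x with radius 1 - |x|^2, and on it
  the density exceeds its value at x by at most the factor 2^|\<alpha>|.\<close>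

lemma measure_nb:
 obtains C where "0 < C" "!!x. x \<in> UB ==> measure M (nb x) <= C * (dl x) powr (real CARD('n) + \<alpha>)"
proof -
 define V where "V = nu_const TYPE('n) * 2 powr \<bar>\<alpha>\<bar> * unit_ball_vol (real CARD('n))"
 have V: "V > 0" using nu_const_pos[where 'n='n] by (simp add: V_def)
 show ?thesis
 proof (rule that[OF V])
  fix x :: "real^'n" assume x: "x \<in> UB"
  define A where "A = dl x"
  have A: "0 < A" using dl_pos[OF x] by (simp add: A_def)
  have sub: "nb x \<subseteq> cball x A"
  proof
   fix z assume z: "z \<in> nb x"
   hence zb: "z \<in> UB" "sg x z <= 1/16" by (auto simp: nb_def)
   have B: "0 < dl z" "dl z <= 2 * A" using dl_pos[OF zb(1)] sg_comparable[OF x zb] by (auto simp: A_def)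
   have "(norm (z - x))^2 = sg x z * (A * (dl z))" using sg_eq[OF x zb(1)] by (simp add: A_def)
   also have "... <= 1/16 * (A * (2 * A))" using zb B A sg_nonneg[OF x zb(1)] by (intro mult_mono) auto
   also have "... <= A^2" using A by (simp add: power2_eq_square)
   finally have "norm (z - x) <= A" by (rule power2_le_imp_le) (use A in simp)
   thus "z \<in> cball x A" by (simp add: dist_norm norm_minus_commute)
  qed
  have meas: "set_borel_measurable lborel UB (indicator (nb x) :: real^'n => real)"
   unfolding set_borel_measurable_def using nb_sets(1)[OF x] by (intro borel_measurable_scaleR borel_measurable_indicator) auto
  have icb: "integrable lborel (%z. indicator (cball x A) z * (2 powr \<bar>\<alpha>\<bar> * A powr \<alpha>))"
   using emeasure_bounded_finite[OF bounded_cball, of x A] by (intro integrable_mult_left integrable_real_indicator) auto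
  have "measure M (nb x) = (\<integral>z. indicator (nb x) z \<partial>M)"
   using nb_sets(2)[OF x] by simp
  also have "... = nu_const TYPE('n) * (LBINT z:UB. (dl z) powr \<alpha> * indicator (nb x) z)"
   using integral_nu_weighted(2)[OF meas, of \<alpha>] by simp
  also have "(LBINT z:UB. (dl z) powr \<alpha> * indicator (nb x) z) <= (LBINT z. indicator (cball x A) z * (2 powr \<bar>\<alpha>\<bar> * A powr \<alpha>))"
   unfolding set_lebesgue_integral_def
  proof (rule integral_mono')
   show "integrable lborel (%z. indicator (cball x A) z * (2 powr \<bar>\<alpha>\<bar> * A powr \<alpha>))" by (rule icb)
   fix z :: "real^'n"
   show "0 <= indicator (cball x A) z * (2 powr \<bar>\<alpha>\<bar> * A powr \<alpha>)" by simp
   show "indicator UB z *\<^sub>R ((dl z) powr \<alpha> * indicator (nb x) z) <= indicator (cball x A) z * (2 powr \<bar>\<alpha>\<bar> * A powr \<alpha>)"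
   proof (cases "z \<in> nb x")
    case True
    hence zb: "z \<in> UB" "sg x z <= 1/16" "sg z x <= 1/16" by (auto simp: nb_def sg_sym)
    have "(dl z) powr \<alpha> <= 2 powr \<bar>\<alpha>\<bar> * A powr \<alpha>"
     unfolding A_def using sg_comparable[OF x zb(1,2)] sg_comparable[OF zb(1) x zb(3)]
     by (intro powr_comparable dl_pos x zb(1)) auto
    moreover have "z \<in> cball x A" using sub True by blast
    ultimately show ?thesis using True zb(1) by (simp del: mem_ball mem_cball)
   qed simp
  qed
  also have "(LBINT z. indicator (cball x A) z * (2 powr \<bar>\<alpha>\<bar> * A powr \<alpha>)) = measure lborel (cball x A) * (2 powr \<bar>\<alpha>\<bar> * A powr \<alpha>)"
   using emeasure_bounded_finite[OF bounded_cball, of x A] by simp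
  also have "measure lborel (cball x A) = unit_ball_vol (real CARD('n)) * A ^ CARD('n)"
   using content_cball[of A x] A by simp
  finally have "measure M (nb x) <= nu_const TYPE('n) * (unit_ball_vol (real CARD('n)) * A ^ CARD('n) * (2 powr \<bar>\<alpha>\<bar> * A powr \<alpha>))"
   using nu_const_pos[where 'n='n] by (simp add: mult_left_mono)
  also have "... = V * (A powr (real CARD('n) + \<alpha>))" using A by (simp add: V_def powr_add powr_realpow mult_ac)
  finally show "measure M (nb x) <= V * (dl x) powr (real CARD('n) + \<alpha>)" by (simp add: A_def)
 qed
qed

text \<open>Subtract the mean value formulas at x and y: the kernels differ by O(\<delta> wi), and
  only on \<open>nb x\<close>, whose mass is O(1 / wi). This serves both the continuity of the
  kernel and gradient bounds.\<close>

lemma local_lipschitz: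
 obtains C where "0 < C"
  "!!g x y \<delta> B. g \<in> h_harmonic ==> x \<in> UB ==> y \<in> UB ==> sg x y <= \<delta>^2 ==> 0 <= \<delta> ==> \<delta>^2 <= 1/128 ==>
   (!!z. z \<in> nb x ==> cmod (g z) <= B) ==> cmod (g x - g y) <= C * \<delta> * B"
proof -
 let ?\<gamma> = "- real CARD('n) - \<alpha>"
 obtain C1 where C1: "0 < C1"
  "!!x y z \<delta>. x \<in> UB ==> y \<in> UB ==> z \<in> UB ==> sg x y <= \<delta>^2 ==> 0 <= \<delta> ==> \<delta>^2 <= 1/128 ==>
   \<bar>kd x z - kd y z\<bar> <= C1 * \<delta> * (dl z) powr ?\<gamma> \<and> (1/16 < sg x z --> kd x z - kd y z = 0)"
  using kd_lipschitz by metis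
 obtain C2 where C2: "0 < C2" "!!x. x \<in> UB ==> measure M (nb x) <= C2 * (dl x) powr (real CARD('n) + \<alpha>)"
  using measure_nb by metis
 show ?thesis
 proof (rule that[of "C1 * 2 powr \<bar>?\<gamma>\<bar> * C2"])
  show "0 < C1 * 2 powr \<bar>?\<gamma>\<bar> * C2" using C1 C2 by simp
  fix g x y \<delta> B assume g: "g \<in> h_harmonic" and x: "x \<in> UB" and y: "y \<in> UB" and d: "sg x y <= \<delta>^2" "0 <= \<delta>" "\<delta>^2 <= 1/128"
   and B: "!!z. z \<in> nb x ==> cmod (g z) <= B"
  have xn: "x \<in> nb x" using x by (simp add: nb_def sg_def)
  have B0: "0 <= B" using B[OF xn] norm_ge_zero order_trans by blast
  define A where "A = dl x"
  have A: "A > 0" using dl_pos[OF x] by (simp add: A_def)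
  define c where "c = C1 * \<delta> * (2 powr \<bar>?\<gamma>\<bar> * A powr ?\<gamma>) * B"
  have c0: "0 <= c" using C1 d B0 by (simp add: c_def)
  note cg = h_harmonic_continuous[OF g]
  have ix: "integrable M (%z. kd x z *\<^sub>R g z)" and iy: "integrable M (%z. kd y z *\<^sub>R g z)"
   by (rule kd_integrable(1)[OF x cg], rule kd_integrable(1)[OF y cg])
  have "g x - g y = (\<integral>z. kd x z *\<^sub>R g z - kd y z *\<^sub>R g z \<partial>M)"
   using kd_mean_value[OF g x] kd_mean_value[OF g y] Bochner_Integration.integral_diff[OF ix iy] by simp
  also have "cmod ... <= (\<integral>z. cmod (kd x z *\<^sub>R g z - kd y z *\<^sub>R g z) \<partial>M)" by (rule integral_norm_bound)
  also have "... <= (\<integral>z. c * indicator (nb x) z \<partial>M)"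
  proof (rule integral_mono)
   show "integrable M (%z. cmod (kd x z *\<^sub>R g z - kd y z *\<^sub>R g z))" using ix iy by simp
   show "integrable M (%z. c * indicator (nb x) z)"
    using nb_sets(2)[OF x] finite_measure.emeasure_finite[OF finite_measure_M] by (intro integrable_mult_right integrable_real_indicator) (auto simp: less_top)
   fix z assume "z \<in> space M"
   hence z: "z \<in> UB" by simp
   have e: "cmod (kd x z *\<^sub>R g z - kd y z *\<^sub>R g z) = \<bar>kd x z - kd y z\<bar> * cmod (g z)"
    unfolding scaleR_diff_left[symmetric] by simp
   note C = C1(2)[OF x y z d]
   show "cmod (kd x z *\<^sub>R g z - kd y z *\<^sub>R g z) <= c * indicator (nb x) z"
   proof (cases "z \<in> nb x")
    case True
    hence zb: "sg x z <= 1/16" "sg z x <= 1/16" by (auto simp: nb_def sg_sym)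
    have "(dl z) powr ?\<gamma> <= 2 powr \<bar>?\<gamma>\<bar> * A powr ?\<gamma>"
     unfolding A_def using sg_comparable[OF x z zb(1)] sg_comparable[OF z x zb(2)]
     by (intro powr_comparable dl_pos x z) auto
    hence "C1 * \<delta> * (dl z) powr ?\<gamma> <= C1 * \<delta> * (2 powr \<bar>?\<gamma>\<bar> * A powr ?\<gamma>)"
     using C1 d by (intro mult_left_mono) auto
    hence "\<bar>kd x z - kd y z\<bar> <= C1 * \<delta> * (2 powr \<bar>?\<gamma>\<bar> * A powr ?\<gamma>)" using C by linarith
    hence "\<bar>kd x z - kd y z\<bar> * cmod (g z) <= c" unfolding c_def using B[OF True] C1 d by (intro mult_mono) auto
    thus ?thesis using True e by simp
   next
    case False
    hence "1/16 < sg x z" using z by (simp add: nb_def)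
    hence "kd x z - kd y z = 0" using C by blast
    thus ?thesis using e False by simp
   qed
  qed
  also have "... = c * measure M (nb x)" using nb_sets(2)[OF x] by simp
  also have "... <= c * (C2 * A powr (real CARD('n) + \<alpha>))"
   using C2(2)[OF x] c0 by (intro mult_left_mono) (auto simp: A_def)
  also have "... = C1 * 2 powr \<bar>?\<gamma>\<bar> * C2 * \<delta> * B * (A powr ?\<gamma> * A powr (real CARD('n) + \<alpha>))" by (simp add: c_def)
  also have "A powr ?\<gamma> * A powr (real CARD('n) + \<alpha>) = 1" unfolding powr_add[symmetric] using A by simp
  finally show "cmod (g x - g y) <= C1 * 2 powr \<bar>?\<gamma>\<bar> * C2 * \<delta> * B" by simp
 qed
qed

lemma Rk_bound_cball:
 assumes \<rho>: "0 <= \<rho>" "\<rho> < 1"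
 obtains D where "0 <= D" "!!x y. norm x <= \<rho> ==> norm y <= \<rho> ==> \<bar>Rk x y\<bar> <= D"
proof -
 obtain C where C: "0 < C" "!!x. x \<in> UB ==> Rk x x <= C * wi x"
  using Rk_diag_bound by metis
 define D where "D = C * (1 - \<rho>^2) powr (- real CARD('n) - \<alpha>)"
 have D: "0 <= D" using C by (simp add: D_def)
 have g: "- real CARD('n) - \<alpha> <= 0" using alpha n by simp
 have d: "Rk x x <= D" if "norm x <= \<rho>" for x
 proof -
  have "(norm x)^2 <= \<rho>^2" using that by (intro power_mono) auto
  moreover have "\<rho>^2 < 1" using \<rho> by (simp add: abs_square_less_1)
  ultimately have "wi x <= (1 - \<rho>^2) powr (- real CARD('n) - \<alpha>)"
   using g by (intro powr_mono2') auto
  hence "C * wi x <= D" unfolding D_def using C(1) by (intro mult_left_mono) auto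
  thus ?thesis using C(2)[of x] that \<rho> by simp
 qed
 show ?thesis
 proof (rule that[OF D])
  fix x y :: "real^'n" assume xy: "norm x <= \<rho>" "norm y <= \<rho>"
  hence b: "x \<in> UB" "y \<in> UB" using \<rho> by auto
  have "(Rk x y)^2 <= Rk x x * Rk y y" by (rule Rk_CS[OF b])
  also have "... <= D * D" using d xy Rk_diag_pos[OF b(1)] Rk_diag_pos[OF b(2)] D by (intro mult_mono) (auto simp: less_imp_le)
  finally have "\<bar>Rk x y\<bar>^2 <= D^2" by (simp add: power2_eq_square)
  thus "\<bar>Rk x y\<bar> <= D" using D by (rule power2_le_imp_le)
 qed
qed

lemma Rk_eq_bk: assumes "x \<in> UB" "y \<in> UB" shows "Rk x y = Re (bk x y)"
 using Rk_sym[OF assms] by (simp add: Rk_def)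

text \<open>R(x0, -) is continuous as an element of \<open>B2\<close>;
  \<open>local_lipschitz\<close> makes the functions R(-, y) equicontinuous at x0 for y in a smaller
  ball, where \<open>Rk_bound_cball\<close> bounds them.\<close>

lemma continuous_on_Rk: "continuous_on (UB \<times> UB) (%(x, y). Rk x y)"
proof -
 have "isCont (%(x, y). Rk x y) (x0, y0)" if x0: "x0 \<in> UB" and y0: "y0 \<in> UB" for x0 y0
 proof -
  obtain C where C: "0 < C"
   "!!g x y \<delta> B. g \<in> h_harmonic ==> x \<in> UB ==> y \<in> UB ==> sg x y <= \<delta>^2 ==> 0 <= \<delta> ==> \<delta>^2 <= 1/128 ==>
   (!!z. z \<in> nb x ==> cmod (g z) <= B) ==> cmod (g x - g y) <= C * \<delta> * B" using local_lipschitz by metis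
  \<comment> \<open>The first entry covers \<open>nb x0\<close> by \<open>sg_support\<close>, the
    second a neighbourhood of y0.\<close>
  define \<rho> where "\<rho> = max (sqrt ((1 + (norm x0)^2) / 2)) ((1 + norm y0) / 2)"
  have \<rho>: "0 <= \<rho>" "\<rho> < 1" "norm y0 < \<rho>"
   using sg_support_radius[of "norm x0"] x0 y0 by (auto simp: \<rho>_def max_def simp del: real_sqrt_lt_1_iff)
  obtain D where D: "0 <= D" "!!x y. norm x <= \<rho> ==> norm y <= \<rho> ==> \<bar>Rk x y\<bar> <= D" using Rk_bound_cball[OF \<rho>(1,2)] by metis
  let ?F = "at (x0, y0)"
  have tx: "((%p. fst p) \<longlongrightarrow> x0) ?F" and ty: "((%p. snd p) \<longlongrightarrow> y0) ?F" by (auto intro!: tendsto_eq_intros)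
  have csg: "((%p. sqrt (sg x0 (fst p))) \<longlongrightarrow> sqrt (sg x0 x0)) ?F"
  proof -
   have "isCont (sg x0) x0" using has_partials_continuous[OF has_partials_sg] x0 continuous_on_eq_continuous_at open_ball by blast
   thus ?thesis by (intro tendsto_real_sqrt isCont_tendsto_compose[OF _ tx])
  qed
  have s0: "sg x0 x0 = 0" by (simp add: sg_def)
  have cR: "((%p. Rk x0 (snd p)) \<longlongrightarrow> Rk x0 y0) ?F"
  proof -
   have "isCont (bk x0) y0"
    using B2D(3)[OF bk_spec(1)[OF x0]] y0 continuous_on_eq_continuous_at[OF open_ball] by blast
   hence "isCont (%y. Re (bk x0 y)) y0" unfolding isCont_def by (rule tendsto_Re)
   hence "((%p. Re (bk x0 (snd p))) \<longlongrightarrow> Re (bk x0 y0)) ?F" by (rule isCont_tendsto_compose[OF _ ty])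
   moreover have "\<forall>\<^sub>F p in ?F. Re (bk x0 (snd p)) = Rk x0 (snd p)"
    using topological_tendstoD[OF ty open_ball y0] by eventually_elim (rule Rk_eq_bk[OF x0, symmetric])
   ultimately show ?thesis unfolding Rk_eq_bk[OF x0 y0] by (rule Lim_transform_eventually)
  qed
  have "((%p. Rk (fst p) (snd p) - Rk x0 (snd p)) \<longlongrightarrow> 0) ?F"
  proof (rule Lim_null_comparison)
   have e1: "\<forall>\<^sub>F p in ?F. fst p \<in> UB" by (rule topological_tendstoD[OF tx open_ball x0])
   have e2: "\<forall>\<^sub>F p in ?F. snd p \<in> ball 0 \<rho>" by (rule topological_tendstoD[OF ty open_ball]) (use \<rho> in simp)
   have e3: "\<forall>\<^sub>F p in ?F. sqrt (sg x0 (fst p)) < 1/16" by (rule order_tendstoD(2)[OF csg]) (simp add: s0)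
   show "\<forall>\<^sub>F p in ?F. norm (Rk (fst p) (snd p) - Rk x0 (snd p)) <= C * sqrt (sg x0 (fst p)) * D"
    using e1 e2 e3
   proof eventually_elim
    case (elim p)
    have y: "snd p \<in> UB" using elim(2) \<rho> by simp
    have sgn: "0 <= sg x0 (fst p)" by (rule sg_nonneg[OF x0 elim(1)])
    have "cmod (bk (snd p) x0 - bk (snd p) (fst p)) <= C * sqrt (sg x0 (fst p)) * D"
    proof (rule C(2)[OF B2D(1)[OF bk_spec(1)[OF y]] x0 elim(1)])
     show "sg x0 (fst p) <= (sqrt (sg x0 (fst p)))^2" "0 <= sqrt (sg x0 (fst p))" using sgn by auto
     have "(sqrt (sg x0 (fst p)))^2 <= (1/16)^2" using elim(3) sgn by (intro power_mono) auto
     thus "(sqrt (sg x0 (fst p)))^2 <= 1/128" by (simp add: power2_eq_square)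
     fix z assume z: "z \<in> nb x0"
     hence zb: "z \<in> UB" "norm z <= \<rho>"
      using sg_support[of x0 "norm x0" z] x0 by (auto simp: nb_def \<rho>_def)
     have "cmod (bk (snd p) z) = \<bar>Rk z (snd p)\<bar>" using bk_real[OF y zb(1)] by simp
     thus "cmod (bk (snd p) z) <= D" using D(2)[OF zb(2), of "snd p"] elim(2) by simp
    qed
    moreover have "bk (snd p) x0 - bk (snd p) (fst p) = of_real (Rk x0 (snd p) - Rk (fst p) (snd p))"
     using bk_real[OF y x0] bk_real[OF y elim(1)] by simp
    ultimately show ?case by (simp only: norm_of_real real_norm_def abs_minus_commute)
   qed
   have "((%p. C * sqrt (sg x0 (fst p)) * D) \<longlongrightarrow> C * sqrt (sg x0 x0) * D) ?F"
    by (intro tendsto_intros csg)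
   thus "((%p. C * sqrt (sg x0 (fst p)) * D) \<longlongrightarrow> 0) ?F" by (simp add: s0)
  qed
  from tendsto_add[OF this cR] show ?thesis by (simp add: isCont_def case_prod_unfold del: split_paired_All)
 qed
 thus ?thesis by (intro continuous_at_imp_continuous_on) auto
qed

end

section \<open>Rotations and the polar form of the equation\<close>

definition has2 :: "(real => real) => real => bool" where
 "has2 \<phi> d \<longleftrightarrow> (\<exists>\<phi>1. (\<forall>\<theta>. (\<phi> has_real_derivative \<phi>1 \<theta>) (at \<theta>)) \<and> (\<phi>1 has_real_derivative d) (at 0))"

lemma has2_unique: assumes "has2 \<phi> d" "has2 \<phi> e" shows "d = e"
proof -
 obtain f where f: "!!\<theta>. (\<phi> has_real_derivative f \<theta>) (at \<theta>)" "(f has_real_derivative d) (at 0)" using assms(1) has2_def by auto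
 obtain g where g: "!!\<theta>. (\<phi> has_real_derivative g \<theta>) (at \<theta>)" "(g has_real_derivative e) (at 0)" using assms(2) has2_def by auto
 have "f = g" using DERIV_unique[OF f(1) g(1)] by (simp add: fun_eq_iff)
 thus ?thesis using DERIV_unique[OF f(2)] g(2) by simp
qed

lemma has2_reflect: assumes "has2 \<phi> d" shows "has2 (%\<theta>. \<phi> (- \<theta>)) d"
proof -
 obtain f where f: "!!\<theta>. (\<phi> has_real_derivative f \<theta>) (at \<theta>)" "(f has_real_derivative d) (at 0)" using assms has2_def by auto
 have m: "((%\<theta>. - \<theta>) has_real_derivative - 1) (at \<theta>)" for \<theta> :: real by (auto intro!: derivative_eq_intros)
 have "((%\<theta>. \<phi> (- \<theta>)) has_real_derivative - f (- \<theta>)) (at \<theta>)" for \<theta>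
  using DERIV_chain2[OF f(1) m] by simp
 moreover have "((%\<theta>. - f (- \<theta>)) has_real_derivative d) (at 0)"
  using DERIV_minus[OF DERIV_chain2[of f d "%\<theta>. - \<theta>" 0, OF _ m]] f(2) by simp
 ultimately show ?thesis unfolding has2_def by (intro exI[of _ "%\<theta>. - f (- \<theta>)"]) auto
qed

lemma has2_max: assumes "has2 \<phi> d" "!!\<theta>. \<phi> \<theta> <= \<phi> 0" shows "d <= 0"
proof (rule ccontr)
 assume "\<not> d <= 0"
 hence d: "d > 0" by simp
 obtain f where f: "!!\<theta>. (\<phi> has_real_derivative f \<theta>) (at \<theta>)" "(f has_real_derivative d) (at 0)" using assms(1) has2_def by auto
 have f0: "f 0 = 0" by (rule DERIV_local_max[OF f(1), of 1]) (use assms(2) in auto)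
 obtain e where e: "e > 0" "!!h. 0 < h ==> h < e ==> f 0 < f (0 + h)" using DERIV_pos_inc_right[OF f(2) d] by auto
 have "\<exists>z. 0 < z \<and> z < e/2 \<and> \<phi> (e/2) - \<phi> 0 = (e/2 - 0) * f z"
  using e(1) by (intro MVT2 f(1)) auto
 then obtain z where z: "0 < z" "z < e/2" "\<phi> (e/2) - \<phi> 0 = e/2 * f z" by auto
 have "0 < f z" using e(2)[of z] z f0 by simp
 hence "0 < e/2 * f z" using e(1) by simp
 thus False using assms(2)[of "e/2"] z(3) by linarith
qed

text \<open>Rotation by \<theta> in the plane of the axes k and l. For k = l it is the identity, so
  that sums may run over all pairs (k, l); each plane is then met twice, whence the factor 1/2 in
  \<open>polar_equation\<close>.\<close>

definition rot :: "'n => 'n => real => real^'n => real^'n" where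
 "rot k l \<theta> x = (if k = l then x else
   x + (cos \<theta> - 1) *\<^sub>R (x$k *\<^sub>R axis k 1 + x$l *\<^sub>R axis l 1) + sin \<theta> *\<^sub>R (x$k *\<^sub>R axis l 1 - x$l *\<^sub>R axis k 1))"

lemma rot_0 [simp]: "rot k l 0 x = x" by (simp add: rot_def)

lemma rot_nth:
 assumes "k \<noteq> l"
 shows "rot k l \<theta> x $ i = (if i = k then cos \<theta> * x$k - sin \<theta> * x$l else if i = l then sin \<theta> * x$k + cos \<theta> * x$l else x$i)"
 using assms by (simp add: rot_def axis_def algebra_simps)

lemma rot_orthogonal:
 fixes k l :: "'n::finite"
 shows "orthogonal_transformation (rot k l \<theta>)"
proof (cases "k = l")
 case True
 have "rot k l \<theta> = (%x. x)" using True by (simp add: rot_def fun_eq_iff)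
 thus ?thesis using orthogonal_transformation_id by simp
next
 case False
 have lin: "linear (rot k l \<theta>)"
  by (rule linearI) (auto simp: vec_eq_iff rot_nth[OF False] algebra_simps)
 have "norm (rot k l \<theta> x) = norm x" for x
 proof -
  have "(\<Sum>i\<in>UNIV. (rot k l \<theta> x $ i)^2 - (x$i)^2) = (\<Sum>i\<in>{k,l}. (rot k l \<theta> x $ i)^2 - (x$i)^2)"
   by (rule sum.mono_neutral_right) (auto simp: rot_nth[OF False])
  also have "... = (cos \<theta> * x$k - sin \<theta> * x$l)^2 - (x$k)^2 + ((sin \<theta> * x$k + cos \<theta> * x$l)^2 - (x$l)^2)"
   using False by (simp add: rot_nth[OF False])
  also have "... = ((sin \<theta>)^2 + (cos \<theta>)^2 - 1) * ((x$k)^2 + (x$l)^2)"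
   by (simp only: power2_eq_square algebra_simps mult_1_left mult_1_right)
  also have "... = 0" by simp
  finally have "(\<Sum>i\<in>UNIV. (rot k l \<theta> x $ i)^2) = (\<Sum>i\<in>UNIV. (x$i)^2)" by (simp add: sum_subtractf)
  thus ?thesis by (simp add: norm_vec_def L2_set_def)
 qed
 thus ?thesis unfolding orthogonal_transformation using lin by blast
qed

lemma rot_inverse: "rot k l (- \<theta>) (rot k l \<theta> x) = x"
proof (cases "k = l")
 case False
 have 1: "cos \<theta> * (cos \<theta> * a - sin \<theta> * b) + sin \<theta> * (sin \<theta> * a + cos \<theta> * b) = a"
  "cos \<theta> * (sin \<theta> * a + cos \<theta> * b) - sin \<theta> * (cos \<theta> * a - sin \<theta> * b) = b" for a b
 proof -
  have "cos \<theta> * (cos \<theta> * a - sin \<theta> * b) + sin \<theta> * (sin \<theta> * a + cos \<theta> * b) = ((sin \<theta>)^2 + (cos \<theta>)^2) * a"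
   "cos \<theta> * (sin \<theta> * a + cos \<theta> * b) - sin \<theta> * (cos \<theta> * a - sin \<theta> * b) = ((sin \<theta>)^2 + (cos \<theta>)^2) * b"
   by (simp_all only: power2_eq_square algebra_simps)
  thus "cos \<theta> * (cos \<theta> * a - sin \<theta> * b) + sin \<theta> * (sin \<theta> * a + cos \<theta> * b) = a"
  "cos \<theta> * (sin \<theta> * a + cos \<theta> * b) - sin \<theta> * (cos \<theta> * a - sin \<theta> * b) = b" by simp_all
 qed
 have "rot k l (- \<theta>) (rot k l \<theta> x) $ i = x $ i" for i
  unfolding rot_nth[OF False, of "- \<theta>"] using False 1[of "x$k" "x$l"] by (auto simp: rot_nth[OF False])
 thus ?thesis by (simp add: vec_eq_iff)
qed (simp add: rot_def)

definition rotgen :: "'n => 'n => ('n => real^'n => real) => real^'n => real" where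
 "rotgen k l f1 x = x$k * f1 l x - x$l * f1 k x"

lemma DERIV_rot:
 fixes f :: "real^'n => real"
 assumes f: "has_partials f f1 UB" and x: "x \<in> UB" and kl: "k \<noteq> l"
 shows "((%\<theta>. f (rot k l \<theta> x)) has_real_derivative rotgen k l f1 (rot k l \<theta> x)) (at \<theta>)"
proof -
 let ?v = "rot k l \<theta> x $ k *\<^sub>R axis l 1 - rot k l \<theta> x $ l *\<^sub>R axis k 1 :: real^'n"
 have "((%\<theta>. x + (cos \<theta> - 1) *\<^sub>R (x$k *\<^sub>R axis k 1 + x$l *\<^sub>R axis l 1) + sin \<theta> *\<^sub>R (x$k *\<^sub>R axis l 1 - x$l *\<^sub>R axis k 1)) has_derivative
   (%h. h *\<^sub>R ((- sin \<theta>) *\<^sub>R (x$k *\<^sub>R axis k 1 + x$l *\<^sub>R axis l 1) + cos \<theta> *\<^sub>R (x$k *\<^sub>R axis l 1 - x$l *\<^sub>R axis k 1)))) (at \<theta>)"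
  by (auto intro!: derivative_eq_intros simp: algebra_simps)
 moreover have "(- sin \<theta>) *\<^sub>R (x$k *\<^sub>R axis k 1 + x$l *\<^sub>R axis l 1) + cos \<theta> *\<^sub>R (x$k *\<^sub>R axis l 1 - x$l *\<^sub>R axis k 1) = ?v"
  using kl by (simp add: rot_nth[OF kl] algebra_simps)
 ultimately have D: "((%\<theta>. rot k l \<theta> x) has_derivative (%h. h *\<^sub>R ?v)) (at \<theta>)"
  using kl by (simp add: rot_def)
 have U: "rot k l \<theta> x \<in> UB" using x by (simp add: orthogonal_transformation_norm[OF rot_orthogonal])
 have s: "(\<Sum>i\<in>UNIV. (h *\<^sub>R ?v) $ i *\<^sub>R f1 i (rot k l \<theta> x)) = rotgen k l f1 (rot k l \<theta> x) * h" for h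
 proof -
  have "(\<Sum>i\<in>UNIV. (h *\<^sub>R ?v) $ i *\<^sub>R f1 i (rot k l \<theta> x)) = (\<Sum>i\<in>UNIV. (h * rot k l \<theta> x $ k) * (axis l 1 $ i * f1 i (rot k l \<theta> x)) - (h * rot k l \<theta> x $ l) * (axis k 1 $ i * f1 i (rot k l \<theta> x)))"
   by (rule sum.cong) (simp_all add: algebra_simps)
  also have "... = (h * rot k l \<theta> x $ k) * f1 l (rot k l \<theta> x) - (h * rot k l \<theta> x $ l) * f1 k (rot k l \<theta> x)"
   by (simp only: sum_subtractf sum_distrib_left[symmetric] sum_axis_real)
  finally show ?thesis by (simp add: rotgen_def algebra_simps)
 qed
 show ?thesis
  unfolding has_field_derivative_def
  by (rule has_derivative_eq_rhs[OF has_derivative_compose[OF D has_partialsD(1)[OF f U]]]) (simp only: s fun_eq_iff mult.commute simp_thms)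
qed

text \<open>The square of the generator x_k d_l - x_l d_k, expanded by the product rule;
  \<open>f2 i j\<close> stands for the derivative of \<open>f1 i\<close> in direction j.\<close>

definition rotgen2 :: "'n => 'n => ('n => real^'n => real) => ('n => 'n => real^'n => real) => real^'n => real" where
 "rotgen2 k l f1 f2 x =
   x$k * ((x$k * f2 l l x + (if l = k then 1 else 0) * f1 l x) - (x$l * f2 k l x + f1 k x))
  - x$l * ((x$k * f2 l k x + f1 l x) - (x$l * f2 k k x + (if k = l then 1 else 0) * f1 k x))"

lemma has2_rot:
 fixes f :: "real^'n => real"
 assumes f: "has_partials f f1 UB" and f1: "!!i. has_partials (f1 i) (f2 i) UB" and x: "x \<in> UB"
 shows "has2 (%\<theta>. f (rot k l \<theta> x)) (rotgen2 k l f1 f2 x)"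
proof (cases "k = l")
 case True
 hence "(%\<theta>. f (rot k l \<theta> x)) = (%\<theta>. f x)" "rotgen2 k l f1 f2 x = 0" by (simp_all add: rot_def rotgen2_def)
 thus ?thesis unfolding has2_def by (intro exI[of _ "%\<theta>. 0"]) auto
next
 case False
 have g: "has_partials (rotgen k l f1) (%j x. (x$k * f2 l j x + (if j = k then 1 else 0) * f1 l x) - (x$l * f2 k j x + (if j = l then 1 else 0) * f1 k x)) UB"
  unfolding rotgen_def[abs_def]
  by (intro has_partials_diff has_partials_mult has_partials_nth f1)
 have "rotgen k l (%j x. (x$k * f2 l j x + (if j = k then 1 else 0) * f1 l x) - (x$l * f2 k j x + (if j = l then 1 else 0) * f1 k x)) x = rotgen2 k l f1 f2 x"
  using False by (simp add: rotgen_def rotgen2_def)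
 with DERIV_rot[OF g x False, of 0] have "((%\<theta>. rotgen k l f1 (rot k l \<theta> x)) has_real_derivative rotgen2 k l f1 f2 x) (at 0)" by simp
 thus ?thesis unfolding has2_def
  by (intro exI[of _ "%\<theta>. rotgen k l f1 (rot k l \<theta> x)"] conjI allI DERIV_rot[OF f x False])
qed

lemma has2_add_cmult: assumes "has2 \<phi> d" "has2 \<psi> e" shows "has2 (%\<theta>. \<phi> \<theta> + c * \<psi> \<theta>) (d + c * e)"
proof -
 obtain f where f: "!!\<theta>. (\<phi> has_real_derivative f \<theta>) (at \<theta>)" "(f has_real_derivative d) (at 0)" using assms(1) has2_def by auto
 obtain g where g: "!!\<theta>. (\<psi> has_real_derivative g \<theta>) (at \<theta>)" "(g has_real_derivative e) (at 0)" using assms(2) has2_def by auto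
 show ?thesis unfolding has2_def
  by (intro exI[of _ "%\<theta>. f \<theta> + c * g \<theta>"] conjI allI DERIV_add DERIV_cmult f g)
qed

definition h_harmonic_real :: "(real^'n => real) => ('n => real^'n => real) => ('n => 'n => real^'n => real) => bool" where
 "h_harmonic_real f f1 f2 \<longleftrightarrow> has_partials f f1 UB \<and> (\<forall>i. has_partials (f1 i) (f2 i) UB) \<and>
  (\<forall>x\<in>UB. (dl x) * (\<Sum>i\<in>UNIV. f2 i i x) = - (2 * (real CARD('n) - 2)) * (\<Sum>i\<in>UNIV. x$i * f1 i x))"

lemma h_harmonic_real_Re:
 fixes f :: "real^'n => complex"
 assumes f: "f \<in> h_harmonic"
 shows "h_harmonic_real (%x. Re (f x)) (%i x. Re (pderivative i f x)) (%i j x. Re (pderivative j (pderivative i f) x))"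
 unfolding h_harmonic_real_def
proof (intro conjI allI ballI)
 fix x :: "real^'n" assume x: "x \<in> UB"
 have "Re (of_real (dl x) * (\<Sum>i\<in>UNIV. pderivative i (pderivative i f) x)) = Re (- (of_real (2 * (real CARD('n) - 2)) * radial_derivative f x))"
  by (simp only: h_harmonic_laplacian[OF f x])
 thus "(dl x) * (\<Sum>i\<in>UNIV. Re (pderivative i (pderivative i f) x)) = - (2 * (real CARD('n) - 2)) * (\<Sum>i\<in>UNIV. x $ i * Re (pderivative i f x))"
  by (simp only: Re_complex_of_real Re_sum radial_derivative_def uminus_complex.sel times_complex.sel Im_complex_of_real mult_zero_left diff_0_right minus_mult_left)
qed (auto intro!: has_partials_bounded_linear[OF bounded_linear_Re] h_harmonicD f)

text \<open>Besides (r d/dr)^2 the equation contains r d/dr with coefficient n - 2 from the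
  Euclidean Laplacian and 2 (n - 2) r^2 / (1 - r^2) from the drift; this is their sum.\<close>

definition bcoef :: "nat => real => real" where "bcoef n r = (real n - 2) * (1 + r^2) / (1 - r^2)"

text \<open>Polar form of the equation: the radial part equals minus the spherical Laplacian, which is a sum
 of squares of the generators of rotations.\<close>

lemma polar_equation:
 fixes f :: "real^'n => real"
 assumes h: "h_harmonic_real f f1 f2" and x: "x \<in> UB"
 shows "(\<Sum>i\<in>UNIV. \<Sum>j\<in>UNIV. x$i * x$j * f2 i j x) + (\<Sum>i\<in>UNIV. x$i * f1 i x) + bcoef CARD('n) (norm x) * (\<Sum>i\<in>UNIV. x$i * f1 i x)
  = - (1/2) * (\<Sum>k\<in>UNIV. \<Sum>l\<in>UNIV. rotgen2 k l f1 f2 x)"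
proof -
 define E H D where "E = (\<Sum>i\<in>UNIV. x$i * f1 i x)" and "H = (\<Sum>i\<in>UNIV. \<Sum>j\<in>UNIV. x$i * x$j * f2 i j x)" and "D = (\<Sum>i\<in>UNIV. f2 i i x)"
 define n where "n = real CARD('n)"
 have B: "dl x > 0" by (rule dl_pos[OF x])
 have eq: "(dl x) * D = - (2 * (n - 2)) * E"
  using h x unfolding h_harmonic_real_def D_def E_def n_def by blast
 have n2: "(norm x)^2 = (\<Sum>i\<in>UNIV. x$i * x$i)" by (simp add: power2_norm_eq_inner inner_vec_def)
 \<comment> \<open>Renaming the indices gives the same double sum for both orders of the mixed
   partials.\<close>
 have H': "(\<Sum>k\<in>UNIV. \<Sum>l\<in>UNIV. x$k * x$l * f2 l k x) = H" unfolding H_def by (subst sum.swap) (simp add: mult_ac)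
 have d1: "(\<Sum>l\<in>UNIV. x$k * ((if l = k then 1 else 0) * f1 l x)) = x$k * f1 k x" for k
  by (simp add: if_distrib[of "%c. c * _"] if_distrib[of "%c. _ * c"] cong: if_cong)
 have d2: "(\<Sum>l\<in>UNIV. x$l * ((if k = l then 1 else 0) * f1 k x)) = x$k * f1 k x" for k
  by (simp add: if_distrib[of "%c. c * _"] if_distrib[of "%c. _ * c"] cong: if_cong)
 have "(\<Sum>k\<in>UNIV. \<Sum>l\<in>UNIV. rotgen2 k l f1 f2 x) = (\<Sum>k\<in>UNIV. \<Sum>l\<in>UNIV.
   (x$k * x$k) * f2 l l x + x$k * ((if l = k then 1 else 0) * f1 l x) - x$k * x$l * f2 k l x - x$k * f1 k x
   - x$k * x$l * f2 l k x - x$l * f1 l x + (x$l * x$l) * f2 k k x + x$l * ((if k = l then 1 else 0) * f1 k x))"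
  unfolding rotgen2_def by (intro sum.cong refl) (simp add: algebra_simps)
 also have "... = (norm x)^2 * D + E - H - n * E - H - n * E + (norm x)^2 * D + E"
 proof -
  have 1: "(\<Sum>k\<in>UNIV. \<Sum>l\<in>UNIV. (x$k * x$k) * f2 l l x) = (norm x)^2 * D"
   unfolding n2 D_def by (simp add: sum_product)
  have 2: "(\<Sum>k\<in>UNIV. \<Sum>l\<in>UNIV. (x$l * x$l) * f2 k k x) = (norm x)^2 * D"
   unfolding n2 D_def by (subst sum.swap) (simp add: sum_product)
  have 3: "(\<Sum>k\<in>(UNIV::'n set). \<Sum>l\<in>(UNIV::'n set). x$k * f1 k x) = n * E"
   unfolding E_def n_def by (simp add: sum_distrib_left)
  have 4: "(\<Sum>k\<in>(UNIV::'n set). \<Sum>l\<in>UNIV. x$l * f1 l x) = n * E" unfolding E_def n_def by simp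
  show ?thesis
   unfolding sum.distrib sum_subtractf 1 2 3 4 d1 d2 H' by (simp add: E_def H_def)
 qed
 finally have R: "(\<Sum>k\<in>UNIV. \<Sum>l\<in>UNIV. rotgen2 k l f1 f2 x) = 2 * ((norm x)^2 * D - H - (n - 1) * E)" by (simp add: algebra_simps)
 define c where "c = (norm x)^2 / (dl x)"
 have "D = - (2 * (n - 2)) * E / (dl x)" using eq B by (simp add: field_simps)
 hence "(norm x)^2 * D = - 2 * (n - 2) * c * E" by (simp add: c_def)
 moreover have b: "bcoef CARD('n) (norm x) = (n - 2) + 2 * (n - 2) * c"
  using B unfolding c_def by (simp add: bcoef_def n_def divide_simps) (simp add: algebra_simps)
 ultimately show ?thesis unfolding R E_def[symmetric] H_def[symmetric] b by (simp add: algebra_simps)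
qed

lemma DERIV_line:
 fixes f :: "real^'n => real"
 assumes f: "has_partials f f1 UB" and x: "r *\<^sub>R \<zeta> \<in> UB"
 shows "((%r. f (r *\<^sub>R \<zeta>)) has_real_derivative (\<Sum>i\<in>UNIV. \<zeta>$i * f1 i (r *\<^sub>R \<zeta>))) (at r)"
proof -
 have D: "((%r. r *\<^sub>R \<zeta>) has_derivative (%h. h *\<^sub>R \<zeta>)) (at r)" by (auto intro!: derivative_eq_intros)
 show ?thesis
  unfolding has_field_derivative_def
  by (rule has_derivative_eq_rhs[OF has_derivative_compose[OF D has_partialsD(1)[OF f x]]])
   (simp add: fun_eq_iff sum_distrib_left sum_distrib_right mult_ac)
qed

text \<open>The reflection in the hyperplane orthogonal to \<zeta> - \<eta>. An exchange of the two
  vectors, not just a map of one to the other, is what pairs the terms of \<open>qform\<close> in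
  \<open>Rk_le_diag\<close>.\<close>

lemma reflection_exists:
 fixes \<zeta> \<eta> :: "real^'n"
 assumes "norm \<zeta> = 1" "norm \<eta> = 1"
 obtains U where "orthogonal_transformation U" "U \<zeta> = \<eta>" "U \<eta> = \<zeta>"
proof (cases "\<zeta> = \<eta>")
 case True
 thus ?thesis by (intro that[OF orthogonal_transformation_id]) simp_all
next
 case False
 define u where "u = \<zeta> - \<eta>"
 define q where "q = u \<bullet> u"
 have q: "q \<noteq> 0" using False by (simp add: q_def u_def)
 have 1: "\<zeta> \<bullet> \<zeta> = 1" "\<eta> \<bullet> \<eta> = 1" using assms by (simp_all add: norm_eq_1)
 have uz: "u \<bullet> \<zeta> = q / 2" "u \<bullet> \<eta> = - (q / 2)"
  unfolding q_def u_def by (simp_all add: inner_diff 1 inner_commute algebra_simps diff_divide_distrib)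
 define U where "U x = x - (2 * (u \<bullet> x) / q) *\<^sub>R u" for x
 have "linear U" by (rule linearI) (auto simp: U_def inner_right_distrib algebra_simps add_divide_distrib)
 moreover have "U v \<bullet> U w = v \<bullet> w" for v w
 proof -
  have "U v \<bullet> U w = v \<bullet> w - (2 * (u \<bullet> w) / q) * (u \<bullet> v) - (2 * (u \<bullet> v) / q) * (u \<bullet> w) + (2 * (u \<bullet> v) / q) * (2 * (u \<bullet> w) / q) * q"
   unfolding U_def q_def by (simp add: inner_diff inner_commute algebra_simps)
  thus ?thesis using q by (simp add: field_simps)
 qed
 ultimately have "orthogonal_transformation U" by (simp add: orthogonal_transformation_def)
 moreover have "U \<zeta> = \<eta>" "U \<eta> = \<zeta>" using q by (simp_all add: U_def uz) (simp_all add: u_def)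
 ultimately show ?thesis using that by blast
qed

section \<open>The kernel along two rays is C2 in both radii\<close>

context bergman begin

text \<open>Averaging kernels depending on a radius, with compact support in z that is locally
  uniform in r. Negative radii are allowed, so that derivatives at r = 0 are two-sided.\<close>

definition kfam :: "(real => real^'n => real) => bool" where
 "kfam A \<longleftrightarrow> continuous_on ({-1<..<1} \<times> UB) (%(r, z). A r z) \<and>
  (\<forall>\<rho> r z. 0 <= \<rho> --> \<rho> < 1 --> \<bar>r\<bar> <= \<rho> --> z \<in> UB - cball 0 (sqrt ((1 + \<rho>^2) / 2)) --> A r z = 0)"

text \<open>At this point R is jointly continuous, but smooth only in each argument. The mean value
  formula in both arguments writes R(r \<zeta>, t \<eta>) as such a double integral, and derivatives
  in r and t fall on the averaging kernels.\<close>

definition II :: "(real => real^'n => real) => (real => real^'n => real) => real \<times> real => real" where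
 "II A B p = (LBINT q:UB \<times> UB. A (fst p) (fst q) * B (snd p) (snd q) * Rk (fst q) (snd q))"

lemma kfam_add_cmult: "kfam A ==> kfam B ==> kfam (%r z. A r z + c * B r z)"
 unfolding kfam_def split_beta by (auto intro!: continuous_intros)

lemma II_continuous:
 assumes "kfam A" "kfam B"
 shows "continuous_on (Sq \<times> (UB \<times> UB)) (%(p, q). A (fst p) (fst q) * B (snd p) (snd q) * Rk (fst q) (snd q))"
proof -
 have "continuous_on (Sq \<times> (UB \<times> UB) :: ((real \<times> real) \<times> _) set) (%x. (case (fst (fst x), fst (snd x)) of (r, z) => A r z))"
  by (rule continuous_on_compose2[OF conjunct1[OF assms(1)[unfolded kfam_def]]]) (auto intro!: continuous_intros)
 hence A: "continuous_on (Sq \<times> (UB \<times> UB) :: ((real \<times> real) \<times> _) set) (%x. A (fst (fst x)) (fst (snd x)))" by simp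
 have "continuous_on (Sq \<times> (UB \<times> UB) :: ((real \<times> real) \<times> _) set) (%x. (case (snd (fst x), snd (snd x)) of (r, z) => B r z))"
  by (rule continuous_on_compose2[OF conjunct1[OF assms(2)[unfolded kfam_def]]]) (auto intro!: continuous_intros)
 hence B: "continuous_on (Sq \<times> (UB \<times> UB) :: ((real \<times> real) \<times> _) set) (%x. B (snd (fst x)) (snd (snd x)))" by simp
 have "continuous_on (Sq \<times> (UB \<times> UB) :: ((real \<times> real) \<times> _) set) (%x. (case (fst (snd x), snd (snd x)) of (r, z) => Rk r z))"
  by (rule continuous_on_compose2[OF continuous_on_Rk]) (auto intro!: continuous_intros)
 hence R: "continuous_on (Sq \<times> (UB \<times> UB) :: ((real \<times> real) \<times> _) set) (%x. Rk (fst (snd x)) (snd (snd x)))" by (simp add: case_prod_unfold)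
 show ?thesis unfolding split_beta by (intro continuous_on_mult A B R)
qed

lemma II_slice:
 assumes "kfam A" "kfam B" "p \<in> Sq"
 shows "continuous_on (UB \<times> UB) (%q. A (fst p) (fst q) * B (snd p) (snd q) * Rk (fst q) (snd q))"
proof -
 have "continuous_on (UB \<times> UB) (%q. (case (p, q) of (p, q) => A (fst p) (fst q) * B (snd p) (snd q) * Rk (fst q) (snd q)))"
  by (rule continuous_on_compose2[OF II_continuous[OF assms(1,2)]]) (use assms(3) in \<open>auto intro!: continuous_intros\<close>)
 thus ?thesis by simp
qed

lemma II_support:
 assumes "kfam A" "kfam B" "0 <= \<rho>" "\<rho> < 1" "\<bar>fst p\<bar> <= \<rho>" "\<bar>snd p\<bar> <= \<rho>"
  "q \<in> UB \<times> UB - cball 0 (sqrt ((1 + \<rho>^2) / 2)) \<times> cball 0 (sqrt ((1 + \<rho>^2) / 2))"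
 shows "A (fst p) (fst q) * B (snd p) (snd q) * Rk (fst q) (snd q) = 0"
proof -
 have "A (fst p) (fst q) = 0 \<or> B (snd p) (snd q) = 0"
  using assms unfolding kfam_def by (cases q) auto
 thus ?thesis by auto
qed

lemma ball_prod: "open (UB \<times> UB :: ((real^'n) \<times> (real^'n)) set)" "bounded (UB \<times> UB :: ((real^'n) \<times> (real^'n)) set)"
 by (auto intro: open_Times bounded_Times)

lemma cball_prod:
 assumes "0 <= \<rho>" "\<rho> < 1"
 shows "compact (cball 0 (sqrt ((1 + \<rho>^2) / 2)) \<times> cball 0 (sqrt ((1 + \<rho>^2) / 2)) :: ((real^'n) \<times> (real^'n)) set)"
  "cball 0 (sqrt ((1 + \<rho>^2) / 2)) \<times> cball 0 (sqrt ((1 + \<rho>^2) / 2)) \<subseteq> (UB \<times> UB :: ((real^'n) \<times> (real^'n)) set)"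
proof -
 show "compact (cball 0 (sqrt ((1 + \<rho>^2) / 2)) \<times> cball 0 (sqrt ((1 + \<rho>^2) / 2)) :: ((real^'n) \<times> (real^'n)) set)"
  by (intro compact_Times) auto
 show "cball 0 (sqrt ((1 + \<rho>^2) / 2)) \<times> cball 0 (sqrt ((1 + \<rho>^2) / 2)) \<subseteq> (UB \<times> UB :: ((real^'n) \<times> (real^'n)) set)"
  using sg_support_radius[OF assms] by (auto simp del: real_sqrt_lt_1_iff)
qed

lemma II_integrable:
 assumes "kfam A" "kfam B" "p \<in> Sq"
 shows "set_integrable lborel (UB \<times> UB) (%q. A (fst p) (fst q) * B (snd p) (snd q) * Rk (fst q) (snd q))"
proof -
 define \<rho> where "\<rho> = max \<bar>fst p\<bar> \<bar>snd p\<bar>"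
 have \<rho>: "0 <= \<rho>" "\<rho> < 1" "\<bar>fst p\<bar> <= \<rho>" "\<bar>snd p\<bar> <= \<rho>" using assms(3) by (auto simp: \<rho>_def)
 show ?thesis
 proof (rule integrable_compact_support[OF ball_prod(1) cball_prod[OF \<rho>(1,2)]])
  show "continuous_on (UB \<times> UB) (%q. A (fst p) (fst q) * B (snd p) (snd q) * Rk (fst q) (snd q))"
   by (rule II_slice[OF assms])
 qed (rule II_support[OF assms(1,2) \<rho>])
qed

lemma II_derivative:
 assumes k: "kfam A" "kfam A'" "kfam B" "kfam B'"
  and A: "!!r z. r \<in> {-1<..<1} ==> z \<in> UB ==> ((%r. A r z) has_real_derivative A' r z) (at r)"
  and B: "!!r z. r \<in> {-1<..<1} ==> z \<in> UB ==> ((%r. B r z) has_real_derivative B' r z) (at r)"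
  and p: "p \<in> Sq"
 shows "(II A B has_derivative (%h. fst h * II A' B p + snd h * II A B' p)) (at p)"
proof -
 define \<rho> where "\<rho> = (1 + max \<bar>fst p\<bar> \<bar>snd p\<bar>) / 2"
 have \<rho>: "0 <= \<rho>" "\<rho> < 1" "\<bar>fst p\<bar> < \<rho>" "\<bar>snd p\<bar> < \<rho>" using p by (auto simp: \<rho>_def max_def)
 define U where "U = {-\<rho><..<\<rho>} \<times> {-\<rho><..<\<rho>}"
 have U: "open U" "convex U" "p \<in> U" "U \<subseteq> Sq"
  using \<rho> by (auto simp: U_def intro!: open_Times convex_Times abs_less_iff[THEN iffD1, THEN conjunct1] simp: mem_Times_iff abs_less_iff)
 let ?F = "%p q. A (fst p) (fst q) * B (snd p) (snd q) * Rk (fst q) (snd q)"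
 let ?F' = "%p q h. fst h * (A' (fst p) (fst q) * B (snd p) (snd q) * Rk (fst q) (snd q)) + snd h * (A (fst p) (fst q) * B' (snd p) (snd q) * Rk (fst q) (snd q))"
 have "(II A B has_derivative (%h. LBINT q:UB \<times> UB. ?F' p q h)) (at p)"
  unfolding II_def[abs_def]
 proof (rule has_derivative_integral_compact_support(1)[OF U(1,2) ball_prod cball_prod[OF \<rho>(1,2)] _ _ _ _ U(3)])
  show "continuous_on (UB \<times> UB) (?F p')" if "p' \<in> U" for p'
   using II_slice[OF k(1,3)] that U(4) by blast
  show "continuous_on (U \<times> UB \<times> UB) (%(p, q). ?F' p q h)" for h
  proof -
   have S: "U \<times> UB \<times> UB \<subseteq> Sq \<times> (UB \<times> UB :: ((real^'n) \<times> (real^'n)) set)" using U(4) by blast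
   show ?thesis unfolding case_prod_unfold
    by (intro continuous_on_add continuous_on_mult_left continuous_on_subset[OF II_continuous[OF k(2,3), unfolded case_prod_unfold] S]
      continuous_on_subset[OF II_continuous[OF k(1,4), unfolded case_prod_unfold] S])
  qed
  show "?F p' q = 0" if "p' \<in> U" "q \<in> UB \<times> UB - cball 0 (sqrt ((1 + \<rho>^2) / 2)) \<times> cball 0 (sqrt ((1 + \<rho>^2) / 2))" for p' q
   by (rule II_support[OF k(1,3) \<rho>(1,2) _ _ that(2)]) (use that(1) in \<open>auto simp: U_def\<close>)
  fix p' and q :: "(real^'n) \<times> (real^'n)" assume p': "p' \<in> U" and q: "q \<in> UB \<times> UB"
  have pp: "fst p' \<in> {-1<..<1}" "snd p' \<in> {-1<..<1}" using p' U(4) by auto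
  have "((%p. A (fst p) (fst q)) has_derivative (%h. fst h * A' (fst p') (fst q))) (at p')"
   using has_derivative_compose[OF has_derivative_fst[OF has_derivative_ident] A[OF pp(1), of "fst q", unfolded has_field_derivative_def]] q
   by (auto simp: mult.commute)
  moreover have "((%p. B (snd p) (snd q)) has_derivative (%h. snd h * B' (snd p') (snd q))) (at p')"
   using has_derivative_compose[OF has_derivative_snd[OF has_derivative_ident] B[OF pp(2), of "snd q", unfolded has_field_derivative_def]] q
   by (auto simp: mult.commute)
  ultimately show "((%p. ?F p q) has_derivative ?F' p' q) (at p')"
   by (auto intro!: derivative_eq_intros simp: algebra_simps)
 qed
 moreover have "(LBINT q:UB \<times> UB. ?F' p q h) = fst h * II A' B p + snd h * II A B' p" for h
 proof -
  have "set_integrable lborel (UB \<times> UB) (%q. fst h * (A' (fst p) (fst q) * B (snd p) (snd q) * Rk (fst q) (snd q)))"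
   "set_integrable lborel (UB \<times> UB) (%q. snd h * (A (fst p) (fst q) * B' (snd p) (snd q) * Rk (fst q) (snd q)))"
   using II_integrable[OF k(2,3) p] II_integrable[OF k(1,4) p] by (intro set_integrable_mult_right; simp)+
  from set_integral_add(2)[OF this] show ?thesis unfolding set_integral_mult_right II_def .
 qed
 ultimately show ?thesis by simp
qed

lemma II_add_left:
 assumes "kfam A" "kfam B" "kfam C" "p \<in> Sq"
 shows "II (%r z. A r z + c * B r z) C p = II A C p + c * II B C p"
proof -
 have "set_integrable lborel (UB \<times> UB) (%q. c * (B (fst p) (fst q) * C (snd p) (snd q) * Rk (fst q) (snd q)))"
  using II_integrable[OF assms(2,3,4)] by (intro set_integrable_mult_right)
 from set_integral_add(2)[OF II_integrable[OF assms(1,3,4)] this]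
 show ?thesis unfolding set_integral_mult_right II_def by (simp add: algebra_simps)
qed

lemma II_add_right:
 assumes "kfam A" "kfam B" "kfam C" "p \<in> Sq"
 shows "II C (%r z. A r z + c * B r z) p = II C A p + c * II C B p"
proof -
 have "set_integrable lborel (UB \<times> UB) (%q. c * (C (fst p) (fst q) * B (snd p) (snd q) * Rk (fst q) (snd q)))"
  using II_integrable[OF assms(3,2,4)] by (intro set_integrable_mult_right)
 from set_integral_add(2)[OF II_integrable[OF assms(3,1,4)] this]
 show ?thesis unfolding set_integral_mult_right II_def by (simp add: algebra_simps)
qed

definition kw :: "real^'n => real" where "kw z = 1 / (ball_mass (0::real^'n) * (dl z) ^ CARD('n))"

text \<open>The averaging kernel centred at r \<zeta>; \<open>A1\<close> and \<open>A2\<close> are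
  its first two derivatives in r (\<open>DERIV_A\<close>).\<close>

definition A0 :: "real^'n => real => real^'n => real" where
 "A0 \<zeta> r z = kw z * bump (1/128) (sg z (r *\<^sub>R \<zeta>))"
definition A1 :: "real^'n => real => real^'n => real" where
 "A1 \<zeta> r z = kw z * (\<Sum>i\<in>UNIV. \<zeta>$i * (sg1 z i (r *\<^sub>R \<zeta>) * bump1 (1/128) (sg z (r *\<^sub>R \<zeta>))))"
definition A2 :: "real^'n => real => real^'n => real" where
 "A2 \<zeta> r z = kw z * (\<Sum>i\<in>UNIV. \<zeta>$i * (\<Sum>j\<in>UNIV. \<zeta>$j * (sg1 z i (r *\<^sub>R \<zeta>) * (sg1 z j (r *\<^sub>R \<zeta>) * bump2 (1/128) (sg z (r *\<^sub>R \<zeta>)))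
   + sg2 z i j (r *\<^sub>R \<zeta>) * bump1 (1/128) (sg z (r *\<^sub>R \<zeta>)))))"

lemma line_in_ball: "norm \<zeta> = 1 ==> r \<in> {-1<..<1} ==> r *\<^sub>R \<zeta> \<in> (UB :: (real^'n) set)"
 by auto

lemma kfam_A:
 assumes z: "norm \<zeta> = 1" shows "kfam (A0 \<zeta>)" "kfam (A1 \<zeta>)" "kfam (A2 \<zeta>)"
proof -
 have J: "ball_mass (0::real^'n) \<noteq> 0" using ball_mass_pos[OF n] by simp
 have cp: "continuous_on ({-1<..<1} \<times> UB) (%x. F (snd x) (fst x *\<^sub>R \<zeta>))"
  if "continuous_on (UB \<times> UB) (%(y, z). F y z)" for F :: "real^'n => real^'n => real"
  using continuous_on_compose2[OF that, of "{-1<..<1} \<times> UB" "%x. (snd x, fst x *\<^sub>R \<zeta>)"] line_in_ball[OF z]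
  by (force intro!: continuous_intros)
 note c = cp[OF continuous_on_sg1] cp[OF continuous_on_sg2]
  cp[OF continuous_on_sg_compose[OF continuous_on_bump(1)]] cp[OF continuous_on_sg_compose[OF continuous_on_bump(2)]] cp[OF continuous_on_sg_compose[OF continuous_on_bump(3)]]
 have "continuous_on UB kw" unfolding kw_def[abs_def] using J by (intro continuous_intros) (auto simp: power2_eq_1_iff)
 hence w: "continuous_on ({-1<..<1} \<times> UB) (%x :: real \<times> _. kw (snd x))"
  by (rule continuous_on_compose2) (auto intro!: continuous_intros)
 have supp: "1/128 <= sg z (r *\<^sub>R \<zeta>)" if "0 <= \<rho>" "\<rho> < 1" "\<bar>r\<bar> <= \<rho>" "z \<in> UB - cball 0 (sqrt ((1 + \<rho>^2) / 2))" for \<rho> r z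
 proof (rule ccontr)
  assume "\<not> ?thesis"
  hence "sg (r *\<^sub>R \<zeta>) z <= 1/16" by (simp add: sg_sym[of "r *\<^sub>R \<zeta>"])
  moreover have "norm (r *\<^sub>R \<zeta>) <= \<rho>" using assms that by simp
  ultimately have "norm z <= sqrt ((1 + \<rho>^2) / 2)" using that by (intro sg_support[of "r *\<^sub>R \<zeta>" \<rho> z]) auto
  thus False using that by simp
 qed
 show "kfam (A0 \<zeta>)" "kfam (A1 \<zeta>)" "kfam (A2 \<zeta>)"
  unfolding kfam_def A0_def A1_def A2_def split_beta
  using supp by (auto intro!: continuous_intros w c simp: bump_zero simp del: mem_ball mem_cball)
qed

lemma DERIV_A:
 assumes z: "norm \<zeta> = 1" and r: "r \<in> {-1<..<1}"
 shows "((%r. A0 \<zeta> r z) has_real_derivative A1 \<zeta> r z) (at r)" "((%r. A1 \<zeta> r z) has_real_derivative A2 \<zeta> r z) (at r)"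
proof -
 note rb = line_in_ball[OF z r]
 show "((%r. A0 \<zeta> r z) has_real_derivative A1 \<zeta> r z) (at r)"
  unfolding A0_def A1_def
  by (rule DERIV_cmult[OF DERIV_line[OF has_partials_real_sg_compose[OF DERIV_bump continuous_on_bump(2)] rb]])
 show "((%r. A1 \<zeta> r z) has_real_derivative A2 \<zeta> r z) (at r)"
  unfolding A1_def A2_def
  by (rule DERIV_cmult, rule DERIV_sum, rule DERIV_cmult,
    rule DERIV_line[OF has_partials_mult[OF has_partials_sg1 has_partials_real_sg_compose[OF DERIV_bump1 continuous_on_bump(3)]] rb])
qed

lemma lk_mean_value_Re:
 fixes f :: "real^'n => complex"
 assumes f: "f \<in> h_harmonic" and y: "y \<in> UB"
 shows "Re (f y) = (LBINT z:UB. (lk y z / (dl z) ^ CARD('n)) * Re (f z))"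
proof -
 have "integrable M (%z. kd y z *\<^sub>R f z)" by (rule kd_integrable(1)[OF y h_harmonic_continuous[OF f]])
 from integral_Re[OF this] have "Re (f y) = (\<integral>z. kd y z *\<^sub>R Re (f z) \<partial>M)"
  using kd_mean_value[OF f y] by simp
 also have "... = (LBINT z:UB. (lk y z / (dl z) ^ CARD('n)) *\<^sub>R Re (f z))"
  by (rule kd_integrable(2)[OF y]) (intro continuous_intros h_harmonic_continuous[OF f])
 finally show ?thesis by simp
qed

lemma A0_eq: "A0 \<zeta> r z = lk (r *\<^sub>R \<zeta>) z / (dl z) ^ CARD('n)"
 by (simp add: A0_def lk_def kw_def sg_sym[of z])

text \<open>Fubini, then the mean value formula in each argument; the symmetry of R makes the inner
  integrand a function in \<open>B2\<close> of the inner variable.\<close>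

lemma II_A0:
 assumes z: "norm \<zeta> = 1" "norm \<eta> = 1" and p: "p \<in> Sq"
 shows "II (A0 \<zeta>) (A0 \<eta>) p = Rk (fst p *\<^sub>R \<zeta>) (snd p *\<^sub>R \<eta>)"
proof -
 let ?x = "fst p *\<^sub>R \<zeta>" and ?y = "snd p *\<^sub>R \<eta>"
 have xb: "?x \<in> UB" and yb: "?y \<in> UB" using p z line_in_ball by (auto simp: mem_Times_iff)
 let ?f = "%q. indicator (UB \<times> UB) q *\<^sub>R (A0 \<zeta> (fst p) (fst q) * A0 \<eta> (snd p) (snd q) * Rk (fst q) (snd q))"
 have int: "integrable (lborel \<Otimes>\<^sub>M lborel) ?f"
  using II_integrable[OF kfam_A(1)[OF z(1)] kfam_A(1)[OF z(2)] p] unfolding set_integrable_def lborel_prod .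
 have "II (A0 \<zeta>) (A0 \<eta>) p = (\<integral>q. ?f q \<partial>(lborel \<Otimes>\<^sub>M lborel))"
  unfolding II_def set_lebesgue_integral_def lborel_prod ..
 also have "... = (\<integral>u. (\<integral>v. ?f (u, v) \<partial>lborel) \<partial>lborel)"
  by (rule lborel_pair.integral_fst'[OF int, symmetric])
 also have "... = (\<integral>u. indicator UB u *\<^sub>R (A0 \<zeta> (fst p) u * Re (bk ?y u)) \<partial>lborel)"
 proof (rule Bochner_Integration.integral_cong[OF refl])
  fix u :: "real^'n"
  show "(\<integral>v. ?f (u, v) \<partial>lborel) = indicator UB u *\<^sub>R (A0 \<zeta> (fst p) u * Re (bk ?y u))"
  proof (cases "u \<in> UB")
   case True
   have "(\<integral>v. ?f (u, v) \<partial>lborel) = (\<integral>v. A0 \<zeta> (fst p) u * (indicator UB v *\<^sub>R (A0 \<eta> (snd p) v * Re (bk u v))) \<partial>lborel)"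
    by (rule Bochner_Integration.integral_cong[OF refl]) (use True Rk_eq_bk[OF True] in \<open>auto simp: indicator_def\<close>)
   also have "... = A0 \<zeta> (fst p) u * (LBINT v:UB. A0 \<eta> (snd p) v * Re (bk u v))"
    unfolding set_lebesgue_integral_def by (rule integral_mult_right_zero)
   also have "(LBINT v:UB. A0 \<eta> (snd p) v * Re (bk u v)) = Re (bk u ?y)"
    unfolding A0_eq using lk_mean_value_Re[OF B2D(1)[OF bk_spec(1)[OF True]] yb] by simp
   also have "Re (bk u ?y) = Re (bk ?y u)" using Rk_eq_bk[OF True yb] by (simp add: Rk_def)
   finally show ?thesis using True by simp
  qed (simp add: indicator_def)
 qed
 also have "... = Re (bk ?y ?x)"
  using lk_mean_value_Re[OF B2D(1)[OF bk_spec(1)[OF yb]] xb] by (simp add: A0_eq set_lebesgue_integral_def)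
 finally show ?thesis by (simp add: Rk_def)
qed

end

lemma partial_derivs:
 fixes G :: "real \<times> real => real"
 assumes "(G has_derivative (%h. fst h * a + snd h * b)) (at (r, t))"
 shows "((%r. G (r, t)) has_real_derivative a) (at r)" "((%t. G (r, t)) has_real_derivative b) (at t)"
proof -
 have 1: "((%r. (r, t)) has_derivative (%h. (h, 0))) (at r)" by (auto intro!: derivative_eq_intros)
 have 2: "((%t. (r, t)) has_derivative (%h. (0, h))) (at t)" by (auto intro!: derivative_eq_intros)
 show "((%r. G (r, t)) has_real_derivative a) (at r)"
  unfolding has_field_derivative_def
  by (rule has_derivative_eq_rhs[OF has_derivative_compose[OF 1 assms]]) (simp add: fun_eq_iff)
 show "((%t. G (r, t)) has_real_derivative b) (at t)"
  unfolding has_field_derivative_def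
  by (rule has_derivative_eq_rhs[OF has_derivative_compose[OF 2 assms]]) (simp add: fun_eq_iff)
qed

lemma DERIV_eq_on_interval:
 assumes "!!r. r \<in> {-1<..<1} ==> f r = g r" "(f has_real_derivative a) (at x)" "(g has_real_derivative b) (at x)" "x \<in> {-1<..<1}"
 shows "a = b"
 using has_field_derivative_transform_within_open[OF assms(2) _ assms(4), of g] assms(1) DERIV_unique[OF _ assms(3)] by auto

lemma bcoef_bounds:
 assumes "2 <= n"
 shows "0 <= r ==> r < 1 ==> 0 <= bcoef n r" "0 <= t ==> t <= r ==> r < 1 ==> bcoef n t <= bcoef n r"
proof -
 have pos: "1 - r^2 > 0" if "0 <= r" "r < 1" for r :: real using that by (simp add: abs_square_less_1)
 show "0 <= bcoef n r" if "0 <= r" "r < 1" using pos[OF that] assms by (simp add: bcoef_def)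
 show "bcoef n t <= bcoef n r" if tr: "0 <= t" "t <= r" "r < 1"
 proof -
  have "t^2 <= r^2" using tr by (intro power_mono) auto
  hence "(1 + t^2) / (1 - t^2) <= (1 + r^2) / (1 - r^2)" using pos[of r] tr by (intro frac_le) auto
  from mult_left_mono[OF this, of "real n - 2"] show ?thesis using assms by (simp add: bcoef_def)
 qed
qed

section \<open>The symmetrised kernel satisfies the ultrahyperbolic equation\<close>

context bergman begin

text \<open>The real part of the inner product of \<open>bk a + \<sigma> bk b\<close> and
  \<open>bk c + \<sigma> bk d\<close>. For a, b = r \<zeta>, r \<eta> and c, d = t \<zeta>, t \<eta>
  both vectors run through the same curve, so the form is positive definite in (r, t).\<close>

definition qform :: "real => real^'n => real^'n => real^'n => real^'n => real" where
 "qform \<sigma> a b c d = Rk a c + \<sigma> * Rk a d + \<sigma> * (Rk b c + \<sigma> * Rk b d)"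

lemma qform_swap:
 assumes "a \<in> UB" "b \<in> UB" "c \<in> UB" "d \<in> UB"
 shows "qform \<sigma> a b c d = qform \<sigma> c d a b"
 using Rk_sym[OF assms(1,3)] Rk_sym[OF assms(1,4)] Rk_sym[OF assms(2,3)] Rk_sym[OF assms(2,4)] by (simp add: qform_def algebra_simps)

lemma qform_orthogonal:
 assumes "orthogonal_transformation U" "a \<in> UB" "b \<in> UB" "c \<in> UB" "d \<in> UB"
 shows "qform \<sigma> (U a) (U b) (U c) (U d) = qform \<sigma> a b c d"
 using assms by (simp add: qform_def Rk_orthogonal)

lemma qform_pos_def:
 assumes "a \<in> UB" "b \<in> UB" "c \<in> UB" "d \<in> UB"
 shows "2 * qform \<sigma> a b c d <= qform \<sigma> a b a b + qform \<sigma> c d c d"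
proof -
 let ?v = "%a b z. bk a z + of_real \<sigma> * bk b z"
 have v: "?v a b \<in> B2" if "a \<in> UB" "b \<in> UB" for a b
  using that by (intro B2_add B2_cmult bk_spec(1))
 have ip: "Re (ip (?v a b) (?v c d)) = qform \<sigma> a b c d" if "a \<in> UB" "b \<in> UB" "c \<in> UB" "d \<in> UB" for a b c d
 proof -
  have "ip (?v a b) (?v c d) = cnj (ip (?v c d) (?v a b))" by (simp add: ip_cnj)
  also have "... = cnj (ip (bk c) (?v a b) + of_real \<sigma> * ip (bk d) (?v a b))"
   using that by (simp add: ip_add_left[OF bk_spec(1) B2_cmult[OF bk_spec(1)] v] ip_cmult_left)
  also have "... = ip (?v a b) (bk c) + of_real \<sigma> * ip (?v a b) (bk d)" by (simp add: ip_cnj)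
  also have "... = ?v a b c + of_real \<sigma> * ?v a b d" using bk_spec(2)[OF that(3) v] bk_spec(2)[OF that(4) v] that by simp
  finally show ?thesis using that by (simp add: bk_real qform_def Rk_sym algebra_simps)
 qed
 have nsq: "nsq (?v a b) = qform \<sigma> a b a b" if "a \<in> UB" "b \<in> UB" for a b
  using ip[OF that that] unfolding ip_self by simp
 have "0 <= nsq (%z. ?v a b z - ?v c d z)" by (rule nsq_nonneg)
 also have "... = nsq (?v a b) + nsq (?v c d) - 2 * Re (ip (?v a b) (?v c d))"
  using assms by (intro nsq_diff v)
 finally show ?thesis using ip[OF assms] nsq assms by simp
qed

context
 fixes \<zeta> \<eta> :: "real^'n" and \<sigma> :: real
 assumes ze: "norm \<zeta> = 1" "norm \<eta> = 1"
begin

abbreviation "C0 \<equiv> %r z. A0 \<zeta> r z + \<sigma> * A0 \<eta> r z"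
abbreviation "C1 \<equiv> %r z. A1 \<zeta> r z + \<sigma> * A1 \<eta> r z"
abbreviation "C2 \<equiv> %r z. A2 \<zeta> r z + \<sigma> * A2 \<eta> r z"

lemma kfam_C: "kfam C0" "kfam C1" "kfam C2"
 using kfam_A[OF ze(1)] kfam_A[OF ze(2)] by (simp_all add: kfam_add_cmult)

lemma DERIV_C:
 assumes "r \<in> {-1<..<1}"
 shows "((%r. C0 r z) has_real_derivative C1 r z) (at r)" "((%r. C1 r z) has_real_derivative C2 r z) (at r)"
 by (intro DERIV_add DERIV_cmult DERIV_A ze assms)+

lemma II_C:
 assumes p: "p \<in> Sq"
 shows "(II C0 C0 has_derivative (%h. fst h * II C1 C0 p + snd h * II C0 C1 p)) (at p)"
  "(II C1 C0 has_derivative (%h. fst h * II C2 C0 p + snd h * II C1 C1 p)) (at p)"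
  "(II C0 C1 has_derivative (%h. fst h * II C1 C1 p + snd h * II C0 C2 p)) (at p)"
 by (intro II_derivative kfam_C DERIV_C p; simp)+

lemma II_C_value:
 assumes r: "r \<in> {-1<..<1}" and t: "t \<in> {-1<..<1}"
 shows "II C0 C0 (r, t) = qform \<sigma> (r *\<^sub>R \<zeta>) (r *\<^sub>R \<eta>) (t *\<^sub>R \<zeta>) (t *\<^sub>R \<eta>)"
proof -
 have p: "(r, t) \<in> Sq" using r t by simp
 note k = kfam_A(1)[OF ze(1)] kfam_A(1)[OF ze(2)]
 have "II C0 C0 (r, t) = II (A0 \<zeta>) C0 (r, t) + \<sigma> * II (A0 \<eta>) C0 (r, t)"
  by (rule II_add_left[OF k kfam_C(1) p])
 also have "II (A0 \<zeta>) C0 (r, t) = II (A0 \<zeta>) (A0 \<zeta>) (r, t) + \<sigma> * II (A0 \<zeta>) (A0 \<eta>) (r, t)"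
  by (rule II_add_right[OF k k(1) p])
 also have "II (A0 \<eta>) C0 (r, t) = II (A0 \<eta>) (A0 \<zeta>) (r, t) + \<sigma> * II (A0 \<eta>) (A0 \<eta>) (r, t)"
  by (rule II_add_right[OF k k(2) p])
 finally show ?thesis by (simp add: II_A0 ze p[simplified] r[simplified] t[simplified] qform_def)
qed

text \<open>The symmetry of the values is differentiated once and twice: on the open interval both
  sides are derivatives of one function.\<close>

lemma II_C_sym:
 assumes r: "r \<in> {-1<..<1}" and t: "t \<in> {-1<..<1}"
 shows "II C0 C1 (r, t) = II C1 C0 (t, r)" "II C0 C2 (r, t) = II C2 C0 (t, r)"
proof -
 have s: "II C0 C0 (r, t) = II C0 C0 (t, r)" if "r \<in> {-1<..<1}" "t \<in> {-1<..<1}" for r t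
  unfolding II_C_value[OF that] II_C_value[OF that(2,1)]
  by (rule qform_swap) (use that ze in auto)
 have s1: "II C0 C1 (r, t) = II C1 C0 (t, r)" if "r \<in> {-1<..<1}" "t \<in> {-1<..<1}" for r t
  by (rule DERIV_eq_on_interval[OF s partial_derivs(2)[OF II_C(1)] partial_derivs(1)[OF II_C(1)]]) (use that in auto)
 show "II C0 C1 (r, t) = II C1 C0 (t, r)" by (rule s1[OF r t])
 show "II C0 C2 (r, t) = II C2 C0 (t, r)"
  by (rule DERIV_eq_on_interval[OF s1 partial_derivs(2)[OF II_C(3)] partial_derivs(1)[OF II_C(2)]]) (use r t in auto)
qed

abbreviation "LQ r t \<equiv> r^2 * II C2 C0 (r, t) + r * II C1 C0 (r, t) + bcoef CARD('n) r * (r * II C1 C0 (r, t))"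
abbreviation "GQ r t k l \<theta> \<equiv> qform \<sigma> (rot k l \<theta> (r *\<^sub>R \<zeta>)) (rot k l \<theta> (r *\<^sub>R \<eta>)) (t *\<^sub>R \<zeta>) (t *\<^sub>R \<eta>)"

text \<open>\<open>polar_equation\<close> at r \<zeta> and r \<eta> for the function R(-, t \<zeta>)
  + \<sigma> R(-, t \<eta>). The spherical part is kept as second derivatives of \<open>GQ\<close>
  at angle 0: in this form it can be compared between the two arguments and has a sign on the
  diagonal.\<close>

lemma radial_part:
 assumes r: "0 < r" "r < 1" and t: "t \<in> {-1<..<1}"
 obtains d where "!!k l. has2 (GQ r t k l) (d k l)" "LQ r t = - (1/2) * (\<Sum>k\<in>UNIV. \<Sum>l\<in>UNIV. d k l)"
proof -
 define F where "F x = bk (t *\<^sub>R \<zeta>) x + of_real \<sigma> * bk (t *\<^sub>R \<eta>) x" for x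
 define f where "f x = Re (F x)" for x
 have tb: "t *\<^sub>R \<zeta> \<in> UB" "t *\<^sub>R \<eta> \<in> UB" using t ze line_in_ball by auto
 have F: "F \<in> h_harmonic" unfolding F_def[abs_def]
  by (intro h_harmonic_add h_harmonic_cmult B2D(1) bk_spec(1) tb)
 obtain f1 f2 where h: "h_harmonic_real f f1 f2" using h_harmonic_real_Re[OF F] unfolding f_def[symmetric, abs_def] by blast
 hence p1: "has_partials f f1 UB" and p2: "!!i. has_partials (f1 i) (f2 i) UB" by (auto simp: h_harmonic_real_def)
 have fv: "f x = Rk x (t *\<^sub>R \<zeta>) + \<sigma> * Rk x (t *\<^sub>R \<eta>)" if "x \<in> UB" for x
  using that tb by (simp add: f_def F_def bk_real)
 define Q1 where "Q1 r = (\<Sum>i\<in>UNIV. \<zeta>$i * f1 i (r *\<^sub>R \<zeta>)) + \<sigma> * (\<Sum>i\<in>UNIV. \<eta>$i * f1 i (r *\<^sub>R \<eta>))" for r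
 define Q2 where "Q2 r = (\<Sum>i\<in>UNIV. \<zeta>$i * (\<Sum>j\<in>UNIV. \<zeta>$j * f2 i j (r *\<^sub>R \<zeta>))) + \<sigma> * (\<Sum>i\<in>UNIV. \<eta>$i * (\<Sum>j\<in>UNIV. \<eta>$j * f2 i j (r *\<^sub>R \<eta>)))" for r
 have Q0: "II C0 C0 (s, t) = f (s *\<^sub>R \<zeta>) + \<sigma> * f (s *\<^sub>R \<eta>)" if "s \<in> {-1<..<1}" for s
  by (simp add: II_C_value[OF that t] qform_def fv[OF line_in_ball[OF ze(1) that]] fv[OF line_in_ball[OF ze(2) that]])
 have D1: "((%r. f (r *\<^sub>R \<zeta>) + \<sigma> * f (r *\<^sub>R \<eta>)) has_real_derivative Q1 s) (at s)" if "s \<in> {-1<..<1}" for s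
  unfolding Q1_def by (intro DERIV_add DERIV_cmult DERIV_line p1 line_in_ball ze that)
 have D2: "(Q1 has_real_derivative Q2 s) (at s)" if "s \<in> {-1<..<1}" for s
  unfolding Q1_def[abs_def] Q2_def by (intro DERIV_add DERIV_cmult DERIV_sum DERIV_line p2 line_in_ball ze that)
 have q1: "II C1 C0 (s, t) = Q1 s" if "s \<in> {-1<..<1}" for s
  by (rule DERIV_eq_on_interval[OF Q0 partial_derivs(1)[OF II_C(1)] D1]) (use that t in auto)
 have rr: "r \<in> {-1<..<1}" using r by simp
 have q2: "II C2 C0 (r, t) = Q2 r"
  by (rule DERIV_eq_on_interval[OF q1 partial_derivs(1)[OF II_C(2)] D2]) (use rr t in auto)
 have rb: "r *\<^sub>R \<zeta> \<in> UB" "r *\<^sub>R \<eta> \<in> UB" using rr ze line_in_ball by auto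
 define d where "d k l = rotgen2 k l f1 f2 (r *\<^sub>R \<zeta>) + \<sigma> * rotgen2 k l f1 f2 (r *\<^sub>R \<eta>)" for k l
 define L where "L x = (\<Sum>i\<in>UNIV. \<Sum>j\<in>UNIV. x$i * x$j * f2 i j x) + (\<Sum>i\<in>UNIV. x$i * f1 i x) + bcoef CARD('n) r * (\<Sum>i\<in>UNIV. x$i * f1 i x)" for x
 have Lr: "L (r *\<^sub>R v) = r^2 * (\<Sum>i\<in>UNIV. v$i * (\<Sum>j\<in>UNIV. v$j * f2 i j (r *\<^sub>R v))) + r * (\<Sum>i\<in>UNIV. v$i * f1 i (r *\<^sub>R v))
   + bcoef CARD('n) r * (r * (\<Sum>i\<in>UNIV. v$i * f1 i (r *\<^sub>R v)))" for v
  by (simp add: L_def sum_distrib_left power2_eq_square mult_ac)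
 have Ld: "L (r *\<^sub>R v) = - (1/2) * (\<Sum>k\<in>UNIV. \<Sum>l\<in>UNIV. rotgen2 k l f1 f2 (r *\<^sub>R v))" if "norm v = 1" for v
  using polar_equation[OF h line_in_ball[OF that rr]] that r unfolding L_def by simp
 have "LQ r t = L (r *\<^sub>R \<zeta>) + \<sigma> * L (r *\<^sub>R \<eta>)"
  unfolding q1[OF rr] q2 Q1_def Q2_def Lr by (simp add: algebra_simps)
 also have "... = - (1/2) * (\<Sum>k\<in>UNIV. \<Sum>l\<in>UNIV. d k l)"
  unfolding Ld[OF ze(1)] Ld[OF ze(2)] d_def sum.distrib sum_distrib_left[symmetric] by (simp add: algebra_simps)
 finally have 2: "LQ r t = - (1/2) * (\<Sum>k\<in>UNIV. \<Sum>l\<in>UNIV. d k l)" .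
 have "has2 (GQ r t k l) (d k l)" for k l
 proof -
  have "GQ r t k l = (%\<theta>. f (rot k l \<theta> (r *\<^sub>R \<zeta>)) + \<sigma> * f (rot k l \<theta> (r *\<^sub>R \<eta>)))"
   using rb orthogonal_transformation_norm[OF rot_orthogonal] by (simp add: fun_eq_iff qform_def fv orthogonal_transformation_norm[OF rot_orthogonal])
  thus ?thesis unfolding d_def by (simp only:) (intro has2_add_cmult has2_rot p1 p2 rb)
 qed
 with 2 show thesis using that by blast
qed

text \<open>Apply the inverse rotation to all four points and use symmetry. A second derivative at 0
  does not see the sign of \<theta> (\<open>has2_reflect\<close>), so both radial operators have the
  same spherical part.\<close>

lemma GQ_swap:
 assumes "r \<in> {-1<..<1}" "t \<in> {-1<..<1}" shows "GQ r t k l \<theta> = GQ t r k l (- \<theta>)"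
proof -
 have b: "r *\<^sub>R \<zeta> \<in> UB" "r *\<^sub>R \<eta> \<in> UB" "t *\<^sub>R \<zeta> \<in> UB" "t *\<^sub>R \<eta> \<in> UB" using assms ze line_in_ball by auto
 have rb: "rot k l \<theta> x \<in> UB" if "x \<in> UB" for x and \<theta>
  using that by (simp add: orthogonal_transformation_norm[OF rot_orthogonal])
 have "GQ r t k l \<theta> = qform \<sigma> (rot k l (-\<theta>) (rot k l \<theta> (r *\<^sub>R \<zeta>))) (rot k l (-\<theta>) (rot k l \<theta> (r *\<^sub>R \<eta>))) (rot k l (-\<theta>) (t *\<^sub>R \<zeta>)) (rot k l (-\<theta>) (t *\<^sub>R \<eta>))"
  by (rule qform_orthogonal[OF rot_orthogonal, symmetric]; intro rb b)
 also have "... = GQ t r k l (- \<theta>)"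
  unfolding rot_inverse by (rule qform_swap) (intro rb b)+
 finally show ?thesis .
qed

text \<open>The rotated and the unrotated vector have equal norms, so by
  \<open>qform_pos_def\<close> their inner product is largest at angle 0. This gives the sign in
  \<open>diag\<close>.\<close>

lemma GQ_le:
 assumes "r \<in> {-1<..<1}" shows "GQ r r k l \<theta> <= GQ r r k l 0"
proof -
 have b: "r *\<^sub>R \<zeta> \<in> UB" "r *\<^sub>R \<eta> \<in> UB" using assms ze line_in_ball by auto
 have rb: "rot k l \<theta> x \<in> UB" if "x \<in> UB" for x and \<theta>
  using that by (simp add: orthogonal_transformation_norm[OF rot_orthogonal])
 have "2 * GQ r r k l \<theta> <= qform \<sigma> (rot k l \<theta> (r *\<^sub>R \<zeta>)) (rot k l \<theta> (r *\<^sub>R \<eta>)) (rot k l \<theta> (r *\<^sub>R \<zeta>)) (rot k l \<theta> (r *\<^sub>R \<eta>)) + GQ r r k l 0"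
  unfolding rot_0 by (intro qform_pos_def rb b)
 thus ?thesis using b by (simp add: qform_orthogonal[OF rot_orthogonal])
qed

lemma Rk_hyperbolic: "hyperbolic (II C0 C0) (II C1 C0) (II C0 C1) (II C2 C0) (II C1 C1) (II C0 C2) (bcoef CARD('n))"
proof
 fix r t :: real
 show "II C0 C1 (r, t) = II C1 C0 (t, r)" if "r \<in> {-1<..<1}" "t \<in> {-1<..<1}" by (rule II_C_sym(1)[OF that])
 show "LQ r t = t^2 * II C0 C2 (r, t) + t * II C0 C1 (r, t) + bcoef CARD('n) t * (t * II C0 C1 (r, t))"
  if rt: "0 < r" "r < 1" "0 < t" "t < 1"
 proof -
  have i: "r \<in> {-1<..<1}" "t \<in> {-1<..<1}" using rt by auto
  obtain d where d: "!!k l. has2 (GQ r t k l) (d k l)" "LQ r t = - (1/2) * (\<Sum>k\<in>UNIV. \<Sum>l\<in>UNIV. d k l)"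
   using radial_part[OF rt(1,2) i(2)] by blast
  obtain e where e: "!!k l. has2 (GQ t r k l) (e k l)" "LQ t r = - (1/2) * (\<Sum>k\<in>UNIV. \<Sum>l\<in>UNIV. e k l)"
   using radial_part[OF rt(3,4) i(1)] by blast
  have "d k l = e k l" for k l
   using has2_unique[OF d(1) has2_reflect[OF e(1), of k l, folded GQ_swap[OF i]]] .
  thus ?thesis unfolding II_C_sym[OF i] using d(2) e(2) by simp
 qed
 show "0 <= LQ r r" if r: "0 < r" "r < 1"
 proof -
  have i: "r \<in> {-1<..<1}" using r by auto
  obtain d where d: "!!k l. has2 (GQ r r k l) (d k l)" "LQ r r = - (1/2) * (\<Sum>k\<in>UNIV. \<Sum>l\<in>UNIV. d k l)"
   using radial_part[OF r i] by blast
  have "d k l <= 0" for k l by (rule has2_max[OF d(1) GQ_le[OF i]])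
  hence "(\<Sum>k\<in>UNIV. \<Sum>l\<in>UNIV. d k l) <= 0" by (intro sum_nonpos)
  thus ?thesis using d(2) by linarith
 qed
 show "2 * II C0 C0 (r, t) <= II C0 C0 (r, r) + II C0 C0 (t, t)" if "r \<in> {0<..<1}" "t \<in> {0<..<1}"
 proof -
  have i: "r \<in> {-1<..<1}" "t \<in> {-1<..<1}" using that by auto
  show ?thesis unfolding II_C_value[OF i] II_C_value[OF i(1) i(1)] II_C_value[OF i(2) i(2)]
   by (intro qform_pos_def line_in_ball ze i)
 qed
qed (auto intro: II_C bcoef_bounds[OF n] simp del: split_paired_All)

lemma qform_bound:
 assumes "0 < t" "t <= r" "r < 1"
 shows "qform \<sigma> 0 0 0 0 <= qform \<sigma> (r *\<^sub>R \<zeta>) (r *\<^sub>R \<eta>) (t *\<^sub>R \<zeta>) (t *\<^sub>R \<eta>)"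
  "qform \<sigma> (r *\<^sub>R \<zeta>) (r *\<^sub>R \<eta>) (t *\<^sub>R \<zeta>) (t *\<^sub>R \<eta>) <= qform \<sigma> (sqrt (r * t) *\<^sub>R \<zeta>) (sqrt (r * t) *\<^sub>R \<eta>) (sqrt (r * t) *\<^sub>R \<zeta>) (sqrt (r * t) *\<^sub>R \<eta>)"
proof -
 have "r * t < 1" using assms mult_strict_mono[of r 1 t 1] by simp
 hence i: "r \<in> {-1<..<1}" "t \<in> {-1<..<1}" "sqrt (r * t) \<in> {-1<..<1}" "(0::real) \<in> {-1<..<1}"
  using assms by (auto intro: less_le_trans[of _ 0])
 show "qform \<sigma> 0 0 0 0 <= qform \<sigma> (r *\<^sub>R \<zeta>) (r *\<^sub>R \<eta>) (t *\<^sub>R \<zeta>) (t *\<^sub>R \<eta>)"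
  "qform \<sigma> (r *\<^sub>R \<zeta>) (r *\<^sub>R \<eta>) (t *\<^sub>R \<zeta>) (t *\<^sub>R \<eta>) <= qform \<sigma> (sqrt (r * t) *\<^sub>R \<zeta>) (sqrt (r * t) *\<^sub>R \<eta>) (sqrt (r * t) *\<^sub>R \<zeta>) (sqrt (r * t) *\<^sub>R \<eta>)"
  using hyperbolic.hyperbolic_bound[OF Rk_hyperbolic assms]
  unfolding II_C_value[OF i(1,2)] II_C_value[OF i(3,3)] II_C_value[OF i(4,4)] by simp_all
qed

end

text \<open>The reflection that swaps \<zeta> and \<eta> pairs the four terms of
  \<open>qform\<close> as (1 + \<sigma>^2) P + 2 \<sigma> S, with P = R(r \<zeta>, t \<zeta>) and S
  = R(r \<zeta>, t \<eta>). The cases \<sigma> = 1 and \<sigma> = -1 of \<open>qform_bound\<close>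
  confine P + S and P - S to [0, 2 D], hence |S| <= D.\<close>

lemma Rk_le_diag:
 assumes x: "x \<in> UB" "x \<noteq> 0" and a: "a \<in> UB" "a \<noteq> 0" and le: "norm a <= norm x"
 obtains w where "w \<in> UB" "(norm w)^2 = norm x * norm a" "\<bar>Rk x a\<bar> <= Rk w w"
proof -
 define r t \<zeta> \<eta> where "r = norm x" and "t = norm a" and "\<zeta> = (1 / norm x) *\<^sub>R x" and "\<eta> = (1 / norm a) *\<^sub>R a"
 have rt: "0 < t" "t <= r" "r < 1" using x a le by (auto simp: r_def t_def)
 have ze: "norm \<zeta> = 1" "norm \<eta> = 1" using x a by (auto simp: \<zeta>_def \<eta>_def)
 have xa: "x = r *\<^sub>R \<zeta>" "a = t *\<^sub>R \<eta>" using x a by (auto simp: r_def t_def \<zeta>_def \<eta>_def)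
 define s where "s = sqrt (r * t)"
 have s1: "r * t < 1" using rt mult_strict_mono[of r 1 t 1] by simp
 have s: "0 <= s" "s < 1" "s^2 = r * t" using rt s1 by (auto simp: s_def)
 have b: "c *\<^sub>R \<zeta> \<in> UB" "c *\<^sub>R \<eta> \<in> UB" if "0 <= c" "c < 1" for c using that ze by auto
 obtain U where U: "orthogonal_transformation U" "U \<zeta> = \<eta>" "U \<eta> = \<zeta>" using reflection_exists[OF ze] by blast
 have Us: "U (c *\<^sub>R v) = c *\<^sub>R U v" for c v using U(1) orthogonal_transformation_linear linear_cmul by blast
 have U1: "Rk (c *\<^sub>R \<eta>) (d *\<^sub>R \<eta>) = Rk (c *\<^sub>R \<zeta>) (d *\<^sub>R \<zeta>)" "Rk (c *\<^sub>R \<eta>) (d *\<^sub>R \<zeta>) = Rk (c *\<^sub>R \<zeta>) (d *\<^sub>R \<eta>)"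
  if "0 <= c" "c < 1" "0 <= d" "d < 1" for c d
  using Rk_orthogonal[OF U(1) b(1)[OF that(1,2)] b(1)[OF that(3,4)]] Rk_orthogonal[OF U(1) b(1)[OF that(1,2)] b(2)[OF that(3,4)]]
  unfolding Us U(2,3) by simp_all
 have q: "qform \<sigma> (c *\<^sub>R \<zeta>) (c *\<^sub>R \<eta>) (d *\<^sub>R \<zeta>) (d *\<^sub>R \<eta>) = (1 + \<sigma>^2) * Rk (c *\<^sub>R \<zeta>) (d *\<^sub>R \<zeta>) + 2 * \<sigma> * Rk (c *\<^sub>R \<zeta>) (d *\<^sub>R \<eta>)"
  if "0 <= c" "c < 1" "0 <= d" "d < 1" for c d \<sigma>
  unfolding qform_def U1[OF that] by (simp add: power2_eq_square algebra_simps)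
 define D where "D = Rk (s *\<^sub>R \<zeta>) (s *\<^sub>R \<zeta>)"
 have E: "\<bar>Rk (s *\<^sub>R \<zeta>) (s *\<^sub>R \<eta>)\<bar> <= D"
 proof -
  have "(Rk (s *\<^sub>R \<zeta>) (s *\<^sub>R \<eta>))^2 <= D^2"
   using Rk_CS[OF b(1)[OF s(1,2)] b(2)[OF s(1,2)]] U1(1)[OF s(1,2) s(1,2)] by (simp add: D_def power2_eq_square)
  moreover have "0 <= D" unfolding D_def using Rk_diag_pos[OF b(1)[OF s(1,2)]] by simp
  ultimately show ?thesis using abs_le_square_iff[of _ D] by simp
 qed
 have r01: "0 <= r" "r < 1" "0 <= t" "t < 1" using rt by auto
 have 0: "0 < Rk (0::real^'n) 0" using Rk_diag_pos[of 0] by simp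
 note qb = qform_bound[OF ze rt, folded s_def]
 have p: "0 <= Rk (r *\<^sub>R \<zeta>) (t *\<^sub>R \<zeta>) + Rk (r *\<^sub>R \<zeta>) (t *\<^sub>R \<eta>)" "Rk (r *\<^sub>R \<zeta>) (t *\<^sub>R \<zeta>) + Rk (r *\<^sub>R \<zeta>) (t *\<^sub>R \<eta>) <= 2 * D"
  using qb[of 1] E 0 unfolding q[OF r01] q[OF s(1,2) s(1,2)] D_def[symmetric] by (auto simp: qform_def)
 have m: "0 <= Rk (r *\<^sub>R \<zeta>) (t *\<^sub>R \<zeta>) - Rk (r *\<^sub>R \<zeta>) (t *\<^sub>R \<eta>)" "Rk (r *\<^sub>R \<zeta>) (t *\<^sub>R \<zeta>) - Rk (r *\<^sub>R \<zeta>) (t *\<^sub>R \<eta>) <= 2 * D"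
  using qb[of "-1"] E 0 unfolding q[OF r01] q[OF s(1,2) s(1,2)] D_def[symmetric] by (auto simp: qform_def)
 have "\<bar>Rk (r *\<^sub>R \<zeta>) (t *\<^sub>R \<eta>)\<bar> <= D" using p m by linarith
 moreover have "(norm (s *\<^sub>R \<zeta>))^2 = norm x * norm a" using s ze by (simp add: r_def t_def)
 ultimately show ?thesis using that[of "s *\<^sub>R \<zeta>"] b(1)[OF s(1,2)] unfolding D_def xa[symmetric] by blast
qed

text \<open>\<open>Rk_le_diag\<close> gives a diagonal value at w with |w|^2 = |x| |a|, and 1 - |x|
  |a| >= 1 - |a| >= (1 - |a|^2) / 2 removes x from the bound.\<close>

theorem Rk_bound:
 obtains C where "0 < C" "!!x a. x \<in> UB ==> a \<in> UB ==> \<bar>Rk x a\<bar> <= C * wi a"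
proof -
 obtain C where C: "0 < C" "!!x. x \<in> UB ==> Rk x x <= C * wi x"
  using Rk_diag_bound by blast
 define \<beta> where "\<beta> = real CARD('n) + \<alpha>"
 have \<beta>: "0 < \<beta>" "- real CARD('n) - \<alpha> = - \<beta>" using n alpha by (auto simp: \<beta>_def)
 have dl: "C * (1 - u * v) powr (-\<beta>) <= C * 2 powr \<beta> * (1 - v^2) powr (-\<beta>)" if "0 <= u" "u < 1" "0 <= v" "v < 1" for u v
 proof -
  have "1 - v^2 = (1 - v) * (1 + v)" by (simp add: power2_eq_square algebra_simps)
  also have "... <= (1 - v) * 2" using that by (intro mult_left_mono) auto
  also have "1 - v <= 1 - u * v" using that mult_right_mono[of u 1 v] by simp
  finally have a: "(1 - v^2) / 2 <= 1 - u * v" by simp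
  have pos: "0 < 1 - v^2" using that by (simp add: abs_square_less_1)
  have "(1 - u * v) powr (-\<beta>) <= ((1 - v^2) / 2) powr (-\<beta>)"
   using a pos \<beta> by (intro powr_mono2') auto
  also have "... = 2 powr \<beta> * (1 - v^2) powr (-\<beta>)" using pos by (simp add: powr_divide powr_minus field_simps)
  finally show ?thesis using C(1) by simp
 qed
 have nz: "\<bar>Rk x a\<bar> <= C * 2 powr \<beta> * (dl a) powr (-\<beta>)"
  if x: "x \<in> UB" "x \<noteq> 0" and a: "a \<in> UB" "a \<noteq> 0" for x a
 proof -
  obtain w where w: "w \<in> UB" "(norm w)^2 = norm x * norm a" "\<bar>Rk x a\<bar> <= Rk w w"
  proof (cases "norm a <= norm x")
   case True
   show ?thesis using Rk_le_diag[OF x a True] that by blast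
  next
   case False
   then obtain w where "w \<in> UB" "(norm w)^2 = norm a * norm x" "\<bar>Rk a x\<bar> <= Rk w w"
    using Rk_le_diag[OF a x] by (metis linear)
   thus ?thesis using that[of w] Rk_sym[OF x(1) a(1)] by (simp add: mult.commute)
  qed
  have "\<bar>Rk x a\<bar> <= C * (1 - norm x * norm a) powr (-\<beta>)" using w(3) C(2)[OF w(1)] unfolding w(2) \<beta>(2) by simp
  also have "... <= C * 2 powr \<beta> * (dl a) powr (-\<beta>)" using x a by (intro dl) auto
  finally show ?thesis .
 qed
 \<comment> \<open>\<open>Rk_le_diag\<close> works with the directions of x and a; the cases x = 0
   and a = 0 follow by continuity along X k.\<close>
 let ?e = "axis undefined 1 :: real^'n"
 define X where "X k = (1 / (real k + 2)) *\<^sub>R ?e" for k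
 have X0: "X \<longlonglongrightarrow> 0"
 proof -
  have "(%k. 1 / (real k + 2)) \<longlonglongrightarrow> 0" by real_asymp
  from tendsto_scaleR[OF this tendsto_const[of ?e]] show ?thesis by (simp add: X_def[abs_def])
 qed
 have Xb: "X k \<in> UB" "X k \<noteq> 0" for k by (auto simp: X_def axis_eq_0_iff)
 have Rc: "(%k. Rk (fst (P k)) (snd (P k))) \<longlonglongrightarrow> Rk (fst p) (snd p)" if "P \<longlonglongrightarrow> p" "!!k. P k \<in> UB \<times> UB" "p \<in> UB \<times> UB" for P p
  using continuous_on_tendsto_compose[OF continuous_on_Rk that(1,3)] that(2) by (simp add: case_prod_unfold)
 have wc: "(%k. C * 2 powr \<beta> * (dl (Y k)) powr (-\<beta>)) \<longlonglongrightarrow> C * 2 powr \<beta> * (dl y) powr (-\<beta>)" if "Y \<longlonglongrightarrow> y" "y \<in> UB" for Y and y :: "real^'n"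
  using dl_pos[OF that(2)] by (intro tendsto_intros that(1)) auto
 have nz2: "\<bar>Rk x a\<bar> <= C * 2 powr \<beta> * (dl a) powr (-\<beta>)"
  if x: "x \<in> UB" and a: "a \<in> UB" "a \<noteq> 0" for x a
 proof (cases "x = 0")
  case True
  have "(%k. \<bar>Rk (X k) a\<bar>) \<longlonglongrightarrow> \<bar>Rk x a\<bar>"
   using tendsto_rabs[OF Rc[OF tendsto_Pair[OF X0 tendsto_const[of a]]]] Xb(1) a(1) True by simp
  thus ?thesis by (rule LIMSEQ_le_const2) (use nz[OF Xb a] in auto)
 qed (use nz x a in auto)
 have "\<bar>Rk x a\<bar> <= C * 2 powr \<beta> * (dl a) powr (-\<beta>)" if x: "x \<in> UB" and a: "a \<in> UB" for x a
 proof (cases "a = 0")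
  case True
  have "(%k. \<bar>Rk x (X k)\<bar>) \<longlonglongrightarrow> \<bar>Rk x a\<bar>"
   using tendsto_rabs[OF Rc[OF tendsto_Pair[OF tendsto_const[of x] X0]]] Xb(1) x True by simp
  moreover have "(%k. C * 2 powr \<beta> * (dl (X k)) powr (-\<beta>)) \<longlonglongrightarrow> C * 2 powr \<beta> * (dl a) powr (-\<beta>)"
   using wc[OF X0] True by simp
  ultimately show ?thesis by (rule LIMSEQ_le) (use nz2[OF x Xb] in auto)
 qed (use nz2 x a in auto)
 thus ?thesis using that[of "C * 2 powr \<beta>"] C(1) \<beta>(2) by simp
qed

end

section \<open>Bloch functions\<close>

lemma bloch_density_nonneg: "x \<in> UB ==> 0 <= bloch_density f x"
 using dl_pos[of x] by (simp add: bloch_density_def)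

lemma bloch_norm_bounds:
 fixes f :: "real^'n => complex"
 assumes "f \<in> bloch_space"
 shows "!!x. x \<in> UB ==> bloch_density f x <= bloch_norm f" "cmod (f 0) <= bloch_norm f" "0 <= bloch_norm f"
proof -
 have bd: "bdd_above (bloch_density f ` UB)" using assms by (simp add: bloch_space_def)
 have u: "bloch_density f x <= (SUP x\<in>UB. bloch_density f x)" if "x \<in> UB" for x
  by (rule cSUP_upper[OF that bd])
 have "0 <= bloch_density f 0" by (rule bloch_density_nonneg) simp
 also have "... <= (SUP x\<in>UB. bloch_density f x)" by (rule u) simp
 finally have s: "0 <= (SUP x\<in>UB. bloch_density f x)" .
 show "bloch_density f x <= bloch_norm f" if "x \<in> UB" for x
  using u[OF that] by (simp add: bloch_norm_def add_increasing)
 show "cmod (f 0) <= bloch_norm f" "0 <= bloch_norm f" using s by (simp_all add: bloch_norm_def)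
qed

lemma pderivative_le_density:
 fixes f :: "real^'n => complex"
 assumes "x \<in> UB"
 shows "(dl x) * cmod (pderivative i f x) <= bloch_density f x"
 using dl_pos[OF assms] Finite_Cartesian_Product.norm_nth_le[of "gradient f x" i]
 by (simp add: bloch_density_def gradient_def)

lemma bloch_density_le_sum:
 fixes f :: "real^'n => complex"
 assumes "x \<in> UB"
 shows "bloch_density f x <= (\<Sum>i\<in>UNIV. (dl x) * cmod (pderivative i f x))"
 using dl_pos[OF assms] L2_set_le_sum[of UNIV "%i. norm (gradient f x $ i)"]
 unfolding bloch_density_def norm_vec_def[of "gradient f x"] sum_distrib_left[symmetric] by (simp add: gradient_def)

lemma line_sum_bound:
 fixes f :: "real^'n => complex"
 assumes x: "x \<in> UB"
 shows "(dl x) * cmod (\<Sum>i\<in>UNIV. of_real (v$i) * pderivative i f x) <= real CARD('n) * norm v * bloch_density f x"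
proof -
 have "(dl x) * cmod (\<Sum>i\<in>UNIV. of_real (v$i) * pderivative i f x) <= (dl x) * (\<Sum>i\<in>UNIV. \<bar>v$i\<bar> * cmod (pderivative i f x))"
  using dl_pos[OF x] by (intro mult_left_mono order_trans[OF norm_sum]) (simp_all add: norm_mult)
 also have "... = (\<Sum>i\<in>UNIV. \<bar>v$i\<bar> * ((dl x) * cmod (pderivative i f x)))"
  by (simp add: sum_distrib_left mult_ac)
 also have "... <= (\<Sum>i\<in>(UNIV :: 'n set). norm v * bloch_density f x)"
  using dl_pos[OF x] by (intro sum_mono mult_mono pderivative_le_density x component_le_norm_cart) auto
 finally show ?thesis by (simp add: mult.assoc)
qed

text \<open>Integration of the gradient bound along the radius. The logarithm that would appear is
  majorised from the start by a power: 1/u <= u^(-e-1), with antiderivative \<phi>. As any e > 0 is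
  allowed, the loss of exponent can be made as small as desired.\<close>

lemma bloch_growth:
 fixes f :: "real^'n => complex"
 assumes f: "f \<in> bloch_space" and x: "x \<in> UB" and e: "0 < e"
 shows "cmod (f x) <= (1 + real CARD('n) / e) * bloch_norm f * (1 - norm x) powr (- e)"
proof -
 have fh: "f \<in> h_harmonic" using f by (simp add: bloch_space_def)
 define p where "p = bloch_norm f"
 define c where "c = real CARD('n) * p / e"
 have p: "0 <= p" and c0: "0 <= c" using bloch_norm_bounds(3)[OF f] e by (auto simp: p_def c_def)
 have tb: "t *\<^sub>R x \<in> UB" "t * norm x < 1" if "0 <= t" "t <= 1" for t
 proof -
  have "t * norm x <= 1 * norm x" using that by (intro mult_right_mono) auto
  thus "t * norm x < 1" "t *\<^sub>R x \<in> UB" using x that by auto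
 qed
 define \<phi> where "\<phi> t = c * (1 - t * norm x) powr (- e)" for t
 have "norm (f (1 *\<^sub>R x) - f (0 *\<^sub>R x)) <= \<phi> 1 - \<phi> 0"
 proof (rule differentiable_bound_general[where f = "%t. f (t *\<^sub>R x)" and \<phi> = \<phi>
    and f' = "%t. \<Sum>i\<in>UNIV. of_real (x$i) * pderivative i f (t *\<^sub>R x)" and \<phi>' = "%t. c * (e * norm x * (1 - t * norm x) powr (- e - 1))"])
  have Df: "((%t. f (t *\<^sub>R x)) has_vector_derivative (\<Sum>i\<in>UNIV. of_real (x$i) * pderivative i f (t *\<^sub>R x))) (at t)" if "0 <= t" "t <= 1" for t
  proof -
   have D: "((%r. r *\<^sub>R x) has_derivative (%h. h *\<^sub>R x)) (at t)" by (auto intro!: derivative_eq_intros)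
   show ?thesis unfolding has_vector_derivative_def
    by (rule has_derivative_eq_rhs[OF has_derivative_compose[OF D has_partialsD(1)[OF h_harmonicD(1)[OF fh] tb(1)[OF that]]]])
     (simp add: fun_eq_iff scaleR_sum_right scaleR_conv_of_real[where 'a = complex] mult_ac sum_distrib_left)
  qed
  have D\<phi>: "(\<phi> has_real_derivative c * (e * norm x * (1 - t * norm x) powr (- e - 1))) (at t)" if "0 <= t" "t <= 1" for t
   unfolding \<phi>_def[abs_def] using tb(2)[OF that] by (auto intro!: derivative_eq_intros simp: powr_diff)
  show "continuous_on {0..1} (%t. f (t *\<^sub>R x))"
   by (intro continuous_at_imp_continuous_on ballI has_vector_derivative_continuous[OF Df]) auto
  show "continuous_on {0..1} \<phi>"
   by (intro continuous_at_imp_continuous_on ballI DERIV_isCont[OF D\<phi>]) auto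
  fix t :: real assume t: "0 < t" "t < 1"
  show "((%t. f (t *\<^sub>R x)) has_vector_derivative (\<Sum>i\<in>UNIV. of_real (x$i) * pderivative i f (t *\<^sub>R x))) (at t)" using Df t by auto
  show "(\<phi> has_vector_derivative c * (e * norm x * (1 - t * norm x) powr (- e - 1))) (at t)"
   using D\<phi>[of t] t by (simp add: has_real_derivative_iff_has_vector_derivative)
  let ?u = "1 - t * norm x"
  have u: "0 < ?u" "?u <= 1" using tb[of t] t by auto
  have tx: "t *\<^sub>R x \<in> UB" using tb t by auto
  have "dl (t *\<^sub>R x) = ?u * (1 + t * norm x)" using t by (simp add: power2_eq_square algebra_simps)
  moreover have "?u * 1 <= ?u * (1 + t * norm x)" using u t by (intro mult_left_mono) auto
  ultimately have u2: "?u <= dl (t *\<^sub>R x)" by simp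
  let ?S = "cmod (\<Sum>i\<in>UNIV. of_real (x$i) * pderivative i f (t *\<^sub>R x))"
  have "?u * ?S <= (dl (t *\<^sub>R x)) * ?S" by (intro mult_right_mono u2) auto
  also have "... <= real CARD('n) * norm x * bloch_density f (t *\<^sub>R x)" by (rule line_sum_bound[OF tx])
  also have "... <= real CARD('n) * norm x * p" unfolding p_def by (intro mult_left_mono bloch_norm_bounds(1)[OF f tx]) auto
  finally have "?S <= real CARD('n) * norm x * p * (1 / ?u)" using u by (simp add: field_simps)
  also have "1 / ?u <= ?u powr (- e - 1)"
  proof -
   have "1 / ?u = ?u powr (- 1)" using u by (simp add: powr_minus divide_inverse)
   also have "... <= ?u powr (- e - 1)" using u e by (intro powr_mono') auto
   finally show ?thesis .
  qed
  hence "real CARD('n) * norm x * p * (1 / ?u) <= real CARD('n) * norm x * p * ?u powr (- e - 1)" using p by (intro mult_left_mono) auto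
  also have "... = c * (e * norm x * ?u powr (- e - 1))" using e by (simp add: c_def)
  finally show "?S <= c * (e * norm x * ?u powr (- e - 1))" .
 qed auto
 moreover have "0 <= \<phi> 0" using c0 by (simp add: \<phi>_def)
 ultimately have "cmod (f x) <= cmod (f 0) + \<phi> 1" using norm_triangle_ineq2[of "f x" "f 0"] by simp
 also have "... <= p * (1 - norm x) powr (- e) + c * (1 - norm x) powr (- e)"
 proof -
  have "1 = (1 - norm x) powr 0" using x by simp
  also have "... <= (1 - norm x) powr (- e)" using x e by (intro powr_mono') auto
  finally have "p * 1 <= p * (1 - norm x) powr (- e)" using p by (intro mult_left_mono)
  thus ?thesis using bloch_norm_bounds(2)[OF f] by (simp add: \<phi>_def p_def)
 qed
 also have "... = (1 + real CARD('n) / e) * p * (1 - norm x) powr (- e)" by (simp add: c_def algebra_simps)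
 finally show ?thesis by (simp add: p_def)
qed

lemma bloch_growth_sq:
 fixes f :: "real^'n => complex"
 assumes f: "f \<in> bloch_space" and x: "x \<in> UB" and e: "0 < e"
 shows "cmod (f x) <= (1 + real CARD('n) / e) * 2 powr e * bloch_norm f * (dl x) powr (- e)"
proof -
 have B: "0 < dl x" by (rule dl_pos[OF x])
 have "dl x = (1 - norm x) * (1 + norm x)" by (simp add: power2_eq_square algebra_simps)
 also have "... <= (1 - norm x) * 2" using x by (intro mult_left_mono) auto
 finally have "(1 - norm x) powr (- e) <= ((dl x) / 2) powr (- e)" using B e by (intro powr_mono2') auto
 also have "... = 2 powr e * (dl x) powr (- e)" using B by (simp add: powr_divide powr_minus field_simps)
 finally have "(1 + real CARD('n) / e) * bloch_norm f * (1 - norm x) powr (- e) <= (1 + real CARD('n) / e) * bloch_norm f * (2 powr e * (dl x) powr (- e))"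
  using bloch_norm_bounds(3)[OF f] e by (intro mult_left_mono) auto
 with bloch_growth[OF assms] show ?thesis by (simp add: mult_ac)
qed

context bergman begin

text \<open>For small h, x and x + h e_i are at most (2 |h| / (1 - |x|^2))^2 apart in
  \<open>sg\<close>, so \<open>local_lipschitz\<close> bounds the difference quotients by 2 C B / (1
  - |x|^2).\<close>

lemma bounded_h_harmonic_density:
 obtains C where "0 < C" "!!(g :: real^'n => complex) B x. g \<in> h_harmonic ==> (!!z. z \<in> UB ==> cmod (g z) <= B) ==> x \<in> UB ==> bloch_density g x <= C * B"
proof -
 obtain C where C: "0 < C" "!!(g :: real^'n => complex) x y \<delta> B. g \<in> h_harmonic ==> x \<in> UB ==> y \<in> UB ==> sg x y <= \<delta>^2 ==> 0 <= \<delta> ==> \<delta>^2 <= 1/128 ==>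
   (!!z. z \<in> nb x ==> cmod (g z) <= B) ==> cmod (g x - g y) <= C * \<delta> * B"
  using local_lipschitz by blast
 have "bloch_density g x <= (real CARD('n) * 2 * C) * B"
  if g: "g \<in> h_harmonic" and B: "!!z. z \<in> UB ==> cmod (g z) <= B" and x: "x \<in> UB" for g :: "real^'n => complex" and B x
 proof -
  define w where "w = dl x"
  have w: "0 < w" unfolding w_def by (rule dl_pos[OF x])
  have "cmod (pderivative i g x) <= C * (2 / w) * B" for i
  proof -
   let ?D = "pderivative i g x" and ?e = "axis i 1 :: real^'n"
   have D: "((%t. x + t *\<^sub>R ?e) has_derivative (%h. h *\<^sub>R ?e)) (at 0)" by (auto intro!: derivative_eq_intros)
   have "((%t. g (x + t *\<^sub>R ?e)) has_derivative (%h. h *\<^sub>R ?D)) (at 0)"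
   proof (rule has_derivative_eq_rhs[OF has_derivative_compose[OF D]])
    show "(g has_derivative (%v. \<Sum>i\<in>UNIV. v $ i *\<^sub>R pderivative i g x)) (at (x + 0 *\<^sub>R ?e))"
     using has_partialsD(1)[OF h_harmonicD(1)[OF g] x] by simp
    show "(%h. \<Sum>j\<in>UNIV. (h *\<^sub>R ?e) $ j *\<^sub>R pderivative j g x) = (%h. h *\<^sub>R ?D)"
     by (simp only: vector_scaleR_component real_scaleR_def scaleR_scaleR[symmetric] scaleR_sum_right[symmetric] sum_axis)
   qed
   hence lim: "((%h. norm (g (x + (0 + h) *\<^sub>R ?e) - g (x + 0 *\<^sub>R ?e) - h *\<^sub>R ?D) / norm h) \<longlongrightarrow> 0) (at 0)"
    unfolding has_derivative_at by simp
   have cont: "((%h. x + h *\<^sub>R ?e) \<longlongrightarrow> x) (at (0::real))" by (auto intro!: tendsto_eq_intros)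
   have e1: "\<forall>\<^sub>F h in at (0::real). x + h *\<^sub>R ?e \<in> UB" using topological_tendstoD[OF cont open_ball x] .
   have cw: "((%h. dl (x + h *\<^sub>R ?e)) \<longlongrightarrow> w) (at (0::real))" unfolding w_def by (intro tendsto_intros cont)
   \<comment> \<open>The fraction 1/4 makes the square root of h^2 / (w (w/4)) come out as 2 |h| /
     w.\<close>
   have e2: "\<forall>\<^sub>F h in at (0::real). w / 4 < dl (x + h *\<^sub>R ?e)" by (rule order_tendstoD(1)[OF cw]) (use w in simp)
   have c0: "((%h. (2 * \<bar>h\<bar> / w)^2) \<longlongrightarrow> 0) (at (0::real))" using w by (auto intro!: tendsto_eq_intros)
   have e3: "\<forall>\<^sub>F h in at (0::real). (2 * \<bar>h\<bar> / w)^2 < 1/128" by (rule order_tendstoD(2)[OF c0]) simp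
   have "\<forall>\<^sub>F h in at 0. cmod ?D <= norm (g (x + (0 + h) *\<^sub>R ?e) - g (x + 0 *\<^sub>R ?e) - h *\<^sub>R ?D) / norm h + C * (2 / w) * B"
    using e1 e2 e3 eventually_neq_at_within[of 0 0 UNIV]
   proof eventually_elim
    case (elim h)
    let ?y = "x + h *\<^sub>R ?e"
    have s: "sg x ?y <= (2 * \<bar>h\<bar> / w)^2"
    proof -
     have "sg x ?y = h^2 / (w * (dl ?y))" by (simp add: sg_def w_def norm_axis_1)
     also have "... <= h^2 / (w * (w / 4))" using w elim(2) by (intro divide_left_mono mult_left_mono mult_pos_pos) auto
     also have "... = (2 * \<bar>h\<bar> / w)^2" by (simp add: power_divide power_mult_distrib power2_eq_square)
     finally show ?thesis .
    qed
    have "cmod (g x - g ?y) <= C * (2 * \<bar>h\<bar> / w) * B"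
     by (rule C(2)[OF g x elim(1) s]) (use w elim(3) B in \<open>auto simp: nb_def\<close>)
    moreover have "cmod (h *\<^sub>R ?D) <= cmod (g ?y - g x - h *\<^sub>R ?D) + cmod (g x - g ?y)"
     using norm_triangle_ineq4[of "g ?y - g x" "g ?y - g x - h *\<^sub>R ?D"] by (simp add: norm_minus_commute)
    ultimately have "\<bar>h\<bar> * cmod ?D <= cmod (g ?y - g x - h *\<^sub>R ?D) + \<bar>h\<bar> * (C * (2 / w) * B)" by (simp add: mult_ac)
    thus ?case using elim(4) by (simp add: field_simps)
   qed
   from tendsto_lowerbound[OF tendsto_add[OF lim tendsto_const] this] show ?thesis by simp
  qed
  hence "w * cmod (pderivative i g x) <= w * (C * (2 / w) * B)" for i using w by (intro mult_left_mono) auto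
  hence "bloch_density g x <= (\<Sum>i\<in>(UNIV::'n set). w * (C * (2 / w) * B))"
   unfolding w_def by (intro order_trans[OF bloch_density_le_sum[OF x]] sum_mono)
  thus ?thesis using w by simp
 qed
 thus ?thesis using that[of "real CARD('n) * 2 * C"] C(1) by simp
qed

abbreviation wt :: "real^'n => real" where "wt x \<equiv> (dl x) powr (real CARD('n) + \<alpha>)"

lemma powr_neg: "wi x = 1 / wt (x::real^'n)"
 using powr_minus_divide[of "dl x" "real CARD('n) + \<alpha>"] by simp

text \<open>Here the uniform bound of the kernel enters: \<open>bk a\<close> is at most a multiple
  of 1 / \<open>wt a\<close> on the whole ball, and \<open>bounded_h_harmonic_density\<close> bounds
  the gradient by the same quantity.\<close>

lemma bk_bloch:
 obtains C where "0 < C" "!!a. a \<in> UB ==> bk a \<in> bloch_space" "!!a. a \<in> UB ==> bloch_norm (bk a) * wt a <= C"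
proof -
 obtain C where C: "0 < C" "!!x a. x \<in> UB ==> a \<in> UB ==> \<bar>Rk x a\<bar> <= C * wi a"
  using Rk_bound by blast
 obtain C' where C': "0 < C'" "!!(g :: real^'n => complex) B x. g \<in> h_harmonic ==> (!!z. z \<in> UB ==> cmod (g z) <= B) ==> x \<in> UB ==> bloch_density g x <= C' * B"
  using bounded_h_harmonic_density by blast
 have 1: "cmod (bk a x) <= C / wt a" if "a \<in> UB" "x \<in> UB" for a x
  using C(2)[OF that(2,1)] bk_real[OF that] unfolding powr_neg by simp
 have 2: "bloch_density (bk a) x <= C' * (C / wt a)" if "a \<in> UB" "x \<in> UB" for a x
  by (rule C'(2)[OF B2D(1)[OF bk_spec(1)[OF that(1)]] _ that(2)]) (rule 1[OF that(1)])
 have 3: "bk a \<in> bloch_space" if "a \<in> UB" for a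
  using B2D(1)[OF bk_spec(1)[OF that]] 2[OF that] by (auto simp: bloch_space_def intro!: bdd_aboveI2)
 have 4: "bloch_norm (bk a) * wt a <= C + C' * C" if a: "a \<in> UB" for a
 proof -
  have "(SUP x\<in>UB. bloch_density (bk a) x) <= C' * (C / wt a)"
   by (rule cSUP_least) (use 2[OF a] in auto)
  hence "bloch_norm (bk a) <= (C + C' * C) / wt a"
   using 1[OF a, of 0] by (simp add: bloch_norm_def add_divide_distrib)
  thus ?thesis using dl_pos[OF a] by (simp add: field_simps)
 qed
 show ?thesis by (rule that[OF _ 3 4]) (use C(1) C'(1) in \<open>auto intro: add_pos_pos\<close>)
qed

lemma bloch_norm_bk_pos:
 assumes a: "a \<in> UB" shows "0 < bloch_norm (bk a)"
proof (rule ccontr)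
 assume neg: "\<not> ?thesis"
 have bl: "bk a \<in> bloch_space" using bk_bloch a by metis
 hence 0: "bloch_norm (bk a) = 0" using bloch_norm_bounds(3)[OF bl] neg by simp
 have "cmod (bk a a) <= 0" using bloch_growth_sq[OF bl a, of 1] unfolding 0 by simp
 thus False using Rk_diag_pos[OF a] by (simp add: Rk_def)
qed

text \<open>The loss of exponent in \<open>bloch_growth_sq\<close>: small enough that (1 -
  |z|^2)^(\<alpha> - 2 eb) is integrable, which puts Bloch functions into \<open>B2\<close>, and
  below 1, so that (1 - |z|^2)^(1 - eb) tends to 0 at the boundary.\<close>

definition eb :: real where "eb = min (1/2) ((1 + \<alpha>) / 4)"
lemma eb: "0 < eb" "eb <= 1/2" "-1 < \<alpha> - 2 * eb" using alpha by (auto simp: eb_def min_def field_simps)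

lemma bloch_B2: assumes f: "f \<in> bloch_space" shows "f \<in> B2"
proof (rule B2I)
 show fh: "f \<in> h_harmonic" using f by (simp add: bloch_space_def)
 note cf = h_harmonic_continuous[OF fh]
 define K where "K = (1 + real CARD('n) / eb) * 2 powr eb * bloch_norm f"
 have "integrable M (%z. K^2 * (dl z) powr (- 2 * eb))"
 proof -
  have "set_integrable lborel UB (%z::real^'n. (dl z) powr \<alpha> *\<^sub>R (dl z) powr (- 2 * eb))"
   using weight_integrable[OF eb(3), where 'n = 'n] by (simp add: powr_add[symmetric])
  hence "integrable M (%z. (dl z) powr (- 2 * eb))"
   by (subst integral_nu_weighted(1)) (auto intro: continuous_set_measurable continuous_on_weight_powr)
  thus ?thesis by simp
 qed
 thus "integrable M (%z. (cmod (f z))^2)"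
 proof (rule Bochner_Integration.integrable_bound)
  show "(%z. (cmod (f z))^2) \<in> borel_measurable M" by (intro continuous_measurable continuous_intros cf)
  show "AE z in M. norm ((cmod (f z))^2) <= norm (K^2 * (dl z) powr (- 2 * eb))"
  proof (rule AE_I2)
   fix z :: "real^'n" assume "z \<in> space M"
   hence z: "z \<in> UB" by simp
   have "(cmod (f z))^2 <= (K * (dl z) powr (- eb))^2"
    unfolding K_def by (intro power_mono bloch_growth_sq[OF f z eb(1)]) auto
   also have "... = K^2 * (dl z) powr (- 2 * eb)"
    using dl_pos[OF z] by (simp add: power_mult_distrib powr_powr power2_eq_square powr_add[symmetric])
   finally show "norm ((cmod (f z))^2) <= norm (K^2 * (dl z) powr (- 2 * eb))" by simp
  qed
 qed
qed

text \<open>The \<phi> of the integration by parts. With t = |z|^2 and W = (1 - t)^(\<alpha>+1) one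
  has n W + 2 t W' = (1 - t)^\<alpha> ((n + 2 (\<alpha> + 1)) (1 - t) - 2 (\<alpha> + 1)); solving
  the divergence identity of f g for the last term gives this formula. The common factor 1 - |z|^2
  makes it bounded for Bloch f.\<close>

definition bsym :: "(real^'n => complex) => real^'n => complex" where
 "bsym f z = of_real (dl z) * (radial_derivative f z + of_real (real CARD('n) / 2 + \<alpha> + 1) * f z) / of_real (\<alpha> + 1)"

lemma bsym_bound_pointwise:
 assumes f: "f \<in> bloch_space" and z: "z \<in> UB"
 shows "cmod (bsym f z) <= (real CARD('n) * bloch_density f z
   + (real CARD('n) / 2 + \<alpha> + 1) * ((1 + real CARD('n) / eb) * 2 powr eb * bloch_norm f * (dl z) powr (1 - eb))) / (\<alpha> + 1)"
proof -
 let ?w = "dl z" define c where "c = real CARD('n) / 2 + \<alpha> + 1" let ?K = "(1 + real CARD('n) / eb) * 2 powr eb * bloch_norm f"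
 have w: "0 < ?w" by (rule dl_pos[OF z])
 have c: "0 <= c" using alpha by (simp add: c_def)
 have 1: "?w * cmod (radial_derivative f z) <= real CARD('n) * bloch_density f z"
 proof -
  have "?w * cmod (radial_derivative f z) <= real CARD('n) * norm z * bloch_density f z"
   unfolding radial_derivative_def by (rule line_sum_bound[OF z])
  also have "... <= real CARD('n) * 1 * bloch_density f z" using z by (intro mult_mono bloch_density_nonneg) auto
  finally show ?thesis by simp
 qed
 have "?w * cmod (f z) <= ?w * (?K * ?w powr (- eb))" using w by (intro mult_left_mono bloch_growth_sq[OF f z eb(1)]) auto
 also have "... = ?K * ?w powr (1 - eb)" using w by (simp add: powr_diff powr_minus field_simps)
 finally have 2: "c * (?w * cmod (f z)) <= c * (?K * ?w powr (1 - eb))" using c by (rule mult_left_mono)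
 have "cmod (bsym f z) = ?w * cmod (radial_derivative f z + of_real c * f z) / (\<alpha> + 1)"
  using w alpha unfolding bsym_def c_def[symmetric] norm_divide norm_mult norm_of_real by (simp add: abs_of_pos)
 also have "... <= ?w * (cmod (radial_derivative f z) + c * cmod (f z)) / (\<alpha> + 1)"
  using w alpha c by (intro divide_right_mono mult_left_mono order_trans[OF norm_triangle_ineq]) (auto simp: norm_mult)
 also have "... <= (real CARD('n) * bloch_density f z + c * (?K * ?w powr (1 - eb))) / (\<alpha> + 1)"
  using alpha 1 2 by (intro divide_right_mono) (auto simp: algebra_simps)
 finally show ?thesis unfolding c_def .
qed

lemma bsym_bound:
 obtains C where "0 < C" "!!f z. f \<in> bloch_space ==> z \<in> UB ==> cmod (bsym f z) <= C * bloch_norm f"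
proof -
 define C where "C = (real CARD('n) + (real CARD('n) / 2 + \<alpha> + 1) * ((1 + real CARD('n) / eb) * 2 powr eb)) / (\<alpha> + 1)"
 have a: "0 < real CARD('n) / 2 + \<alpha> + 1" "0 < \<alpha> + 1" using alpha n by auto
 have C: "0 < C" unfolding C_def using n eb
  by (intro divide_pos_pos[OF _ a(2)] add_pos_pos[OF _ mult_pos_pos[OF a(1)]] mult_pos_pos) (auto intro: add_pos_pos divide_pos_pos)
 have "cmod (bsym f z) <= C * bloch_norm f" if f: "f \<in> bloch_space" and z: "z \<in> UB" for f z
 proof -
  have w: "0 < dl z" by (rule dl_pos[OF z])
  have "(dl z) powr (1 - eb) <= (dl z) powr 0" using w eb by (intro powr_mono') auto
  hence p: "(dl z) powr (1 - eb) <= 1" using w by simp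
  let ?c = "real CARD('n) / 2 + \<alpha> + 1" let ?K = "(1 + real CARD('n) / eb) * 2 powr eb"
  have "cmod (bsym f z) <= (real CARD('n) * bloch_density f z + ?c * (?K * bloch_norm f * (dl z) powr (1 - eb))) / (\<alpha> + 1)"
   by (rule bsym_bound_pointwise[OF f z])
  also have "... <= (real CARD('n) * bloch_norm f + ?c * (?K * bloch_norm f * 1)) / (\<alpha> + 1)"
   using alpha eb bloch_norm_bounds(3)[OF f] by (intro divide_right_mono add_mono mult_left_mono p bloch_norm_bounds(1)[OF f z]) auto
  also have "... = C * bloch_norm f" by (simp add: C_def algebra_simps)
  finally show ?thesis .
 qed
 with C show thesis using that by blast
qed

lemma bsym_little:
 assumes f: "f \<in> little_bloch_space" and e: "0 < e"
 shows "\<exists>\<rho><1. \<forall>z\<in>UB. \<rho> < norm z --> cmod (bsym f z) < e"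
proof -
 have fb: "f \<in> bloch_space" and lim: "(bloch_density f \<longlongrightarrow> 0) (filtercomap norm (at_left 1))" using f by (auto simp: little_bloch_space_def)
 let ?c = "real CARD('n) / 2 + \<alpha> + 1" let ?K = "(1 + real CARD('n) / eb) * 2 powr eb * bloch_norm f"
 have 1: "((%r. (1 - r^2) powr (1 - eb)) \<longlongrightarrow> 0) (at_left (1::real))"
 proof -
  have "((%r::real. (1 - r^2) powr (1 - eb)) \<longlongrightarrow> (1 - 1^2) powr (1 - eb)) (at_left 1)"
  proof (intro tendsto_powr2 tendsto_intros)
   have "\<forall>\<^sub>F r in at_left 1. r \<in> {0<..<1::real}" by (rule eventually_at_left_real) simp
   thus "\<forall>\<^sub>F r in at_left (1::real). 0 <= 1 - r^2" by (rule eventually_mono) (auto simp: abs_square_le_1)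
  qed (use eb in auto)
  thus ?thesis by simp
 qed
 have 2: "((%z::real^'n. (dl z) powr (1 - eb)) \<longlongrightarrow> 0) (filtercomap norm (at_left 1))"
  using filterlim_compose[OF 1 filterlim_filtercomap] .
 have "((%z. (real CARD('n) * bloch_density f z + ?c * (?K * (dl z) powr (1 - eb))) / (\<alpha> + 1)) \<longlongrightarrow> (real CARD('n) * 0 + ?c * (?K * 0)) / (\<alpha> + 1)) (filtercomap norm (at_left 1))"
  using alpha by (intro tendsto_intros lim 2) auto
 hence "\<forall>\<^sub>F z in filtercomap norm (at_left 1). (real CARD('n) * bloch_density f z + ?c * (?K * (dl z) powr (1 - eb))) / (\<alpha> + 1) < e"
  by (rule order_tendstoD(2)) (use e in simp)
 then obtain P where P: "eventually P (at_left 1)" "!!z. P (norm z) ==> (real CARD('n) * bloch_density f z + ?c * (?K * (dl z) powr (1 - eb))) / (\<alpha> + 1) < e"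
  unfolding eventually_filtercomap by blast
 then obtain b where b: "b < 1" "!!y. b < y ==> y < 1 ==> P y" unfolding eventually_at_left_field by blast
 show ?thesis
 proof (intro exI[of _ b] conjI ballI impI)
  fix z :: "real^'n" assume z: "z \<in> UB" "b < norm z"
  show "cmod (bsym f z) < e" using bsym_bound_pointwise[OF fb z(1)] P(2)[OF b(2)[OF z(2)]] z(1) by simp
 qed (rule b)
qed

lemma continuous_on_bsym: "f \<in> h_harmonic ==> continuous_on UB (bsym f)"
 unfolding bsym_def[abs_def] using alpha
 by (intro continuous_intros continuous_on_radial_derivative h_harmonic_continuous) (auto simp flip: of_real_add)

text \<open>The divergence identity for f g contains f times the radial derivative of g;
  \<open>radial_derivative_symmetric\<close> replaces it by g times that of f, so that g ends up
  undifferentiated. Cutoffs provide compact support and are removed by dominated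
  convergence.\<close>

theorem bsym_pairing:
 assumes f: "f \<in> bloch_space" and g: "g \<in> B2"
 shows "integrable M (%z. bsym f z * g z)" "(\<integral>z. f z * g z \<partial>M) = (\<integral>z. bsym f z * g z \<partial>M)"
proof -
 have fh: "f \<in> h_harmonic" using f by (simp add: bloch_space_def)
 note gh = B2D(1)[OF g]
 note cf = h_harmonic_continuous[OF fh] and cg = h_harmonic_continuous[OF gh]
  and cEf = continuous_on_radial_derivative[OF fh] and cEg = continuous_on_radial_derivative[OF gh]
 obtain C where C: "0 < C" "!!z. z \<in> UB ==> cmod (bsym f z) <= C * bloch_norm f" using bsym_bound f by metis
 have gi: "integrable M (%z. cmod (g z))" using B2_mult_integrable(3)[OF B2_const[of 1] g] by simp
 have cb: "continuous_on UB (%z. bsym f z * g z)" by (intro continuous_intros continuous_on_bsym fh cg)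
 show ib: "integrable M (%z. bsym f z * g z)"
 proof (rule Bochner_Integration.integrable_bound)
  show "integrable M (%z. C * bloch_norm f * cmod (g z))" using gi by simp
  show "AE z in M. norm (bsym f z * g z) <= norm (C * bloch_norm f * cmod (g z))"
   using C bloch_norm_bounds(3)[OF f] by (intro AE_I2) (auto simp: norm_mult abs_mult intro!: mult_right_mono)
 qed (rule continuous_measurable(2)[OF cb])
 have ifg: "integrable M (%z. f z * g z)" by (rule B2_mult_integrable(1)[OF bloch_B2[OF f] g])
 define n' where "n' = real CARD('n)"
 \<comment> \<open>The identity with cutoff, divided by the weight (1 - |z|^2)^\<alpha>; c and c'
   stand for the cutoff and its derivative.\<close>
 define G where "G c c' z = of_real (2 * ((dl z) * c ((norm z)^2))) * (g z * radial_derivative f z)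
   + of_real (n' * ((dl z) * c ((norm z)^2)) + 2 * (norm z)^2 * ((dl z) * c' ((norm z)^2) - (\<alpha> + 1) * c ((norm z)^2))) * (f z * g z)"
  for c c' :: "real => real" and z :: "real^'n"
 have cG: "continuous_on UB (G (cutoff \<epsilon>) (cutoff' \<epsilon>))" for \<epsilon>
 proof -
  have s: "continuous_on UB (%z::real^'n. c ((norm z)^2))" if "continuous_on {..<1} c" for c :: "real => real"
   by (rule continuous_on_compose2[OF that]) (auto intro!: continuous_intros norm_sq_less_1)
  have "continuous_on {..<1} (cutoff \<epsilon>)"
   by (intro continuous_at_imp_continuous_on ballI DERIV_isCont[OF DERIV_cutoff]) auto
  thus ?thesis unfolding G_def by (intro continuous_intros s continuous_on_cutoff' cf cg cEf)
 qed
 have G0: "(\<integral>z. G (cutoff \<epsilon>) (cutoff' \<epsilon>) z \<partial>M) = 0" if e: "0 < \<epsilon>" for \<epsilon>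
 proof -
  let ?w = "%z::real^'n. complex_of_real (cw \<alpha> \<epsilon> ((norm z)^2))"
  let ?v = "%z::real^'n. complex_of_real (n' * cw \<alpha> \<epsilon> ((norm z)^2) + 2 * (norm z)^2 * cw' \<alpha> \<epsilon> ((norm z)^2))"
  have cwc: "continuous_on UB ?w"
   by (intro continuous_intros continuous_on_compose2[OF continuous_on_cw[OF e]]) auto
  have "continuous_on UB (%z::real^'n. cw' \<alpha> \<epsilon> ((norm z)^2))"
   by (rule continuous_on_compose2[OF continuous_on_cw']) (auto intro!: continuous_intros norm_sq_less_1)
  moreover have "continuous_on UB (%z::real^'n. cw \<alpha> \<epsilon> ((norm z)^2))"
   by (rule continuous_on_compose2[OF continuous_on_cw[OF e]]) (auto intro!: continuous_intros)
  ultimately have cv: "continuous_on UB ?v" by (intro continuous_intros)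
  have z0: "?w z = 0" "?v z = 0" if "z \<in> UB - cball 0 (sqrt (max 0 (1 - \<epsilon>)))" for z
  proof -
   have t: "1 - \<epsilon> <= (norm z)^2" "(norm z)^2 < 1" using cutoff_support[OF e that] norm_sq_less_1[of z] that by auto
   show "?w z = 0" "?v z = 0" using cw_zero[OF e t(1)] cutoff_zero[OF e t(1)] t(2) by (simp_all add: cw'_def)
  qed
  have i: "set_integrable lborel UB (%z. ?w z * h z)" "set_integrable lborel UB (%z. ?v z * h z)" if "continuous_on UB h" for h
   by (rule integrable_compact_support[OF open_ball cutoff_cball[OF e] continuous_on_mult[OF cwc that]], simp only: z0 mult_zero_left,
     rule integrable_compact_support[OF open_ball cutoff_cball[OF e] continuous_on_mult[OF cv that]], simp only: z0 mult_zero_left)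
  have c1: "continuous_on UB (%z. f z * radial_derivative g z)" "continuous_on UB (%z. g z * radial_derivative f z)" "continuous_on UB (%z. f z * g z)"
   by (intro continuous_intros cf cg cEf cEg)+
  have s: "(LBINT z:UB. ?w z * (f z * radial_derivative g z - g z * radial_derivative f z)) = 0"
   by (rule radial_derivative_symmetric[OF n fh gh continuous_on_cw[OF e], of "1 - \<epsilon>"]) (use e cw_zero[OF e] in auto)
  have a1: "(LBINT z:UB. ?w z * (f z * radial_derivative g z)) = (LBINT z:UB. ?w z * (g z * radial_derivative f z))"
   using s set_integral_diff(2)[OF i(1)[OF c1(1)] i(1)[OF c1(2)]] by (simp add: right_diff_distrib)
  have E: "(\<Sum>i\<in>UNIV. of_real (z$i) * (f z * pderivative i g z + pderivative i f z * g z)) = f z * radial_derivative g z + g z * radial_derivative f z" for z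
   by (simp add: radial_derivative_def sum.distrib sum_distrib_left distrib_left mult_ac)
  have "(LBINT z:UB. ?w z * (f z * radial_derivative g z + g z * radial_derivative f z)) = - (LBINT z:UB. ?v z * (f z * g z))"
   using integral_radial_field(2)[OF has_partials_mult[OF h_harmonicD(1)[OF fh] h_harmonicD(1)[OF gh]] e, of \<alpha>] unfolding E n'_def .
  also have "(LBINT z:UB. ?w z * (f z * radial_derivative g z + g z * radial_derivative f z))
    = (LBINT z:UB. ?w z * (f z * radial_derivative g z)) + (LBINT z:UB. ?w z * (g z * radial_derivative f z))"
   using set_integral_add(2)[OF i(1)[OF c1(1)] i(1)[OF c1(2)]] by (simp add: distrib_left)
  finally have eq: "2 * (LBINT z:UB. ?w z * (g z * radial_derivative f z)) + (LBINT z:UB. ?v z * (f z * g z)) = 0"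
   unfolding a1 by simp
  have p: "(dl z) powr \<alpha> *\<^sub>R G (cutoff \<epsilon>) (cutoff' \<epsilon>) z = 2 * (?w z * (g z * radial_derivative f z)) + ?v z * (f z * g z)" if z: "z \<in> UB" for z
  proof -
   have t: "0 < dl z" "(norm z)^2 < 1" using dl_pos[OF z] by auto
   define P where "P = (dl z) powr \<alpha>"
   have "(dl z) powr (\<alpha> + 1) = P * (dl z)" using t by (simp add: powr_add P_def)
   hence c: "cw \<alpha> \<epsilon> ((norm z)^2) = P * (dl z) * cutoff \<epsilon> ((norm z)^2)"
    "cw' \<alpha> \<epsilon> ((norm z)^2) = P * (dl z) * cutoff' \<epsilon> ((norm z)^2) - (\<alpha> + 1) * P * cutoff \<epsilon> ((norm z)^2)"
    using t by (simp_all add: cw_def cw'_def P_def)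
   show ?thesis unfolding G_def c P_def[symmetric] by (simp add: scaleR_conv_of_real algebra_simps)
  qed
  have "(LBINT z:UB. (dl z) powr \<alpha> *\<^sub>R G (cutoff \<epsilon>) (cutoff' \<epsilon>) z) = (LBINT z:UB. 2 * (?w z * (g z * radial_derivative f z)) + ?v z * (f z * g z))"
   by (rule set_lebesgue_integral_cong) (use p in auto)
  also have "... = 0" using eq set_integral_add(2)[OF set_integrable_mult_right[OF i(1)[OF c1(2)]] i(2)[OF c1(3)], of 2] by (simp only: set_integral_mult_right)
  finally show ?thesis unfolding integral_nu_weighted(2)[OF continuous_set_measurable[OF cG]] by simp
 qed
 define G1 where "G1 z = of_real (2 * (\<alpha> + 1)) * (bsym f z * g z - f z * g z)" for z
 \<comment> \<open>\<open>Gs\<close> below expresses the integrand through bsym f times g and f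
   times g, both integrable. The second constant in the majorant is any number above 4 + 2 (\<alpha>
   + 1), where 4 = 2 * 2 comes from (1 - t) |cutoff'| <= 2.\<close>
 have "(%j. \<integral>z. G (cutoff (1 / real (Suc j))) (cutoff' (1 / real (Suc j))) z \<partial>M) \<longlonglongrightarrow> (\<integral>z. G1 z \<partial>M)"
 proof (rule integral_dominated_convergence[where w = "%z. 2 * (\<alpha> + 1) * cmod (bsym f z * g z) + (3 * n' + 4 * (\<alpha> + 4)) * cmod (f z * g z)"])
  show "integrable M (%z. 2 * (\<alpha> + 1) * cmod (bsym f z * g z) + (3 * n' + 4 * (\<alpha> + 4)) * cmod (f z * g z))"
   using ib ifg by simp
  show "G1 \<in> borel_measurable M" unfolding G1_def[abs_def] by (intro continuous_measurable(2) continuous_intros cf cg continuous_on_bsym fh)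
  show "G (cutoff (1 / real (Suc j))) (cutoff' (1 / real (Suc j))) \<in> borel_measurable M" for j by (rule continuous_measurable(2)[OF cG])
  have Gs: "G c c' z = of_real (c ((norm z)^2) * (2 * (\<alpha> + 1))) * (bsym f z * g z)
    + of_real (2 * (norm z)^2 * ((dl z) * c' ((norm z)^2)) - 2 * (\<alpha> + 1) * c ((norm z)^2)) * (f z * g z)" if "z \<in> UB" for c c' z
  proof -
   have bs: "of_real (2 * (\<alpha> + 1)) * bsym f z = of_real (dl z) * (2 * radial_derivative f z + of_real (n' + 2 * (\<alpha> + 1)) * f z)"
   proof -
    define A where "A = complex_of_real (\<alpha> + 1)"
    have A: "A \<noteq> 0" unfolding A_def using alpha by (simp only: of_real_eq_0_iff)
    define X where "X = of_real (dl z) * (radial_derivative f z + of_real (n' / 2 + \<alpha> + 1) * f z)"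
    have bs: "of_real (2 * (\<alpha> + 1)) * bsym f z = of_real 2 * A * (X / A)"
     unfolding bsym_def of_real_mult A_def X_def n'_def ..
    also have "... = 2 * X" using A by simp
    also have "... = of_real (dl z) * (2 * radial_derivative f z + of_real (2 * (n' / 2 + \<alpha> + 1)) * f z)"
     unfolding X_def of_real_mult[of 2] by (simp only: of_real_numeral distrib_left mult_ac)
    also have "2 * (n' / 2 + \<alpha> + 1) = n' + 2 * (\<alpha> + 1)" by simp
    finally show ?thesis .
   qed
   have "of_real (c ((norm z)^2) * (2 * (\<alpha> + 1))) * (bsym f z * g z) = of_real (c ((norm z)^2)) * (of_real (dl z) * (2 * radial_derivative f z + of_real (n' + 2 * (\<alpha> + 1)) * f z)) * g z"
    unfolding bs[symmetric] of_real_mult[of "c ((norm z)^2)" "2 * (\<alpha> + 1)"] by (simp only: mult_ac)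
   thus ?thesis unfolding G_def by (simp add: algebra_simps)
  qed
  show "AE z in M. (%j. G (cutoff (1 / real (Suc j))) (cutoff' (1 / real (Suc j))) z) \<longlonglongrightarrow> G1 z"
  proof (rule AE_I2)
   fix z :: "real^'n" assume "z \<in> space M"
   hence z: "z \<in> UB" by simp
   have "(%j. G (cutoff (1 / real (Suc j))) (cutoff' (1 / real (Suc j))) z) \<longlonglongrightarrow> of_real (1 * (2 * (\<alpha> + 1))) * (bsym f z * g z)
    + of_real (2 * (norm z)^2 * ((dl z) * 0) - 2 * (\<alpha> + 1) * 1) * (f z * g z)"
    unfolding Gs[OF z] by (intro tendsto_intros cutoff_tendsto norm_sq_less_1 z)
   thus "(%j. G (cutoff (1 / real (Suc j))) (cutoff' (1 / real (Suc j))) z) \<longlonglongrightarrow> G1 z" by (simp add: G1_def algebra_simps)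
  qed
  show "AE z in M. norm (G (cutoff (1 / real (Suc j))) (cutoff' (1 / real (Suc j))) z) <= 2 * (\<alpha> + 1) * cmod (bsym f z * g z) + (3 * n' + 4 * (\<alpha> + 4)) * cmod (f z * g z)" for j
  proof (rule AE_I2)
   fix z :: "real^'n" assume "z \<in> space M"
   hence z: "z \<in> UB" by simp
   define t where "t = (norm z)^2"
   have t: "0 <= t" "t < 1" using norm_sq_less_1[OF z] by (auto simp: t_def)
   have j: "0 < 1 / real (Suc j)" by simp
   define c c' where "c = cutoff (1 / real (Suc j)) t" and "c' = cutoff' (1 / real (Suc j)) t"
   have c: "0 <= c" "c <= 1" unfolding c_def by (rule cutoff_bounds[OF j])+
   have c': "\<bar>(1 - t) * c'\<bar> <= 2"
   proof -
    have "\<bar>c'\<bar> <= 2 / (1 - t)" using cutoff'_bounds[OF j t(2)] unfolding c'_def by simp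
    hence "(1 - t) * \<bar>c'\<bar> <= (1 - t) * (2 / (1 - t))" using t by (intro mult_left_mono) auto
    also have "(1 - t) * (2 / (1 - t)) = 2" using t by (simp add: field_simps)
    finally show ?thesis using t by (simp add: abs_mult)
   qed
   have "\<bar>2 * t * ((1 - t) * c') - 2 * (\<alpha> + 1) * c\<bar> <= \<bar>2 * t * ((1 - t) * c')\<bar> + \<bar>2 * (\<alpha> + 1) * c\<bar>" by linarith
   also have "\<bar>2 * t * ((1 - t) * c')\<bar> <= 2 * 2"
   proof -
    have "(2 * t) * \<bar>(1 - t) * c'\<bar> <= 2 * 2" using t c' by (intro mult_mono) auto
    thus ?thesis using t by (simp add: abs_mult)
   qed
   also have "\<bar>2 * (\<alpha> + 1) * c\<bar> <= 2 * (\<alpha> + 1)" using alpha c by (simp add: abs_mult)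
   finally have b: "\<bar>2 * t * ((1 - t) * c') - 2 * (\<alpha> + 1) * c\<bar> <= 3 * n' + 4 * (\<alpha> + 4)" using alpha by (simp add: n'_def)
   have "norm (G (cutoff (1 / real (Suc j))) (cutoff' (1 / real (Suc j))) z) <= \<bar>c * (2 * (\<alpha> + 1))\<bar> * cmod (bsym f z * g z) + \<bar>2 * t * ((1 - t) * c') - 2 * (\<alpha> + 1) * c\<bar> * cmod (f z * g z)"
    unfolding Gs[OF z] c_def c'_def t_def by (intro order_trans[OF norm_triangle_ineq]) (simp only: norm_mult[of "of_real _"] norm_of_real order_refl)
   also have "... <= 2 * (\<alpha> + 1) * cmod (bsym f z * g z) + (3 * n' + 4 * (\<alpha> + 4)) * cmod (f z * g z)"
    using c alpha by (intro add_mono mult_right_mono b) (auto simp: abs_mult)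
   finally show "norm (G (cutoff (1 / real (Suc j))) (cutoff' (1 / real (Suc j))) z) <= 2 * (\<alpha> + 1) * cmod (bsym f z * g z) + (3 * n' + 4 * (\<alpha> + 4)) * cmod (f z * g z)" .
  qed
 qed
 hence "(\<integral>z. G1 z \<partial>M) = 0" using G0 LIMSEQ_unique[OF _ tendsto_const] by simp
 moreover have "(\<integral>z. G1 z \<partial>M) = of_real (2 * (\<alpha> + 1)) * ((\<integral>z. bsym f z * g z \<partial>M) - (\<integral>z. f z * g z \<partial>M))"
  unfolding G1_def using ib ifg by simp
 moreover have "complex_of_real (2 * (\<alpha> + 1)) \<noteq> 0" using alpha by (simp only: of_real_eq_0_iff) simp
 ultimately show "(\<integral>z. f z * g z \<partial>M) = (\<integral>z. bsym f z * g z \<partial>M)" by simp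
qed

end

section \<open>Discretisation\<close>

definition vanishing :: "(real^'n => complex) => bool" where
 "vanishing \<phi> \<longleftrightarrow> (\<forall>e>0. \<exists>\<rho><1. \<forall>z\<in>UB. \<rho> < norm z --> cmod (\<phi> z) < e)"

text \<open>The set \<open>J\<close> of admissible indices is a parameter because the construction
  is used twice, with all centres and without \<open>a 0\<close>. \<delta>, \<open>L\<close> and
  \<open>Cn\<close> are the mesh, the variation of the mean value kernel over the mesh, and the mass
  constant; L Cn <= 1/2 makes the perturbation a contraction.\<close>

locale bergman_net = bergman \<alpha> N for \<alpha> :: real and N :: "'n::finite itself" +
 fixes \<delta> L Cn :: real and a :: "nat => real^'n" and J :: "nat set"
 assumes Cn: "0 < Cn" and \<delta>: "0 < \<delta>" "\<delta>^2 <= 1/128" and L: "0 <= L" "L * Cn <= 1/2"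
  and lip: "!!x y z. x \<in> UB ==> y \<in> UB ==> z \<in> UB ==> sg x y < \<delta>^2 ==>
   \<bar>kd x z - kd y z\<bar> <= L / wt z \<and> (1/16 < sg x z --> kd x z - kd y z = 0)"
  and mass: "!!z. z \<in> UB ==> measure M (nb z) <= Cn * wt z"
  and a: "!!m. a m \<in> UB" and cover: "!!y. y \<in> UB ==> \<exists>m\<in>J. sg y (a m) < \<delta>^2"
begin

text \<open>Taking the least admissible index makes the cells {jx = m} a measurable partition of the
  ball.\<close>

definition jx :: "real^'n => nat" where "jx y = (LEAST m. m \<in> J \<and> sg y (a m) < \<delta>^2)"

lemma jx: assumes "y \<in> UB" shows "jx y \<in> J" "sg y (a (jx y)) < \<delta>^2"
proof -
 obtain m where "m \<in> J \<and> sg y (a m) < \<delta>^2" using cover[OF assms] by blast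
 from LeastI[of "%m. m \<in> J \<and> sg y (a m) < \<delta>^2", OF this] show "jx y \<in> J" "sg y (a (jx y)) < \<delta>^2"
  unfolding jx_def by auto
qed

lemma jx_nb: assumes "y \<in> UB" shows "y \<in> nb (a (jx y))"
 using jx(2)[OF assms] \<delta> assms by (simp add: nb_def sg_sym[of y])

lemma jx_measurable [measurable]: "jx \<in> measurable M (count_space UNIV)"
proof -
 have [measurable]: "(%y. sg y (a m)) \<in> borel_measurable M" for m
  using has_partials_continuous[OF has_partials_sg, of "a m"] by (intro continuous_measurable) (simp add: sg_sym[of "a m"])
 show ?thesis unfolding jx_def[abs_def] by measurable
qed

lemma jx_compose [measurable]: "(%y. h (jx y)) \<in> borel_measurable M" for h :: "nat => 'c::euclidean_space"
 by (rule measurable_compose_countable[OF _ jx_measurable]) simp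

text \<open>\<open>M\<close> has the sets of \<open>lebesgue_on UB\<close>; the identity from its
  square to the Borel space of the product is measurable, and the claim is pulled back along
  it.\<close>

lemma pair_measurable:
 fixes F :: "real^'n => real^'n => real"
 assumes F: "continuous_on (UB \<times> UB) (%(y, z). F y z)"
 shows "(%(y, z). F y z) \<in> borel_measurable (M \<Otimes>\<^sub>M M)"
proof -
 have [measurable]: "(%x. x) \<in> measurable M borel" by (rule continuous_measurable) (rule continuous_on_id)
 have "(%p. (fst p, snd p)) \<in> measurable (M \<Otimes>\<^sub>M M) (borel :: ((real^'n) \<times> (real^'n)) measure)"
  by (rule borel_measurable_Pair) (use measurable_compose[OF measurable_fst, of "%x. x" M borel M] measurable_compose[OF measurable_snd, of "%x. x" M borel M] in auto)
 hence id: "(%p. p) \<in> measurable (M \<Otimes>\<^sub>M M) (borel :: ((real^'n) \<times> (real^'n)) measure)" by simp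
 have "(%p. indicator (UB \<times> UB) p *\<^sub>R (%(y, z). F y z) p) \<in> borel_measurable borel"
  by (rule borel_measurable_continuous_on_indicator[OF _ F]) (simp add: borel_open open_Times)
 from measurable_compose[OF id this]
 show ?thesis by (rule measurable_cong[THEN iffD1, rotated]) (auto simp: space_pair_measure indicator_def)
qed

definition Dk :: "real^'n => real^'n => real" where "Dk y z = kd y z - kd (a (jx y)) z"

lemma Dk_measurable: "(%(y, z). Dk y z) \<in> borel_measurable (M \<Otimes>\<^sub>M M)"
proof -
 have J: "ball_mass (0::real^'n) \<noteq> 0" using ball_mass_pos[OF n] by simp
 have "continuous_on (UB \<times> UB) (%x. wi (snd x :: real^'n))"
  by (rule continuous_on_compose2[OF continuous_on_weight_powr]) (auto intro!: continuous_intros)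
 moreover have "continuous_on (UB \<times> UB) (%x. bump (1/128) (sg (fst x) (snd x :: real^'n)))"
  using continuous_on_sg_compose[OF continuous_on_bump(1)] by (simp add: case_prod_unfold)
 ultimately have "continuous_on (UB \<times> UB) (%(y, z). kd y z)"
  unfolding kd_def lk_def case_prod_unfold using J nu_const_pos[where 'n='n] by (intro continuous_intros) (auto simp: power2_eq_1_iff)
 from pair_measurable[OF this] have 1: "(%p. kd (fst p) (snd p)) \<in> borel_measurable (M \<Otimes>\<^sub>M M)" by (simp add: case_prod_unfold)
 have kdm: "kd (a m) \<in> borel_measurable M" for m by (rule continuous_measurable) (rule continuous_on_kd[OF a])
 have 2: "(%p. kd (a (jx (fst p))) (snd p)) \<in> borel_measurable (M \<Otimes>\<^sub>M M)"
  by (rule measurable_compose_countable[OF measurable_compose[OF measurable_snd kdm] measurable_compose[OF measurable_fst jx_measurable]])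
 show ?thesis unfolding Dk_def case_prod_unfold by (rule borel_measurable_diff[OF 1 2])
qed

lemma Dk_bound:
 assumes "y \<in> UB" "z \<in> UB" shows "\<bar>Dk y z\<bar> <= L / wt z * indicator (nb z) y"
 using lip[OF assms(1) a assms(2) jx(2)[OF assms(1)]] assms by (auto simp: Dk_def nb_def indicator_def sg_sym[of z])

lemma wt_pos: "z \<in> UB ==> 0 < wt z" using dl_pos by fastforce

text \<open>By \<open>KK_pairing\<close> this is the transpose of the error operator that sends g to
  g - g (a (jx -)) on bounded h-harmonic g, realised through the mean value kernel.\<close>

definition KK :: "(real^'n => complex) => real^'n => complex" where "KK \<phi> z = (\<integral>y. \<phi> y * of_real (Dk y z) \<partial>M)"

sublocale finite_measure M by (rule finite_measure_M)
sublocale pair_sigma_finite M M ..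

lemma KK_measurable:
 assumes \<phi>: "\<phi> \<in> borel_measurable M" shows "KK \<phi> \<in> borel_measurable M"
proof -
 have "(%p. \<phi> (snd p)) \<in> borel_measurable (M \<Otimes>\<^sub>M M)" by (rule measurable_compose[OF measurable_snd \<phi>])
 moreover have "(%p. Dk (snd p) (fst p)) \<in> borel_measurable (M \<Otimes>\<^sub>M M)"
  using measurable_pair_swap[OF Dk_measurable] by (simp add: case_prod_unfold)
 ultimately have "(%(z, y). \<phi> y * of_real (Dk y z)) \<in> borel_measurable (M \<Otimes>\<^sub>M M)" unfolding case_prod_unfold by measurable
 thus ?thesis unfolding KK_def[abs_def] by (rule sigma_finite_measure.borel_measurable_lebesgue_integral[OF finite_measure.axioms(1)[OF finite_measure_M]])
qed

lemma Dk_slice: "z \<in> UB ==> (%y. Dk y z) \<in> borel_measurable M"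
 using measurable_compose[OF measurable_Pair2'[of z M M] Dk_measurable] by simp

text \<open>\<open>Dk\<close> is at most L / \<open>wt z\<close> on \<open>nb z\<close> and zero
  elsewhere, and the mass of \<open>nb z\<close> is at most Cn \<open>wt z\<close>. The bound is
  local in \<phi>, which is what preserves vanishing at the boundary.\<close>

lemma KK_bound:
 assumes \<phi>: "\<phi> \<in> borel_measurable M" and z: "z \<in> UB" and B: "!!y. y \<in> nb z ==> cmod (\<phi> y) <= B" and B0: "0 <= B"
 shows "cmod (KK \<phi> z) <= B / 2"
proof -
 have w: "0 < wt z" by (rule wt_pos[OF z])
 have ib: "integrable M (%y. B * (L / wt z) * indicator (nb z) y :: real)"
  using nb_sets(2)[OF z] by (intro integrable_mult_right integrable_real_indicator) (auto simp: emeasure_finite less_top[symmetric])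
 have le: "cmod (\<phi> y * of_real (Dk y z)) <= B * (L / wt z) * indicator (nb z) y" if "y \<in> UB" for y
 proof -
  have "cmod (\<phi> y * of_real (Dk y z)) <= cmod (\<phi> y) * (L / wt z * indicator (nb z) y)"
   unfolding norm_mult norm_of_real by (intro mult_left_mono Dk_bound[OF that z]) auto
  also have "... <= B * (L / wt z * indicator (nb z) y)" using B L w by (cases "y \<in> nb z") (auto intro!: mult_right_mono divide_right_mono)
  finally show ?thesis by (simp add: mult.assoc)
 qed
 have "integrable M (%y. \<phi> y * of_real (Dk y z))"
 proof (rule Bochner_Integration.integrable_bound[OF ib])
  show "(%y. \<phi> y * of_real (Dk y z)) \<in> borel_measurable M" using \<phi> Dk_slice[OF z] by measurable
  show "AE y in M. norm (\<phi> y * of_real (Dk y z)) <= norm (B * (L / wt z) * indicator (nb z) y)"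
  proof (rule AE_I2)
   fix y assume "y \<in> space M"
   hence "norm (\<phi> y * of_real (Dk y z)) <= B * (L / wt z) * indicator (nb z) y" using le[of y] by simp
   thus "norm (\<phi> y * of_real (Dk y z)) <= norm (B * (L / wt z) * indicator (nb z) y :: real)" by (rule order_trans) (simp only: real_norm_def abs_ge_self)
  qed
 qed
 hence "cmod (KK \<phi> z) <= (\<integral>y. B * (L / wt z) * indicator (nb z) y \<partial>M)"
  unfolding KK_def using ib le by (intro Bochner_Integration.integral_norm_bound_integral) auto
 also have "... = B * (L / wt z) * measure M (nb z)" using nb_sets(2)[OF z] by simp
 also have "... <= B * (L / wt z) * (Cn * wt z)" using mass[OF z] B0 L w by (intro mult_left_mono) auto
 also have "... = B * (L * Cn)" using w by simp
 also have "... <= B * (1/2)" using L B0 by (intro mult_left_mono) auto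
 finally show ?thesis by simp
qed

lemma bounded_integrable:
 fixes F :: "real^'n => complex"
 assumes "F \<in> borel_measurable M" "!!y. y \<in> UB ==> cmod (F y) <= B"
 shows "integrable M F"
 using assms by (intro integrable_const_bound[of _ B]) auto

text \<open>Integrate \<phi>(y) Dk y z g(z) in both orders. In z first, the mean value formulas at y
  and at the centre a (jx y) give g y - g (a (jx y)); in y first, the result is KK \<phi> z. The
  integrability for Fubini comes from the mass 1 of \<open>kd\<close>.\<close>

lemma KK_pairing:
 assumes \<phi>: "\<phi> \<in> borel_measurable M" and B: "!!y. y \<in> UB ==> cmod (\<phi> y) <= B"
  and g: "g \<in> h_harmonic" and G: "!!y. y \<in> UB ==> cmod (g y) <= G"
 shows "(\<integral>y. \<phi> y * g y \<partial>M) = (\<integral>y. \<phi> y * g (a (jx y)) \<partial>M) + (\<integral>z. KK \<phi> z * g z \<partial>M)"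
proof -
 have B0: "0 <= B" by (rule order_trans[OF norm_ge_zero B[of 0]]) simp
 have gm: "g \<in> borel_measurable M" by (rule continuous_measurable(2)[OF h_harmonic_continuous[OF g]])
 define F where "F y z = \<phi> y * (of_real (Dk y z) * g z)" for y z
 have Fm: "case_prod F \<in> borel_measurable (M \<Otimes>\<^sub>M M)"
 proof -
  note [measurable] = measurable_compose[OF measurable_fst \<phi>] measurable_compose[OF measurable_snd gm] Dk_measurable[unfolded case_prod_unfold]
  show ?thesis unfolding F_def case_prod_unfold by measurable
 qed
 have kg: "integrable M (%z. of_real (kd x z) * g z)" "(\<integral>z. of_real (kd x z) * g z \<partial>M) = g x" if "x \<in> UB" for x
  using kd_integrable(1)[OF that h_harmonic_continuous[OF g]] kd_mean_value[OF g that] by (simp_all add: scaleR_conv_of_real)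
 have Fz: "integrable M (F y)" "(\<integral>z. F y z \<partial>M) = \<phi> y * (g y - g (a (jx y)))" if y: "y \<in> UB" for y
 proof -
  have "F y = (%z. \<phi> y * (of_real (kd y z) * g z - of_real (kd (a (jx y)) z) * g z))"
   by (simp add: F_def Dk_def left_diff_distrib fun_eq_iff)
  thus "integrable M (F y)" "(\<integral>z. F y z \<partial>M) = \<phi> y * (g y - g (a (jx y)))"
   using kg[OF y] kg[OF a] by simp_all
 qed
 have Fn: "(\<integral>z. norm (F y z) \<partial>M) <= B * (2 * G)" if y: "y \<in> UB" for y
 proof -
  have "(\<integral>z. norm (F y z) \<partial>M) <= (\<integral>z. B * (G * (kd y z + kd (a (jx y)) z)) \<partial>M)"
  proof (rule integral_mono)
   fix z assume "z \<in> space M"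
   hence z: "z \<in> UB" by simp
   have "\<bar>Dk y z\<bar> <= kd y z + kd (a (jx y)) z" using kd_nonneg[of y z] kd_nonneg[of "a (jx y)" z] unfolding Dk_def by linarith
   hence "\<bar>Dk y z\<bar> * cmod (g z) <= (kd y z + kd (a (jx y)) z) * G"
    using G[OF z] kd_nonneg[of y z] kd_nonneg[of "a (jx y)" z] by (intro mult_mono) auto
   hence "cmod (\<phi> y) * (\<bar>Dk y z\<bar> * cmod (g z)) <= B * ((kd y z + kd (a (jx y)) z) * G)"
    by (rule mult_mono[OF B[OF y]]) (use B0 in auto)
   thus "norm (F y z) <= B * (G * (kd y z + kd (a (jx y)) z))"
    unfolding F_def norm_mult norm_of_real by (simp only: mult.commute[of G])
  qed (use Fz(1)[OF y] kd_mass(1)[OF y] kd_mass(1)[OF a] in auto)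
  also have "... = B * (G * (1 + 1))" using kd_mass[OF y] kd_mass[OF a] by simp
  finally show ?thesis by simp
 qed
 have int: "integrable (M \<Otimes>\<^sub>M M) (case_prod F)"
 proof (rule Fubini_integrable)
  show "case_prod F \<in> borel_measurable (M \<Otimes>\<^sub>M M)" by (rule Fm)
  have "(%(y, z). norm (F y z)) \<in> borel_measurable (M \<Otimes>\<^sub>M M)" using Fm unfolding case_prod_unfold by measurable
  from sigma_finite_measure.borel_measurable_lebesgue_integral[OF finite_measure.axioms(1)[OF finite_measure_M] this]
  show "integrable M (%y. \<integral>z. norm (case (y, z) of (y, z) => F y z) \<partial>M)"
   using Fn by (intro integrable_const_bound[of _ "B * (2 * G)"]) auto
  show "AE y in M. integrable M (%z. case (y, z) of (y, z) => F y z)" using Fz(1) by (intro AE_I2) auto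
 qed
 have "(\<integral>y. (\<integral>z. F y z \<partial>M) \<partial>M) = (\<integral>y. \<phi> y * g y - \<phi> y * g (a (jx y)) \<partial>M)"
  using Fz(2) by (intro Bochner_Integration.integral_cong) (auto simp: right_diff_distrib)
 also have "... = (\<integral>y. \<phi> y * g y \<partial>M) - (\<integral>y. \<phi> y * g (a (jx y)) \<partial>M)"
 proof (rule Bochner_Integration.integral_diff)
  show "integrable M (%y. \<phi> y * g y)"
   using B G B0 \<phi> gm by (intro bounded_integrable[of _ "B * G"]) (auto simp: norm_mult intro!: mult_mono)
  have "(%y. g (a (jx y))) \<in> borel_measurable M" by (rule jx_compose)
  thus "integrable M (%y. \<phi> y * g (a (jx y)))"
   using B G[OF a] B0 \<phi> by (intro bounded_integrable[of _ "B * G"]) (auto simp: norm_mult intro!: mult_mono)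
 qed
 finally have 1: "(\<integral>y. (\<integral>z. F y z \<partial>M) \<partial>M) = (\<integral>y. \<phi> y * g y \<partial>M) - (\<integral>y. \<phi> y * g (a (jx y)) \<partial>M)" .
 have "(\<integral>y. F y z \<partial>M) = KK \<phi> z * g z" for z unfolding F_def KK_def mult.assoc[symmetric] by (rule integral_mult_left_zero)
 hence "(\<integral>z. (\<integral>y. F y z \<partial>M) \<partial>M) = (\<integral>z. KK \<phi> z * g z \<partial>M)" by simp
 with 1 Fubini_integral[OF int] show ?thesis by (simp add: algebra_simps)
qed

lemma nb_boundary:
 assumes "\<rho> < 1" obtains \<rho>' where "\<rho>' < 1" "!!z y. z \<in> UB ==> \<rho>' < norm z ==> y \<in> nb z ==> \<rho> < norm y"
proof -
 define r where "r = max 0 \<rho>"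
 have r: "0 <= r" "r < 1" "\<rho> <= r" using assms by (auto simp: r_def)
 show ?thesis
 proof (rule that[of "sqrt ((1 + r^2) / 2)"])
  show "sqrt ((1 + r^2) / 2) < 1" by (rule sg_support_radius[OF r(1,2)])
  fix z y :: "real^'n" assume z: "z \<in> UB" "sqrt ((1 + r^2) / 2) < norm z" and y: "y \<in> nb z"
  show "\<rho> < norm y"
  proof (rule ccontr)
   assume "\<not> \<rho> < norm y"
   hence "norm y <= r" using r by simp
   moreover have "sg y z <= 1/16" using y sg_sym[of y z] by (simp add: nb_def)
   ultimately have "norm z <= sqrt ((1 + r^2) / 2)" using sg_support[of y r z] r z by blast
   thus False using z by simp
  qed
 qed
qed

lemma KK_vanishing:
 assumes \<phi>: "\<phi> \<in> borel_measurable M" "vanishing \<phi>" shows "vanishing (KK \<phi>)"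
 unfolding vanishing_def
proof (intro allI impI)
 fix e :: real assume e: "0 < e"
 then obtain \<rho> where \<rho>: "\<rho> < 1" "!!z. z \<in> UB ==> \<rho> < norm z ==> cmod (\<phi> z) < e" using \<phi>(2) unfolding vanishing_def by meson
 obtain \<rho>' where \<rho>': "\<rho>' < 1" "!!z y. z \<in> UB ==> \<rho>' < norm z ==> y \<in> nb z ==> \<rho> < norm y" using nb_boundary[OF \<rho>(1)] by metis
 have "cmod (KK \<phi> z) < e" if z: "z \<in> UB" "\<rho>' < norm z" for z
 proof -
  have "cmod (KK \<phi> z) <= e / 2"
  proof (rule KK_bound[OF \<phi>(1) z(1)])
   fix y assume y: "y \<in> nb z"
   thus "cmod (\<phi> y) <= e" using \<rho>(2)[of y] \<rho>'(2)[OF z y] by (simp add: nb_def)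
  qed (use e in simp)
  thus ?thesis using e by simp
 qed
 thus "\<exists>\<rho><1. \<forall>z\<in>UB. \<rho> < norm z --> cmod (KK \<phi> z) < e" using \<rho>'(1) by blast
qed

section \<open>Neumann series and coefficients\<close>

context
 fixes \<phi> :: "real^'n => complex" and B :: real
 assumes \<phi>: "\<phi> \<in> borel_measurable M" and B: "!!y. y \<in> UB ==> cmod (\<phi> y) <= B"
begin

abbreviation "ph k \<equiv> (KK ^^ k) \<phi>"
definition PS :: "nat => real^'n => complex" where "PS k z = (\<Sum>i<k. ph i z)"
text \<open>The Neumann series for \<Phi> = \<phi> + KK \<Phi>; it converges uniformly on the ball
  at the geometric rate 1/2 (\<open>Phi_PS\<close>).\<close>

definition Phi :: "real^'n => complex" where "Phi z = (\<Sum>i. ph i z)"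

lemma B_nonneg: "0 <= B" by (rule order_trans[OF norm_ge_zero B[of 0]]) simp

lemma ph_measurable: "ph k \<in> borel_measurable M"
 by (induction k) (simp_all add: \<phi> KK_measurable)

lemma ph_bound: "z \<in> UB ==> cmod (ph k z) <= B * (1/2) ^ k"
proof (induction k arbitrary: z)
 case (Suc k)
 have "cmod (KK (ph k) z) <= (B * (1/2) ^ k) / 2"
  using Suc.IH B_nonneg by (intro KK_bound ph_measurable Suc.prems) (auto simp: nb_def)
 thus ?case by simp
qed (simp add: B)

lemma PS_bound: assumes z: "z \<in> UB" shows "cmod (PS k z) <= 2 * B"
proof -
 have "cmod (PS k z) <= (\<Sum>i<k. B * (1/2) ^ i)"
  unfolding PS_def by (rule sum_norm_le) (rule ph_bound[OF z])
 also have "... = B * (\<Sum>i<k. (1/2) ^ i)" by (simp add: sum_distrib_left)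
 also have "... <= B * 2" using B_nonneg by (intro mult_left_mono) (simp_all add: geometric_sum)
 finally show ?thesis by simp
qed

lemma ph_summable: assumes z: "z \<in> UB" shows "summable (%k. ph k z)"
 by (rule summable_comparison_test[of _ "%k. B * (1/2) ^ k"]) (auto intro!: ph_bound[OF z] summable_mult)

lemma PS_tendsto: "z \<in> UB ==> (%k. PS k z) \<longlonglongrightarrow> Phi z"
 unfolding PS_def Phi_def by (rule summable_LIMSEQ[OF ph_summable])

lemma PS_measurable: "PS k \<in> borel_measurable M"
 unfolding PS_def[abs_def] by (intro borel_measurable_sum ph_measurable)

lemma Phi_measurable: "Phi \<in> borel_measurable M"
 by (rule borel_measurable_LIMSEQ_metric[where f = PS, OF PS_measurable]) (simp add: PS_tendsto)

lemma Phi_bound: assumes z: "z \<in> UB" shows "cmod (Phi z) <= 2 * B"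
 by (rule LIMSEQ_le_const2[OF tendsto_norm[OF PS_tendsto[OF z]]]) (auto intro: PS_bound[OF z])

lemma Phi_PS: assumes z: "z \<in> UB" shows "cmod (Phi z - PS k z) <= 2 * B * (1/2) ^ k"
proof -
 have s: "(%i. B * (1/2) ^ (i + k)) sums (B * (1/2) ^ k * 2)"
  using sums_mult[OF geometric_sums[of "1/2 :: real"], of "B * (1/2) ^ k"] by (simp add: power_add mult_ac)
 have "Phi z - PS k z = (\<Sum>i. ph (i + k) z)" unfolding Phi_def PS_def using suminf_split_initial_segment[OF ph_summable[OF z], of k] by simp
 also have "cmod ... <= (\<Sum>i. B * (1/2) ^ (i + k))"
  by (rule norm_suminf_le[OF ph_bound[OF z] sums_summable[OF s]])
 finally show ?thesis using sums_unique[OF s] by (simp add: mult_ac)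
qed

text \<open>Each term vanishes at the boundary by \<open>KK_vanishing\<close>, and uniform
  convergence of the partial sums passes this on.\<close>

lemma Phi_vanishing: assumes v: "vanishing \<phi>" shows "vanishing Phi"
proof -
 have ph: "vanishing (ph k)" for k by (induction k) (simp_all add: v KK_vanishing ph_measurable)
 have PS: "vanishing (PS k)" for k
 proof (induction k)
  case 0 show ?case by (auto simp: vanishing_def PS_def intro!: exI[of _ 0])
 next
  case (Suc k)
  show ?case unfolding vanishing_def
  proof (intro allI impI)
   fix e :: real assume e: "0 < e"
   hence e2: "0 < e / 2" by simp
   obtain \<rho>1 where 1: "\<rho>1 < 1" "!!z. z \<in> UB ==> \<rho>1 < norm z ==> cmod (PS k z) < e / 2" using Suc e2 unfolding vanishing_def by meson
   obtain \<rho>2 where 2: "\<rho>2 < 1" "!!z. z \<in> UB ==> \<rho>2 < norm z ==> cmod (ph k z) < e / 2" using ph[of k] e2 unfolding vanishing_def by meson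
   show "\<exists>\<rho><1. \<forall>z\<in>UB. \<rho> < norm z --> cmod (PS (Suc k) z) < e"
   proof (intro exI[of _ "max \<rho>1 \<rho>2"] conjI ballI impI)
    fix z :: "real^'n" assume z: "z \<in> UB" "max \<rho>1 \<rho>2 < norm z"
    have "cmod (PS (Suc k) z) <= cmod (PS k z) + cmod (ph k z)" unfolding PS_def sum.lessThan_Suc by (rule norm_triangle_ineq)
    thus "cmod (PS (Suc k) z) < e" using 1(2)[of z] 2(2)[of z] z by simp
   qed (use 1 2 in auto)
  qed
 qed
 show ?thesis unfolding vanishing_def
 proof (intro allI impI)
  fix e :: real assume e: "0 < e"
  have "(%k. 2 * B * (1/2) ^ k) \<longlonglongrightarrow> 2 * B * 0" by (intro tendsto_intros LIMSEQ_realpow_zero) auto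
  hence "\<forall>\<^sub>F k in sequentially. 2 * B * (1/2) ^ k < e / 2" by (rule order_tendstoD(2)) (use e in simp)
  then obtain k where k: "2 * B * (1/2) ^ k < e / 2" by (auto simp: eventually_sequentially)
  obtain \<rho> where \<rho>: "\<rho> < 1" "!!z. z \<in> UB ==> \<rho> < norm z ==> cmod (PS k z) < e / 2" using PS[of k] e unfolding vanishing_def by (meson half_gt_zero)
  show "\<exists>\<rho><1. \<forall>z\<in>UB. \<rho> < norm z --> cmod (Phi z) < e"
  proof (intro exI[of _ \<rho>] conjI ballI impI)
   fix z :: "real^'n" assume z: "z \<in> UB" "\<rho> < norm z"
   show "cmod (Phi z) < e" using \<rho>(2)[OF z] Phi_PS[OF z(1), of k] k norm_triangle_sub[of "Phi z" "PS k z"] by linarith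
  qed (rule \<rho>)
 qed
qed

definition mu :: "nat => complex" where "mu m = (\<integral>y. (if jx y = m then Phi y else 0) \<partial>M)"

lemma restrict_integrable:
 assumes "F \<in> borel_measurable M" "!!y. y \<in> UB ==> cmod (F y) <= K"
 shows "integrable M (%y. if P (jx y) then F y else (0::complex))"
proof (rule Bochner_Integration.integrable_bound[OF bounded_integrable[OF assms(1,2)]])
 have "(%y. of_bool (P (jx y)) *\<^sub>R F y) \<in> borel_measurable M"
  using assms(1) jx_compose[of "%m. of_bool (P m) :: real"] by measurable
 thus "(%y. if P (jx y) then F y else 0) \<in> borel_measurable M"
  by (rule measurable_cong[THEN iffD1, rotated]) auto
qed auto

text \<open>The cell of index m lies in \<open>nb (a m)\<close> by \<open>jx_nb\<close>, so the size
  of \<Phi> near \<open>a m\<close> and the mass of that neighbourhood control the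
  coefficient.\<close>

lemma mu_bound:
 assumes K: "!!y. y \<in> nb (a m) ==> cmod (Phi y) <= K" and K0: "0 <= K"
 shows "cmod (mu m) <= K * (Cn * wt (a m))"
proof -
 have nbs: "nb (a m) \<in> sets M" by (rule nb_sets(2)[OF a])
 have ib: "integrable M (%y. K * indicator (nb (a m)) y :: real)"
  using nbs by (intro integrable_mult_right integrable_real_indicator) (auto simp: emeasure_finite less_top[symmetric])
 have "cmod (mu m) <= (\<integral>y. K * indicator (nb (a m)) y \<partial>M)"
  unfolding mu_def
 proof (rule Bochner_Integration.integral_norm_bound_integral[OF _ ib])
  show "integrable M (%y. if jx y = m then Phi y else 0)" by (rule restrict_integrable[OF Phi_measurable Phi_bound])
  fix y assume "y \<in> space M"
  hence y: "y \<in> UB" by simp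
  show "cmod (if jx y = m then Phi y else 0) <= K * indicator (nb (a m)) y"
   using jx_nb[OF y] K[of y] K0 by auto
 qed
 also have "... = K * measure M (nb (a m))" using nbs by simp
 also have "... <= K * (Cn * wt (a m))" using mass[OF a] K0 by (intro mult_left_mono) auto
 finally show ?thesis .
qed

lemma mu_outside: assumes "m \<notin> J" shows "mu m = 0"
proof -
 have "mu m = (\<integral>y. 0 \<partial>M)" unfolding mu_def
  by (rule Bochner_Integration.integral_cong) (use jx(1) assms in auto)
 thus ?thesis by simp
qed

lemma mu_partial_sum:
 assumes F: "F \<in> borel_measurable M" "!!y. y \<in> UB ==> cmod (F y) <= K"
 shows "(\<Sum>m<k. \<integral>y. (if jx y = m then F y else 0) \<partial>M) = (\<integral>y. (if jx y < k then F y else 0) \<partial>M)"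
proof -
 have "(\<Sum>m<k. \<integral>y. (if jx y = m then F y else 0) \<partial>M) = (\<integral>y. (\<Sum>m<k. if jx y = m then F y else 0) \<partial>M)"
  by (rule Bochner_Integration.integral_sum[symmetric]) (rule restrict_integrable[OF F])
 also have "(%y. \<Sum>m<k. if jx y = m then F y else 0) = (%y. if jx y < k then F y else 0)"
  by (simp add: fun_eq_iff sum.delta)
 finally show ?thesis .
qed

lemma mu_summable: "summable (%m. cmod (mu m))"
proof (rule bounded_imp_summable)
 \<comment> \<open>|\<Phi>| as a complex function, so that the lemmas on complex integrands apply.
   The sums over cells are bounded by the integral of the constant 2 B over the finite measure
   \<open>M\<close>.\<close>
 define F where "F y = complex_of_real (cmod (Phi y))" for y
 have F: "F \<in> borel_measurable M" "!!y. y \<in> UB ==> cmod (F y) <= 2 * B"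
  using Phi_measurable Phi_bound by (auto simp: F_def[abs_def])
 fix k
 have m: "cmod (mu m) <= Re (\<integral>y. (if jx y = m then F y else 0) \<partial>M)" for m
 proof -
  have i: "integrable M (%y. if jx y = m then F y else 0)" by (rule restrict_integrable[OF F])
  have "cmod (mu m) <= (\<integral>y. Re (if jx y = m then F y else 0) \<partial>M)"
   unfolding mu_def
   by (rule Bochner_Integration.integral_norm_bound_integral[OF restrict_integrable[OF Phi_measurable Phi_bound] integrable_Re[OF i]]) (auto simp: F_def)
  thus ?thesis using integral_Re[OF i] by simp
 qed
 have "(\<Sum>m\<le>k. cmod (mu m)) <= (\<Sum>m\<le>k. Re (\<integral>y. (if jx y = m then F y else 0) \<partial>M))" by (intro sum_mono m)
 also have "... = Re (\<Sum>m<Suc k. \<integral>y. (if jx y = m then F y else 0) \<partial>M)" by (simp only: Re_sum lessThan_Suc_atMost)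
 also have "... = Re (\<integral>y. (if jx y < Suc k then F y else 0) \<partial>M)" by (rule arg_cong[where f = Re]) (rule mu_partial_sum[OF F])
 also have "... <= cmod (\<integral>y. (if jx y < Suc k then F y else 0) \<partial>M)" by (rule complex_Re_le_cmod)
 also have "... <= (\<integral>y. 2 * B \<partial>M)"
  using F(2) B_nonneg by (intro Bochner_Integration.integral_norm_bound_integral restrict_integrable[OF F]) auto
 finally show "(\<Sum>m\<le>k. cmod (mu m)) <= (\<integral>y. 2 * B \<partial>M)" .
qed simp

context
 fixes g :: "real^'n => complex" and G :: real
 assumes g: "g \<in> h_harmonic" and G: "!!y. y \<in> UB ==> cmod (g y) <= G"
begin

lemma ga_measurable: "(%y. g (a (jx y))) \<in> borel_measurable M" by (rule jx_compose)
lemma g_measurable: "g \<in> borel_measurable M" by (rule continuous_measurable(2)[OF h_harmonic_continuous[OF g]])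
lemma G_nonneg: "0 <= G" by (rule order_trans[OF norm_ge_zero G[of 0]]) simp

lemma ga_integrable:
 assumes "F \<in> borel_measurable M" "!!y. y \<in> UB ==> cmod (F y) <= K"
 shows "integrable M (%y. F y * g (a (jx y)))"
 using assms ga_measurable G[OF a]
 by (intro bounded_integrable[of _ "K * G"]) (auto simp: norm_mult intro!: mult_mono order_trans[OF norm_ge_zero])

text \<open>\<open>KK_pairing\<close> iterated: the error left by each step is the pairing with the
  next term of the series.\<close>

lemma PS_pairing: "(\<integral>y. \<phi> y * g y \<partial>M) = (\<integral>y. PS k y * g (a (jx y)) \<partial>M) + (\<integral>y. ph k y * g y \<partial>M)"
proof (induction k)
 case (Suc k)
 have b: "cmod (ph k y) <= B" if "y \<in> UB" for y
  by (rule order_trans[OF ph_bound[OF that]]) (use B_nonneg in \<open>auto intro!: mult_left_le power_le_one\<close>)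
 have "(\<integral>y. PS (Suc k) y * g (a (jx y)) \<partial>M) = (\<integral>y. PS k y * g (a (jx y)) + ph k y * g (a (jx y)) \<partial>M)"
  by (simp add: PS_def distrib_right)
 also have "... = (\<integral>y. PS k y * g (a (jx y)) \<partial>M) + (\<integral>y. ph k y * g (a (jx y)) \<partial>M)"
  by (intro Bochner_Integration.integral_add ga_integrable[OF PS_measurable PS_bound] ga_integrable[OF ph_measurable b])
 finally show ?case using Suc KK_pairing[OF ph_measurable b g G] by simp
qed (simp add: PS_def)

lemma Phi_pairing: "(\<integral>y. \<phi> y * g y \<partial>M) = (\<integral>y. Phi y * g (a (jx y)) \<partial>M)"
proof -
 have "(%k. \<integral>y. ph k y * g y \<partial>M) \<longlonglongrightarrow> 0"
 proof (rule Lim_null_comparison)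
  show "\<forall>\<^sub>F k in sequentially. norm (\<integral>y. ph k y * g y \<partial>M) <= (B * G * measure M (space M)) * (1/2) ^ k"
  proof (intro always_eventually allI)
   fix k
   have le: "cmod (ph k y * g y) <= B * (1/2) ^ k * G" if "y \<in> UB" for y
    unfolding norm_mult using B_nonneg by (intro mult_mono ph_bound G that) auto
   have "norm (\<integral>y. ph k y * g y \<partial>M) <= (\<integral>y. B * (1/2) ^ k * G \<partial>M)"
    using ph_measurable g_measurable le
    by (intro Bochner_Integration.integral_norm_bound_integral bounded_integrable[OF _ le]) auto
   thus "norm (\<integral>y. ph k y * g y \<partial>M) <= (B * G * measure M (space M)) * (1/2) ^ k" by (simp add: mult_ac)
  qed
  have "(%k. (B * G * measure M (space M)) * (1/2) ^ k) \<longlonglongrightarrow> (B * G * measure M (space M)) * 0" by (intro tendsto_intros LIMSEQ_realpow_zero) auto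
  thus "(%k. (B * G * measure M (space M)) * (1/2) ^ k) \<longlonglongrightarrow> 0" by simp
 qed
 moreover have "(%k. \<integral>y. PS k y * g (a (jx y)) \<partial>M) \<longlonglongrightarrow> (\<integral>y. Phi y * g (a (jx y)) \<partial>M)"
 proof (rule integral_dominated_convergence[where w = "%y. 2 * B * G"])
  show "(%y. Phi y * g (a (jx y))) \<in> borel_measurable M" "(%y. PS k y * g (a (jx y))) \<in> borel_measurable M" for k
   using Phi_measurable PS_measurable ga_measurable by auto
  show "AE y in M. (%k. PS k y * g (a (jx y))) \<longlonglongrightarrow> Phi y * g (a (jx y))"
   by (intro AE_I2 tendsto_mult PS_tendsto tendsto_const) simp
  show "AE y in M. norm (PS k y * g (a (jx y))) <= 2 * B * G" for k
   unfolding norm_mult using B_nonneg by (intro AE_I2 mult_mono PS_bound G a) auto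
 qed simp
 ultimately have "(%k. (\<integral>y. PS k y * g (a (jx y)) \<partial>M) + (\<integral>y. ph k y * g y \<partial>M)) \<longlonglongrightarrow> (\<integral>y. Phi y * g (a (jx y)) \<partial>M) + 0"
  by (rule tendsto_add[rotated])
 thus ?thesis unfolding PS_pairing[symmetric] using LIMSEQ_unique[OF tendsto_const] by fastforce
qed

lemma mu_sums: "(%m. mu m * g (a m)) sums (\<integral>y. \<phi> y * g y \<partial>M)"
proof -
 let ?F = "%y. Phi y * g (a (jx y))"
 have F: "?F \<in> borel_measurable M" "cmod (?F y) <= 2 * B * G" if "y \<in> UB" for y
  using Phi_measurable ga_measurable B_nonneg that by (auto simp: norm_mult intro!: mult_mono Phi_bound G a)
 have Fm: "?F \<in> borel_measurable M" using F(1)[of 0] by simp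
 have mg: "mu m * g (a m) = (\<integral>y. (if jx y = m then ?F y else 0) \<partial>M)" for m
 proof -
  have "mu m * g (a m) = (\<integral>y. (if jx y = m then Phi y else 0) * g (a m) \<partial>M)" unfolding mu_def by simp
  also have "(%y. (if jx y = m then Phi y else 0) * g (a m)) = (%y. if jx y = m then ?F y else 0)" by (auto simp: fun_eq_iff)
  finally show ?thesis .
 qed
 have "(%k. \<integral>y. (if jx y < k then ?F y else 0) \<partial>M) \<longlonglongrightarrow> (\<integral>y. ?F y \<partial>M)"
 proof (rule integral_dominated_convergence[where w = "%y. 2 * B * G"])
  show "(%y. if jx y < k then ?F y else 0) \<in> borel_measurable M" for k
   using borel_measurable_integrable[OF restrict_integrable[OF Fm F(2), of "%m. m < k"]] .
  show "AE y in M. (%k. if jx y < k then ?F y else 0) \<longlonglongrightarrow> ?F y"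
  proof (rule AE_I2)
   fix y show "(%k. if jx y < k then ?F y else 0) \<longlonglongrightarrow> ?F y"
   proof (rule tendsto_eventually)
    show "\<forall>\<^sub>F k in sequentially. (if jx y < k then ?F y else 0) = ?F y"
     using eventually_gt_at_top[of "jx y"] by (rule eventually_mono) simp
   qed
  qed
  show "AE y in M. norm (if jx y < k then ?F y else 0) <= 2 * B * G" for k
   using F(2) B_nonneg G_nonneg by (intro AE_I2) auto
 qed (use Fm in auto)
 moreover have "(%k. \<Sum>m<k. mu m * g (a m)) = (%k. \<integral>y. (if jx y < k then ?F y else 0) \<partial>M)"
  unfolding mg by (rule ext) (rule mu_partial_sum[OF Fm F(2)])
 ultimately show ?thesis unfolding sums_def Phi_pairing by simp
qed

end

text \<open>By \<open>fin\<close> the neighbourhoods \<open>nb (a m)\<close> move to the boundary,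
  where \<Phi> is small; division by \<open>wt (a m)\<close> removes the mass of the cell.\<close>

lemma mu_vanishing:
 assumes v: "vanishing \<phi>" and fin: "!!\<rho>. \<rho> < 1 ==> finite {m. norm (a m) <= \<rho>}"
 shows "(%m. mu m / of_real (wt (a m))) \<longlonglongrightarrow> 0"
proof (rule LIMSEQ_I)
 fix e :: real assume e: "0 < e"
 obtain \<rho> where \<rho>: "\<rho> < 1" "!!z. z \<in> UB ==> \<rho> < norm z ==> cmod (Phi z) < e / (2 * Cn)"
  using Phi_vanishing[OF v] e Cn unfolding vanishing_def by (metis divide_pos_pos mult_pos_pos zero_less_numeral)
 obtain \<rho>' where \<rho>': "\<rho>' < 1" "!!z y. z \<in> UB ==> \<rho>' < norm z ==> y \<in> nb z ==> \<rho> < norm y" using nb_boundary[OF \<rho>(1)] by metis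
 obtain m0 where m0: "!!m. m \<in> {m. norm (a m) <= \<rho>'} ==> m < m0" using fin[OF \<rho>'(1)] finite_nat_bounded by (metis lessThan_iff subsetD)
 show "\<exists>m0. \<forall>m\<ge>m0. norm (mu m / of_real (wt (a m)) - 0) < e"
 proof (intro exI[of _ m0] allI impI)
  fix m assume "m0 <= m"
  hence "\<rho>' < norm (a m)" using m0[of m] by force
  hence "cmod (Phi y) <= e / (2 * Cn)" if "y \<in> nb (a m)" for y
   using \<rho>(2)[of y] \<rho>'(2)[OF a _ that] that by (auto simp: nb_def)
  hence "cmod (mu m) <= e / (2 * Cn) * (Cn * wt (a m))" using e Cn by (intro mu_bound) auto
  also have "... = (e / 2) * wt (a m)" using Cn by simp
  finally have le: "cmod (mu m) <= (e / 2) * wt (a m)" .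
  define W where "W = wt (a m)"
  have W: "0 < W" unfolding W_def by (rule wt_pos[OF a])
  have "(e / 2) * W < e * W" using W e by (intro mult_strict_right_mono) auto
  hence "cmod (mu m) / W < e" using W le unfolding W_def[symmetric] by (simp only: pos_divide_less_eq)
  thus "norm (mu m / of_real (wt (a m)) - 0) < e" unfolding W_def[symmetric] using W by (simp add: norm_divide)
 qed
qed

end

end

section \<open>Geometry of lattices\<close>

lemma bracket_eq:
 fixes x y :: "real^'n"
 shows "1 - 2 * (x \<bullet> y) + (norm x)^2 * (norm y)^2 = (norm (y - x))^2 + (dl x) * (dl y)"
 by (simp add: power2_norm_eq_inner inner_diff inner_commute algebra_simps)

text \<open>By \<open>bracket_eq\<close> the square p of the pseudo-hyperbolic distance is sg / (1 +
  sg), hence sg = p / (1 - p); for r < 1/2 the denominator exceeds 3/4, and 2 is a convenient upper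
  bound for 4/3.\<close>

lemma pseudo_hyp_sg:
 fixes x y :: "real^'n"
 assumes x: "x \<in> UB" and y: "y \<in> UB" and r: "0 < r" "r < 1/2" and h: "pseudo_hyp x y < r"
 shows "sg x y < 2 * r^2"
proof -
 define P where "P = (dl x) * (dl y)"
 define d where "d = (norm (y - x))^2"
 have P: "0 < P" unfolding P_def using dl_pos[OF x] dl_pos[OF y] by simp
 have d: "0 <= d" by (simp add: d_def)
 have "(pseudo_hyp x y)^2 = d / (d + P)"
  unfolding pseudo_hyp_def bracket_eq P_def[symmetric] d_def[symmetric] using d P by (simp add: power_divide d_def norm_minus_commute)
 moreover have pn: "0 <= pseudo_hyp x y"
  unfolding pseudo_hyp_def bracket_eq P_def[symmetric] d_def[symmetric] using d P by (intro divide_nonneg_nonneg real_sqrt_ge_zero norm_ge_zero) auto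
 moreover have "(pseudo_hyp x y)^2 < r^2" using h pn by (intro power_strict_mono) auto
 ultimately have 1: "d < r^2 * (d + P)" using d P by (simp add: pos_divide_less_eq)
 have r2: "r^2 <= 1/4" using r power_mono[of r "1/2" 2] by (simp add: power2_eq_square)
 have "d < 2 * r^2 * P"
 proof -
  have "r^2 * d <= 1/4 * d" using r2 d by (rule mult_right_mono)
  thus ?thesis using 1 d by (simp add: algebra_simps)
 qed
 thus ?thesis using P by (simp add: sg_def d_def[symmetric] P_def[symmetric] pos_divide_less_eq)
qed

text \<open>The bracket [a, b] is at least 1 - |a| |b|, so in the ball of radius \<rho> separation r
  implies Euclidean distances of at least r (1 - \<rho>^2); a bounded uniformly discrete set is
  finite.\<close>

lemma separated_finite:
 fixes a :: "nat => real^'n"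
 assumes s: "separated r a" and r: "0 < r" and \<rho>: "\<rho> < 1"
 shows "finite {m. norm (a m) <= \<rho>}"
proof (cases "0 <= \<rho>")
 case True
 let ?S = "{m. norm (a m) <= \<rho>}"
 define e where "e = r * (1 - \<rho>^2)"
 have \<rho>2: "0 < 1 - \<rho>^2" using True \<rho> by (simp add: abs_square_less_1)
 have e: "0 < e" using r \<rho>2 by (simp add: e_def)
 have far: "e <= dist (a m) (a k)" if "m \<in> ?S" "k \<in> ?S" "m \<noteq> k" for m k
 proof -
  have h: "r <= pseudo_hyp (a m) (a k)" using s that by (simp add: separated_def)
  let ?D = "1 - 2 * (a m \<bullet> a k) + (norm (a m))^2 * (norm (a k))^2"
  have "norm (a m) * norm (a k) <= \<rho> * \<rho>" using that True by (intro mult_mono) auto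
  hence l: "1 - \<rho>^2 <= 1 - norm (a m) * norm (a k)" by (simp add: power2_eq_square)
  have "(1 - norm (a m) * norm (a k))^2 <= ?D"
   using norm_cauchy_schwarz[of "a m" "a k"] by (simp add: power2_eq_square algebra_simps)
  hence "1 - norm (a m) * norm (a k) <= sqrt ?D" by (rule real_le_rsqrt)
  hence D: "1 - \<rho>^2 <= sqrt ?D" using l by simp
  have sp: "0 < sqrt ?D" using D \<rho>2 by linarith
  have "r * (1 - \<rho>^2) <= r * sqrt ?D" using D r by (intro mult_left_mono) auto
  also have "... <= norm (a m - a k)" using h unfolding pseudo_hyp_def pos_le_divide_eq[OF sp] .
  finally show ?thesis by (simp add: e_def dist_norm)
 qed
 have "uniform_discrete (a ` ?S)"
  unfolding uniform_discrete_def using e far by (intro exI[of _ e]) force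
 moreover have "bounded (a ` ?S)" by (rule boundedI[of _ \<rho>]) auto
 ultimately have "finite (a ` ?S)" using uniform_discrete_finite_iff by blast
 moreover have "inj_on a ?S"
 proof (rule inj_onI, rule ccontr)
  fix m k assume mk: "m \<in> ?S" "k \<in> ?S" "a m = a k" "m \<noteq> k"
  show False using far[OF mk(1,2,4)] mk(3) e by simp
 qed
 ultimately show ?thesis by (rule finite_imageD)
next
 case False
 hence "{m. norm (a m) <= \<rho>} = {}" by (auto simp: not_le intro: less_le_trans)
 thus ?thesis by simp
qed

text \<open>Intermediate value theorem on the connected ball, between x itself and a point outside
  the set sg <= 1/16.\<close>

lemma sg_attains:
 fixes x :: "real^'n"
 assumes x: "x \<in> UB" and s: "0 <= s" "s <= 1/16"
 obtains y where "y \<in> UB" "sg x y = s"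
proof -
 define \<rho> where "\<rho> = sqrt ((1 + (norm x)^2) / 2)"
 have \<rho>: "\<rho> < 1" unfolding \<rho>_def using x by (intro sg_support_radius) auto
 have \<rho>0: "0 <= \<rho>" by (simp add: \<rho>_def)
 define z where "z = ((\<rho> + 1) / 2) *\<^sub>R (axis undefined 1 :: real^'n)"
 have nz: "norm z = (\<rho> + 1) / 2" using \<rho>0 by (simp add: z_def norm_axis_1)
 hence z: "z \<in> UB" "\<rho> < norm z" using \<rho> by auto
 have big: "1/16 < sg x z"
 proof (rule ccontr)
  assume "\<not> ?thesis"
  hence "norm z <= \<rho>" unfolding \<rho>_def using x z(1) by (intro sg_support[of x "norm x"]) auto
  thus False using z(2) by simp
 qed
 have sxx: "sg x x = 0" by (simp add: sg_def)
 have "connected (sg x ` UB)"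
  by (intro connected_continuous_image has_partials_continuous[OF has_partials_sg]) (simp add: convex_connected)
 hence "s \<in> sg x ` UB"
  by (rule connectedD_interval[of _ "sg x x" "sg x z"]) (use x z big s sxx in auto)
 thus thesis using that by auto
qed

text \<open>For y near \<open>a 0\<close> take y' with sg (a 0) y' = 2 r^2. By
  \<open>pseudo_hyp_sg\<close> it is not covered by \<open>a 0\<close>, so another centre covers it.
  Two uses of \<open>sg_triangle\<close> give 8 * 2 = 16 and 8 * 16 = 128, rounded up to 130 for a
  strict inequality; r < 1/16 keeps 16 r^2 in its range.\<close>

lemma punctured_cover:
 fixes a :: "nat => real^'n"
 assumes l: "lattice_seq r a" and r: "0 < r" "r < 1/16" and y: "y \<in> UB"
 shows "\<exists>m. m \<noteq> 0 \<and> sg y (a m) < 130 * r^2"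
proof -
 have ab: "a m \<in> UB" for m using l unfolding lattice_seq_def separated_def by blast
 have cov: "\<exists>m. pseudo_hyp x (a m) < r" if "x \<in> UB" for x
  using l that unfolding lattice_seq_def pseudo_hyp_ball_def by auto
 have r2: "r * r < 1/256" using r mult_strict_mono[of r "1/16" r "1/16"] by simp
 have rp: "0 < r^2" using r by simp
 obtain m where m: "pseudo_hyp y (a m) < r" using cov[OF y] by blast
 have m': "sg y (a m) < 2 * r^2" using pseudo_hyp_sg[OF y ab r(1) _ m] r by simp
 show ?thesis
 proof (cases "m = 0")
  case False
  have "2 * r^2 <= 130 * r^2" using rp by simp
  thus ?thesis using order.strict_trans2[OF m'] False by blast
 next
  case True
  obtain y' where y': "y' \<in> UB" "sg (a 0) y' = 2 * r^2"
   using sg_attains[OF ab, of "2 * r^2" 0] r2 r by (auto simp: power2_eq_square)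
  obtain k where k: "pseudo_hyp y' (a k) < r" using cov[OF y'(1)] by blast
  have k': "sg y' (a k) < 2 * r^2" using pseudo_hyp_sg[OF y'(1) ab r(1) _ k] r by simp
  have "k \<noteq> 0" using k' y'(2) by (metis less_irrefl sg_sym)
  have 1: "sg y y' <= 8 * (2 * r^2)"
   by (rule sg_triangle[OF y ab[of 0] y'(1)]) (use m' True y'(2) r2 in \<open>auto simp: power2_eq_square\<close>)
  have k16: "sg y' (a k) <= 16 * r^2" using k' rp by linarith
  have "sg y (a k) <= 8 * (16 * r^2)"
   by (rule sg_triangle[OF y y'(1) ab]) (use 1 k16 r2 in \<open>auto simp: power2_eq_square\<close>)
  hence "sg y (a k) < 130 * r^2" using rp by linarith
  thus ?thesis using \<open>k \<noteq> 0\<close> by blast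
 qed
qed

section \<open>Assembly of the expansion\<close>

context bergman begin

lemma vanishing_kd:
 assumes x: "x \<in> UB" shows "vanishing (%z. of_real (kd x z))"
 unfolding vanishing_def
proof (intro allI impI)
 fix e :: real assume e: "0 < e"
 show "\<exists>\<rho><1. \<forall>z\<in>UB. \<rho> < norm z --> cmod (of_real (kd x z)) < e"
 proof (intro exI[of _ "sqrt ((1 + (norm x)^2) / 2)"] conjI ballI impI)
  show "sqrt ((1 + (norm x)^2) / 2) < 1" using x by (intro sg_support_radius) auto
  fix z :: "real^'n" assume z: "z \<in> UB" "sqrt ((1 + (norm x)^2) / 2) < norm z"
  have "1/128 <= sg x z"
  proof (rule ccontr)
   assume "\<not> ?thesis"
   hence "norm z <= sqrt ((1 + (norm x)^2) / 2)" using x z(1) by (intro sg_support[of x "norm x"]) auto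
   thus False using z(2) by simp
  qed
  thus "cmod (of_real (kd x z)) < e" using e by (simp add: kd_zero)
 qed
qed

lemma net_constants:
 obtains Cn \<delta> L where "0 < Cn" "0 < \<delta>" "\<delta>^2 <= 1/128" "0 <= L" "L * Cn <= 1/2"
  "!!x y z. x \<in> UB ==> y \<in> UB ==> z \<in> UB ==> sg x y < \<delta>^2 ==>
   \<bar>kd x z - kd y z\<bar> <= L / wt z \<and> (1/16 < sg x z --> kd x z - kd y z = 0)"
  "!!z. z \<in> UB ==> measure M (nb z) <= Cn * wt z"
proof -
 obtain C where C: "0 < C" "!!x y z \<delta>. x \<in> UB ==> y \<in> UB ==> z \<in> UB ==> sg x y <= \<delta>^2 ==> 0 <= \<delta> ==> \<delta>^2 <= 1/128 ==>
   \<bar>kd x z - kd y z\<bar> <= C * \<delta> * wi z \<and> (1/16 < sg x z --> kd x z - kd y z = 0)"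
  using kd_lipschitz by blast
 obtain C' where C': "0 < C'" "!!x. x \<in> UB ==> measure M (nb x) <= C' * (dl x) powr (real CARD('n) + \<alpha>)"
  using measure_nb by blast
 \<comment> \<open>1 / (2 C C') makes the product C \<delta> C' of the two constants at most 1/2;
   1/12 keeps \<delta>^2 <= 1/144 below 1/128.\<close>
 define \<delta> where "\<delta> = min (1/12) (1 / (2 * C * C'))"
 have \<delta>: "0 < \<delta>" "\<delta> <= 1/12" "\<delta> <= 1 / (2 * C * C')" using C(1) C'(1) by (auto simp: \<delta>_def)
 have "\<delta>^2 <= (1/12)^2" using \<delta> by (intro power_mono) auto
 hence d2: "\<delta>^2 <= 1/128" by (simp add: power2_eq_square)
 have "C * \<delta> * C' <= 1/2" using \<delta>(3) C(1) C'(1) by (simp add: field_simps)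
 show thesis
 proof (rule that[of C' \<delta> "C * \<delta>"])
  show "\<bar>kd x z - kd y z\<bar> <= C * \<delta> / wt z \<and> (1/16 < sg x z --> kd x z - kd y z = 0)"
   if "x \<in> UB" "y \<in> UB" "z \<in> UB" "sg x y < \<delta>^2" for x y z
   using C(2)[OF that(1-3) less_imp_le[OF that(4)] less_imp_le[OF \<delta>(1)] d2] unfolding powr_neg times_divide_eq_right mult_1_right .
  show "measure M (nb z) <= C' * wt z" if "z \<in> UB" for z by (rule C'(2)[OF that])
  show "C * \<delta> * C' <= 1/2" by fact
  show "0 <= C * \<delta>" using C(1) \<delta>(1) by simp
 qed (fact C'(1) \<delta>(1) d2)+
qed

lemma kernel_atom_eq: "kernel_atom \<alpha> y x = bk y x / of_real (bloch_norm (bk y))"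
 by (simp add: kernel_atom_def bk_def[abs_def])

lemma bk_swap: "x \<in> UB ==> y \<in> UB ==> bk x y = bk y x"
 by (simp add: bk_real Rk_sym)

lemma bk_bounded:
 assumes x: "x \<in> UB" obtains G where "!!y. y \<in> UB ==> cmod (bk x y) <= G"
proof -
 obtain C where "0 < C" "!!y a. y \<in> UB ==> a \<in> UB ==> \<bar>Rk y a\<bar> <= C * wi a"
  using Rk_bound by blast
 thus ?thesis using that[of "C * wi x"] x by (simp add: bk_real)
qed

text \<open>Multiplication by the Bloch norms cancels the normalisation of the atoms. For absolutely
  summable \<mu> the bound C \<open>wi x\<close> of the kernel, uniform in m, gives both modes of
  convergence by comparison and by the M-test.\<close>

lemma kernel_expansionI:
 assumes a: "!!m. a m \<in> UB" and \<mu>: "summable (%m. cmod (\<mu> m))"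
  and f: "!!x. x \<in> UB ==> (%m. \<mu> m * bk (a m) x) sums f x"
 shows "kernel_expansion \<alpha> a (%m. \<mu> m * of_real (bloch_norm (bk (a m)))) f"
proof -
 obtain C where C: "0 < C" "!!y a. y \<in> UB ==> a \<in> UB ==> \<bar>Rk y a\<bar> <= C * wi a"
  using Rk_bound by blast
 have t: "\<mu> m * of_real (bloch_norm (bk (a m))) * kernel_atom \<alpha> (a m) x = \<mu> m * bk (a m) x" for m x
  using bloch_norm_bk_pos[OF a, of m] by (simp add: kernel_atom_eq)
 have b: "cmod (\<mu> m * bk (a m) x) <= cmod (\<mu> m) * (C * wi x)" if x: "x \<in> UB" for m x
  unfolding norm_mult using C(2)[OF a x, of m] bk_real[OF x a, of m] by (intro mult_left_mono) (simp_all add: bk_swap[OF a x])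
 show ?thesis unfolding kernel_expansion_def t
 proof (intro conjI ballI allI impI)
  show "summable (%m. cmod (\<mu> m * bk (a m) x))" if "x \<in> UB" for x
   by (rule summable_comparison_test'[OF summable_mult2[OF \<mu>]]) (use b[OF that] in simp)
  fix K :: "(real^'n) set" assume K: "compact K \<and> K \<subseteq> UB"
  have "continuous_on K (%x. C * wi x)"
   using K by (intro continuous_intros continuous_on_subset[OF continuous_on_weight_powr]) auto
  hence "bounded ((%x. C * wi x) ` K)"
   using K by (intro compact_imp_bounded compact_continuous_image) auto
  then obtain D where D: "!!x. x \<in> K ==> \<bar>C * wi x\<bar> <= D" unfolding bounded_iff by auto
  have ul: "uniform_limit K (%k x. \<Sum>m<k. \<mu> m * bk (a m) x) (%x. \<Sum>m. \<mu> m * bk (a m) x) sequentially"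
  proof (rule Weierstrass_m_test[OF _ summable_mult2[OF \<mu>]])
   fix m x assume x: "x \<in> K"
   have "cmod (\<mu> m * bk (a m) x) <= cmod (\<mu> m) * (C * wi x)" using x K by (intro b) auto
   also have "... <= cmod (\<mu> m) * D" using D[OF x] by (intro mult_left_mono) auto
   finally show "norm (\<mu> m * bk (a m) x) <= cmod (\<mu> m) * D" .
  qed
  have fs: "(\<Sum>m. \<mu> m * bk (a m) x) = f x" if "x \<in> K" for x using sums_unique[OF f] K that by auto
  show "uniform_limit K (%k x. \<Sum>m<k. \<mu> m * bk (a m) x) f sequentially"
   by (rule uniform_limit_cong'[THEN iffD1, OF _ _ ul]) (use fs in auto)
 qed (use f in auto)
qed

text \<open>A Bloch function lies in \<open>B2\<close> and is reproduced by the kernel;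
  \<open>bsym_pairing\<close> with g = \<open>bk x\<close> then exchanges f for a bounded
  function.\<close>

lemma bloch_integral_repr:
 assumes f: "f \<in> bloch_space" and x: "x \<in> UB"
 shows "f x = (\<integral>y. bsym f y * bk x y \<partial>M)"
proof -
 have "f x = ip f (bk x)" by (rule bk_spec(2)[OF x bloch_B2[OF f]])
 also have "... = (\<integral>y. f y * bk x y \<partial>M)"
  unfolding ip_def by (rule Bochner_Integration.integral_cong) (simp_all add: bk_real[OF x])
 also have "... = (\<integral>y. bsym f y * bk x y \<partial>M)" by (rule bsym_pairing(2)[OF f bk_spec(1)[OF x]])
 finally show ?thesis .
qed

end

theorem theorem1p3:
 fixes \<alpha> :: real
 assumes "CARD('n::finite) \<ge> 2" and "\<alpha> > -1"
 shows "\<exists>r0. 0 < r0 \<and> r0 < 1/2 \<and>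
  (\<forall>r (a :: nat \<Rightarrow> real^'n). 0 < r \<and> r < r0 \<and> lattice_seq r a \<longrightarrow>
   (\<exists>C1>0. \<exists>C2>0.
    (\<forall>f\<in>bloch_space. \<exists>c. bounded (range c) \<and> kernel_expansion \<alpha> a c f \<and>
      C1 * bloch_norm f \<le> sup_norm c \<and> sup_norm c \<le> C2 * bloch_norm f) \<and>
    (\<forall>f\<in>little_bloch_space. \<exists>c. c \<longlonglongrightarrow> 0 \<and> kernel_expansion \<alpha> a c f \<and>
      C1 * bloch_norm f \<le> sup_norm c \<and> sup_norm c \<le> C2 * bloch_norm f)))"
proof -
 interpret bergman \<alpha> "TYPE('n)" by unfold_locales (use assms in auto)
 obtain Cn \<delta> L where nc: "0 < Cn" "0 < \<delta>" "\<delta>^2 <= 1/128" "0 <= L" "L * Cn <= 1/2"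
  "!!x y z. x \<in> UB ==> y \<in> UB ==> z \<in> UB ==> sg x y < \<delta>^2 ==>
   \<bar>kd x z - kd y z\<bar> <= L / wt z \<and> (1/16 < sg x z --> kd x z - kd y z = 0)"
  "!!z. z \<in> UB ==> measure M (nb z) <= Cn * wt z"
 proof (rule net_constants, goal_cases)
  case (1 Cn \<delta> L)
  show ?case by (rule that) (fact 1)+
 qed
 obtain Cs where Cs: "0 < Cs" "!!f z. f \<in> bloch_space ==> z \<in> UB ==> cmod (bsym f z) <= Cs * bloch_norm f"
  using bsym_bound by blast
 obtain Cb where Cb: "0 < Cb" "!!y. y \<in> UB ==> bloch_norm (bk y) * wt y <= Cb" using bk_bloch by metis
 have wp: "0 < wt y" if "y \<in> UB" for y using dl_pos[OF that] by simp
 define E where "E = 2 * Cs * Cn * Cb"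
 have E: "0 < E" using Cs Cb nc by (simp add: E_def)
 \<comment> \<open>Then 130 r^2 < (16 r)^2 < \<delta>^2, so even the lattice without
   \<open>a 0\<close> meets the mesh condition; and r0 < 1/16 because \<delta> < 1.\<close>
 define r0 where "r0 = \<delta> / 16"
 have "\<delta> < 1"
 proof (rule ccontr)
  assume "\<not> \<delta> < 1"
  hence "1 <= \<delta>^2" by (simp add: one_le_power)
  thus False using nc(3) by simp
 qed
 hence r0: "0 < r0" "r0 < 1/16" using nc by (auto simp: r0_def)
 have "\<exists>C1>0. \<exists>C2>0.
    (\<forall>f\<in>bloch_space. \<exists>c. bounded (range c) \<and> kernel_expansion \<alpha> a c f \<and>
      C1 * bloch_norm f <= sup_norm c \<and> sup_norm c <= C2 * bloch_norm f) \<and>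
    (\<forall>f\<in>little_bloch_space. \<exists>c. c \<longlonglongrightarrow> 0 \<and> kernel_expansion \<alpha> a c f \<and>
      C1 * bloch_norm f <= sup_norm c \<and> sup_norm c <= C2 * bloch_norm f)"
  if r: "0 < r" "r < r0" and l: "lattice_seq r a" for r and a :: "nat => real^'n"
 proof -
  have ab: "a m \<in> UB" for m using l unfolding lattice_seq_def separated_def by blast
  have fin: "finite {m. norm (a m) <= \<rho>}" if "\<rho> < 1" for \<rho>
   by (rule separated_finite[OF conjunct1[OF l[unfolded lattice_seq_def]] r(1) that])
  have r16: "r < 1/16" using r r0 by simp
  have small: "130 * r^2 < \<delta>^2"
  proof -
   have "(16 * r)^2 < \<delta>^2" using r by (intro power_strict_mono) (auto simp: r0_def)
   hence "256 * r^2 < \<delta>^2" by (simp add: power_mult_distrib)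
   thus ?thesis using zero_le_power2[of r] by linarith
  qed
  have cov1: "\<exists>m\<in>{1..}. sg y (a m) < \<delta>^2" if y: "y \<in> UB" for y
  proof -
   obtain m where "m \<noteq> 0" "sg y (a m) < 130 * r^2" using punctured_cover[OF l r(1) r16 y] by blast
   thus ?thesis using small by (intro bexI[of _ m]) auto
  qed
  have cov0: "\<exists>m\<in>UNIV. sg y (a m) < \<delta>^2" if "y \<in> UB" for y using cov1[OF that] by blast
  \<comment> \<open>\<open>net\<close> uses all centres and expands f; \<open>punct\<close> omits
    \<open>a 0\<close> and produces the relation between the atoms.\<close>
  interpret net: bergman_net \<alpha> "TYPE('n)" \<delta> L Cn a UNIV by unfold_locales (rule nc ab cov0; assumption)+
  interpret punct: bergman_net \<alpha> "TYPE('n)" \<delta> L Cn a "{1..}" by unfold_locales (rule nc ab cov1; assumption)+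
  define Nm where "Nm m = bloch_norm (bk (a m))" for m
  have Nm: "0 < Nm m" "Nm m * wt (a m) <= Cb" for m
   using bloch_norm_bk_pos[OF ab] Cb(2)[OF ab] by (auto simp: Nm_def)
  \<comment> \<open>Integrals over cells are of order \<open>wt (a m)\<close>, and the Bloch norms
    are at most Cb / \<open>wt (a m)\<close>; the weights cancel in the coefficients of the
    normalised atoms.\<close>
  have scale: "cmod (u * of_real (Nm m)) <= A * Cb" if "cmod u <= A * wt (a m)" "0 <= A" for u A m
  proof -
   have "cmod (u * of_real (Nm m)) <= A * wt (a m) * Nm m" using that Nm(1)[of m] by (simp add: norm_mult mult_right_mono)
   also have "... = A * (Nm m * wt (a m))" by simp
   also have "... <= A * Cb" using that Nm(2) by (intro mult_left_mono)
   finally show ?thesis .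
  qed
  have scale0: "(%m. u m * of_real (Nm m)) \<longlonglongrightarrow> 0" if "(%m. u m / of_real (wt (a m))) \<longlonglongrightarrow> 0" for u :: "nat => complex"
  proof (rule Lim_null_comparison)
   show "\<forall>\<^sub>F m in sequentially. norm (u m * of_real (Nm m)) <= cmod (u m / of_real (wt (a m))) * Cb"
    using wp[OF ab] by (intro always_eventually allI scale) (simp_all add: norm_divide)
   show "(%m. cmod (u m / of_real (wt (a m))) * Cb) \<longlonglongrightarrow> 0"
    using tendsto_mult_left_zero[OF tendsto_norm_zero[OF that]] .
  qed
  \<comment> \<open>A bounded function that represents evaluation at \<open>a 0\<close>: its pairing
    with g is g (a 0) by the mean value formula, and it vanishes near the boundary.\<close>
  define \<phi>0 where "\<phi>0 y = complex_of_real (kd (a 0) y)" for y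
  obtain B0 where B0: "0 <= B0" "!!y. y \<in> UB ==> cmod (\<phi>0 y) <= B0"
  proof -
   obtain C where C: "0 < C" "!!y z. y \<in> UB ==> z \<in> UB ==> kd y z <= C * wi y"
    using kd_bound by metis
   show ?thesis using that[of "C * wi (a 0)"] C(2)[OF ab] C(1) kd_nonneg[of "a 0"] by (simp add: \<phi>0_def)
  qed
  have \<phi>0m: "\<phi>0 \<in> borel_measurable M" unfolding \<phi>0_def[abs_def]
   by (intro continuous_measurable(2) continuous_intros continuous_on_kd ab)
  \<comment> \<open>The expansion of R(-, a 0) over the other centres minus R(-, a 0) itself; by
    \<open>mu_outside\<close> the coefficient of index 0 is exactly -1.\<close>
  define \<nu> where "\<nu> m = punct.mu \<phi>0 m - (if m = 0 then 1 else 0)" for m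
  have \<nu>0: "\<nu> 0 = - 1" using punct.mu_outside[OF \<phi>0m B0(2), of 0] by (simp add: \<nu>_def)
  have \<nu>s: "summable (%m. cmod (\<nu> m))"
  proof (rule summable_comparison_test')
   show "summable (%m. cmod (punct.mu \<phi>0 m) + (if m = 0 then 1 else 0))"
    by (rule summable_add[OF punct.mu_summable[OF \<phi>0m B0(2)] summable_single[of 0 "%_. 1"]])
   show "norm (cmod (\<nu> m)) <= cmod (punct.mu \<phi>0 m) + (if m = 0 then 1 else 0)" for m
    unfolding \<nu>_def real_norm_def abs_norm_cancel by (rule order_trans[OF norm_triangle_ineq4]) simp
  qed
  have \<nu>sum: "(%m. \<nu> m * bk (a m) x) sums 0" if x: "x \<in> UB" for x
  proof -
   obtain G where G: "!!y. y \<in> UB ==> cmod (bk x y) <= G" using bk_bounded[OF x] by blast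
   note bh = B2D(1)[OF bk_spec(1)[OF x]]
   have "(\<integral>y. \<phi>0 y * bk x y \<partial>M) = bk x (a 0)"
    using kd_mean_value[OF bh ab, of 0] by (simp add: \<phi>0_def scaleR_conv_of_real)
   hence "(%m. punct.mu \<phi>0 m * bk x (a m)) sums bk x (a 0)"
    using punct.mu_sums[OF \<phi>0m B0(2) bh G] by simp
   moreover have "(%m. if m = 0 then bk x (a m) else 0) sums bk x (a 0)" by (rule sums_single)
   ultimately have "(%m. punct.mu \<phi>0 m * bk x (a m) - (if m = 0 then bk x (a m) else 0)) sums (bk x (a 0) - bk x (a 0))" by (rule sums_diff)
   moreover have "(%m. punct.mu \<phi>0 m * bk x (a m) - (if m = 0 then bk x (a m) else 0)) = (%m. \<nu> m * bk (a m) x)"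
    by (auto simp: fun_eq_iff \<nu>_def left_diff_distrib bk_swap[OF ab x])
   ultimately show ?thesis by simp
  qed
  have \<nu>lim: "(%m. \<nu> m / of_real (wt (a m))) \<longlonglongrightarrow> 0"
  proof (rule Lim_transform_eventually)
   show "(%m. punct.mu \<phi>0 m / of_real (wt (a m))) \<longlonglongrightarrow> 0"
    by (rule punct.mu_vanishing[OF \<phi>0m B0(2) _ fin]) (auto simp: \<phi>0_def[abs_def] intro: vanishing_kd ab)
   show "\<forall>\<^sub>F m in sequentially. punct.mu \<phi>0 m / of_real (wt (a m)) = \<nu> m / of_real (wt (a m))"
    using eventually_gt_at_top[of 0] by (rule eventually_mono) (simp add: \<nu>_def)
  qed
  define K\<nu> where "K\<nu> = 2 * B0 * Cn * Cb + Nm 0"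
  have K\<nu>: "0 < K\<nu>" unfolding K\<nu>_def using B0 nc Cb Nm(1)[of 0] by (intro add_nonneg_pos mult_nonneg_nonneg) auto
  have \<nu>b: "cmod (\<nu> m * of_real (Nm m)) <= K\<nu>" for m
  proof -
   have "cmod (punct.mu \<phi>0 m) <= 2 * B0 * (Cn * wt (a m))"
    using B0 punct.Phi_bound[OF \<phi>0m B0(2)] by (intro punct.mu_bound[OF \<phi>0m B0(2)]) (auto simp: nb_def)
   hence "cmod (punct.mu \<phi>0 m) <= (2 * B0 * Cn) * wt (a m)" by (simp add: mult.assoc)
   from scale[OF this] have 1: "cmod (punct.mu \<phi>0 m * of_real (Nm m)) <= 2 * B0 * Cn * Cb" using B0 nc by simp
   have "cmod (\<nu> m * of_real (Nm m)) <= cmod (punct.mu \<phi>0 m * of_real (Nm m)) + cmod ((if m = 0 then 1 else 0) * of_real (Nm m))"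
    unfolding \<nu>_def left_diff_distrib by (rule norm_triangle_ineq4)
   also have "... <= K\<nu>" using 1 Nm(1)[of 0] by (auto simp: K\<nu>_def)
   finally show ?thesis .
  qed
  \<comment> \<open>\<open>E\<close> for the coefficients of f, plus the largest multiple of the
    relation that is added, times the bound \<open>K\<nu>\<close> of its coefficients. It depends on
    the lattice but not on f.\<close>
  define C2 where "C2 = E + (E + 1) / Nm 0 * K\<nu>"
  have C2: "0 < C2" unfolding C2_def using E K\<nu> Nm(1)[of 0] by (intro add_pos_pos mult_pos_pos divide_pos_pos) auto
  have main: "\<exists>c. bounded (range c) \<and> kernel_expansion \<alpha> a c f \<and> 1 * bloch_norm f <= sup_norm c \<and> sup_norm c <= C2 * bloch_norm f
    \<and> (f \<in> little_bloch_space --> c \<longlonglongrightarrow> 0)" if f: "f \<in> bloch_space" for f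
  proof -
   have fh: "f \<in> h_harmonic" using f by (simp add: bloch_space_def)
   define p where "p = bloch_norm f"
   have p: "0 <= p" unfolding p_def by (rule bloch_norm_bounds(3)[OF f])
   have bm: "bsym f \<in> borel_measurable M" by (rule continuous_measurable(2)[OF continuous_on_bsym[OF fh]])
   have bb: "cmod (bsym f y) <= Cs * p" if "y \<in> UB" for y unfolding p_def by (rule Cs(2)[OF f that])
   define \<mu> where "\<mu> = net.mu (bsym f)"
   have \<mu>s: "summable (%m. cmod (\<mu> m))" unfolding \<mu>_def by (rule net.mu_summable[OF bm bb])
   have \<mu>sum: "(%m. \<mu> m * bk (a m) x) sums f x" if x: "x \<in> UB" for x
   proof -
    obtain G where G: "!!y. y \<in> UB ==> cmod (bk x y) <= G" using bk_bounded[OF x] by blast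
    have "(%m. \<mu> m * bk x (a m)) sums f x"
     unfolding \<mu>_def bloch_integral_repr[OF f x] by (rule net.mu_sums[OF bm bb B2D(1)[OF bk_spec(1)[OF x]] G])
    thus ?thesis by (simp add: bk_swap[OF ab x])
   qed
   have \<mu>b: "cmod (\<mu> m * of_real (Nm m)) <= E * p" for m
   proof -
    have "cmod (\<mu> m) <= 2 * (Cs * p) * (Cn * wt (a m))" unfolding \<mu>_def
     using Cs p net.Phi_bound[OF bm bb] by (intro net.mu_bound[OF bm bb]) (auto simp: nb_def)
    hence "cmod (\<mu> m) <= (2 * (Cs * p) * Cn) * wt (a m)" by (simp add: mult.assoc)
    from scale[OF this] show ?thesis using Cs p nc by (simp add: E_def mult_ac)
   qed
   \<comment> \<open>Solves (\<mu> 0 - t) Nm 0 = p, so that c 0 is the Bloch norm p of f and the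
     supremum of the coefficients is at least p. Its modulus is at most (E + 1) p / Nm 0, the factor
     that appears in \<open>C2\<close>.\<close>
   define t where "t = (\<mu> 0 * of_real (Nm 0) - of_real p) / of_real (Nm 0)"
   define c where "c m = (\<mu> m + t * \<nu> m) * of_real (Nm m)" for m
   have c0: "c 0 = of_real p" using Nm(1)[of 0] by (simp add: c_def t_def \<nu>0 field_simps)
   have tb: "cmod t <= (E * p + p) / Nm 0"
    unfolding t_def norm_divide using Nm(1)[of 0] \<mu>b[of 0] p norm_triangle_ineq4[of "\<mu> 0 * of_real (Nm 0)" "of_real p"]
    by (simp add: divide_right_mono)
   have cb: "cmod (c m) <= C2 * p" for m
   proof -
    have "cmod (c m) <= cmod (\<mu> m * of_real (Nm m)) + cmod t * cmod (\<nu> m * of_real (Nm m))"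
     unfolding c_def distrib_right mult.assoc[of t] norm_mult[of t, symmetric] by (rule norm_triangle_ineq)
    also have "... <= E * p + (E * p + p) / Nm 0 * K\<nu>"
     using tb \<nu>b K\<nu> \<mu>b by (intro add_mono mult_mono) (auto intro: order_trans[OF norm_ge_zero])
    also have "... = C2 * p" by (simp add: C2_def algebra_simps add_divide_distrib)
    finally show ?thesis .
   qed
   have bdd: "bdd_above (range (%m. cmod (c m)))" by (rule bdd_aboveI2[of _ _ "C2 * p"]) (rule cb)
   have "p = cmod (c 0)" using p by (simp add: c0)
   also have "... <= sup_norm c" unfolding sup_norm_def by (rule cSUP_upper[OF _ bdd]) simp
   finally have lower: "p <= sup_norm c" .
   have upper: "sup_norm c <= C2 * p" unfolding sup_norm_def by (rule cSUP_least) (auto intro: cb)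
   have "summable (%m. cmod (\<mu> m + t * \<nu> m))"
    by (rule summable_comparison_test'[OF summable_add[OF \<mu>s summable_mult[OF \<nu>s, of "cmod t"]]])
     (simp add: norm_triangle_le norm_mult)
   moreover have "(%m. (\<mu> m + t * \<nu> m) * bk (a m) x) sums f x" if "x \<in> UB" for x
    using sums_add[OF \<mu>sum[OF that] sums_mult[OF \<nu>sum[OF that], of t]] by (simp add: distrib_right mult.assoc)
   ultimately have ke: "kernel_expansion \<alpha> a c f" unfolding c_def[abs_def] Nm_def by (rule kernel_expansionI[OF ab])
   have lim: "c \<longlonglongrightarrow> 0" if fl: "f \<in> little_bloch_space"
   proof -
    have "vanishing (bsym f)" unfolding vanishing_def using bsym_little[OF fl] by blast
    from net.mu_vanishing[OF bm bb this fin]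
    have "(%m. \<mu> m * of_real (Nm m)) \<longlonglongrightarrow> 0" unfolding \<mu>_def by (rule scale0)
    from tendsto_add[OF this tendsto_mult_right_zero[OF scale0[OF \<nu>lim], of t]]
    show ?thesis by (simp add: c_def[abs_def] distrib_right mult.assoc)
   qed
   have "bounded (range c)" by (rule boundedI[of _ "C2 * p"]) (use cb in auto)
   thus ?thesis using ke lower upper lim unfolding p_def by (intro exI[of _ c]) simp
  qed
  show ?thesis
   using main C2 by (intro exI[of _ "1::real"] exI[of _ C2] conjI ballI) (auto simp: little_bloch_space_def)
 qed
 thus ?thesis using r0 by (intro exI[of _ r0]) auto
qed

end
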